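(* Let $D$ be a bounded domain in $\mathbb{R}^d$ and $T>0$. Let $Y^k$ be the piecewise constant process built from the discrete-time simple random walk on the grid graph $D_k$, with law $\mathbb{P}^k_{m_k}$ when the initial distribution is $m_k$, and let $\widetilde D$ be the $\rho$-completion of $D$, all as defined in the context. Let $(\widetilde X,\mathbb{P})$ be a subsequential (weak) limit of $\{(Y^k,\mathbb{P}^k_{m_k});k\ge1\}$ on $\mathbb{D}([0,T],\widetilde D)$. Then $(\widetilde X,\mathbb{P})$ is a stationary symmetric Markov process (with respect to the measure $m$).
   Context: **Grid.** Fix $c_1\in(0,1)$ and $x_0\in D$. For each integer $k$, $\mathcal{A}_k$ is the family of all closed $d$-dimensional cubes $Q\subset D$ with edge length $2^{-k}$ such that: (a) the vertices of $Q$ belong to $(2^{-k}\mathbb{Z})^d$; (b) the distance from $Q$ to $\partial D$ is greater than $c_12^{-k}$; (c) there exists a sequence of cubes $Q_1,\dots,Q_n=Q$, each satisfying (a) and (b) (closed cubes in $D$ of edge length $2^{-k}$), with $x_0\in Q_1$ and $Q_i\cap Q_{i+1}$ a $(d-1)$-dimensional cube for $i=1,\dots,n-1$. $\mathcal{A}'_k$ is the set of all edges of cubes in $\mathcal{A}_k$ (with $\overline{xy}$ and $\overline{yx}$ both listed). $D_k$ denotes the graph whose vertices are the points of $(2^{-k}\mathbb{Z})^d$ lying in $\bigcup_{Q\in\mathcal{A}_k}Q$ and whose edges join $x,y$ with $|x-y|=2^{-k}$ when the segment $\overline{xy}$ is contained in $\bigcup_{Q\in\mathcal{A}_k}Q$.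 Only $k$ large enough that $\mathcal{A}_k\neq\emptyset$ is considered. $v_k(x)$ is the degree of $x$ in $D_k$, and $m_k(\{x\})=\frac{v_k(x)}{2d}2^{-kd}$ for $x\in D_k$. **Random walk.** $\{X^k_{j2^{-2k}},\,j=0,1,\dots\}$ is the simple random walk on $D_k$ that jumps every $2^{-2k}$ units of time to one of its nearest neighbors in $D_k$ with equal probabilities. $Y^k_t:=X^k_{[2^{2k}t]2^{-2k}}$ for $t\ge0$, where $[\alpha]$ is the largest integer $\le\alpha$. $\mathbb{P}^k_{m_k}$ is its law with initial distribution $m_k$. Initial distributions $m_k$ and $m$ are finite measures, not necessarily of total mass one; laws are understood as finite measures accordingly. **The space $\widetilde D$.** $W^{1,2}(D)$ is the space of $f\in L^2(D)$ with distributional gradient in $L^2(D)$, with norm $\|f\|_{1,2}=(\|f\|^2_{L^2(D)}+\|\nabla f\|^2_{L^2(D)})^{1/2}$, and $\mathcal{E}(f,g)=\frac12\int_D\nabla f\cdot\nabla g\,dx$ for $f,g\in W^{1,2}(D)$. Fix a sequence of bounded functions $\{\varphi_j\}_{j\ge1}\subset W^{1,2}(D)\cap C^\infty(D)$ that is dense in $W^{1,2}(D)$, separates points of $D$ and satisfies, for each $j$, $\limsup_{k\to\infty}2^{k(2-d)}\sum_{\overline{xy}\in\mathcal{A}'_k}(\varphi_j(x)-\varphi_j(y))^2\le2\int_D|\nabla\varphi_j|^2dx$ (sum over ordered pairs); such a sequence exists. Let $\mathcal{C}$ be the algebra over $\mathbb{Q}$ generated by $\{\varphi_j\}$. Fix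 a metric $\rho$ on $D$ (such a metric exists) inducing the Euclidean topology on $D$ and such that the $\rho$-completion $\widetilde D$ of $D$ has the following properties: $\widetilde D$ is a compact space containing $D$ as a dense open subset; with $m$ denoting Lebesgue measure on $D$ extended by $m(\widetilde D\setminus D)=0$, $(\mathcal{E},W^{1,2}(D))$ is a regular Dirichlet form on $L^2(\widetilde D;m)$; the functions in $\mathcal{C}$ extend continuously to $\widetilde D$ and $\mathcal{C}$ is dense in $(C_b(\widetilde D),\|\cdot\|_\infty)$. $\mathbb{D}([0,T],\widetilde D)$ is the space of right-continuous paths with left limits in $(\widetilde D,\rho)$, with the Skorokhod topology. **Terminology.** "Stationary symmetric Markov process" means that $m$ is an invariant measure and the initial distribution, and the finite-dimensional distributions of $\widetilde X$ are determined by $m$ and a semigroup $\{P_t\}$ of operators, $P_tf=\mathbb{E}[f(\widetilde X_t)\mid\widetilde X_0]$, that are symmetric on $L^2(\widetilde D;m)=L^2(D;m)$. *)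

theory Defs
  imports "HOL-Probability.Probability"
begin

section \<open>The grid graphs\<close>

text \<open>The dimension $d$ is \<open>DIM('a)\<close>, and coordinates refer to \<open>Basis\<close>.\<close>

definition lattice_pts :: "nat \<Rightarrow> 'a::euclidean_space set" where
  "lattice_pts k = {x. \<forall>b\<in>Basis. \<exists>z::int. x \<bullet> b = of_int z * (1/2)^k}"

text \<open>Axis-parallel \<open>n\<close>-dimensional closed cubes with edge length \<open>l\<close>.  Taking only axis-parallel
  cubes is no restriction below: a cube of edge length $2^{-k}$ with vertices in
  $(2^{-k}\mathbb{Z})^d$ is axis-parallel.\<close>

definition is_cube :: "nat \<Rightarrow> real \<Rightarrow> 'a::euclidean_space set \<Rightarrow> bool" where
  "is_cube n l Q \<longleftrightarrow> l > 0 \<and> (\<exists>a. \<exists>B\<subseteq>Basis. card B = n \<and> Q = cbox a (a + l *\<^sub>R \<Sum>B))"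

definition admissible_cube :: "'a::euclidean_space set \<Rightarrow> real \<Rightarrow> nat \<Rightarrow> 'a set \<Rightarrow> bool" where
  "admissible_cube D c k Q \<longleftrightarrow>
     is_cube DIM('a) ((1/2)^k) Q \<and> Q \<subseteq> D \<and>
     {v. v extreme_point_of Q} \<subseteq> lattice_pts k \<and>
     setdist Q (frontier D) > c * (1/2)^k"

definition grid_cubes :: "'a::euclidean_space set \<Rightarrow> real \<Rightarrow> 'a \<Rightarrow> nat \<Rightarrow> 'a set set" where
  "grid_cubes D c x0 k =
     {Q. \<exists>Qs. Qs \<noteq> [] \<and> last Qs = Q \<and> x0 \<in> hd Qs \<and>
           (\<forall>R\<in>set Qs. admissible_cube D c k R) \<and>
           successively (\<lambda>R S. \<exists>l. is_cube (DIM('a) - 1) l (R \<inter> S)) Qs}"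

text \<open>Edges are recorded by their ordered pairs of end points.\<close>

definition grid_edges :: "'a::euclidean_space set \<Rightarrow> real \<Rightarrow> 'a \<Rightarrow> nat \<Rightarrow> ('a \<times> 'a) set" where
  "grid_edges D c x0 k =
     {(x, y). \<exists>Q\<in>grid_cubes D c x0 k. closed_segment x y edge_of Q}"

definition graph_verts :: "'a::euclidean_space set \<Rightarrow> real \<Rightarrow> 'a \<Rightarrow> nat \<Rightarrow> 'a set" where
  "graph_verts D c x0 k = lattice_pts k \<inter> \<Union>(grid_cubes D c x0 k)"

definition graph_adj :: "'a::euclidean_space set \<Rightarrow> real \<Rightarrow> 'a \<Rightarrow> nat \<Rightarrow> 'a \<Rightarrow> 'a \<Rightarrow> bool" where
  "graph_adj D c x0 k x y \<longleftrightarrow>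
     x \<in> graph_verts D c x0 k \<and> y \<in> graph_verts D c x0 k \<and>
     norm (x - y) = (1/2)^k \<and> closed_segment x y \<subseteq> \<Union>(grid_cubes D c x0 k)"

definition degree_of :: "('v \<Rightarrow> 'v \<Rightarrow> bool) \<Rightarrow> 'v \<Rightarrow> nat" where
  "degree_of adj x = card {y. adj x y}"

definition grid_weight :: "'a::euclidean_space set \<Rightarrow> real \<Rightarrow> 'a \<Rightarrow> nat \<Rightarrow> 'a \<Rightarrow> real" where
  "grid_weight D c x0 k x =
     real (degree_of (graph_adj D c x0 k) x) / (2 * real DIM('a)) * (1/2)^(k * DIM('a))"


section \<open>Random walks\<close>

text \<open>Simple random walk on a graph with vertex set \<open>V\<close>, under a finite measure that is not
  necessarily a probability, with initial distribution \<open>\<mu>\<close> (given by its point masses).\<close>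

definition simple_random_walk ::
  "'w measure \<Rightarrow> 'v set \<Rightarrow> ('v \<Rightarrow> 'v \<Rightarrow> bool) \<Rightarrow> ('v \<Rightarrow> real) \<Rightarrow> (nat \<Rightarrow> 'w \<Rightarrow> 'v) \<Rightarrow> bool" where
  "simple_random_walk M V adj \<mu> X \<longleftrightarrow>
     finite_measure M \<and>
     (\<forall>j. X j \<in> M \<rightarrow>\<^sub>M count_space V) \<and>
     (\<forall>x\<in>V. measure M {\<omega>\<in>space M. X 0 \<omega> = x} = \<mu> x) \<and>
     (\<forall>n. \<forall>x\<in>{..n} \<rightarrow> V. \<forall>y\<in>V.
        measure M {\<omega>\<in>space M. (\<forall>i\<le>n. X i \<omega> = x i) \<and> X (Suc n) \<omega> = y} =
        measure M {\<omega>\<in>space M. \<forall>i\<le>n. X i \<omega> = x i} *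
          (if adj (x n) y then 1 / real (degree_of adj (x n)) else 0))"

text \<open>\<open>X j\<close> is the position of the walk at time $j 2^{-2k}$.\<close>

definition step_process :: "nat \<Rightarrow> (nat \<Rightarrow> 'w \<Rightarrow> 'v) \<Rightarrow> real \<Rightarrow> 'w \<Rightarrow> 'v" where
  "step_process k X t \<omega> = X (nat \<lfloor>2^(2*k) * t\<rfloor>) \<omega>"


section \<open>The Sobolev space\<close>

abbreviation leb :: "'a::euclidean_space set \<Rightarrow> 'a measure" where
  "leb D \<equiv> restrict_space lborel D"

text \<open>Square-integrable functions, not identified modulo null sets.\<close>

definition L2 :: "'c measure \<Rightarrow> ('c \<Rightarrow> real) set" where
  "L2 M = {f \<in> borel_measurable M. integrable M (\<lambda>x. (f x)\<^sup>2)}"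

definition norm_L2 :: "'c measure \<Rightarrow> ('c \<Rightarrow> real) \<Rightarrow> real" where
  "norm_L2 M f = sqrt (\<integral>x. (f x)\<^sup>2 \<partial>M)"

primrec Cn_on :: "nat \<Rightarrow> 'a::euclidean_space set \<Rightarrow> ('a \<Rightarrow> real) \<Rightarrow> bool" where
  "Cn_on 0 S f \<longleftrightarrow> continuous_on S f"
| "Cn_on (Suc n) S f \<longleftrightarrow>
     (\<forall>x\<in>S. f differentiable (at x)) \<and>
     (\<forall>b\<in>Basis. Cn_on n S (\<lambda>x. frechet_derivative f (at x) b))"

definition smooth_on :: "'a::euclidean_space set \<Rightarrow> ('a \<Rightarrow> real) \<Rightarrow> bool" where
  "smooth_on S f \<longleftrightarrow> (\<forall>n. Cn_on n S f)"

definition test_functions :: "'a::euclidean_space set \<Rightarrow> ('a \<Rightarrow> real) set" where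
  "test_functions D =
     {\<eta>. smooth_on UNIV \<eta> \<and> compact (closure {x. \<eta> x \<noteq> 0}) \<and> closure {x. \<eta> x \<noteq> 0} \<subseteq> D}"

definition is_weak_grad ::
  "'a::euclidean_space set \<Rightarrow> ('a \<Rightarrow> real) \<Rightarrow> ('a \<Rightarrow> 'a) \<Rightarrow> bool" where
  "is_weak_grad D f G \<longleftrightarrow>
     (\<forall>b\<in>Basis. (\<lambda>x. G x \<bullet> b) \<in> L2 (leb D) \<and>
        (\<forall>\<eta>\<in>test_functions D.
           (\<integral>x. f x * frechet_derivative \<eta> (at x) b \<partial>leb D) = - (\<integral>x. (G x \<bullet> b) * \<eta> x \<partial>leb D)))"

definition W12 :: "'a::euclidean_space set \<Rightarrow> ('a \<Rightarrow> real) set" where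
  "W12 D = {f \<in> L2 (leb D). \<exists>G. is_weak_grad D f G}"

text \<open>The distributional gradient is unique only almost everywhere; some version is chosen.\<close>

definition weak_grad :: "'a::euclidean_space set \<Rightarrow> ('a \<Rightarrow> real) \<Rightarrow> 'a \<Rightarrow> 'a" where
  "weak_grad D f = (SOME G. is_weak_grad D f G)"

definition norm_W12 :: "'a::euclidean_space set \<Rightarrow> ('a \<Rightarrow> real) \<Rightarrow> real" where
  "norm_W12 D f = sqrt ((\<integral>x. (f x)\<^sup>2 \<partial>leb D) + (\<integral>x. (norm (weak_grad D f x))\<^sup>2 \<partial>leb D))"

definition energy :: "'a::euclidean_space set \<Rightarrow> ('a \<Rightarrow> real) \<Rightarrow> ('a \<Rightarrow> real) \<Rightarrow> real" where
  "energy D f g = 1/2 * (\<integral>x. weak_grad D f x \<bullet> weak_grad D g x \<partial>leb D)"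


section \<open>Dirichlet forms\<close>

text \<open>The form and its domain live on representatives; the second clause says that they are
  well-defined on classes modulo \<open>m\<close>-null sets.\<close>

definition dirichlet_form ::
  "'b measure \<Rightarrow> ('b \<Rightarrow> real) set \<Rightarrow> (('b \<Rightarrow> real) \<Rightarrow> ('b \<Rightarrow> real) \<Rightarrow> real) \<Rightarrow> bool" where
  "dirichlet_form m F E \<longleftrightarrow>
     F \<subseteq> L2 m \<and>
     (\<forall>f\<in>F. \<forall>g\<in>borel_measurable m. (AE x in m. f x = g x) \<longrightarrow>
        g \<in> F \<and> (\<forall>h\<in>F. E g h = E f h)) \<and>
     (\<lambda>x. 0) \<in> F \<and>
     (\<forall>f\<in>F. \<forall>g\<in>F. \<forall>a. (\<lambda>x. a * f x + g x) \<in> F \<and>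
        (\<forall>h\<in>F. E (\<lambda>x. a * f x + g x) h = a * E f h + E g h)) \<and>
     (\<forall>f\<in>F. \<forall>g\<in>F. E f g = E g f) \<and>
     (\<forall>f\<in>F. E f f \<ge> 0) \<and>
     (\<forall>f\<in>L2 m. \<forall>e>0. \<exists>g\<in>F. norm_L2 m (\<lambda>x. f x - g x) < e) \<and>
     (\<forall>u. (\<forall>n. u n \<in> F) \<and>
          (\<forall>e>0. \<exists>N::nat. \<forall>i\<ge>N. \<forall>j\<ge>N.
             E (\<lambda>x. u i x - u j x) (\<lambda>x. u i x - u j x) + (norm_L2 m (\<lambda>x. u i x - u j x))\<^sup>2 < e)
        \<longrightarrow> (\<exists>f\<in>F. (\<lambda>n. E (\<lambda>x. u n x - f x) (\<lambda>x. u n x - f x)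
                          + (norm_L2 m (\<lambda>x. u n x - f x))\<^sup>2) \<longlonglongrightarrow> 0)) \<and>
     (\<forall>f\<in>F. (\<lambda>x. min (max (f x) 0) 1) \<in> F \<and>
        E (\<lambda>x. min (max (f x) 0) 1) (\<lambda>x. min (max (f x) 0) 1) \<le> E f f)"

definition Cc :: "('b::topological_space \<Rightarrow> real) set" where
  "Cc = {f. continuous_on UNIV f \<and> compact (closure {x. f x \<noteq> 0})}"

definition regular_dirichlet_form ::
  "'b::topological_space measure \<Rightarrow> ('b \<Rightarrow> real) set \<Rightarrow>
     (('b \<Rightarrow> real) \<Rightarrow> ('b \<Rightarrow> real) \<Rightarrow> real) \<Rightarrow> bool" where
  "regular_dirichlet_form m F E \<longleftrightarrow>
     dirichlet_form m F E \<and>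
     (\<forall>f\<in>F. \<forall>e>0. \<exists>g\<in>F \<inter> Cc.
        E (\<lambda>x. f x - g x) (\<lambda>x. f x - g x) + (norm_L2 m (\<lambda>x. f x - g x))\<^sup>2 < e) \<and>
     (\<forall>f\<in>Cc. \<forall>e>0. \<exists>g\<in>F \<inter> Cc. \<forall>x. \<bar>f x - g x\<bar> < e)"


section \<open>The completion\<close>

definition good_functions ::
  "'a::euclidean_space set \<Rightarrow> real \<Rightarrow> 'a \<Rightarrow> (nat \<Rightarrow> 'a \<Rightarrow> real) \<Rightarrow> bool" where
  "good_functions D c x0 \<phi> \<longleftrightarrow>
     (\<forall>j. bounded (\<phi> j ` D) \<and> \<phi> j \<in> W12 D \<and> smooth_on D (\<phi> j)) \<and>
     (\<forall>f\<in>W12 D. \<forall>e>0. \<exists>j. norm_W12 D (\<lambda>x. f x - \<phi> j x) < e) \<and>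
     (\<forall>x\<in>D. \<forall>y\<in>D. x \<noteq> y \<longrightarrow> (\<exists>j. \<phi> j x \<noteq> \<phi> j y)) \<and>
     (\<forall>j. limsup (\<lambda>k. ereal (2 powi (int k * (2 - int DIM('a))) *
                   (\<Sum>(x, y)\<in>grid_edges D c x0 k. (\<phi> j x - \<phi> j y)\<^sup>2)))
          \<le> ereal (2 * (\<integral>x. (norm (weak_grad D (\<phi> j) x))\<^sup>2 \<partial>leb D)))"

text \<open>The unital algebra over the rationals generated by \<open>\<Phi>\<close>.  Including the constants only weakens
  the density assumption in \<open>is_good_completion\<close>.\<close>

inductive_set rat_algebra :: "('a \<Rightarrow> real) set \<Rightarrow> ('a \<Rightarrow> real) set" for \<Phi> where
  gen: "f \<in> \<Phi> \<Longrightarrow> f \<in> rat_algebra \<Phi>"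
| const: "(\<lambda>x. of_rat q) \<in> rat_algebra \<Phi>"
| add: "f \<in> rat_algebra \<Phi> \<Longrightarrow> g \<in> rat_algebra \<Phi> \<Longrightarrow> (\<lambda>x. f x + g x) \<in> rat_algebra \<Phi>"
| mult: "f \<in> rat_algebra \<Phi> \<Longrightarrow> g \<in> rat_algebra \<Phi> \<Longrightarrow> (\<lambda>x. f x * g x) \<in> rat_algebra \<Phi>"

text \<open>Lebesgue measure on \<open>D\<close>, transported to the completion; the complement of \<open>\<iota> ` D\<close> is null.\<close>

definition ext_lebesgue ::
  "'a::euclidean_space set \<Rightarrow> ('a \<Rightarrow> 'b::topological_space) \<Rightarrow> 'b measure" where
  "ext_lebesgue D \<iota> = distr (leb D) borel \<iota>"

text \<open>The completion of \<open>(D, \<rho>)\<close> is the complete metric type \<open>'b\<close>, into which \<open>\<iota>\<close> embeds \<open>D\<close>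
  isometrically and densely.  Since \<open>D\<close> is separable, every completion is a Polish space.\<close>

definition is_good_completion ::
  "'a::euclidean_space set \<Rightarrow> (nat \<Rightarrow> 'a \<Rightarrow> real) \<Rightarrow> ('a \<Rightarrow> 'a \<Rightarrow> real) \<Rightarrow>
     ('a \<Rightarrow> 'b::polish_space) \<Rightarrow> bool" where
  "is_good_completion D \<phi> \<rho> \<iota> \<longleftrightarrow>
     Metric_space D \<rho> \<and> Metric_space.mtopology D \<rho> = top_of_set D \<and>
     (\<forall>x\<in>D. \<forall>y\<in>D. dist (\<iota> x) (\<iota> y) = \<rho> x y) \<and> closure (\<iota> ` D) = UNIV \<and>
     compact (UNIV :: 'b set) \<and> open (\<iota> ` D) \<and>
     regular_dirichlet_form (ext_lebesgue D \<iota>)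
       {f \<in> borel_measurable borel. f \<circ> \<iota> \<in> W12 D} (\<lambda>f g. energy D (f \<circ> \<iota>) (g \<circ> \<iota>)) \<and>
     (\<forall>f\<in>rat_algebra (range \<phi>). \<exists>F::'b \<Rightarrow>\<^sub>C real. \<forall>x\<in>D. apply_bcontfun F (\<iota> x) = f x) \<and>
     closure {F::'b \<Rightarrow>\<^sub>C real. \<exists>f\<in>rat_algebra (range \<phi>). \<forall>x\<in>D. apply_bcontfun F (\<iota> x) = f x} = UNIV"


section \<open>The Skorokhod space\<close>

text \<open>Paths on $[0,T]$ are extensional functions, so that equality of paths is equality of
  functions.\<close>

definition cadlag :: "real \<Rightarrow> (real \<Rightarrow> 'b::metric_space) set" where
  "cadlag T = {w \<in> extensional {0..T}.
     (\<forall>t\<in>{0..<T}. (w \<longlongrightarrow> w t) (at_right t)) \<and>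
     (\<forall>t\<in>{0<..T}. \<exists>l. (w \<longlongrightarrow> l) (at_left t))}"

text \<open>Increasing bijections of $[0,T]$; they are automatically continuous.\<close>

definition time_changes :: "real \<Rightarrow> (real \<Rightarrow> real) set" where
  "time_changes T = {\<theta>. strict_mono_on {0..T} \<theta> \<and> \<theta> ` {0..T} = {0..T}}"

text \<open>This is $\inf_\theta \max(\sup_t |\theta(t) - t|, \sup_t d(v(t), w(\theta(t))))$.  The value
  \<open>0\<close> outside \<open>cadlag T\<close> is there because \<open>Metric_space\<close> asks for nonnegativity and symmetry
  everywhere.\<close>

definition skorokhod_dist :: "real \<Rightarrow> (real \<Rightarrow> 'b::metric_space) \<Rightarrow> (real \<Rightarrow> 'b) \<Rightarrow> real" where
  "skorokhod_dist T v w =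
     (if v \<in> cadlag T \<and> w \<in> cadlag T
      then Inf {e. 0 \<le> e \<and> (\<exists>\<theta>\<in>time_changes T. \<forall>t\<in>{0..T}.
             \<bar>\<theta> t - t\<bar> \<le> e \<and> dist (v t) (w (\<theta> t)) \<le> e)}
      else 0)"

lemma time_changes_id: "(\<lambda>t. t) \<in> time_changes T"
  by (auto simp: time_changes_def strict_mono_on_def)

lemma time_changes_range: "\<theta> \<in> time_changes T \<Longrightarrow> t \<in> {0..T} \<Longrightarrow> \<theta> t \<in> {0..T}"
  by (auto simp: time_changes_def)

lemma time_changes_comp:
  assumes "\<theta> \<in> time_changes T" "\<eta> \<in> time_changes T"
  shows "(\<lambda>t. \<eta> (\<theta> t)) \<in> time_changes T"
proof -
  have "(\<lambda>t. \<eta> (\<theta> t)) ` {0..T} = \<eta> ` (\<theta> ` {0..T})" by auto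
  moreover have "strict_mono_on {0..T} (\<lambda>t. \<eta> (\<theta> t))"
  proof (rule strict_mono_onI)
    fix s t assume st: "s \<in> {0..T}" "t \<in> {0..T}" "s < t"
    then have "\<theta> s < \<theta> t"
      using assms(1) by (auto simp: time_changes_def strict_mono_on_def)
    then show "\<eta> (\<theta> s) < \<eta> (\<theta> t)"
      using assms(2) time_changes_range[OF assms(1)] st
      by (auto simp: time_changes_def strict_mono_on_def)
  qed
  ultimately show ?thesis using assms by (simp add: time_changes_def)
qed

lemma time_changes_inv:
  assumes "\<theta> \<in> time_changes T"
  obtains \<eta> where "\<eta> \<in> time_changes T" "\<And>t. t \<in> {0..T} \<Longrightarrow> \<theta> (\<eta> t) = t"
proof
  let ?A = "{0..T}"
  let ?\<eta> = "inv_into ?A \<theta>"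
  have sm: "strict_mono_on ?A \<theta>" and im: "\<theta> ` ?A = ?A"
    using assms by (auto simp: time_changes_def)
  have inj: "inj_on \<theta> ?A" using sm by (rule strict_mono_on_imp_inj_on)
  show r: "\<theta> (?\<eta> t) = t" if "t \<in> ?A" for t
    using that im by (simp add: f_inv_into_f)
  have m: "?\<eta> t \<in> ?A" if "t \<in> ?A" for t
    using that im by (metis inv_into_into)
  have "?\<eta> ` ?A = ?A"
    using inj im by (metis inj_on_imp_bij_betw bij_betw_inv_into bij_betw_imp_surj_on)
  moreover have "strict_mono_on ?A ?\<eta>"
  proof (rule strict_mono_onI)
    fix s t assume st: "s \<in> ?A" "t \<in> ?A" "s < t"
    show "?\<eta> s < ?\<eta> t"
    proof (rule ccontr)
      assume "\<not> ?\<eta> s < ?\<eta> t"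
      then have "?\<eta> t \<le> ?\<eta> s" by simp
      then have "\<theta> (?\<eta> t) \<le> \<theta> (?\<eta> s)"
        using strict_mono_on_leD[OF sm m[OF st(2)] m[OF st(1)]] by simp
      then show False using r st by simp
    qed
  qed
  ultimately show "?\<eta> \<in> time_changes T" by (simp add: time_changes_def)
qed

lemma time_changes_end:
  assumes "\<theta> \<in> time_changes T" "T \<ge> 0"
  shows "\<theta> T = T"
proof -
  have "T \<in> \<theta> ` {0..T}" using assms by (auto simp: time_changes_def)
  then obtain s where s: "s \<in> {0..T}" "\<theta> s = T" by auto
  then have "\<theta> s \<le> \<theta> T"
    using strict_mono_on_leD[of "{0..T}" \<theta> s T] assms by (auto simp: time_changes_def)
  moreover have "\<theta> T \<in> {0..T}" using time_changes_range[OF assms(1)] assms(2) by simp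
  ultimately show ?thesis using s by simp
qed

lemma cadlag_bounded:
  fixes w :: "real \<Rightarrow> 'b::metric_space"
  assumes w: "w \<in> cadlag T"
  shows "bounded (w ` {0..T})"
proof -
  have "\<exists>U. open U \<and> t \<in> U \<and> bounded (w ` (U \<inter> {0..T}))" if t: "t \<in> {0..T}" for t
  proof -
    have R: "\<exists>b>t. bounded (w ` ({t<..<b} \<inter> {0..T}))"
    proof (cases "t < T")
      case True
      then have "(w \<longlongrightarrow> w t) (at_right t)" using w t by (auto simp: cadlag_def)
      then have "eventually (\<lambda>s. dist (w s) (w t) < 1) (at_right t)"
        by (rule tendstoD) simp
      then obtain b where b: "b > t" "\<And>s. s > t \<Longrightarrow> s < b \<Longrightarrow> dist (w s) (w t) < 1"
        by (auto simp: eventually_at_right_field)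
      have "w ` ({t<..<b} \<inter> {0..T}) \<subseteq> ball (w t) 1"
        using b(2) by (auto simp: dist_commute)
      then show ?thesis using b(1) bounded_subset[OF bounded_ball] by blast
    next
      case False
      then have "{t<..<t+1} \<inter> {0..T} = {}" using t by auto
      then show ?thesis by (intro exI[of _ "t+1"]) simp
    qed
    have L: "\<exists>a<t. bounded (w ` ({a<..<t} \<inter> {0..T}))"
    proof (cases "t > 0")
      case True
      then have "\<exists>l. (w \<longlongrightarrow> l) (at_left t)" using w t unfolding cadlag_def by simp
      then obtain l where "(w \<longlongrightarrow> l) (at_left t)" by blast
      then have "eventually (\<lambda>s. dist (w s) l < 1) (at_left t)"
        by (rule tendstoD) simp
      then obtain a where a: "a < t" "\<And>s. s > a \<Longrightarrow> s < t \<Longrightarrow> dist (w s) l < 1"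
        by (auto simp: eventually_at_left_field)
      have "w ` ({a<..<t} \<inter> {0..T}) \<subseteq> ball l 1"
        using a(2) by (auto simp: dist_commute)
      then show ?thesis using a(1) bounded_subset[OF bounded_ball] by blast
    next
      case False
      then have "{t-1<..<t} \<inter> {0..T} = {}" using t by auto
      then show ?thesis by (intro exI[of _ "t-1"]) simp
    qed
    obtain a b where ab: "a < t" "t < b" "bounded (w ` ({a<..<t} \<inter> {0..T}))"
      "bounded (w ` ({t<..<b} \<inter> {0..T}))"
      using L R by blast
    have "w ` ({a<..<b} \<inter> {0..T}) \<subseteq>
        w ` ({a<..<t} \<inter> {0..T}) \<union> {w t} \<union> w ` ({t<..<b} \<inter> {0..T})"
    proof
      fix y assume "y \<in> w ` ({a<..<b} \<inter> {0..T})"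
      then obtain s where s: "y = w s" "s \<in> {a<..<b}" "s \<in> {0..T}" by blast
      consider "s < t" | "s = t" | "s > t" by linarith
      then show "y \<in> w ` ({a<..<t} \<inter> {0..T}) \<union> {w t} \<union> w ` ({t<..<b} \<inter> {0..T})"
        by cases (use s in auto)
    qed
    moreover have "bounded (w ` ({a<..<t} \<inter> {0..T}) \<union> {w t} \<union> w ` ({t<..<b} \<inter> {0..T}))"
      using ab by simp
    ultimately have "bounded (w ` ({a<..<b} \<inter> {0..T}))" by (rule bounded_subset[rotated])
    then show ?thesis using ab by (intro exI[of _ "{a<..<b}"]) auto
  qed
  then obtain U where U: "\<And>t. t \<in> {0..T} \<Longrightarrow> open (U t) \<and> t \<in> U t \<and> bounded (w ` (U t \<inter> {0..T}))"
    by metis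
  have "compact {0..T}" by simp
  then obtain F where F: "F \<subseteq> {0..T}" "finite F" "{0..T} \<subseteq> (\<Union>t\<in>F. U t)"
    using U by (elim compactE_image[of _ "{0..T}" U]) auto
  have "bounded (\<Union>t\<in>F. w ` (U t \<inter> {0..T}))"
    using F U by (intro bounded_UN) auto
  then show ?thesis by (rule bounded_subset) (use F(3) in blast)
qed

text \<open>The infimum in \<open>skorokhod_dist\<close> is over a nonempty set.\<close>

lemma skorokhod_dist_less_iff:
  assumes T: "T \<ge> 0" and v: "v \<in> cadlag T" and w: "w \<in> cadlag T"
  shows "skorokhod_dist T v w < r \<longleftrightarrow>
    (\<exists>e. 0 \<le> e \<and> e < r \<and> (\<exists>\<theta>\<in>time_changes T. \<forall>t\<in>{0..T}.
       \<bar>\<theta> t - t\<bar> \<le> e \<and> dist (v t) (w (\<theta> t)) \<le> e))"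
proof -
  let ?S = "{e. 0 \<le> e \<and> (\<exists>\<theta>\<in>time_changes T. \<forall>t\<in>{0..T}.
      \<bar>\<theta> t - t\<bar> \<le> e \<and> dist (v t) (w (\<theta> t)) \<le> e)}"
  have "bounded (v ` {0..T} \<union> w ` {0..T})"
    using cadlag_bounded[OF v] cadlag_bounded[OF w] by simp
  then obtain K where K: "\<And>x y. x \<in> v ` {0..T} \<union> w ` {0..T} \<Longrightarrow>
      y \<in> v ` {0..T} \<union> w ` {0..T} \<Longrightarrow> dist x y \<le> K"
    by (metis bounded_two_points)
  have "dist (v t) (w t) \<le> max K 0" if "t \<in> {0..T}" for t
    using K[of "v t" "w t"] that by auto
  then have "max K 0 \<in> ?S"
    using time_changes_id[of T] by (auto intro!: bexI[of _ "\<lambda>t. t"])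
  then have ne: "?S \<noteq> {}" by blast
  have "bdd_below ?S" by (rule bdd_belowI[of _ 0]) auto
  then show ?thesis
    using cInf_less_iff[OF ne, of r] v w by (auto simp: skorokhod_dist_def)
qed

lemma skorokhod_dist_nonneg:
  assumes "T \<ge> 0" "v \<in> cadlag T" "w \<in> cadlag T"
  shows "0 \<le> skorokhod_dist T v w"
  using skorokhod_dist_less_iff[OF assms, of 0] by force

lemma skorokhod_dist_commute_le:
  assumes T: "T \<ge> 0" and v: "v \<in> cadlag T" and w: "w \<in> cadlag T"
  shows "skorokhod_dist T w v \<le> skorokhod_dist T v w"
proof (rule dense_ge)
  fix r assume "skorokhod_dist T v w < r"
  then obtain e \<theta> where e: "0 \<le> e" "e < r" and \<theta>: "\<theta> \<in> time_changes T"
      "\<And>t. t \<in> {0..T} \<Longrightarrow> \<bar>\<theta> t - t\<bar> \<le> e \<and> dist (v t) (w (\<theta> t)) \<le> e"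
    using skorokhod_dist_less_iff[OF T v w] by blast
  obtain \<eta> where \<eta>: "\<eta> \<in> time_changes T" "\<And>t. t \<in> {0..T} \<Longrightarrow> \<theta> (\<eta> t) = t"
    using time_changes_inv[OF \<theta>(1)] by blast
  have "\<bar>\<eta> t - t\<bar> \<le> e \<and> dist (w t) (v (\<eta> t)) \<le> e" if "t \<in> {0..T}" for t
    using \<theta>(2)[OF time_changes_range[OF \<eta>(1) that]] \<eta>(2)[OF that]
    by (simp add: dist_commute abs_minus_commute)
  then have "skorokhod_dist T w v < r"
    using skorokhod_dist_less_iff[OF T w v] e \<eta>(1) by blast
  then show "skorokhod_dist T w v \<le> r" by simp
qed

lemma skorokhod_dist_triangle:
  assumes T: "T \<ge> 0" and u: "u \<in> cadlag T" and v: "v \<in> cadlag T" and w: "w \<in> cadlag T"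
  shows "skorokhod_dist T u w \<le> skorokhod_dist T u v + skorokhod_dist T v w"
proof (rule field_le_epsilon)
  fix \<epsilon> :: real assume "\<epsilon> > 0"
  then have "skorokhod_dist T u v < skorokhod_dist T u v + \<epsilon>/2"
    "skorokhod_dist T v w < skorokhod_dist T v w + \<epsilon>/2" by auto
  note less = this[unfolded skorokhod_dist_less_iff[OF T u v] skorokhod_dist_less_iff[OF T v w]]
  obtain e1 \<theta> where e1: "0 \<le> e1" "e1 < skorokhod_dist T u v + \<epsilon>/2"
    and \<theta>: "\<theta> \<in> time_changes T"
      "\<And>t. t \<in> {0..T} \<Longrightarrow> \<bar>\<theta> t - t\<bar> \<le> e1 \<and> dist (u t) (v (\<theta> t)) \<le> e1"
    using less(1) by blast
  obtain e2 \<eta> where e2: "0 \<le> e2" "e2 < skorokhod_dist T v w + \<epsilon>/2"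
    and \<eta>: "\<eta> \<in> time_changes T"
      "\<And>t. t \<in> {0..T} \<Longrightarrow> \<bar>\<eta> t - t\<bar> \<le> e2 \<and> dist (v t) (w (\<eta> t)) \<le> e2"
    using less(2) by blast
  have "\<bar>\<eta> (\<theta> t) - t\<bar> \<le> e1 + e2 \<and> dist (u t) (w (\<eta> (\<theta> t))) \<le> e1 + e2" if "t \<in> {0..T}" for t
    using \<theta>(2)[OF that] \<eta>(2)[OF time_changes_range[OF \<theta>(1) that]]
      dist_triangle[of "u t" "w (\<eta> (\<theta> t))" "v (\<theta> t)"] by linarith
  then have "\<exists>\<zeta>\<in>time_changes T. \<forall>t\<in>{0..T}.
      \<bar>\<zeta> t - t\<bar> \<le> e1 + e2 \<and> dist (u t) (w (\<zeta> t)) \<le> e1 + e2"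
    using time_changes_comp[OF \<theta>(1) \<eta>(1)] by (intro bexI[of _ "\<lambda>t. \<eta> (\<theta> t)"]) auto
  moreover have "0 \<le> e1 + e2" "e1 + e2 < skorokhod_dist T u v + skorokhod_dist T v w + \<epsilon>"
    using e1 e2 by auto
  ultimately have "skorokhod_dist T u w < skorokhod_dist T u v + skorokhod_dist T v w + \<epsilon>"
    using skorokhod_dist_less_iff[OF T u w] by blast
  then show "skorokhod_dist T u w \<le> skorokhod_dist T u v + skorokhod_dist T v w + \<epsilon>" by simp
qed

lemma skorokhod_dist_zero:
  assumes T: "T \<ge> 0" and v: "v \<in> cadlag T" and w: "w \<in> cadlag T"
    and 0: "skorokhod_dist T v w = 0"
  shows "v = w"
proof (rule extensionalityI)
  show "v \<in> extensional {0..T}" "w \<in> extensional {0..T}" using v w by (auto simp: cadlag_def)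
  fix t assume t: "t \<in> {0..T}"
  have near: "\<exists>\<theta>\<in>time_changes T. \<forall>t\<in>{0..T}. \<bar>\<theta> t - t\<bar> < \<epsilon> \<and> dist (v t) (w (\<theta> t)) < \<epsilon>"
    if "\<epsilon> > 0" for \<epsilon>
  proof -
    have "skorokhod_dist T v w < \<epsilon>" using that 0 by simp
    then obtain e \<theta> where e: "e < \<epsilon>" and \<theta>: "\<theta> \<in> time_changes T"
      "\<And>t. t \<in> {0..T} \<Longrightarrow> \<bar>\<theta> t - t\<bar> \<le> e \<and> dist (v t) (w (\<theta> t)) \<le> e"
      using skorokhod_dist_less_iff[OF T v w] by blast
    have "\<forall>t\<in>{0..T}. \<bar>\<theta> t - t\<bar> < \<epsilon> \<and> dist (v t) (w (\<theta> t)) < \<epsilon>"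
      using e \<theta>(2) by (meson le_less_trans)
    then show ?thesis using \<theta>(1) by blast
  qed
  have "dist (v t) (w t) \<le> \<epsilon>" if \<epsilon>: "\<epsilon> > 0" for \<epsilon>
  proof (cases "t < T")
    case True
    have "(v \<longlongrightarrow> v t) (at_right t)" "(w \<longlongrightarrow> w t) (at_right t)"
      using v w t True by (auto simp: cadlag_def)
    then have "eventually (\<lambda>s. dist (v s) (v t) < \<epsilon>/3) (at_right t)"
      "eventually (\<lambda>s. dist (w s) (w t) < \<epsilon>/3) (at_right t)"
      using tendstoD[of _ _ _ "\<epsilon>/3"] \<epsilon> by simp_all
    then have "eventually (\<lambda>s. dist (v s) (v t) < \<epsilon>/3 \<and> dist (w s) (w t) < \<epsilon>/3) (at_right t)"
      by (rule eventually_conj)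
    then obtain b where b: "b > t" "\<And>s. s > t \<Longrightarrow> s < b \<Longrightarrow>
        dist (v s) (v t) < \<epsilon>/3 \<and> dist (w s) (w t) < \<epsilon>/3"
      by (auto simp: eventually_at_right_field)
    define c where "c = min b T"
    define s where "s = (t + c) / 2"
    have c: "c > t" "c \<le> b" "c \<le> T" using b(1) True by (auto simp: c_def)
    have s: "t < s" "s < c" "s \<in> {0..T}" using c t by (auto simp: s_def)
    have pos: "min (\<epsilon>/3) ((c - t)/2) > 0" using \<epsilon> c by simp
    obtain \<theta> where \<theta>: "\<theta> \<in> time_changes T" "\<forall>q\<in>{0..T}. \<bar>\<theta> q - q\<bar> < min (\<epsilon>/3) ((c - t)/2) \<and>
        dist (v q) (w (\<theta> q)) < min (\<epsilon>/3) ((c - t)/2)"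
      using near[OF pos] by (elim bexE) (rule that)
    have "\<bar>\<theta> s - s\<bar> < (c - t)/2" "dist (v s) (w (\<theta> s)) < \<epsilon>/3" 
      using bspec[OF \<theta>(2) s(3)] by simp_all
    then have "t < \<theta> s" "\<theta> s < c" unfolding s_def by argo+
    then have "dist (w (\<theta> s)) (w t) < \<epsilon>/3" "dist (v s) (v t) < \<epsilon>/3"
      using b(2)[of "\<theta> s"] b(2)[of s] s c by auto
    then show ?thesis
      using \<open>dist (v s) (w (\<theta> s)) < \<epsilon>/3\<close> dist_triangle[of "v t" "w t" "v s"]
        dist_triangle[of "v s" "w t" "w (\<theta> s)"] by (simp add: dist_commute)
  next
    case False
    then have "t = T" using t by simp
    obtain \<theta> where "\<theta> \<in> time_changes T" "\<forall>t\<in>{0..T}. \<bar>\<theta> t - t\<bar> < \<epsilon> \<and> dist (v t) (w (\<theta> t)) < \<epsilon>"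
      using near[OF \<epsilon>] by (elim bexE) (rule that)
    then show ?thesis using time_changes_end[of \<theta> T] T t \<open>t = T\<close> by force
  qed
  then have "dist (v t) (w t) \<le> 0" by (rule field_le_epsilon) simp
  then show "v t = w t" by simp
qed

lemma Metric_space_skorokhod:
  assumes T: "T \<ge> 0"
  shows "Metric_space (cadlag T :: (real \<Rightarrow> 'b::metric_space) set) (skorokhod_dist T)"
proof
  fix u v w :: "real \<Rightarrow> 'b"
  show "0 \<le> skorokhod_dist T v w"
    using skorokhod_dist_nonneg[OF T, of v w] by (auto simp: skorokhod_dist_def)
  show "skorokhod_dist T v w = skorokhod_dist T w v"
  proof (cases "v \<in> cadlag T \<and> w \<in> cadlag T")
    case True
    then show ?thesis
      using skorokhod_dist_commute_le[OF T, of v w] skorokhod_dist_commute_le[OF T, of w v] by simp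
  next
    case False
    then show ?thesis unfolding skorokhod_dist_def by auto
  qed
  assume vw: "v \<in> cadlag T" "w \<in> cadlag T"
  have "skorokhod_dist T v v \<le> r" if "r > 0" for r
  proof -
    have "skorokhod_dist T v v < r"
      unfolding skorokhod_dist_less_iff[OF T vw(1) vw(1)]
      using time_changes_id[of T] that by (intro exI[of _ 0]) (auto intro!: bexI[of _ "\<lambda>t. t"])
    then show ?thesis by simp
  qed
  then have "skorokhod_dist T v v = 0"
    using skorokhod_dist_nonneg[OF T vw(1) vw(1)] by (metis add_0 antisym field_le_epsilon)
  then show "skorokhod_dist T v w = 0 \<longleftrightarrow> v = w"
    using skorokhod_dist_zero[OF T vw] by auto
  assume "u \<in> cadlag T"
  then show "skorokhod_dist T u w \<le> skorokhod_dist T u v + skorokhod_dist T v w"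
    using skorokhod_dist_triangle[OF T _ vw] by simp
qed

definition skorokhod_topology :: "real \<Rightarrow> (real \<Rightarrow> 'b::metric_space) topology" where
  "skorokhod_topology T = Metric_space.mtopology (cadlag T) (skorokhod_dist T)"

definition skorokhod_borel :: "real \<Rightarrow> (real \<Rightarrow> 'b::metric_space) measure" where
  "skorokhod_borel T = sigma (cadlag T) {U. openin (skorokhod_topology T) U}"

lemma space_skorokhod_borel:
  assumes "T \<ge> 0"
  shows "space (skorokhod_borel T) = (cadlag T :: (real \<Rightarrow> 'b::metric_space) set)"
proof -
  interpret Metric_space "cadlag T :: (real \<Rightarrow> 'b) set" "skorokhod_dist T"
    by (rule Metric_space_skorokhod[OF assms])
  show "space (skorokhod_borel T) = (cadlag T :: (real \<Rightarrow> 'b) set)"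
    unfolding skorokhod_borel_def skorokhod_topology_def
    by (rule space_measure_of) (use openin_subset topspace_mtopology in blast)
qed

text \<open>Weak convergence of finite measures on the Borel sets of a topology \<open>S\<close>.\<close>

definition weakly_converges ::
  "'c topology \<Rightarrow> (nat \<Rightarrow> 'c measure) \<Rightarrow> 'c measure \<Rightarrow> bool" where
  "weakly_converges S \<mu> \<nu> \<longleftrightarrow>
     (\<forall>F. continuous_map S euclideanreal F \<and> bounded (F ` topspace S) \<longrightarrow>
        (\<lambda>n. \<integral>x. F x \<partial>\<mu> n) \<longlonglongrightarrow> (\<integral>x. F x \<partial>\<nu>))"

definition walk_law ::
  "real \<Rightarrow> ('v \<Rightarrow> 'b::metric_space) \<Rightarrow> nat \<Rightarrow> 'w measure \<Rightarrow> (nat \<Rightarrow> 'w \<Rightarrow> 'v) \<Rightarrow>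
     (real \<Rightarrow> 'b) measure" where
  "walk_law T \<iota> k M X =
     distr M (skorokhod_borel T) (\<lambda>\<omega>. \<lambda>t\<in>{0..T}. \<iota> (step_process k X t \<omega>))"


section \<open>Stationary symmetric Markov processes\<close>

definition symmetric_semigroup ::
  "'b measure \<Rightarrow> (real \<Rightarrow> ('b \<Rightarrow> real) \<Rightarrow> 'b \<Rightarrow> real) \<Rightarrow> bool" where
  "symmetric_semigroup m P \<longleftrightarrow>
     (\<forall>t\<ge>0. \<forall>f\<in>L2 m. P t f \<in> L2 m) \<and>
     (\<forall>t\<ge>0. \<forall>f\<in>L2 m. \<forall>g\<in>L2 m. (AE x in m. f x = g x) \<longrightarrow> (AE x in m. P t f x = P t g x)) \<and>
     (\<forall>t\<ge>0. \<forall>f\<in>L2 m. \<forall>g\<in>L2 m. \<forall>a.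
        AE x in m. P t (\<lambda>x. a * f x + g x) x = a * P t f x + P t g x) \<and>
     (\<forall>f\<in>L2 m. AE x in m. P 0 f x = f x) \<and>
     (\<forall>s\<ge>0. \<forall>t\<ge>0. \<forall>f\<in>L2 m. AE x in m. P (s + t) f x = P s (P t f) x) \<and>
     (\<forall>t\<ge>0. \<forall>f\<in>L2 m. \<forall>g\<in>L2 m. (\<integral>x. P t f x * g x \<partial>m) = (\<integral>x. f x * P t g x \<partial>m))"

text \<open>For times $s \le t_1 \le \dots \le t_n$ this is
  $P_{t_1-s}(f_1 P_{t_2-t_1}(f_2 \cdots P_{t_n-t_{n-1}} f_n))$.\<close>

fun iterated_semigroup ::
  "(real \<Rightarrow> ('b \<Rightarrow> real) \<Rightarrow> 'b \<Rightarrow> real) \<Rightarrow> real \<Rightarrow> (real \<times> ('b \<Rightarrow> real)) list \<Rightarrow> 'b \<Rightarrow> real" where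
  "iterated_semigroup P s [] = (\<lambda>x. 1)"
| "iterated_semigroup P s ((t, f) # tfs) =
     P (t - s) (\<lambda>x. f x * iterated_semigroup P t tfs x)"

text \<open>The process \<open>Z\<close> is indexed by $[0,T]$ and \<open>M\<close> is a finite measure.  The last clause says that
  the finite-dimensional distributions are determined by \<open>m\<close> and \<open>P\<close>.\<close>

definition stationary_symmetric_markov ::
  "real \<Rightarrow> 'b::topological_space measure \<Rightarrow> 'p measure \<Rightarrow> (real \<Rightarrow> 'p \<Rightarrow> 'b) \<Rightarrow> bool" where
  "stationary_symmetric_markov T m M Z \<longleftrightarrow>
     (\<forall>t\<in>{0..T}. Z t \<in> M \<rightarrow>\<^sub>M borel) \<and>
     distr M borel (Z 0) = m \<and>
     (\<exists>P. symmetric_semigroup m P \<and>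
        (\<forall>t\<ge>0. \<forall>f\<in>L2 m. (\<integral>x. P t f x \<partial>m) = (\<integral>x. f x \<partial>m)) \<and>
        (\<forall>t\<in>{0..T}. \<forall>f\<in>L2 m.
           AE \<omega> in M. P t f (Z 0 \<omega>) =
             real_cond_exp M (vimage_algebra (space M) (Z 0) borel) (\<lambda>\<omega>. f (Z t \<omega>)) \<omega>) \<and>
        (\<forall>tfs. sorted (map fst tfs) \<and>
               (\<forall>(t, f)\<in>set tfs. t \<in> {0..T} \<and> f \<in> borel_measurable borel \<and> bounded (range f)) \<longrightarrow>
           (\<integral>\<omega>. (\<Prod>(t, f)\<leftarrow>tfs. f (Z t \<omega>)) \<partial>M) = (\<integral>x. iterated_semigroup P 0 tfs x \<partial>m)))"

end

theory Submission
  imports Defs "HOL-Library.Diagonal_Subsequence"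
begin

text \<open>The transition operator of the walk on \<open>D\<^sub>k\<close> is a contraction of \<open>L\<^sup>2(m\<^sub>k)\<close>, symmetric with respect to
  \<open>m\<^sub>k\<close>, and its powers do not increase the discrete Dirichlet form. For the functions of the algebra
  \<open>\<C>\<close> this form is bounded in \<open>k\<close>, so a discrete Poincare inequality on small cubes makes the images
  of a core function under the discrete semigroups precompact for strong \<open>L\<^sup>2\<close>-convergence along the
  varying measures \<open>m\<^sub>k \<rightarrow> m\<close>. A diagonal argument over the countable core and rational times gives a
  subsequence along which the discrete semigroups converge strongly to a symmetric semigroup on
  \<open>L\<^sup>2(D)\<close>; no identification of the limit is needed. Finite-dimensional distributions are integrals of
  nested products of semigroups and bounded continuous functions, and strong convergence passes
  through these products. Evaluation at a fixed time is not continuous on the Skorokhod space, but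
  its average over a short time interval is, and averaging is undone at the end by right-continuity
  of the paths.\<close>

section \<open>Square-integrable functions\<close>

text \<open>For an arbitrary bounded domain the embedding of \<open>W12 D\<close> into L2 need not
  be compact, and nothing is known about the graphs near the frontier. Compactness is rescued by
  boundedness: core functions are bounded and the walks preserve sup bounds. On cells inside
  \<open>D\<close> the energy controls the oscillation; the remaining layer costs at most the
  squared bound times its mass, which tends to zero. That the grid sees the whole interior is due to
  connectedness: every compact subset of \<open>D\<close> is eventually covered by cubes chained to
  \<open>x0\<close>. The functions on the different graphs lie in different L2 spaces. They are
  compared through one class \<open>TT\<close> of bounded, almost everywhere continuous functions,
  each of which has a restriction to every vertex set. Almost everywhere continuity admits both the
  cell indicators, from which limits are assembled, and the pull-backs of continuous functions on
  the completion. The part of the completion outside the image of \<open>D\<close> is null, so the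
  limiting semigroup is built on \<open>L2 (leb D)\<close> and moved to the completion only at the
  end. Thinning the sequence once more does not change the given weak limit.\<close>

lemma L2_I: "f \<in> borel_measurable N \<Longrightarrow> integrable N (\<lambda>x. (f x)\<^sup>2) \<Longrightarrow> f \<in> L2 N"
  by (simp add: L2_def)

lemma L2_measurable [measurable_dest]: "f \<in> L2 N \<Longrightarrow> f \<in> borel_measurable N"
  by (simp add: L2_def)

lemma L2_integrable_sq: "f \<in> L2 N \<Longrightarrow> integrable N (\<lambda>x. (f x)\<^sup>2)"
  by (simp add: L2_def)

lemma L2_integrable_mult:
  assumes "f \<in> L2 N" "g \<in> L2 N"
  shows "integrable N (\<lambda>x. f x * g x)"
proof (rule Bochner_Integration.integrable_bound)
  show "integrable N (\<lambda>x. (f x)\<^sup>2 + (g x)\<^sup>2)"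
    using assms by (intro Bochner_Integration.integrable_add L2_integrable_sq)
  show "(\<lambda>x. f x * g x) \<in> borel_measurable N"
    using assms by measurable
  have "\<bar>a * b\<bar> \<le> a\<^sup>2 + b\<^sup>2" for a b :: real
  proof -
    have "2 * (\<bar>a\<bar> * \<bar>b\<bar>) \<le> a\<^sup>2 + b\<^sup>2"
      using sum_squares_bound[of "\<bar>a\<bar>" "\<bar>b\<bar>"] by simp
    moreover have "0 \<le> \<bar>a\<bar> * \<bar>b\<bar>" by simp
    ultimately show ?thesis unfolding abs_mult by linarith
  qed
  then show "AE x in N. norm (f x * g x) \<le> norm ((f x)\<^sup>2 + (g x)\<^sup>2)"
    by (simp add: abs_of_nonneg)
qed

lemma L2_lin:
  assumes "f \<in> L2 N" "g \<in> L2 N"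
  shows "(\<lambda>x. a * f x + g x) \<in> L2 N"
proof (rule L2_I)
  show "(\<lambda>x. a * f x + g x) \<in> borel_measurable N" using assms by measurable
  have "integrable N (\<lambda>x. a\<^sup>2 * (f x)\<^sup>2 + 2 * a * (f x * g x) + (g x)\<^sup>2)"
    using assms by (intro Bochner_Integration.integrable_add integrable_mult_right
        L2_integrable_sq L2_integrable_mult)
  then show "integrable N (\<lambda>x. (a * f x + g x)\<^sup>2)"
    by (simp add: power2_sum power_mult_distrib algebra_simps)
qed

lemma L2_diff: "f \<in> L2 N \<Longrightarrow> g \<in> L2 N \<Longrightarrow> (\<lambda>x. f x - g x) \<in> L2 N"
  using L2_lin[of g N f "-1"] by simp

lemma L2_zero [simp]: "(\<lambda>x. 0) \<in> L2 N"
  by (simp add: L2_def)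

lemma L2_cmult: "f \<in> L2 N \<Longrightarrow> (\<lambda>x. a * f x) \<in> L2 N"
  using L2_lin[of f N "\<lambda>x. 0" a] by simp

lemma L2_dominated:
  assumes "f \<in> L2 N" "g \<in> borel_measurable N" "AE x in N. \<bar>g x\<bar> \<le> K * \<bar>f x\<bar>"
  shows "g \<in> L2 N"
proof (rule L2_I[OF assms(2)])
  have "integrable N (\<lambda>x. K\<^sup>2 * (f x)\<^sup>2)"
    using assms by (intro integrable_mult_right L2_integrable_sq)
  moreover have "(\<lambda>x. (g x)\<^sup>2) \<in> borel_measurable N" using assms(2) by measurable
  moreover have "AE x in N. norm ((g x)\<^sup>2) \<le> norm (K\<^sup>2 * (f x)\<^sup>2)"
    using assms(3)
  proof eventually_elim
    case (elim x)
    have "(g x)\<^sup>2 \<le> (K * \<bar>f x\<bar>)\<^sup>2" using elim by (metis abs_ge_zero power2_abs power_mono)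
    then show ?case by (simp add: power_mult_distrib)
  qed
  ultimately show "integrable N (\<lambda>x. (g x)\<^sup>2)"
    by (rule Bochner_Integration.integrable_bound)
qed

lemma L2_bounded_mult:
  assumes "f \<in> L2 N" "g \<in> borel_measurable N" "AE x in N. \<bar>g x\<bar> \<le> K"
  shows "(\<lambda>x. g x * f x) \<in> L2 N"
proof (rule L2_dominated[OF assms(1), of _ K])
  show "AE x in N. \<bar>g x * f x\<bar> \<le> K * \<bar>f x\<bar>"
    using assms(3) by eventually_elim (simp add: abs_mult mult_right_mono)
qed (use assms in measurable)

lemma (in finite_measure) L2_bounded:
  assumes "g \<in> borel_measurable M" "AE x in M. \<bar>g x\<bar> \<le> K"
  shows "g \<in> L2 M"
proof -
  have "(\<lambda>x. 1) \<in> L2 M" by (simp add: L2_def)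
  from L2_bounded_mult[OF this assms] show ?thesis by simp
qed

lemma (in finite_measure) L2_integrable:
  assumes "g \<in> L2 M"
  shows "integrable M g"
proof -
  have "(\<lambda>x. 1) \<in> L2 M" by (simp add: L2_def)
  from L2_integrable_mult[OF assms this] show ?thesis by simp
qed

lemma norm_L2_nonneg [simp]: "0 \<le> norm_L2 N f"
  by (simp add: norm_L2_def)

lemma norm_L2_sq: "(norm_L2 N f)\<^sup>2 = (\<integral>x. (f x)\<^sup>2 \<partial>N)"
  by (simp add: norm_L2_def)

lemma L2_Cauchy_Schwarz:
  assumes "f \<in> L2 N" "g \<in> L2 N"
  shows "\<bar>\<integral>x. f x * g x \<partial>N\<bar> \<le> norm_L2 N f * norm_L2 N g"
proof -
  let ?a = "\<integral>x. (f x)\<^sup>2 \<partial>N" and ?b = "\<integral>x. f x * g x \<partial>N" and ?c = "\<integral>x. (g x)\<^sup>2 \<partial>N"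
  note ints = L2_integrable_sq[OF assms(1)] L2_integrable_sq[OF assms(2)] L2_integrable_mult[OF assms]
  have quad: "0 \<le> s\<^sup>2 * ?a + 2 * s * t * ?b + t\<^sup>2 * ?c" for s t
  proof -
    have "0 \<le> (\<integral>x. (s * f x + t * g x)\<^sup>2 \<partial>N)" by simp
    also have "(\<lambda>x. (s * f x + t * g x)\<^sup>2) =
        (\<lambda>x. s\<^sup>2 * (f x)\<^sup>2 + 2 * s * t * (f x * g x) + t\<^sup>2 * (g x)\<^sup>2)"
      by (auto simp: power2_eq_square algebra_simps)
    also have "(\<integral>x. s\<^sup>2 * (f x)\<^sup>2 + 2 * s * t * (f x * g x) + t\<^sup>2 * (g x)\<^sup>2 \<partial>N) =
        s\<^sup>2 * ?a + 2 * s * t * ?b + t\<^sup>2 * ?c"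
      using ints by simp
    finally show ?thesis .
  qed
  have "?b\<^sup>2 \<le> ?a * ?c"
  proof (cases "?c = 0")
    case True
    have "?b = 0"
    proof (rule ccontr)
      assume "?b \<noteq> 0"
      \<comment> \<open>With \<open>?c = 0\<close> the form is affine in its second variable; at
        this point it takes the value -1.\<close>
      then show False using quad[of 1 "- (?a + 1) / (2 * ?b)"] True by (simp add: field_simps)
    qed
    then show ?thesis using True by simp
  next
    case False
    have "0 \<le> ?c" by simp
    with False have "?c > 0" by linarith
    \<comment> \<open>Evaluating the form at \<open>(?c, - ?b)\<close> produces the discriminant
      multiplied by \<open>?c\<close>.\<close>
    moreover have "0 \<le> ?c * (?a * ?c - ?b\<^sup>2)"
      using quad[of ?c "- ?b"] by (simp add: power2_eq_square algebra_simps)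
    ultimately show ?thesis by (simp add: zero_le_mult_iff)
  qed
  then have "\<bar>?b\<bar> \<le> sqrt (?a * ?c)" by (simp add: real_le_rsqrt)
  then show ?thesis by (simp add: norm_L2_def real_sqrt_mult)
qed

lemma norm_L2_triangle:
  assumes "f \<in> L2 N" "g \<in> L2 N"
  shows "norm_L2 N (\<lambda>x. f x + g x) \<le> norm_L2 N f + norm_L2 N g"
proof -
  have "(norm_L2 N (\<lambda>x. f x + g x))\<^sup>2 =
      (norm_L2 N f)\<^sup>2 + 2 * (\<integral>x. f x * g x \<partial>N) + (norm_L2 N g)\<^sup>2"
    using L2_integrable_sq[OF assms(1)] L2_integrable_sq[OF assms(2)] L2_integrable_mult[OF assms]
    by (simp add: norm_L2_sq power2_sum mult.assoc)
  also have "\<dots> \<le> (norm_L2 N f + norm_L2 N g)\<^sup>2"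
    using L2_Cauchy_Schwarz[OF assms] by (simp add: power2_sum)
  finally show ?thesis by (rule power2_le_imp_le) simp
qed

lemma norm_L2_minus: "norm_L2 N (\<lambda>x. f x - g x) = norm_L2 N (\<lambda>x. g x - f x)"
  by (simp add: norm_L2_def power2_commute)

lemma norm_L2_cmult: "norm_L2 N (\<lambda>x. a * f x) = \<bar>a\<bar> * norm_L2 N f"
  by (simp add: norm_L2_def power_mult_distrib real_sqrt_mult)

lemma norm_L2_triangle_diff:
  assumes "f \<in> L2 N" "g \<in> L2 N" "h \<in> L2 N"
  shows "norm_L2 N (\<lambda>x. f x - h x) \<le> norm_L2 N (\<lambda>x. f x - g x) + norm_L2 N (\<lambda>x. g x - h x)"
  using norm_L2_triangle[OF L2_diff[OF assms(1,2)] L2_diff[OF assms(2,3)]] by simp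

lemma norm_L2_diff_ge:
  assumes "f \<in> L2 N" "g \<in> L2 N"
  shows "\<bar>norm_L2 N f - norm_L2 N g\<bar> \<le> norm_L2 N (\<lambda>x. f x - g x)"
  using norm_L2_triangle_diff[OF assms L2_zero] norm_L2_triangle_diff[OF assms(2,1) L2_zero]
  by (simp add: norm_L2_minus[of _ g f])

lemma norm_L2_mono:
  assumes "f \<in> borel_measurable N" "g \<in> L2 N" "AE x in N. \<bar>f x\<bar> \<le> K * \<bar>g x\<bar>"
  shows "norm_L2 N f \<le> \<bar>K\<bar> * norm_L2 N g"
proof -
  have f: "f \<in> L2 N" by (rule L2_dominated[OF assms(2,1,3)])
  have "(\<integral>x. (f x)\<^sup>2 \<partial>N) \<le> (\<integral>x. (K * g x)\<^sup>2 \<partial>N)"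
  proof (rule integral_mono_AE)
    show "integrable N (\<lambda>x. (f x)\<^sup>2)" "integrable N (\<lambda>x. (K * g x)\<^sup>2)"
      using f L2_cmult[OF assms(2)] by (auto intro: L2_integrable_sq)
    show "AE x in N. (f x)\<^sup>2 \<le> (K * g x)\<^sup>2"
      using assms(3)
    proof eventually_elim
      case (elim x)
      then have "\<bar>f x\<bar> \<le> \<bar>K * g x\<bar>" using mult_right_mono[OF abs_ge_self abs_ge_zero, of K "g x"] by (simp add: abs_mult)
      then show ?case by (simp add: abs_le_square_iff)
    qed
  qed
  then show ?thesis
    unfolding norm_L2_cmult[symmetric] by (simp add: norm_L2_def)
qed

lemma norm_L2_cong_AE:
  assumes "f \<in> borel_measurable N" "g \<in> borel_measurable N" "AE x in N. f x = g x"
  shows "norm_L2 N f = norm_L2 N g"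
  unfolding norm_L2_def using assms by (subst integral_cong_AE[of _ _ "\<lambda>x. (g x)\<^sup>2"]) auto

lemma norm_L2_eq_0:
  assumes "f \<in> L2 N" "norm_L2 N f = 0"
  shows "AE x in N. f x = 0"
proof -
  have "(\<integral>x. (f x)\<^sup>2 \<partial>N) = 0" using assms(2) by (simp add: norm_L2_def)
  then have "AE x in N. (f x)\<^sup>2 = 0"
    using integral_nonneg_eq_0_iff_AE[OF L2_integrable_sq[OF assms(1)]] by simp
  then show ?thesis by simp
qed

lemma (in finite_measure) L2_integral_diff_le:
  assumes "f \<in> L2 M" "g \<in> L2 M"
  shows "\<bar>(\<integral>x. f x \<partial>M) - (\<integral>x. g x \<partial>M)\<bar> \<le>
    sqrt (measure M (space M)) * norm_L2 M (\<lambda>x. f x - g x)"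
proof -
  have one: "(\<lambda>x. 1) \<in> L2 M" by (simp add: L2_def)
  have "\<bar>\<integral>x. 1 * (f x - g x) \<partial>M\<bar> \<le> norm_L2 M (\<lambda>x. 1) * norm_L2 M (\<lambda>x. f x - g x)"
    by (rule L2_Cauchy_Schwarz[OF one L2_diff[OF assms]])
  then show ?thesis
    using assms L2_integrable by (simp add: norm_L2_def)
qed

text \<open>Riesz-Fischer on a finite measure space. There L2-Cauchy implies L1-Cauchy, which gives
  an almost everywhere convergent subsequence; Fatou's lemma turns the Cauchy bounds into L2 bounds
  against the pointwise limit.\<close>

lemma (in finite_measure) L2_complete:
  assumes u: "\<And>n. u n \<in> L2 M"
    and cauchy: "\<And>e. e > 0 \<Longrightarrow> \<exists>K. \<forall>i\<ge>K. \<forall>j\<ge>K. norm_L2 M (\<lambda>x. u i x - u j x) < e"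
  shows "\<exists>f\<in>L2 M. (\<lambda>n. norm_L2 M (\<lambda>x. u n x - f x)) \<longlonglongrightarrow> 0"
proof -
  note um [measurable] = L2_measurable[OF u]
  have one: "(\<lambda>x. 1) \<in> L2 M" by (simp add: L2_def)
  define C where "C = sqrt (measure M (space M))"
  have L1: "(\<integral>x. norm (u i x - u j x) \<partial>M) \<le> C * norm_L2 M (\<lambda>x. u i x - u j x)" for i j
  proof -
    have d: "(\<lambda>x. norm (u i x - u j x)) \<in> L2 M"
      by (rule L2_dominated[OF L2_diff[OF u u, of i j], of _ 1])
        (simp_all add: borel_measurable_norm borel_measurable_diff um)
    from L2_Cauchy_Schwarz[OF one d] show ?thesis
      by (simp add: norm_L2_def C_def)
  qed
  have "\<exists>K. \<forall>i\<ge>K. \<forall>j\<ge>K. (\<integral>x. norm (u i x - u j x) \<partial>M) < e" if e: "e > 0" for e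
  proof -
    have "e / (C + 1) > 0" using e by (simp add: C_def add_nonneg_pos)
    from cauchy[OF this] obtain K where K: "\<And>i j. i \<ge> K \<Longrightarrow> j \<ge> K \<Longrightarrow>
      norm_L2 M (\<lambda>x. u i x - u j x) < e / (C + 1)" by blast
    have C0: "C \<ge> 0" by (simp add: C_def)
    have "(\<integral>x. norm (u i x - u j x) \<partial>M) < e" if "i \<ge> K" "j \<ge> K" for i j
    proof -
      have "C * norm_L2 M (\<lambda>x. u i x - u j x) \<le> C * (e / (C + 1))"
        using K[OF that] C0 by (intro mult_left_mono) auto
      also have "\<dots> < e" using C0 e by (simp add: field_simps)
      finally show ?thesis using L1[of i j] by linarith
    qed
    then show ?thesis by blast
  qed
  then obtain r where r: "strict_mono r" "AE x in M. Cauchy (\<lambda>i. u (r i) x)"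
    using cauchy_L1_AE_cauchy_subseq[of M u] L2_integrable[OF u] by blast
  define f where "f x = lim (\<lambda>i. u (r i) x)" for x
  have f_meas [measurable]: "f \<in> borel_measurable M"
    unfolding f_def using u by (intro borel_measurable_lim_metric) (auto dest: L2_measurable)
  have lim: "AE x in M. (\<lambda>i. u (r i) x) \<longlonglongrightarrow> f x"
    using r(2) by eventually_elim (simp add: f_def Cauchy_convergent_iff convergent_LIMSEQ_iff)
  have key: "integrable M (\<lambda>x. (u n x - f x)\<^sup>2) \<and> (\<integral>x. (u n x - f x)\<^sup>2 \<partial>M) \<le> e\<^sup>2"
    if K: "\<And>i j. i \<ge> K \<Longrightarrow> j \<ge> K \<Longrightarrow> norm_L2 M (\<lambda>x. u i x - u j x) < e" and n: "n \<ge> K" for n K e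
  proof -
    have e0: "e \<ge> 0" using K[OF order_refl order_refl] norm_L2_nonneg[of M "\<lambda>x. u K x - u K x"] by linarith
    have "(\<integral>\<^sup>+x. ennreal ((u n x - f x)\<^sup>2) \<partial>M) =
        (\<integral>\<^sup>+x. liminf (\<lambda>i. ennreal ((u n x - u (r i) x)\<^sup>2)) \<partial>M)"
    proof (rule nn_integral_cong_AE)
      show "AE x in M. ennreal ((u n x - f x)\<^sup>2) = liminf (\<lambda>i. ennreal ((u n x - u (r i) x)\<^sup>2))"
        using lim
      proof eventually_elim
        case (elim x)
        then have "(\<lambda>i. ennreal ((u n x - u (r i) x)\<^sup>2)) \<longlonglongrightarrow> ennreal ((u n x - f x)\<^sup>2)"
          by (intro tendsto_intros)
        then show ?case by (rule lim_imp_Liminf[OF trivial_limit_sequentially, symmetric])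
      qed
    qed
    also have "\<dots> \<le> liminf (\<lambda>i. (\<integral>\<^sup>+x. ennreal ((u n x - u (r i) x)\<^sup>2) \<partial>M))"
      by (rule nn_integral_liminf) measurable
    also have "\<dots> \<le> liminf (\<lambda>i::nat. ennreal (e\<^sup>2))"
    proof (rule Liminf_mono)
      show "\<forall>\<^sub>F i in sequentially. (\<integral>\<^sup>+x. ennreal ((u n x - u (r i) x)\<^sup>2) \<partial>M) \<le> ennreal (e\<^sup>2)"
        using eventually_ge_at_top[of K]
      proof eventually_elim
        case (elim i)
        then have ri: "r i \<ge> K" using seq_suble[OF r(1), of i] by linarith
        have "(\<integral>\<^sup>+x. ennreal ((u n x - u (r i) x)\<^sup>2) \<partial>M) =
            ennreal ((norm_L2 M (\<lambda>x. u n x - u (r i) x))\<^sup>2)"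
          unfolding norm_L2_sq
          using L2_integrable_sq[OF L2_diff[OF u u]] by (intro nn_integral_eq_integral) auto
        also have "\<dots> \<le> ennreal (e\<^sup>2)"
          using K[OF n ri] by (intro ennreal_leI power_mono) auto
        finally show ?case .
      qed
    qed
    also have "\<dots> = ennreal (e\<^sup>2)" by (simp add: Liminf_const)
    finally have le: "(\<integral>\<^sup>+x. ennreal ((u n x - f x)\<^sup>2) \<partial>M) \<le> ennreal (e\<^sup>2)" .
    have int: "integrable M (\<lambda>x. (u n x - f x)\<^sup>2)"
    proof (rule integrableI_bounded)
      show "(\<integral>\<^sup>+x. ennreal (norm ((u n x - f x)\<^sup>2)) \<partial>M) < \<infinity>"
        using le by (simp add: le_less_trans)
    qed measurable
    moreover have "ennreal (\<integral>x. (u n x - f x)\<^sup>2 \<partial>M) \<le> ennreal (e\<^sup>2)"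
      using le nn_integral_eq_integral[OF int] by simp
    ultimately show ?thesis by (simp add: ennreal_le_iff)
  qed
  have "f \<in> L2 M"
  proof -
    obtain K where K: "\<And>i j. i \<ge> K \<Longrightarrow> j \<ge> K \<Longrightarrow> norm_L2 M (\<lambda>x. u i x - u j x) < 1"
      using cauchy[of 1] by auto
    have "(\<lambda>x. u K x - f x) \<in> L2 M"
      using key[of K 1 K] K by (intro L2_I) auto
    from L2_diff[OF u this, of K] show ?thesis by simp
  qed
  moreover have "(\<lambda>n. norm_L2 M (\<lambda>x. u n x - f x)) \<longlonglongrightarrow> 0"
  proof (rule LIMSEQ_I)
    fix e :: real assume e: "e > 0"
    then obtain K where K: "\<And>i j. i \<ge> K \<Longrightarrow> j \<ge> K \<Longrightarrow> norm_L2 M (\<lambda>x. u i x - u j x) < e/2"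
      using cauchy[of "e/2"] by auto
    have "norm_L2 M (\<lambda>x. u n x - f x) < e" if "n \<ge> K" for n
    proof -
      have "(norm_L2 M (\<lambda>x. u n x - f x))\<^sup>2 \<le> (e/2)\<^sup>2"
        using key[OF K that] by (simp add: norm_L2_sq)
      then have "norm_L2 M (\<lambda>x. u n x - f x) \<le> e/2"
        by (rule power2_le_imp_le) (use e in simp)
      then show ?thesis using e by simp
    qed
    then show "\<exists>no. \<forall>n\<ge>no. norm (norm_L2 M (\<lambda>x. u n x - f x) - 0) < e" by auto
  qed
  ultimately show ?thesis by blast
qed

section \<open>Strong convergence along varying measures\<close>

lemma norm_L2_lin_le:
  assumes "f \<in> L2 N" "g \<in> L2 N"
  shows "norm_L2 N (\<lambda>x. a * f x + g x) \<le> \<bar>a\<bar> * norm_L2 N f + norm_L2 N g"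
  using norm_L2_triangle[OF L2_cmult[OF assms(1), of a] assms(2)] by (simp add: norm_L2_cmult)

lemma norm_L2_zero [simp]: "norm_L2 N (\<lambda>x. 0) = 0"
  by (simp add: norm_L2_def)

text \<open>Polarisation, which later reduces limits of inner products to limits of norms. The
  factor \<open>1 *\<close> is kept so that the sum has the shape of the linear combinations in
  \<open>sconv_lin\<close>.\<close>

lemma L2_inner_polar:
  assumes "f \<in> L2 N" "g \<in> L2 N"
  shows "(\<integral>x. f x * g x \<partial>N) =
    ((norm_L2 N (\<lambda>x. 1 * f x + g x))\<^sup>2 - (norm_L2 N f)\<^sup>2 - (norm_L2 N g)\<^sup>2) / 2"
  using L2_integrable_sq[OF assms(1)] L2_integrable_sq[OF assms(2)] L2_integrable_mult[OF assms]
  by (simp add: norm_L2_sq power2_sum mult.assoc)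

lemma norm_L2_bounded_mult:
  assumes "f \<in> L2 N" "g \<in> borel_measurable N" "AE x in N. \<bar>g x\<bar> \<le> K"
  shows "norm_L2 N (\<lambda>x. g x * f x) \<le> \<bar>K\<bar> * norm_L2 N f"
proof (rule norm_L2_mono[OF _ assms(1)])
  show "(\<lambda>x. g x * f x) \<in> borel_measurable N" using assms by measurable
  show "AE x in N. \<bar>g x * f x\<bar> \<le> K * \<bar>f x\<bar>"
    using assms(3) by eventually_elim (simp add: abs_mult mult_right_mono)
qed

definition truncate :: "real \<Rightarrow> real \<Rightarrow> real" where
  "truncate B y = max (- B) (min B y)"

lemma truncate_lipschitz: "\<bar>truncate B y - truncate B z\<bar> \<le> \<bar>y - z\<bar>"
  by (auto simp: truncate_def max_def min_def)

lemma truncate_bound: "B \<ge> 0 \<Longrightarrow> \<bar>truncate B y\<bar> \<le> B"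
  by (auto simp: truncate_def max_def min_def)

lemma truncate_id: "\<bar>y\<bar> \<le> B \<Longrightarrow> truncate B y = y"
  by (auto simp: truncate_def max_def min_def)

lemma borel_measurable_truncate [measurable]: "truncate B \<in> borel_measurable borel"
  unfolding truncate_def by measurable

text \<open>The \<open>\<mu> k\<close> stand for weights on finite vertex sets, where every function
  is measurable and square integrable; this is \<open>all_L2\<close>. A member of \<open>TT\<close>
  is one function on the common type, so it represents an element of every
  \<open>L2 (\<mu> k)\<close> and of \<open>L2 M\<close> at once, and \<open>TT_integral\<close> is
  convergence of the measures tested on it.\<close>

locale L2_approx =
  fixes \<mu> :: "nat \<Rightarrow> 'a measure" and M :: "'a measure" and TT :: "('a \<Rightarrow> real) set"
  assumes all_L2: "\<And>k u. u \<in> L2 (\<mu> k)"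
    and fin_M: "finite_measure M"
    and TT_measurable: "\<And>c. c \<in> TT \<Longrightarrow> c \<in> borel_measurable M"
    and TT_bounded: "\<And>c. c \<in> TT \<Longrightarrow> \<exists>B. (\<forall>x\<in>space M. \<bar>c x\<bar> \<le> B) \<and> (\<forall>k. \<forall>x\<in>space (\<mu> k). \<bar>c x\<bar> \<le> B)"
    and TT_lin: "\<And>a c c'. c \<in> TT \<Longrightarrow> c' \<in> TT \<Longrightarrow> (\<lambda>x. a * c x + c' x) \<in> TT"
    and TT_mult: "\<And>c c'. c \<in> TT \<Longrightarrow> c' \<in> TT \<Longrightarrow> (\<lambda>x. c x * c' x) \<in> TT"
    and TT_truncate: "\<And>B c. c \<in> TT \<Longrightarrow> (\<lambda>x. truncate B (c x)) \<in> TT"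
    and TT_one: "(\<lambda>x. 1) \<in> TT"
    and TT_integral: "\<And>c. c \<in> TT \<Longrightarrow> (\<lambda>k. \<integral>x. c x \<partial>\<mu> k) \<longlonglongrightarrow> (\<integral>x. c x \<partial>M)"
    and TT_dense: "\<And>h e. h \<in> L2 M \<Longrightarrow> e > 0 \<Longrightarrow> \<exists>c\<in>TT. norm_L2 M (\<lambda>x. h x - c x) < e"
begin

sublocale finite_measure M by (rule fin_M)

text \<open>Strong convergence along varying Hilbert spaces in the sense of Kuwae and Shioya: since
  \<open>u k\<close> and \<open>h\<close> lie in different spaces, closeness is measured by a common
  approximant \<open>c\<close>, chosen before \<open>k\<close> tends to infinity.\<close>

definition sconv :: "(nat \<Rightarrow> 'a \<Rightarrow> real) \<Rightarrow> ('a \<Rightarrow> real) \<Rightarrow> bool" where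
  "sconv u h \<longleftrightarrow> h \<in> L2 M \<and> (\<forall>e>0. \<exists>c\<in>TT. norm_L2 M (\<lambda>x. h x - c x) < e \<and>
     (\<forall>\<^sub>F k in sequentially. norm_L2 (\<mu> k) (\<lambda>x. u k x - c x) < e))"

lemma TT_L2: "c \<in> TT \<Longrightarrow> c \<in> L2 M"
  using TT_bounded[of c] TT_measurable[of c] by (blast intro: L2_bounded AE_I2)

lemma TT_norm:
  assumes "c \<in> TT"
  shows "(\<lambda>k. norm_L2 (\<mu> k) c) \<longlonglongrightarrow> norm_L2 M c"
  using TT_integral[OF TT_mult[OF assms assms]] unfolding norm_L2_def power2_eq_square
  by (intro tendsto_real_sqrt)

lemma sconv_L2: "sconv u h \<Longrightarrow> h \<in> L2 M"
  by (simp add: sconv_def)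

lemma sconvE:
  assumes "sconv u h" "e > 0"
  obtains c where "c \<in> TT" "norm_L2 M (\<lambda>x. h x - c x) < e"
    "\<forall>\<^sub>F k in sequentially. norm_L2 (\<mu> k) (\<lambda>x. u k x - c x) < e"
  using assms by (auto simp: sconv_def)

lemma sconv_TT: "c \<in> TT \<Longrightarrow> sconv (\<lambda>k. c) c"
  using TT_L2 by (auto simp: sconv_def intro!: bexI[of _ c])

text \<open>Closedness of strong convergence: an approximant of \<open>v\<close> and
  \<open>g\<close> at half the tolerance serves for \<open>u\<close> and \<open>h\<close> by the
  triangle inequality in each space.\<close>

lemma sconv_stable:
  assumes h: "h \<in> L2 M"
    and *: "\<And>e. e > 0 \<Longrightarrow> \<exists>v g. sconv v g \<and> norm_L2 M (\<lambda>x. h x - g x) < e \<and>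
       (\<forall>\<^sub>F k in sequentially. norm_L2 (\<mu> k) (\<lambda>x. u k x - v k x) < e)"
  shows "sconv u h"
  unfolding sconv_def
proof (intro conjI allI impI)
  fix e :: real assume e: "e > 0"
  then obtain v g where v: "sconv v g" "norm_L2 M (\<lambda>x. h x - g x) < e/2"
      "\<forall>\<^sub>F k in sequentially. norm_L2 (\<mu> k) (\<lambda>x. u k x - v k x) < e/2"
    using *[of "e/2"] by auto
  from e obtain c where c: "c \<in> TT" "norm_L2 M (\<lambda>x. g x - c x) < e/2"
    "\<forall>\<^sub>F k in sequentially. norm_L2 (\<mu> k) (\<lambda>x. v k x - c x) < e/2"
    using sconvE[OF v(1), of "e/2"] by auto
  have "norm_L2 M (\<lambda>x. h x - c x) < e"
    using norm_L2_triangle_diff[OF h sconv_L2[OF v(1)] TT_L2[OF c(1)]] v(2) c(2) by simp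
  moreover have "\<forall>\<^sub>F k in sequentially. norm_L2 (\<mu> k) (\<lambda>x. u k x - c x) < e"
    using v(3) c(3)
  proof eventually_elim
    case (elim k)
    then show ?case
      using norm_L2_triangle_diff[OF all_L2 all_L2 all_L2, of k "u k" c "v k"] by simp
  qed
  ultimately show "\<exists>c\<in>TT. norm_L2 M (\<lambda>x. h x - c x) < e \<and>
     (\<forall>\<^sub>F k in sequentially. norm_L2 (\<mu> k) (\<lambda>x. u k x - c x) < e)"
    using c(1) by blast
qed (rule h)

lemma sconv_lin:
  assumes u: "sconv u h" and v: "sconv v g"
  shows "sconv (\<lambda>k x. a * u k x + v k x) (\<lambda>x. a * h x + g x)"
proof -
  have hL: "h \<in> L2 M" and gL: "g \<in> L2 M" using u v by (auto simp: sconv_L2)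
  show ?thesis
    unfolding sconv_def
  proof (intro conjI allI impI)
    show "(\<lambda>x. a * h x + g x) \<in> L2 M" by (rule L2_lin[OF hL gL])
    fix e :: real assume e: "e > 0"
    define d where "d = e / (2 * (\<bar>a\<bar> + 1))"
    have d: "d > 0" "\<bar>a\<bar> * d \<le> e/2" using e by (auto simp: d_def field_simps)
    obtain c where c: "c \<in> TT" "norm_L2 M (\<lambda>x. h x - c x) < d"
      "\<forall>\<^sub>F k in sequentially. norm_L2 (\<mu> k) (\<lambda>x. u k x - c x) < d"
      by (rule sconvE[OF u d(1)])
    obtain c' where c': "c' \<in> TT" "norm_L2 M (\<lambda>x. g x - c' x) < e/2"
      "\<forall>\<^sub>F k in sequentially. norm_L2 (\<mu> k) (\<lambda>x. v k x - c' x) < e/2"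
      using sconvE[OF v, of "e/2"] e by auto
    have eq: "a * p + q - (a * p' + q') = a * (p - p') + (q - q')" for p q p' q' :: real
      by (simp add: algebra_simps)
    have bound: "norm_L2 N (\<lambda>x. a * p x + q x - (a * c x + c' x)) < e"
      if "norm_L2 N (\<lambda>x. p x - c x) < d" "norm_L2 N (\<lambda>x. q x - c' x) < e/2"
        "p \<in> L2 N" "q \<in> L2 N" "c \<in> L2 N" "c' \<in> L2 N" for N p q
    proof -
      have "norm_L2 N (\<lambda>x. a * (p x - c x) + (q x - c' x)) \<le>
          \<bar>a\<bar> * norm_L2 N (\<lambda>x. p x - c x) + norm_L2 N (\<lambda>x. q x - c' x)"
        using that by (intro norm_L2_lin_le L2_diff)
      moreover have "\<bar>a\<bar> * norm_L2 N (\<lambda>x. p x - c x) \<le> \<bar>a\<bar> * d"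
        using that by (intro mult_left_mono) auto
      ultimately show ?thesis using d that unfolding eq by linarith
    qed
    have "norm_L2 M (\<lambda>x. a * h x + g x - (a * c x + c' x)) < e"
      using c c' hL gL by (intro bound) (auto intro: TT_L2)
    moreover have "\<forall>\<^sub>F k in sequentially. norm_L2 (\<mu> k) (\<lambda>x. a * u k x + v k x - (a * c x + c' x)) < e"
      using c(3) c'(3) by eventually_elim (intro bound all_L2)
    ultimately show "\<exists>c\<in>TT. norm_L2 M (\<lambda>x. a * h x + g x - c x) < e \<and>
       (\<forall>\<^sub>F k in sequentially. norm_L2 (\<mu> k) (\<lambda>x. a * u k x + v k x - c x) < e)"
      by (intro bexI[OF _ TT_lin[OF c(1) c'(1)]] conjI)
  qed
qed

lemma sconv_diff:
  assumes u: "sconv u h" and v: "sconv v g"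
  shows "sconv (\<lambda>k x. u k x - v k x) (\<lambda>x. h x - g x)"
  using sconv_lin[OF v u, of "-1"] by simp

lemma sconv_norm:
  assumes u: "sconv u h"
  shows "(\<lambda>k. norm_L2 (\<mu> k) (u k)) \<longlonglongrightarrow> norm_L2 M h"
proof (rule tendstoI)
  fix e :: real assume e: "e > 0"
  then have "e/3 > 0" by simp
  obtain c where c: "c \<in> TT" "norm_L2 M (\<lambda>x. h x - c x) < e/3"
    "\<forall>\<^sub>F k in sequentially. norm_L2 (\<mu> k) (\<lambda>x. u k x - c x) < e/3"
    by (rule sconvE[OF u \<open>e/3 > 0\<close>])
  from tendstoD[OF TT_norm[OF c(1)] \<open>e/3 > 0\<close>] c(3)
  show "\<forall>\<^sub>F k in sequentially. dist (norm_L2 (\<mu> k) (u k)) (norm_L2 M h) < e"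
  proof eventually_elim
    case (elim k)
    then show ?case
      using norm_L2_diff_ge[OF all_L2 all_L2, of k "u k" c]
        norm_L2_diff_ge[OF sconv_L2[OF u] TT_L2[OF c(1)]] c(2)
      unfolding dist_real_def by linarith
  qed
qed

lemma sconv_inner:
  assumes u: "sconv u h" and v: "sconv v g"
  shows "(\<lambda>k. \<integral>x. u k x * v k x \<partial>\<mu> k) \<longlonglongrightarrow> (\<integral>x. h x * g x \<partial>M)"
  unfolding L2_inner_polar[OF all_L2 all_L2] L2_inner_polar[OF sconv_L2[OF u] sconv_L2[OF v]]
  by (intro tendsto_intros sconv_norm sconv_lin u v) simp

lemma sconv_integral:
  assumes u: "sconv u h"
  shows "(\<lambda>k. \<integral>x. u k x \<partial>\<mu> k) \<longlonglongrightarrow> (\<integral>x. h x \<partial>M)"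
  using sconv_inner[OF u sconv_TT[OF TT_one]] by simp

text \<open>The difference of the two sequences is identically zero, and \<open>sconv_norm\<close>
  carries its norm to the norm of \<open>h - g\<close>.\<close>

lemma sconv_unique:
  assumes u: "sconv u h" and v: "sconv u g"
  shows "AE x in M. h x = g x"
proof -
  have "(\<lambda>k::nat. 0) \<longlonglongrightarrow> norm_L2 M (\<lambda>x. h x - g x)"
    using sconv_norm[OF sconv_diff[OF u v]] by simp
  then have "norm_L2 M (\<lambda>x. h x - g x) = 0"
    by (metis LIMSEQ_unique tendsto_const)
  then have "AE x in M. h x - g x = 0"
    by (intro norm_L2_eq_0 L2_diff sconv_L2[OF u] sconv_L2[OF v])
  then show ?thesis by simp
qed

lemma L2_cong_AE:
  assumes "f \<in> L2 N" "g \<in> borel_measurable N" "AE x in N. f x = g x"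
  shows "g \<in> L2 N"
  by (rule L2_dominated[OF assms(1,2), of 1]) (use assms(3) in auto)

lemma sconv_cong:
  assumes u: "sconv u h" and g: "g \<in> borel_measurable M" "AE x in M. h x = g x"
  shows "sconv u g"
proof (rule sconv_stable)
  have hm: "h \<in> borel_measurable M" using sconv_L2[OF u] by (rule L2_measurable)
  show "g \<in> L2 M" by (rule L2_cong_AE[OF sconv_L2[OF u] g])
  have "norm_L2 M (\<lambda>x. g x - h x) = norm_L2 M (\<lambda>x. h x - h x)"
    using g hm by (intro norm_L2_cong_AE) auto
  then show "\<exists>v w. sconv v w \<and> norm_L2 M (\<lambda>x. g x - w x) < e \<and>
       (\<forall>\<^sub>F k in sequentially. norm_L2 (\<mu> k) (\<lambda>x. u k x - v k x) < e)" if "e > 0" for e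
    using u that by (intro exI[of _ u] exI[of _ h]) simp
qed

lemma sconv_close:
  assumes u: "sconv u h" and v: "(\<lambda>k. norm_L2 (\<mu> k) (\<lambda>x. v k x - u k x)) \<longlonglongrightarrow> 0"
  shows "sconv v h"
proof (rule sconv_stable)
  show "h \<in> L2 M" using u by (rule sconv_L2)
  fix e :: real assume "e > 0"
  then show "\<exists>w g. sconv w g \<and> norm_L2 M (\<lambda>x. h x - g x) < e \<and>
       (\<forall>\<^sub>F k in sequentially. norm_L2 (\<mu> k) (\<lambda>x. v k x - w k x) < e)"
    using u order_tendstoD(2)[OF v] by (intro exI[of _ u] exI[of _ h]) simp
qed

text \<open>A product of two strongly convergent sequences need not be square integrable in the
  limit, so one factor is a fixed member of \<open>TT\<close>. Its bound holds on all the spaces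
  simultaneously, which keeps the error uniform in \<open>k\<close>.\<close>

lemma sconv_mult:
  assumes u: "sconv u h" and c: "c \<in> TT"
  shows "sconv (\<lambda>k x. c x * u k x) (\<lambda>x. c x * h x)"
  unfolding sconv_def
proof (intro conjI allI impI)
  obtain B where B: "\<And>x. x \<in> space M \<Longrightarrow> \<bar>c x\<bar> \<le> B" "\<And>k x. x \<in> space (\<mu> k) \<Longrightarrow> \<bar>c x\<bar> \<le> B"
    using TT_bounded[OF c] by blast
  note h = sconv_L2[OF u] and cM = TT_measurable[OF c]
  show "(\<lambda>x. c x * h x) \<in> L2 M" by (rule L2_bounded_mult[OF h cM]) (use B in auto)
  fix e :: real assume e: "e > 0"
  define d where "d = e / (\<bar>B\<bar> + 1)"
  have d: "d > 0" "\<bar>B\<bar> * d < e" using e by (auto simp: d_def field_simps)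
  obtain q where q: "q \<in> TT" "norm_L2 M (\<lambda>x. h x - q x) < d"
    "\<forall>\<^sub>F k in sequentially. norm_L2 (\<mu> k) (\<lambda>x. u k x - q x) < d"
    by (rule sconvE[OF u d(1)])
  have bound: "norm_L2 N (\<lambda>x. c x * p x - c x * q x) < e"
    if "norm_L2 N (\<lambda>x. p x - q x) < d" "p \<in> L2 N" "q \<in> L2 N" "c \<in> borel_measurable N"
       "AE x in N. \<bar>c x\<bar> \<le> B" for N p
  proof -
    have "norm_L2 N (\<lambda>x. c x * (p x - q x)) \<le> \<bar>B\<bar> * norm_L2 N (\<lambda>x. p x - q x)"
      using that by (intro norm_L2_bounded_mult L2_diff)
    also have "\<dots> \<le> \<bar>B\<bar> * d" using that by (intro mult_left_mono) auto
    finally show ?thesis using d by (simp add: right_diff_distrib)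
  qed
  have "norm_L2 M (\<lambda>x. c x * h x - c x * q x) < e"
    using q h cM B by (intro bound) (auto intro: TT_L2)
  moreover have "\<forall>\<^sub>F k in sequentially. norm_L2 (\<mu> k) (\<lambda>x. c x * u k x - c x * q x) < e"
    using q(3)
  proof eventually_elim
    case (elim k)
    then show ?case using B(2) by (intro bound all_L2 L2_measurable AE_I2)
  qed
  ultimately show "\<exists>q\<in>TT. norm_L2 M (\<lambda>x. c x * h x - q x) < e \<and>
     (\<forall>\<^sub>F k in sequentially. norm_L2 (\<mu> k) (\<lambda>x. c x * u k x - q x) < e)"
    by (intro bexI[OF _ TT_mult[OF c q(1)]] conjI)
qed

lemma norm_L2_truncate_le:
  assumes "f \<in> L2 N" "g \<in> L2 N"
  shows "norm_L2 N (\<lambda>x. truncate B (f x) - truncate B (g x)) \<le> norm_L2 N (\<lambda>x. f x - g x)"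
proof -
  have "norm_L2 N (\<lambda>x. truncate B (f x) - truncate B (g x)) \<le> \<bar>1\<bar> * norm_L2 N (\<lambda>x. f x - g x)"
  proof (rule norm_L2_mono[OF _ L2_diff[OF assms]])
    show "(\<lambda>x. truncate B (f x) - truncate B (g x)) \<in> borel_measurable N"
      using assms by measurable
  qed (simp add: truncate_lipschitz)
  then show ?thesis by simp
qed

lemma sconv_truncate:
  assumes u: "sconv u h"
  shows "sconv (\<lambda>k x. truncate B (u k x)) (\<lambda>x. truncate B (h x))"
  unfolding sconv_def
proof (intro conjI allI impI)
  note h = sconv_L2[OF u]
  show "(\<lambda>x. truncate B (h x)) \<in> L2 M"
    by (rule L2_bounded[of _ "\<bar>B\<bar>"]) (use h in \<open>measurable, auto simp: truncate_def max_def min_def\<close>)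
  fix e :: real assume e: "e > 0"
  obtain q where q: "q \<in> TT" "norm_L2 M (\<lambda>x. h x - q x) < e"
    "\<forall>\<^sub>F k in sequentially. norm_L2 (\<mu> k) (\<lambda>x. u k x - q x) < e"
    by (rule sconvE[OF u e])
  have "norm_L2 M (\<lambda>x. truncate B (h x) - truncate B (q x)) < e"
    using norm_L2_truncate_le[OF h TT_L2[OF q(1)], of B] q(2) by linarith
  moreover have "\<forall>\<^sub>F k in sequentially. norm_L2 (\<mu> k) (\<lambda>x. truncate B (u k x) - truncate B (q x)) < e"
    using q(3)
  proof eventually_elim
    case (elim k)
    then show ?case using norm_L2_truncate_le[OF all_L2[of "u k" k] all_L2[of q k], of B] by linarith
  qed
  ultimately show "\<exists>q\<in>TT. norm_L2 M (\<lambda>x. truncate B (h x) - q x) < e \<and>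
     (\<forall>\<^sub>F k in sequentially. norm_L2 (\<mu> k) (\<lambda>x. truncate B (u k x) - q x) < e)"
    by (intro bexI[OF _ TT_truncate[OF q(1)]] conjI)
qed

text \<open>Completeness without a candidate for the limit: approximable sequences converge. The
  limit is found as the L2 limit of the limits \<open>g i\<close> of better and better approximating
  sequences.\<close>

lemma sconv_complete:
  assumes *: "\<And>e. e > 0 \<Longrightarrow> \<exists>v g. sconv v g \<and>
     (\<forall>\<^sub>F k in sequentially. norm_L2 (\<mu> k) (\<lambda>x. u k x - v k x) < e)"
  shows "\<exists>h. sconv u h"
proof -
  define \<delta> :: "nat \<Rightarrow> real" where "\<delta> i = inverse (real (Suc i))" for i
  have \<delta>: "\<delta> i > 0" for i by (simp add: \<delta>_def)
  have \<delta>0: "\<delta> \<longlonglongrightarrow> 0" unfolding \<delta>_def by (rule LIMSEQ_inverse_real_of_nat)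
  have "\<forall>i. \<exists>v g. sconv v g \<and>
      (\<forall>\<^sub>F k in sequentially. norm_L2 (\<mu> k) (\<lambda>x. u k x - v k x) < \<delta> i)"
    using *[OF \<delta>] by (rule allI)
  then have "\<exists>v g. \<forall>i. sconv (v i) (g i) \<and>
      (\<forall>\<^sub>F k in sequentially. norm_L2 (\<mu> k) (\<lambda>x. u k x - v i k x) < \<delta> i)"
    by (simp only: choice_iff)
  then obtain v g where vg: "\<forall>i. sconv (v i) (g i) \<and>
      (\<forall>\<^sub>F k in sequentially. norm_L2 (\<mu> k) (\<lambda>x. u k x - v i k x) < \<delta> i)"
    by (elim exE) (rule that)
  have v: "sconv (v i) (g i)"
    and ev: "\<forall>\<^sub>F k in sequentially. norm_L2 (\<mu> k) (\<lambda>x. u k x - v i k x) < \<delta> i" for i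
    using spec[OF vg, of i] by auto
  \<comment> \<open>Both \<open>v i\<close> and \<open>v j\<close> are eventually close to
    \<open>u\<close>, hence to each other, and \<open>sconv_norm\<close> moves the estimate to
    \<open>M\<close>.\<close>
  have le: "norm_L2 M (\<lambda>x. g i x - g j x) \<le> \<delta> i + \<delta> j" for i j
  proof (rule tendsto_upperbound[OF sconv_norm[OF sconv_diff[OF v v]]])
    show "\<forall>\<^sub>F k in sequentially. norm_L2 (\<mu> k) (\<lambda>x. v i k x - v j k x) \<le> \<delta> i + \<delta> j"
      using ev[of i] ev[of j]
    proof eventually_elim
      case (elim k)
      then show ?case
        using norm_L2_triangle_diff[OF all_L2 all_L2 all_L2, of k "v i k" "v j k" "u k"]
        by (simp add: norm_L2_minus[of _ "v i k"])
    qed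
  qed simp
  have "\<exists>h\<in>L2 M. (\<lambda>n. norm_L2 M (\<lambda>x. g n x - h x)) \<longlonglongrightarrow> 0"
  proof (rule L2_complete)
    show "g n \<in> L2 M" for n using v by (rule sconv_L2)
    fix e :: real assume "e > 0"
    then have "\<forall>\<^sub>F i in sequentially. \<delta> i < e/2" by (intro order_tendstoD[OF \<delta>0]) simp
    then obtain K where K: "\<And>i. i \<ge> K \<Longrightarrow> \<delta> i < e/2" by (auto simp: eventually_sequentially)
    have "norm_L2 M (\<lambda>x. g i x - g j x) < e" if "i \<ge> K" "j \<ge> K" for i j
      using le[of i j] K[OF that(1)] K[OF that(2)] by linarith
    then show "\<exists>K. \<forall>i\<ge>K. \<forall>j\<ge>K. norm_L2 M (\<lambda>x. g i x - g j x) < e" by blast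
  qed
  then obtain h where h: "h \<in> L2 M" and lim: "(\<lambda>n. norm_L2 M (\<lambda>x. g n x - h x)) \<longlonglongrightarrow> 0" by blast
  have "sconv u h"
  proof (rule sconv_stable[OF h])
    fix e :: real assume "e > 0"
    then have "\<forall>\<^sub>F i in sequentially. \<delta> i < e \<and> norm_L2 M (\<lambda>x. g i x - h x) < e"
      using order_tendstoD(2)[OF \<delta>0] order_tendstoD(2)[OF lim] by (simp add: eventually_conj)
    then obtain i where i: "\<delta> i < e" "norm_L2 M (\<lambda>x. g i x - h x) < e"
      by (auto simp: eventually_sequentially)
    show "\<exists>v g. sconv v g \<and> norm_L2 M (\<lambda>x. h x - g x) < e \<and>
       (\<forall>\<^sub>F k in sequentially. norm_L2 (\<mu> k) (\<lambda>x. u k x - v k x) < e)"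
      using v[of i] i(2) eventually_mono[OF ev[of i], of "\<lambda>k. norm_L2 (\<mu> k) (\<lambda>x. u k x - v i k x) < e"] i(1)
      by (intro exI[of _ "v i"] exI[of _ "g i"]) (auto simp: norm_L2_minus[of _ h])
  qed
  then show ?thesis by (intro exI)
qed

text \<open>A diagonal construction: stage \<open>k\<close> uses the approximant
  \<open>c (I k)\<close> of the largest index that is already under control at \<open>k\<close>.
  This recovery sequence allows properties of the discrete operators to be passed to any element of
  \<open>L2 M\<close>.\<close>

lemma sconv_approx:
  assumes h: "h \<in> L2 M"
  shows "\<exists>u. sconv u h"
proof -
  define \<delta> :: "nat \<Rightarrow> real" where "\<delta> i = inverse (real (Suc i))" for i
  have \<delta>: "\<delta> i > 0" for i by (simp add: \<delta>_def)
  have \<delta>0: "\<delta> \<longlonglongrightarrow> 0" unfolding \<delta>_def by (rule LIMSEQ_inverse_real_of_nat)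
  have \<delta>_mono: "\<delta> j \<le> \<delta> i" if "i \<le> j" for i j using that by (simp add: \<delta>_def field_simps)
  obtain c where c: "\<And>i. c i \<in> TT" "\<And>i. norm_L2 M (\<lambda>x. h x - c i x) < \<delta> i"
    using TT_dense[OF h \<delta>] by metis
  \<comment> \<open>In \<open>M\<close> the distance of \<open>c i'\<close> and \<open>c i\<close>
    is below \<open>\<delta> i' + \<delta> i\<close>, at most \<open>2 * \<delta> i'\<close>; the
    third \<open>\<delta> i'\<close> leaves room for the passage to large \<open>k\<close>.\<close>
  define good where "good i k \<longleftrightarrow>
    (\<forall>k'\<ge>k. \<forall>i'\<le>i. norm_L2 (\<mu> k') (\<lambda>x. c i' x - c i x) \<le> 3 * \<delta> i')" for i k
  have "\<exists>k. good i k" for i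
  proof -
    have "\<forall>\<^sub>F k in sequentially. norm_L2 (\<mu> k) (\<lambda>x. c i' x - c i x) < 3 * \<delta> i'" if "i' \<le> i" for i'
    proof (rule order_tendstoD(2)[OF sconv_norm[OF sconv_diff[OF sconv_TT sconv_TT]]])
      show "norm_L2 M (\<lambda>x. c i' x - c i x) < 3 * \<delta> i'"
        using norm_L2_triangle_diff[OF TT_L2 h TT_L2, of "c i'" "c i"] c(1) c(2)[of i] c(2)[of i']
          \<delta>_mono[OF that] \<delta>[of i'] by (simp add: norm_L2_minus[of _ "c i'" h])
    qed (use c in auto)
    then have "\<forall>\<^sub>F k in sequentially. \<forall>i'\<in>{..i}. norm_L2 (\<mu> k) (\<lambda>x. c i' x - c i x) < 3 * \<delta> i'"
      by (intro eventually_ball_finite) auto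
    then show ?thesis
      unfolding good_def eventually_sequentially by (metis atMost_iff less_imp_le)
  qed
  then obtain N where N: "\<And>i. good i (N i)" by metis
  have good_mono: "good i k \<Longrightarrow> k \<le> k' \<Longrightarrow> good i k'" for i k k'
    unfolding good_def by (meson order_trans)
  have good0: "good 0 k" for k using \<delta>[of 0] by (simp add: good_def)
  \<comment> \<open>The bound \<open>i \<le> k\<close> makes the maximum exist, and index 0 is
    always good, so the set is not empty.\<close>
  define I where "I k = (GREATEST i. i \<le> k \<and> good i k)" for k
  have I: "I k \<le> k \<and> good (I k) k" for k
    unfolding I_def by (rule GreatestI_nat[of _ 0 k]) (use good0 in auto)
  have I_ge: "i \<le> I k" if "i \<le> k" "good i k" for i k
    unfolding I_def by (rule Greatest_le_nat[of _ _ k]) (use that in auto)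
  have "sconv (\<lambda>k. c (I k)) h"
    unfolding sconv_def
  proof (intro conjI allI impI h)
    fix e :: real assume "e > 0"
    then have "\<forall>\<^sub>F i in sequentially. \<delta> i < e/3" by (intro order_tendstoD[OF \<delta>0]) simp
    then obtain i where i: "\<delta> i < e/3" by (auto simp: eventually_sequentially)
    have "norm_L2 (\<mu> k) (\<lambda>x. c (I k) x - c i x) < e" if "k \<ge> max i (N i)" for k
    proof -
      have "i \<le> I k" using that good_mono[OF N] by (intro I_ge) auto
      then have "norm_L2 (\<mu> k) (\<lambda>x. c i x - c (I k) x) \<le> 3 * \<delta> i"
        using I[of k] by (auto simp: good_def)
      then show ?thesis using i by (simp add: norm_L2_minus[of _ "c i"])
    qed
    then have "\<forall>\<^sub>F k in sequentially. norm_L2 (\<mu> k) (\<lambda>x. c (I k) x - c i x) < e"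
      by (rule eventually_sequentiallyI)
    moreover have "norm_L2 M (\<lambda>x. h x - c i x) < e" using c(2)[of i] i \<delta>[of i] by linarith
    ultimately show "\<exists>c'\<in>TT. norm_L2 M (\<lambda>x. h x - c' x) < e \<and>
      (\<forall>\<^sub>F k in sequentially. norm_L2 (\<mu> k) (\<lambda>x. c (I k) x - c' x) < e)"
      using c(1) by blast
  qed
  then show ?thesis by (intro exI)
qed

end

section \<open>Limits of discrete-time symmetric semigroups\<close>

text \<open>\<open>P k n\<close> is the n-step operator of the k-th chain and
  \<open>\<tau> k\<close> the duration of a step. Convergence is demanded only for core functions at
  rational times, which is what a countable diagonal argument supplies. All other times follow from
  \<open>core_equi\<close>, a Hoelder bound of exponent 1/2 in time uniform in large
  \<open>k\<close>, and all other functions from contractivity and density.\<close>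

locale L2_semigroup = L2_approx \<mu> M TT
  for \<mu> :: "nat \<Rightarrow> 'a measure" and M :: "'a measure" and TT :: "('a \<Rightarrow> real) set" +
  fixes P :: "nat \<Rightarrow> nat \<Rightarrow> ('a \<Rightarrow> real) \<Rightarrow> 'a \<Rightarrow> real" and \<tau> :: "nat \<Rightarrow> real"
    and core :: "('a \<Rightarrow> real) set"
  assumes P_0: "\<And>k u. P k 0 u = u"
    and P_add: "\<And>k m n u. P k (m + n) u = P k m (P k n u)"
    and P_lin: "\<And>k n a u v. P k n (\<lambda>x. a * u x + v x) = (\<lambda>x. a * P k n u x + P k n v x)"
    and P_contraction: "\<And>k n u. norm_L2 (\<mu> k) (P k n u) \<le> norm_L2 (\<mu> k) u"
    and P_symmetric: "\<And>k n u v. (\<integral>x. P k n u x * v x \<partial>\<mu> k) = (\<integral>x. u x * P k n v x \<partial>\<mu> k)"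
    and P_bounded: "\<And>k n u B. (\<And>x. x \<in> space (\<mu> k) \<Longrightarrow> \<bar>u x\<bar> \<le> B) \<Longrightarrow> 0 \<le> B \<Longrightarrow>
        x \<in> space (\<mu> k) \<Longrightarrow> \<bar>P k n u x\<bar> \<le> B"
    and P_integral: "\<And>k n u. (\<integral>x. P k n u x \<partial>\<mu> k) = (\<integral>x. u x \<partial>\<mu> k)"
    and core_TT: "core \<subseteq> TT"
    and core_dense: "\<And>h e. h \<in> L2 M \<Longrightarrow> e > 0 \<Longrightarrow> \<exists>c\<in>core. norm_L2 M (\<lambda>x. h x - c x) < e"
    and core_equi: "\<And>c. c \<in> core \<Longrightarrow> \<exists>K. \<forall>\<^sub>F k in sequentially. \<forall>m n.
        (norm_L2 (\<mu> k) (\<lambda>x. P k m c x - P k n c x))\<^sup>2 \<le> K * \<bar>real m - real n\<bar> * \<tau> k"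
    and \<tau>_pos: "\<And>k. \<tau> k > 0" and \<tau>_lim: "\<tau> \<longlonglongrightarrow> 0"
    and core_limit: "\<And>c t. c \<in> core \<Longrightarrow> t \<in> \<rat> \<Longrightarrow> 0 \<le> t \<Longrightarrow>
        \<exists>h. sconv (\<lambda>k. P k (nat \<lfloor>t / \<tau> k\<rfloor>) c) h"
begin

lemma floor_steps:
  assumes "0 \<le> t"
  shows "(\<lambda>k. real (nat \<lfloor>t / \<tau> k\<rfloor>) * \<tau> k) \<longlonglongrightarrow> t"
proof (rule tendsto_sandwich)
  have eq: "real (nat \<lfloor>t / \<tau> k\<rfloor>) = of_int \<lfloor>t / \<tau> k\<rfloor>" for k
    using assms \<tau>_pos[of k] by (simp add: divide_nonneg_pos)
  show "\<forall>\<^sub>F k in sequentially. t - \<tau> k \<le> real (nat \<lfloor>t / \<tau> k\<rfloor>) * \<tau> k"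
  proof (intro always_eventually allI)
    fix k
    have "t / \<tau> k - 1 \<le> of_int \<lfloor>t / \<tau> k\<rfloor>" by linarith
    then have "(t / \<tau> k - 1) * \<tau> k \<le> of_int \<lfloor>t / \<tau> k\<rfloor> * \<tau> k"
      using \<tau>_pos[of k] by (intro mult_right_mono) auto
    then show "t - \<tau> k \<le> real (nat \<lfloor>t / \<tau> k\<rfloor>) * \<tau> k"
      using \<tau>_pos[of k] unfolding eq by (simp add: left_diff_distrib)
  qed
  show "\<forall>\<^sub>F k in sequentially. real (nat \<lfloor>t / \<tau> k\<rfloor>) * \<tau> k \<le> t"
  proof (intro always_eventually allI)
    fix k
    have "of_int \<lfloor>t / \<tau> k\<rfloor> * \<tau> k \<le> t / \<tau> k * \<tau> k"
      using \<tau>_pos[of k] by (intro mult_right_mono) auto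
    then show "real (nat \<lfloor>t / \<tau> k\<rfloor>) * \<tau> k \<le> t"
      using \<tau>_pos[of k] unfolding eq by simp
  qed
  show "(\<lambda>k. t - \<tau> k) \<longlonglongrightarrow> t" using tendsto_diff[OF tendsto_const \<tau>_lim, of t] by simp
qed simp

lemma P_diff: "P k n (\<lambda>x. u x - v x) = (\<lambda>x. P k n u x - P k n v x)"
  using P_lin[of k n "-1" v u] by simp

lemma P_close: "norm_L2 (\<mu> k) (\<lambda>x. P k n u x - P k n v x) \<le> norm_L2 (\<mu> k) (\<lambda>x. u x - v x)"
  using P_contraction[of k n "\<lambda>x. u x - v x"] by (simp add: P_diff)

text \<open>The Hoelder bound in a form for step counts that vary with \<open>k\<close>: only the
  time gap of \<open>m k\<close> and \<open>n k\<close> matters, and \<open>\<delta>\<close> is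
  chosen before the two sequences.\<close>

lemma core_equi_eventually:
  assumes c: "c \<in> core" and e: "e > 0"
  shows "\<exists>\<delta>>0. \<forall>m n. (\<forall>\<^sub>F k in sequentially. \<bar>real (m k) - real (n k)\<bar> * \<tau> k < \<delta>) \<longrightarrow>
    (\<forall>\<^sub>F k in sequentially. norm_L2 (\<mu> k) (\<lambda>x. P k (m k) c x - P k (n k) c x) < e)"
proof -
  obtain K where K: "\<forall>\<^sub>F k in sequentially. \<forall>m n.
        (norm_L2 (\<mu> k) (\<lambda>x. P k m c x - P k n c x))\<^sup>2 \<le> K * \<bar>real m - real n\<bar> * \<tau> k"
    using core_equi[OF c] by blast
  \<comment> \<open>The factor \<open>\<bar>K\<bar> + 1\<close> is positive whatever the sign of
    \<open>K\<close>.\<close>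
  define \<delta> where "\<delta> = e\<^sup>2 / (\<bar>K\<bar> + 1)"
  have \<delta>: "\<delta> > 0" "(\<bar>K\<bar> + 1) * \<delta> = e\<^sup>2" using e by (auto simp: \<delta>_def)
  have "\<forall>\<^sub>F k in sequentially. norm_L2 (\<mu> k) (\<lambda>x. P k (m k) c x - P k (n k) c x) < e"
    if mn: "\<forall>\<^sub>F k in sequentially. \<bar>real (m k) - real (n k)\<bar> * \<tau> k < \<delta>" for m n
    using K mn
  proof eventually_elim
    case (elim k)
    let ?d = "\<bar>real (m k) - real (n k)\<bar> * \<tau> k"
    have d0: "?d \<ge> 0" using \<tau>_pos[of k] by simp
    have "(norm_L2 (\<mu> k) (\<lambda>x. P k (m k) c x - P k (n k) c x))\<^sup>2 \<le> K * ?d"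
      using elim(1)[rule_format, of "m k" "n k"] by (simp add: mult.assoc)
    also have "\<dots> \<le> (\<bar>K\<bar> + 1) * ?d" using d0 by (intro mult_right_mono) auto
    also have "\<dots> < (\<bar>K\<bar> + 1) * \<delta>" using elim(2) by (intro mult_strict_left_mono) auto
    also have "\<dots> = e\<^sup>2" by (rule \<delta>)
    finally show ?case using e by (simp add: power_less_imp_less_base)
  qed
  then show ?thesis using \<delta>(1) by (intro exI[of _ \<delta>]) simp
qed

text \<open>From rational to real times: equicontinuity replaces \<open>t\<close> by a slightly
  larger rational \<open>q\<close>, where convergence is known, and \<open>sconv_complete\<close>
  supplies the limit.\<close>

lemma core_conv:
  assumes c: "c \<in> core" and t: "0 \<le> t" and n: "(\<lambda>k. real (n k) * \<tau> k) \<longlonglongrightarrow> t"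
  shows "\<exists>h. sconv (\<lambda>k. P k (n k) c) h"
proof (rule sconv_complete)
  fix e :: real assume "e > 0"
  then obtain \<delta> where \<delta>: "\<delta> > 0" and close:
    "\<And>m n. (\<forall>\<^sub>F k in sequentially. \<bar>real (m k) - real (n k)\<bar> * \<tau> k < \<delta>) \<Longrightarrow>
    (\<forall>\<^sub>F k in sequentially. norm_L2 (\<mu> k) (\<lambda>x. P k (m k) c x - P k (n k) c x) < e)"
    using core_equi_eventually[OF c] by blast
  obtain q where q: "q \<in> \<rat>" "t < q" "q < t + \<delta>" using Rats_dense_in_real[of t "t + \<delta>"] \<delta> by auto
  then have q0: "0 \<le> q" using t by simp
  define m where "m k = nat \<lfloor>q / \<tau> k\<rfloor>" for k
  have "(\<lambda>k. real (n k) * \<tau> k - real (m k) * \<tau> k) \<longlonglongrightarrow> t - q"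
    unfolding m_def by (intro tendsto_diff n floor_steps q0)
  then have "(\<lambda>k. \<bar>real (n k) * \<tau> k - real (m k) * \<tau> k\<bar>) \<longlonglongrightarrow> \<bar>t - q\<bar>"
    by (rule tendsto_rabs)
  then have "\<forall>\<^sub>F k in sequentially. \<bar>real (n k) * \<tau> k - real (m k) * \<tau> k\<bar> < \<delta>"
    by (rule order_tendstoD) (use q in auto)
  then have "\<forall>\<^sub>F k in sequentially. \<bar>real (n k) - real (m k)\<bar> * \<tau> k < \<delta>"
  proof eventually_elim
    case (elim k)
    then show ?case using \<tau>_pos[of k] by (simp add: abs_mult_pos' flip: left_diff_distrib)
  qed
  from close[OF this] have "\<forall>\<^sub>F k in sequentially. norm_L2 (\<mu> k) (\<lambda>x. P k (n k) c x - P k (m k) c x) < e" .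
  moreover obtain h where "sconv (\<lambda>k. P k (m k) c) h"
    using core_limit[OF c q(1) q0] unfolding m_def by (elim exE)
  ultimately show "\<exists>v g. sconv v g \<and>
      (\<forall>\<^sub>F k in sequentially. norm_L2 (\<mu> k) (\<lambda>x. P k (n k) c x - v k x) < e)"
    by (intro exI conjI)
qed

lemma core_near:
  assumes u: "sconv u h" and e: "e > 0"
  obtains c where "c \<in> core" "norm_L2 M (\<lambda>x. h x - c x) < e"
    "\<forall>\<^sub>F k in sequentially. norm_L2 (\<mu> k) (\<lambda>x. u k x - c x) < e"
proof -
  obtain c where c: "c \<in> core" "norm_L2 M (\<lambda>x. h x - c x) < e"
    using core_dense[OF sconv_L2[OF u] e] by (elim bexE)
  have "sconv (\<lambda>k x. u k x - c x) (\<lambda>x. h x - c x)"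
    using c(1) core_TT by (intro sconv_diff u sconv_TT) auto
  from order_tendstoD(2)[OF sconv_norm[OF this] c(2)] c show ?thesis by (intro that)
qed

lemma P_conv:
  assumes u: "sconv u h" and t: "0 \<le> t" and n: "(\<lambda>k. real (n k) * \<tau> k) \<longlonglongrightarrow> t"
  shows "\<exists>g. sconv (\<lambda>k. P k (n k) (u k)) g"
proof (rule sconv_complete)
  fix e :: real assume e: "e > 0"
  obtain c where c: "c \<in> core" "\<forall>\<^sub>F k in sequentially. norm_L2 (\<mu> k) (\<lambda>x. u k x - c x) < e"
    using core_near[OF u e] by blast
  obtain g where g: "sconv (\<lambda>k. P k (n k) c) g" using core_conv[OF c(1) t n] by (elim exE)
  have "\<forall>\<^sub>F k in sequentially. norm_L2 (\<mu> k) (\<lambda>x. P k (n k) (u k) x - P k (n k) c x) < e"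
    using c(2) by eventually_elim (rule le_less_trans[OF P_close])
  with g show "\<exists>v g. sconv v g \<and>
      (\<forall>\<^sub>F k in sequentially. norm_L2 (\<mu> k) (\<lambda>x. P k (n k) (u k) x - v k x) < e)"
    by (intro exI conjI)
qed

text \<open>Inserting a common core function \<open>c\<close> splits the difference into two errors
  in the initial data, controlled by contractivity, and one in time, controlled by equicontinuity.
  This is what makes the choice in \<open>Q\<close> immaterial.\<close>

lemma P_limit_close:
  assumes u: "sconv u h" and v: "sconv v h"
    and n: "(\<lambda>k. real (n k) * \<tau> k) \<longlonglongrightarrow> t" and m: "(\<lambda>k. real (m k) * \<tau> k) \<longlonglongrightarrow> t"
  shows "(\<lambda>k. norm_L2 (\<mu> k) (\<lambda>x. P k (n k) (u k) x - P k (m k) (v k) x)) \<longlonglongrightarrow> 0"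
proof (rule order_tendstoI)
  fix e :: real assume e: "0 < e"
  then have e3: "e/3 > 0" by simp
  obtain c where c: "c \<in> core" "norm_L2 M (\<lambda>x. h x - c x) < e/3"
     "\<forall>\<^sub>F k in sequentially. norm_L2 (\<mu> k) (\<lambda>x. u k x - c x) < e/3"
    by (rule core_near[OF u e3])
  have vc: "sconv (\<lambda>k x. v k x - c x) (\<lambda>x. h x - c x)"
    using c(1) core_TT by (intro sconv_diff v sconv_TT) auto
  obtain \<delta> where \<delta>: "\<delta> > 0" and close:
    "\<And>m n. (\<forall>\<^sub>F k in sequentially. \<bar>real (m k) - real (n k)\<bar> * \<tau> k < \<delta>) \<Longrightarrow>
    (\<forall>\<^sub>F k in sequentially. norm_L2 (\<mu> k) (\<lambda>x. P k (m k) c x - P k (n k) c x) < e/3)"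
    using core_equi_eventually[OF c(1) e3] by blast
  have "(\<lambda>k. \<bar>real (n k) * \<tau> k - real (m k) * \<tau> k\<bar>) \<longlonglongrightarrow> \<bar>t - t\<bar>"
    by (intro tendsto_rabs tendsto_diff n m)
  then have "\<forall>\<^sub>F k in sequentially. \<bar>real (n k) * \<tau> k - real (m k) * \<tau> k\<bar> < \<delta>"
    by (rule order_tendstoD) (use \<delta> in auto)
  then have "\<forall>\<^sub>F k in sequentially. \<bar>real (n k) - real (m k)\<bar> * \<tau> k < \<delta>"
  proof eventually_elim
    case (elim k)
    then show ?case using \<tau>_pos[of k] by (simp add: abs_mult_pos' flip: left_diff_distrib)
  qed
  from close[OF this] order_tendstoD(2)[OF sconv_norm[OF vc] c(2)] c(3)
  show "\<forall>\<^sub>F k in sequentially. norm_L2 (\<mu> k) (\<lambda>x. P k (n k) (u k) x - P k (m k) (v k) x) < e"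
  proof eventually_elim
    case (elim k)
    have "norm_L2 (\<mu> k) (\<lambda>x. P k (n k) (u k) x - P k (n k) c x) < e/3"
      using P_close[of k "n k" "u k" c] elim(3) by linarith
    moreover have "norm_L2 (\<mu> k) (\<lambda>x. P k (m k) c x - P k (m k) (v k) x) < e/3"
      using P_close[of k "m k" "v k" c] elim(2) by (simp add: norm_L2_minus[of _ "P k (m k) c"])
    ultimately show ?case
      using elim(1) norm_L2_triangle_diff[OF all_L2 all_L2 all_L2, of k "P k (n k) (u k)" "P k (m k) (v k)" "P k (n k) c"]
        norm_L2_triangle_diff[OF all_L2 all_L2 all_L2, of k "P k (n k) c" "P k (m k) (v k)" "P k (m k) c"]
      by linarith
  qed
next
  fix a :: real assume "a < 0"
  then show "\<forall>\<^sub>F k in sequentially. a < norm_L2 (\<mu> k) (\<lambda>x. P k (n k) (u k) x - P k (m k) (v k) x)"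
    by (intro always_eventually allI less_le_trans[OF _ norm_L2_nonneg])
qed

section \<open>The limiting semigroup\<close>

definition Q :: "real \<Rightarrow> ('a \<Rightarrow> real) \<Rightarrow> 'a \<Rightarrow> real" where
  "Q t h = (SOME g. \<exists>u. sconv u h \<and> sconv (\<lambda>k. P k (nat \<lfloor>t / \<tau> k\<rfloor>) (u k)) g)"

text \<open>\<open>Q\<close> selects some limit along some approximating sequence and rounded step
  counts. By \<open>P_limit_close\<close> every other approximating sequence, with any step counts
  of the same limiting time, has the same limit; by \<open>sconv_unique\<close> the selection is
  determined up to null sets.\<close>

lemma Q_conv:
  assumes u: "sconv u h" and t: "0 \<le> t" and n: "(\<lambda>k. real (n k) * \<tau> k) \<longlonglongrightarrow> t"
  shows "sconv (\<lambda>k. P k (n k) (u k)) (Q t h)"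
proof -
  obtain g where "sconv (\<lambda>k. P k (nat \<lfloor>t / \<tau> k\<rfloor>) (u k)) g"
    using P_conv[OF u t floor_steps[OF t]] by (elim exE)
  with u have "\<exists>g u. sconv u h \<and> sconv (\<lambda>k. P k (nat \<lfloor>t / \<tau> k\<rfloor>) (u k)) g"
    by (intro exI conjI)
  then have "\<exists>u. sconv u h \<and> sconv (\<lambda>k. P k (nat \<lfloor>t / \<tau> k\<rfloor>) (u k)) (Q t h)"
    unfolding Q_def by (rule someI_ex)
  then obtain v where v: "sconv v h" "sconv (\<lambda>k. P k (nat \<lfloor>t / \<tau> k\<rfloor>) (v k)) (Q t h)"
    by (elim exE conjE)
  show ?thesis
    by (rule sconv_close[OF v(2) P_limit_close[OF u v(1) n floor_steps[OF t]]])
qed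

lemma Q_L2:
  assumes h: "h \<in> L2 M" and t: "0 \<le> t"
  shows "Q t h \<in> L2 M"
proof -
  obtain u where u: "sconv u h" using sconv_approx[OF h] by (elim exE)
  show ?thesis by (rule sconv_L2[OF Q_conv[OF u t floor_steps[OF t]]])
qed

lemma Q_cong:
  assumes h: "h \<in> L2 M" and g: "g \<in> L2 M" "AE x in M. h x = g x" and t: "0 \<le> t"
  shows "AE x in M. Q t h x = Q t g x"
proof -
  obtain u where u: "sconv u h" using sconv_approx[OF h] by (elim exE)
  have "sconv u g" by (rule sconv_cong[OF u L2_measurable[OF g(1)] g(2)])
  then show ?thesis
    by (intro sconv_unique[OF Q_conv[OF u t floor_steps[OF t]]] Q_conv t floor_steps)
qed

lemma Q_lin:
  assumes h: "h \<in> L2 M" and g: "g \<in> L2 M" and t: "0 \<le> t"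
  shows "AE x in M. Q t (\<lambda>x. a * h x + g x) x = a * Q t h x + Q t g x"
proof -
  obtain u where u: "sconv u h" using sconv_approx[OF h] by (elim exE)
  obtain v where v: "sconv v g" using sconv_approx[OF g] by (elim exE)
  note n = t floor_steps[OF t]
  show ?thesis
    using sconv_unique[OF Q_conv[OF sconv_lin[OF u v, of a] n]]
      sconv_lin[OF Q_conv[OF u n] Q_conv[OF v n], of a] by (simp add: P_lin)
qed

lemma Q_0:
  assumes h: "h \<in> L2 M"
  shows "AE x in M. Q 0 h x = h x"
proof -
  obtain u where u: "sconv u h" using sconv_approx[OF h] by (elim exE)
  have "sconv (\<lambda>k. P k 0 (u k)) (Q 0 h)" by (rule Q_conv[OF u]) auto
  then show ?thesis using u by (intro sconv_unique) (auto simp: P_0)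
qed

text \<open>The sum of the two rounded step counts also approximates \<open>s + t\<close>, so the
  exact discrete semigroup law survives although rounding is not additive.\<close>

lemma Q_add:
  assumes h: "h \<in> L2 M" and s: "0 \<le> s" and t: "0 \<le> t"
  shows "AE x in M. Q (s + t) h x = Q s (Q t h) x"
proof -
  obtain u where u: "sconv u h" using sconv_approx[OF h] by (elim exE)
  have "(\<lambda>k. real (nat \<lfloor>s / \<tau> k\<rfloor> + nat \<lfloor>t / \<tau> k\<rfloor>) * \<tau> k) \<longlonglongrightarrow> s + t"
    using tendsto_add[OF floor_steps[OF s] floor_steps[OF t]] by (simp add: distrib_right)
  from Q_conv[OF u _ this] s t
  have "sconv (\<lambda>k. P k (nat \<lfloor>s / \<tau> k\<rfloor>) (P k (nat \<lfloor>t / \<tau> k\<rfloor>) (u k))) (Q (s + t) h)"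
    by (simp add: P_add)
  moreover have "sconv (\<lambda>k. P k (nat \<lfloor>s / \<tau> k\<rfloor>) (P k (nat \<lfloor>t / \<tau> k\<rfloor>) (u k))) (Q s (Q t h))"
    by (intro Q_conv u s t floor_steps)
  ultimately show ?thesis by (rule sconv_unique)
qed

lemma Q_symmetric:
  assumes h: "h \<in> L2 M" and g: "g \<in> L2 M" and t: "0 \<le> t"
  shows "(\<integral>x. Q t h x * g x \<partial>M) = (\<integral>x. h x * Q t g x \<partial>M)"
proof -
  obtain u where u: "sconv u h" using sconv_approx[OF h] by (elim exE)
  obtain v where v: "sconv v g" using sconv_approx[OF g] by (elim exE)
  note n = t floor_steps[OF t]
  show ?thesis
    using sconv_inner[OF Q_conv[OF u n] v] sconv_inner[OF u Q_conv[OF v n]]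
    by (simp add: P_symmetric LIMSEQ_unique)
qed

lemma Q_integral:
  assumes h: "h \<in> L2 M" and t: "0 \<le> t"
  shows "(\<integral>x. Q t h x \<partial>M) = (\<integral>x. h x \<partial>M)"
proof -
  obtain u where u: "sconv u h" using sconv_approx[OF h] by (elim exE)
  show ?thesis
    using sconv_integral[OF Q_conv[OF u t floor_steps[OF t]]] sconv_integral[OF u]
    by (simp add: P_integral LIMSEQ_unique)
qed

lemma Q_contraction:
  assumes h: "h \<in> L2 M" and t: "0 \<le> t"
  shows "norm_L2 M (Q t h) \<le> norm_L2 M h"
proof -
  obtain u where u: "sconv u h" using sconv_approx[OF h] by (elim exE)
  show ?thesis
    by (rule LIMSEQ_le[OF sconv_norm[OF Q_conv[OF u t floor_steps[OF t]]] sconv_norm[OF u]])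
      (auto intro: P_contraction)
qed

text \<open>Truncation commutes with strong limits. The discrete evolutions of truncated data stay
  within \<open>B\<close>, so truncating them changes nothing, and therefore \<open>Q t h\<close>
  agrees almost everywhere with its own truncation.\<close>

lemma Q_bounded:
  assumes h: "h \<in> L2 M" and B: "AE x in M. \<bar>h x\<bar> \<le> B" "0 \<le> B" and t: "0 \<le> t"
  shows "AE x in M. \<bar>Q t h x\<bar> \<le> B"
proof -
  obtain u where u: "sconv u h" using sconv_approx[OF h] by (elim exE)
  have tr: "sconv (\<lambda>k x. truncate B (u k x)) h"
  proof (rule sconv_cong[OF sconv_truncate[OF u, of B]])
    show "h \<in> borel_measurable M" using h by (rule L2_measurable)
    show "AE x in M. truncate B (h x) = h x"
      using B(1) by eventually_elim (rule truncate_id)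
  qed
  let ?v = "\<lambda>k. P k (nat \<lfloor>t / \<tau> k\<rfloor>) (\<lambda>x. truncate B (u k x))"
  have v: "sconv ?v (Q t h)" by (rule Q_conv[OF tr t floor_steps[OF t]])
  have "norm_L2 (\<mu> k) (\<lambda>x. ?v k x - truncate B (?v k x)) = norm_L2 (\<mu> k) (\<lambda>x. 0)" for k
  proof (rule norm_L2_cong_AE)
    have "\<bar>?v k x\<bar> \<le> B" if "x \<in> space (\<mu> k)" for x
      using that B(2) by (intro P_bounded truncate_bound)
    then show "AE x in \<mu> k. ?v k x - truncate B (?v k x) = 0"
      by (intro AE_I2) (simp add: truncate_id)
  qed (rule L2_measurable[OF all_L2])+
  then have "sconv ?v (\<lambda>x. truncate B (Q t h x))"
    by (intro sconv_close[OF sconv_truncate[OF v, of B]]) simp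
  from sconv_unique[OF v this] show ?thesis
    by eventually_elim (metis truncate_bound[OF B(2)])
qed

end

section \<open>Finite reversible Markov chains\<close>

locale conductances =
  fixes V :: "'v set" and c :: "'v \<Rightarrow> 'v \<Rightarrow> real"
  assumes finite_V: "finite V"
    and c_nonneg: "\<And>x y. 0 \<le> c x y"
    and c_sym: "\<And>x y. c x y = c y x"
begin

definition wt :: "'v \<Rightarrow> real" where "wt x = (\<Sum>y\<in>V. c x y)"
definition prob :: "'v \<Rightarrow> 'v \<Rightarrow> real" where "prob x y = c x y / wt x"
definition step :: "('v \<Rightarrow> real) \<Rightarrow> 'v \<Rightarrow> real" where "step u x = (\<Sum>y\<in>V. prob x y * u y)"
definition steps :: "nat \<Rightarrow> ('v \<Rightarrow> real) \<Rightarrow> 'v \<Rightarrow> real" where "steps n = step ^^ n"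
definition N :: "'v measure" where "N = point_measure V (\<lambda>x. ennreal (wt x))"
text \<open>The sum runs over ordered pairs without a factor 1/2, hence the factor 2 in
  \<open>dirichlet_eq\<close>.\<close>

definition dirichlet :: "('v \<Rightarrow> real) \<Rightarrow> real" where
  "dirichlet u = (\<Sum>x\<in>V. \<Sum>y\<in>V. c x y * (u x - u y)\<^sup>2)"

lemma wt_nonneg: "0 \<le> wt x"
  by (simp add: wt_def sum_nonneg c_nonneg)

lemma space_N [simp]: "space N = V"
  by (simp add: N_def space_point_measure)

lemma integral_N: "(\<integral>x. f x \<partial>N) = (\<Sum>x\<in>V. wt x * f x)" for f :: "'v \<Rightarrow> real"
  unfolding N_def using finite_V wt_nonneg by (subst lebesgue_integral_point_measure_finite) auto

lemma L2_N: "u \<in> L2 N"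
  unfolding L2_def N_def using finite_V by (auto intro!: integrable_point_measure_finite)

text \<open>If \<open>wt x = 0\<close>, all conductances at \<open>x\<close> vanish, so the value 0
  of a division by zero is the right one.\<close>

lemma wt_prob: "y \<in> V \<Longrightarrow> wt x * prob x y = c x y"
  using sum_nonneg_eq_0_iff[OF finite_V, of "c x"] c_nonneg by (auto simp: prob_def wt_def)

lemma prob_nonneg: "0 \<le> prob x y"
  by (simp add: prob_def c_nonneg wt_nonneg)

text \<open>Equality fails exactly at vertices of weight zero, where the row of \<open>prob\<close>
  is zero.\<close>

lemma sum_prob_le: "(\<Sum>y\<in>V. prob x y) \<le> 1"
  by (simp add: prob_def flip: sum_divide_distrib wt_def)

lemma wt_step: "wt x * step u x = (\<Sum>y\<in>V. c x y * u y)"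
  by (simp add: step_def sum_distrib_left wt_prob flip: mult.assoc)

lemma integral_step_mult: "(\<integral>x. step u x * v x \<partial>N) = (\<Sum>x\<in>V. \<Sum>y\<in>V. c x y * u y * v x)"
  by (simp add: integral_N wt_step sum_distrib_right flip: mult.assoc)

lemma step_symmetric: "(\<integral>x. step u x * v x \<partial>N) = (\<integral>x. u x * step v x \<partial>N)"
proof -
  have "(\<integral>x. u x * step v x \<partial>N) = (\<integral>x. step v x * u x \<partial>N)" by (simp add: mult.commute)
  also have "\<dots> = (\<Sum>y\<in>V. \<Sum>x\<in>V. c x y * v y * u x)"
    unfolding integral_step_mult by (rule sum.swap)
  also have "\<dots> = (\<integral>x. step u x * v x \<partial>N)"
    unfolding integral_step_mult by (intro sum.cong refl) (metis c_sym mult.assoc mult.commute)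
  finally show ?thesis by simp
qed

lemma step_lin: "step (\<lambda>x. a * u x + v x) = (\<lambda>x. a * step u x + step v x)"
  by (auto simp: step_def sum_distrib_left sum.distrib algebra_simps)

lemma step_bounded:
  assumes "\<And>x. x \<in> V \<Longrightarrow> \<bar>u x\<bar> \<le> B" "0 \<le> B"
  shows "\<bar>step u x\<bar> \<le> B"
proof -
  have "\<bar>step u x\<bar> \<le> (\<Sum>y\<in>V. prob x y * B)"
    unfolding step_def using assms prob_nonneg
    by (intro order_trans[OF sum_abs] sum_mono) (auto simp: abs_mult intro!: mult_left_mono)
  also have "\<dots> \<le> 1 * B"
    unfolding sum_distrib_right[symmetric] by (intro mult_right_mono sum_prob_le assms)
  finally show ?thesis by simp
qed

lemma sum_c_sq: "(\<Sum>x\<in>V. \<Sum>y\<in>V. c x y * (u x)\<^sup>2) = (\<integral>x. (u x)\<^sup>2 \<partial>N)"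
    "(\<Sum>x\<in>V. \<Sum>y\<in>V. c x y * (u y)\<^sup>2) = (\<integral>x. (u x)\<^sup>2 \<partial>N)"
proof -
  show 1: "(\<Sum>x\<in>V. \<Sum>y\<in>V. c x y * (u x)\<^sup>2) = (\<integral>x. (u x)\<^sup>2 \<partial>N)"
    by (simp add: integral_N wt_def sum_distrib_right)
  show "(\<Sum>x\<in>V. \<Sum>y\<in>V. c x y * (u y)\<^sup>2) = (\<integral>x. (u x)\<^sup>2 \<partial>N)"
    unfolding 1[symmetric] by (subst sum.swap) (simp add: c_sym)
qed

text \<open>One identity for both ends of the spectrum of \<open>step\<close>: with
  \<open>s = -1\<close> the left side is the Dirichlet form, and with \<open>s = 1\<close> its
  nonnegativity says that the spectrum does not go below -1.\<close>

lemma sum_c_quad: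
  "(\<Sum>x\<in>V. \<Sum>y\<in>V. c x y * (u x + s * u y)\<^sup>2) =
     (1 + s\<^sup>2) * (\<integral>x. (u x)\<^sup>2 \<partial>N) + 2 * s * (\<integral>x. step u x * u x \<partial>N)"
proof -
  have "c x y * (u x + s * u y)\<^sup>2 =
      c x y * (u x)\<^sup>2 + 2 * s * (c x y * u y * u x) + s\<^sup>2 * (c x y * (u y)\<^sup>2)" for x y
    by (simp add: power2_eq_square algebra_simps)
  then have "(\<Sum>x\<in>V. \<Sum>y\<in>V. c x y * (u x + s * u y)\<^sup>2) =
     (\<Sum>x\<in>V. \<Sum>y\<in>V. c x y * (u x)\<^sup>2) + 2 * s * (\<Sum>x\<in>V. \<Sum>y\<in>V. c x y * u y * u x) +
       s\<^sup>2 * (\<Sum>x\<in>V. \<Sum>y\<in>V. c x y * (u y)\<^sup>2)"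
    by (simp add: sum.distrib sum_distrib_left)
  then show ?thesis unfolding sum_c_sq integral_step_mult[of u u] by (simp add: distrib_right)
qed

lemma dirichlet_eq: "dirichlet u = 2 * ((\<integral>x. (u x)\<^sup>2 \<partial>N) - (\<integral>x. step u x * u x \<partial>N))"
  using sum_c_quad[of u "-1"] by (simp add: dirichlet_def)

lemma dirichlet_nonneg: "0 \<le> dirichlet u"
  by (auto simp: dirichlet_def intro!: sum_nonneg mult_nonneg_nonneg c_nonneg)

lemma step_contraction: "(\<integral>x. (step u x)\<^sup>2 \<partial>N) \<le> (\<integral>x. (u x)\<^sup>2 \<partial>N)"
proof -
  have sq: "wt x * (step u x)\<^sup>2 \<le> (\<Sum>y\<in>V. c x y * (u y)\<^sup>2)" for x
  proof -
    \<comment> \<open>Jensen's inequality at \<open>x\<close>, obtained as nonnegativity of the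
      weighted variance of \<open>u\<close> around its local mean.\<close>
    have "0 \<le> (\<Sum>y\<in>V. c x y * (u y - step u x)\<^sup>2)"
      by (intro sum_nonneg mult_nonneg_nonneg c_nonneg) auto
    also have "\<dots> = (\<Sum>y\<in>V. c x y * (u y)\<^sup>2 - 2 * step u x * (c x y * u y) + (step u x)\<^sup>2 * c x y)"
      by (intro sum.cong) (auto simp: power2_eq_square algebra_simps)
    also have "\<dots> = (\<Sum>y\<in>V. c x y * (u y)\<^sup>2) - 2 * step u x * (wt x * step u x) + (step u x)\<^sup>2 * wt x"
      unfolding wt_step by (simp add: sum.distrib sum_subtractf sum_distrib_left wt_def)
    also have "\<dots> = (\<Sum>y\<in>V. c x y * (u y)\<^sup>2) - wt x * (step u x)\<^sup>2"
      by (simp add: power2_eq_square algebra_simps)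
    finally show ?thesis by simp
  qed
  have "(\<integral>x. (step u x)\<^sup>2 \<partial>N) \<le> (\<Sum>x\<in>V. \<Sum>y\<in>V. c x y * (u y)\<^sup>2)"
    unfolding integral_N by (intro sum_mono sq)
  then show ?thesis by (simp only: sum_c_sq)
qed

text \<open>With \<open>g = u - step u\<close>, the loss of energy in one step is exactly the sum of
  \<open>c x y * (g x + g y)\<^sup>2\<close>, by symmetry of \<open>step\<close>.\<close>

lemma dirichlet_step_le: "dirichlet (step u) \<le> dirichlet u"
proof -
  define g where "g x = u x - step u x" for x
  have step_g: "step g = (\<lambda>x. step u x - step (step u) x)"
    using step_lin[of "-1" "step u" u] by (simp add: g_def[abs_def])
  have i: "integrable N f" for f :: "'v \<Rightarrow> real"
    unfolding N_def by (rule integrable_point_measure_finite[OF finite_V])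
  have "0 \<le> (\<Sum>x\<in>V. \<Sum>y\<in>V. c x y * (g x + 1 * g y)\<^sup>2)"
    by (intro sum_nonneg mult_nonneg_nonneg c_nonneg) auto
  also have "\<dots> = 2 * ((\<integral>x. (g x)\<^sup>2 \<partial>N) + (\<integral>x. step g x * g x \<partial>N))"
    by (subst sum_c_quad) simp
  also have "(\<integral>x. (g x)\<^sup>2 \<partial>N) = (\<integral>x. (u x)\<^sup>2 \<partial>N) - 2 * (\<integral>x. step u x * u x \<partial>N) + (\<integral>x. (step u x)\<^sup>2 \<partial>N)"
    unfolding g_def by (simp add: power2_diff i mult.assoc step_symmetric[of u u])
  also have "(\<integral>x. step g x * g x \<partial>N) = (\<integral>x. step u x * u x \<partial>N) - (\<integral>x. step u x * step u x \<partial>N)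
      - (\<integral>x. step (step u) x * u x \<partial>N) + (\<integral>x. step (step u) x * step u x \<partial>N)"
    unfolding step_g g_def by (simp add: algebra_simps i)
  also have "(\<integral>x. step (step u) x * u x \<partial>N) = (\<integral>x. (step u x)\<^sup>2 \<partial>N)"
    by (simp add: step_symmetric[of "step u"] power2_eq_square)
  finally show ?thesis by (simp add: dirichlet_eq power2_eq_square)
qed

lemma steps_0: "steps 0 u = u"
  by (simp add: steps_def)

lemma steps_Suc: "steps (Suc n) u = step (steps n u)"
  by (simp add: steps_def)

lemma steps_add: "steps (m + n) u = steps m (steps n u)"
  by (simp add: steps_def funpow_add)

lemma steps_lin: "steps n (\<lambda>x. a * u x + v x) = (\<lambda>x. a * steps n u x + steps n v x)"
  by (induction n) (simp_all add: steps_0 steps_Suc step_lin)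

lemma steps_symmetric: "(\<integral>x. steps n u x * v x \<partial>N) = (\<integral>x. u x * steps n v x \<partial>N)"
proof (induction n arbitrary: v)
  case (Suc n)
  have "(\<integral>x. steps (Suc n) u x * v x \<partial>N) = (\<integral>x. u x * steps n (step v) x \<partial>N)"
    by (simp add: steps_Suc step_symmetric Suc)
  also have "steps n (step v) = steps (Suc n) v"
    using steps_add[of n 1 v] by (simp add: steps_Suc steps_0)
  finally show ?case .
qed (simp add: steps_0)

lemma steps_bounded:
  assumes "\<And>x. x \<in> V \<Longrightarrow> \<bar>u x\<bar> \<le> B" "0 \<le> B" "x \<in> V"
  shows "\<bar>steps n u x\<bar> \<le> B"
  using assms(3) by (induction n arbitrary: x) (auto simp: steps_0 steps_Suc assms intro!: step_bounded)

lemma steps_contraction: "norm_L2 N (steps n u) \<le> norm_L2 N u"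
proof (induction n)
  case (Suc n)
  have "norm_L2 N (steps (Suc n) u) \<le> norm_L2 N (steps n u)"
    unfolding norm_L2_def steps_Suc by (intro real_sqrt_le_mono step_contraction)
  with Suc show ?case by simp
qed (simp add: steps_0)

lemma step_integral: "(\<integral>x. step u x \<partial>N) = (\<integral>x. u x \<partial>N)"
proof -
  have "(\<integral>x. step u x * 1 \<partial>N) = (\<Sum>y\<in>V. \<Sum>x\<in>V. c x y * u y * 1)"
    unfolding integral_step_mult by (rule sum.swap)
  also have "\<dots> = (\<Sum>y\<in>V. \<Sum>x\<in>V. c y x * u y)" by (simp add: c_sym)
  also have "\<dots> = (\<integral>x. u x \<partial>N)" by (simp add: integral_N wt_def sum_distrib_right)
  finally show ?thesis by simp
qed

lemma steps_integral: "(\<integral>x. steps n u x \<partial>N) = (\<integral>x. u x \<partial>N)"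
  by (induction n) (simp_all add: steps_0 steps_Suc step_integral)

lemma dirichlet_steps_le: "dirichlet (steps n u) \<le> dirichlet u"
  by (induction n) (auto simp: steps_0 steps_Suc intro: order_trans[OF dirichlet_step_le])

text \<open>Each further step lowers the inner product with \<open>u\<close> by half the mixed
  energy of \<open>steps n u\<close> and \<open>u\<close>. Nonnegativity of the energy of their
  difference bounds the mixed energy by the mean of the two energies, and
  \<open>dirichlet_steps_le\<close> bounds that mean by the energy of \<open>u\<close>.\<close>

lemma inner_steps_ge: "(\<integral>x. (u x)\<^sup>2 \<partial>N) - (\<integral>x. steps n u x * u x \<partial>N) \<le> n * (dirichlet u / 2)"
proof (induction n)
  case (Suc n)
  define w where "w = steps n u"
  have i: "integrable N f" for f :: "'v \<Rightarrow> real"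
    unfolding N_def by (rule integrable_point_measure_finite[OF finite_V])
  have step_d: "step (\<lambda>x. w x - u x) = (\<lambda>x. step w x - step u x)"
    using step_lin[of "-1" u w] by simp
  have "0 \<le> dirichlet (\<lambda>x. w x - u x)" by (rule dirichlet_nonneg)
  also have "\<dots> = dirichlet w + dirichlet u - 4 * ((\<integral>x. w x * u x \<partial>N) - (\<integral>x. step w x * u x \<partial>N))"
  proof -
    have "(\<integral>x. (w x - u x)\<^sup>2 \<partial>N) = (\<integral>x. (w x)\<^sup>2 \<partial>N) + (\<integral>x. (u x)\<^sup>2 \<partial>N) - 2 * (\<integral>x. w x * u x \<partial>N)"
      by (simp add: power2_diff i mult.assoc)
    moreover have "(\<integral>x. (step w x - step u x) * (w x - u x) \<partial>N) =
        (\<integral>x. step w x * w x \<partial>N) - (\<integral>x. step w x * u x \<partial>N) - (\<integral>x. step u x * w x \<partial>N)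
          + (\<integral>x. step u x * u x \<partial>N)"
      by (simp add: left_diff_distrib right_diff_distrib i)
    moreover have "(\<integral>x. step u x * w x \<partial>N) = (\<integral>x. step w x * u x \<partial>N)"
      by (subst step_symmetric) (simp add: mult.commute)
    ultimately show ?thesis unfolding dirichlet_eq step_d by simp
  qed
  finally have "(\<integral>x. w x * u x \<partial>N) - (\<integral>x. step w x * u x \<partial>N) \<le> dirichlet u / 2"
    using dirichlet_steps_le[of n u] unfolding w_def by simp
  with Suc show ?case unfolding w_def steps_Suc by (simp add: distrib_right)
qed (simp add: steps_0 power2_eq_square)

text \<open>The walk is periodic, so its spectrum may reach \<open>-1\<close> and the time regularity has to come
  from the initial value \<open>u\<close> rather than from smoothing.\<close>

lemma steps_equicontinuous:
  "(norm_L2 N (\<lambda>x. steps m u x - steps n u x))\<^sup>2 \<le> \<bar>real m - real n\<bar> * dirichlet u"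
proof -
  have i: "integrable N f" for f :: "'v \<Rightarrow> real"
    unfolding N_def by (rule integrable_point_measure_finite[OF finite_V])
  have *: "(norm_L2 N (\<lambda>x. steps (n + l) u x - steps n u x))\<^sup>2 \<le> real l * dirichlet u" for n l
  proof -
    \<comment> \<open>The first \<open>n\<close> steps are common to both terms and are removed by
      contractivity.\<close>
    have "(\<lambda>x. steps (n + l) u x - steps n u x) = steps n (\<lambda>x. steps l u x - u x)"
      using steps_lin[of n "-1" u "steps l u"] by (simp add: steps_add)
    then have "norm_L2 N (\<lambda>x. steps (n + l) u x - steps n u x) \<le> norm_L2 N (\<lambda>x. steps l u x - u x)"
      by (simp add: steps_contraction)
    then have "(norm_L2 N (\<lambda>x. steps (n + l) u x - steps n u x))\<^sup>2 \<le> (norm_L2 N (\<lambda>x. steps l u x - u x))\<^sup>2"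
      by (rule power_mono) simp
    also have "\<dots> = (norm_L2 N (steps l u))\<^sup>2 + (norm_L2 N u)\<^sup>2 - 2 * (\<integral>x. steps l u x * u x \<partial>N)"
      by (simp add: norm_L2_sq power2_diff i mult.assoc)
    also have "(norm_L2 N (steps l u))\<^sup>2 \<le> (norm_L2 N u)\<^sup>2"
      by (intro power_mono steps_contraction) simp
    finally show ?thesis using inner_steps_ge[of u l] by (simp add: norm_L2_sq)
  qed
  show ?thesis
  proof (cases "n \<le> m")
    case True
    then show ?thesis using *[of n "m - n"] by (simp add: of_nat_diff)
  next
    case False
    then show ?thesis using *[of m "n - m"] by (simp add: of_nat_diff norm_L2_minus[of _ "steps m u"])
  qed
qed

text \<open>Discrete counterpart of \<open>iterated_semigroup\<close>. Entries carry absolute step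
  numbers, so the truncated subtraction is exact only for sorted lists.\<close>

fun iterated_steps :: "nat \<Rightarrow> (nat \<times> ('v \<Rightarrow> real)) list \<Rightarrow> 'v \<Rightarrow> real" where
  "iterated_steps s [] = (\<lambda>x. 1)"
| "iterated_steps s ((n, f) # l) = steps (n - s) (\<lambda>x. f x * iterated_steps n l x)"

end

lemma (in finite_measure) integral_finite_range:
  fixes H :: "'s \<Rightarrow> real"
  assumes S: "finite S" and W: "\<And>\<omega>. \<omega> \<in> space M \<Longrightarrow> W \<omega> \<in> S"
    and meas: "\<And>w. w \<in> S \<Longrightarrow> {\<omega>\<in>space M. W \<omega> = w} \<in> sets M"
  shows "(\<integral>\<omega>. H (W \<omega>) \<partial>M) = (\<Sum>w\<in>S. H w * measure M {\<omega>\<in>space M. W \<omega> = w})"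
proof -
  have "(\<integral>\<omega>. H (W \<omega>) \<partial>M) = (\<integral>\<omega>. (\<Sum>w\<in>S. H w * indicator {\<omega>\<in>space M. W \<omega> = w} \<omega>) \<partial>M)"
  proof (rule Bochner_Integration.integral_cong[OF refl])
    fix \<omega> assume \<omega>: "\<omega> \<in> space M"
    have "(\<Sum>w\<in>S. H w * indicator {\<omega>\<in>space M. W \<omega> = w} \<omega>) = (\<Sum>w\<in>S. if W \<omega> = w then H w else 0)"
      using \<omega> by (intro sum.cong) (auto simp: indicator_def)
    also have "\<dots> = H (W \<omega>)" using W[OF \<omega>] S by (simp add: sum.delta)
    finally show "H (W \<omega>) = (\<Sum>w\<in>S. H w * indicator {\<omega>\<in>space M. W \<omega> = w} \<omega>)" by simp
  qed
  also have "\<dots> = (\<Sum>w\<in>S. \<integral>\<omega>. H w * indicator {\<omega>\<in>space M. W \<omega> = w} \<omega> \<partial>M)"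
    using meas by (intro Bochner_Integration.integral_sum) (auto intro!: integrable_real_indicator emeasure_finite simp: less_top[symmetric])
  also have "\<dots> = (\<Sum>w\<in>S. H w * measure M {\<omega>\<in>space M. W \<omega> = w})"
    using meas by (intro sum.cong refl) (auto simp: Int_absorb1 sets.sets_into_space)
  finally show ?thesis .
qed

locale reversible_walk = conductances V c + finite_measure \<Omega>
  for V :: "'v set" and c :: "'v \<Rightarrow> 'v \<Rightarrow> real" and \<Omega> :: "'w measure" +
  fixes X :: "nat \<Rightarrow> 'w \<Rightarrow> 'v"
  assumes X_measurable: "\<And>j. X j \<in> \<Omega> \<rightarrow>\<^sub>M count_space V"
    and X_init: "\<And>x. x \<in> V \<Longrightarrow> measure \<Omega> {\<omega>\<in>space \<Omega>. X 0 \<omega> = x} = wt x"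
    and X_trans: "\<And>n x y. x \<in> {..n} \<rightarrow> V \<Longrightarrow> y \<in> V \<Longrightarrow>
        measure \<Omega> {\<omega>\<in>space \<Omega>. (\<forall>i\<le>n. X i \<omega> = x i) \<and> X (Suc n) \<omega> = y} =
        measure \<Omega> {\<omega>\<in>space \<Omega>. \<forall>i\<le>n. X i \<omega> = x i} * prob (x n) y"
begin

text \<open>Restricted to \<open>{..n}\<close>, so that pasts are elements of a finite function set
  and expectations become finite sums over paths.\<close>

definition past :: "nat \<Rightarrow> 'w \<Rightarrow> nat \<Rightarrow> 'v" where
  "past n \<omega> = (\<lambda>i\<in>{..n}. X i \<omega>)"

lemma X_in: "\<omega> \<in> space \<Omega> \<Longrightarrow> X j \<omega> \<in> V"
  using measurable_space[OF X_measurable[of j]] by simp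

lemma X_sets: "{\<omega>\<in>space \<Omega>. X j \<omega> = y} \<in> sets \<Omega>"
proof (cases "y \<in> V")
  case True
  have "X j -` {y} \<inter> space \<Omega> \<in> sets \<Omega>" using True by (intro measurable_sets[OF X_measurable]) auto
  moreover have "X j -` {y} \<inter> space \<Omega> = {\<omega>\<in>space \<Omega>. X j \<omega> = y}" by auto
  ultimately show ?thesis by simp
next
  case False
  then have "{\<omega>\<in>space \<Omega>. X j \<omega> = y} = {}" using X_in by auto
  then show ?thesis by (simp only: sets.empty_sets)
qed

lemma path_sets: "{\<omega>\<in>space \<Omega>. \<forall>i\<le>n. X i \<omega> = x i} \<in> sets \<Omega>"
proof -
  have "{\<omega>\<in>space \<Omega>. \<forall>i\<le>n. X i \<omega> = x i} = (\<Inter>i\<in>{..n}. {\<omega>\<in>space \<Omega>. X i \<omega> = x i})" by auto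
  also have "\<dots> \<in> sets \<Omega>" using X_sets by (intro sets.finite_INT) auto
  finally show ?thesis .
qed

lemma past_in: "\<omega> \<in> space \<Omega> \<Longrightarrow> past n \<omega> \<in> PiE {..n} (\<lambda>_. V)"
  by (auto simp: past_def X_in)

lemma past_eq_iff: "x \<in> PiE {..n} (\<lambda>_. V) \<Longrightarrow> past n \<omega> = x \<longleftrightarrow> (\<forall>i\<le>n. X i \<omega> = x i)"
  by (auto simp: past_def fun_eq_iff PiE_def extensional_def restrict_def)

lemma finite_paths: "finite (PiE {..n::nat} (\<lambda>_. V))"
  by (intro finite_PiE finite_V) auto

lemma past_sets: "x \<in> PiE {..n} (\<lambda>_. V) \<Longrightarrow> {\<omega>\<in>space \<Omega>. past n \<omega> = x} \<in> sets \<Omega>"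
  using path_sets[of n x] by (simp only: past_eq_iff)

text \<open>The transition rule summed over the finitely many pasts. \<open>G\<close> may depend on
  the whole past, which the inductions below exploit to store earlier factors.\<close>

lemma markov_step:
  "(\<integral>\<omega>. G (past n \<omega>) * h (X (Suc n) \<omega>) \<partial>\<Omega>) = (\<integral>\<omega>. G (past n \<omega>) * step h (X n \<omega>) \<partial>\<Omega>)"
proof -
  let ?S = "PiE {..n} (\<lambda>_. V)"
  have "(\<integral>\<omega>. G (past n \<omega>) * h (X (Suc n) \<omega>) \<partial>\<Omega>) =
      (\<integral>\<omega>. (\<lambda>(x, y). G x * h y) (past n \<omega>, X (Suc n) \<omega>) \<partial>\<Omega>)" by simp
  also have "\<dots> = (\<Sum>w\<in>?S \<times> V. (\<lambda>(x, y). G x * h y) w *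
      measure \<Omega> {\<omega>\<in>space \<Omega>. (past n \<omega>, X (Suc n) \<omega>) = w})"
  proof (rule integral_finite_range)
    show "finite (?S \<times> V)" by (intro finite_cartesian_product finite_paths finite_V)
    show "(past n \<omega>, X (Suc n) \<omega>) \<in> ?S \<times> V" if "\<omega> \<in> space \<Omega>" for \<omega>
      using that past_in X_in by simp
    show "{\<omega>\<in>space \<Omega>. (past n \<omega>, X (Suc n) \<omega>) = w} \<in> sets \<Omega>" if w: "w \<in> ?S \<times> V" for w
    proof -
      have "{\<omega>\<in>space \<Omega>. (past n \<omega>, X (Suc n) \<omega>) = w} =
        {\<omega>\<in>space \<Omega>. past n \<omega> = fst w} \<inter> {\<omega>\<in>space \<Omega>. X (Suc n) \<omega> = snd w}" by auto
      then show ?thesis using w past_sets X_sets by auto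
    qed
  qed
  also have "\<dots> = (\<Sum>x\<in>?S. \<Sum>y\<in>V. G x * h y * measure \<Omega> {\<omega>\<in>space \<Omega>. (past n \<omega>, X (Suc n) \<omega>) = (x, y)})"
    by (subst sum.cartesian_product) (simp add: case_prod_unfold prod_eq_iff)
  also have "\<dots> = (\<Sum>x\<in>?S. \<Sum>y\<in>V. G x * h y * (measure \<Omega> {\<omega>\<in>space \<Omega>. past n \<omega> = x} * prob (x n) y))"
  proof (intro sum.cong refl)
    fix x y assume x: "x \<in> ?S" and y: "y \<in> V"
    then have "x \<in> {..n} \<rightarrow> V" by auto
    from X_trans[OF this y] show "G x * h y * measure \<Omega> {\<omega>\<in>space \<Omega>. (past n \<omega>, X (Suc n) \<omega>) = (x, y)} =
       G x * h y * (measure \<Omega> {\<omega>\<in>space \<Omega>. past n \<omega> = x} * prob (x n) y)"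
      using x by (simp add: past_eq_iff)
  qed
  also have "\<dots> = (\<Sum>x\<in>?S. G x * step h (x n) * measure \<Omega> {\<omega>\<in>space \<Omega>. past n \<omega> = x})"
    by (intro sum.cong refl) (simp add: step_def sum_distrib_left sum_distrib_right mult_ac)
  also have "\<dots> = (\<integral>\<omega>. (\<lambda>x. G x * step h (x n)) (past n \<omega>) \<partial>\<Omega>)"
    using finite_paths past_in past_sets by (intro integral_finite_range[symmetric]) auto
  also have "\<dots> = (\<integral>\<omega>. G (past n \<omega>) * step h (X n \<omega>) \<partial>\<Omega>)"
    by (simp add: past_def)
  finally show ?thesis .
qed

lemma past_past: "n \<le> m \<Longrightarrow> past n \<omega> = restrict (past m \<omega>) {..n}"
  by (auto simp: past_def fun_eq_iff)

lemma markov_steps: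
  "(\<integral>\<omega>. G (past n \<omega>) * h (X (n + j) \<omega>) \<partial>\<Omega>) = (\<integral>\<omega>. G (past n \<omega>) * steps j h (X n \<omega>) \<partial>\<Omega>)"
proof (induction j arbitrary: h)
  case (Suc j)
  have "(\<integral>\<omega>. G (past n \<omega>) * h (X (n + Suc j) \<omega>) \<partial>\<Omega>) =
      (\<integral>\<omega>. (\<lambda>x. G (restrict x {..n})) (past (n + j) \<omega>) * h (X (Suc (n + j)) \<omega>) \<partial>\<Omega>)"
    by (simp flip: past_past)
  also have "\<dots> = (\<integral>\<omega>. G (past n \<omega>) * step h (X (n + j) \<omega>) \<partial>\<Omega>)"
    by (subst markov_step) (simp flip: past_past)
  also have "\<dots> = (\<integral>\<omega>. G (past n \<omega>) * steps j (step h) (X n \<omega>) \<partial>\<Omega>)" by (rule Suc)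
  also have "steps j (step h) = steps (Suc j) h"
    using steps_add[of j 1 h] by (simp add: steps_Suc steps_0)
  finally show ?case .
qed (simp add: steps_0)

lemma markov_iterated:
  assumes "sorted (s # map fst l)"
  shows "(\<integral>\<omega>. G (past s \<omega>) * (\<Prod>(n, f)\<leftarrow>l. f (X n \<omega>)) \<partial>\<Omega>) =
    (\<integral>\<omega>. G (past s \<omega>) * iterated_steps s l (X s \<omega>) \<partial>\<Omega>)"
  using assms
proof (induction l arbitrary: s G)
  case (Cons a l)
  obtain n f where a: "a = (n, f)" by (cases a)
  have sn: "s \<le> n" and srt: "sorted (n # map fst l)" using Cons.prems a by auto
  \<comment> \<open>The factor at time \<open>n\<close> is absorbed into the functional of the past
    up to \<open>n\<close>; the induction continues from there.\<close>
  let ?G = "\<lambda>x. G (restrict x {..s}) * f (x n)"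
  have G: "?G (past n \<omega>) = G (past s \<omega>) * f (X n \<omega>)" for \<omega>
    using sn past_past[OF sn, of \<omega>] by (simp add: past_def)
  have "(\<integral>\<omega>. G (past s \<omega>) * (\<Prod>(n, f)\<leftarrow>a # l. f (X n \<omega>)) \<partial>\<Omega>) =
      (\<integral>\<omega>. ?G (past n \<omega>) * (\<Prod>(n, f)\<leftarrow>l. f (X n \<omega>)) \<partial>\<Omega>)"
    unfolding G by (simp add: a mult.assoc)
  also have "\<dots> = (\<integral>\<omega>. ?G (past n \<omega>) * iterated_steps n l (X n \<omega>) \<partial>\<Omega>)"
    by (rule Cons.IH[OF srt])
  also have "\<dots> = (\<integral>\<omega>. G (past s \<omega>) * (\<lambda>x. f x * iterated_steps n l x) (X (s + (n - s)) \<omega>) \<partial>\<Omega>)"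
    unfolding G using sn by (simp add: mult.assoc)
  also have "\<dots> = (\<integral>\<omega>. G (past s \<omega>) * steps (n - s) (\<lambda>x. f x * iterated_steps n l x) (X s \<omega>) \<partial>\<Omega>)"
    by (rule markov_steps)
  finally show ?case by (simp add: a)
qed simp

lemma walk_fdd:
  assumes "sorted (map fst l)"
  shows "(\<integral>\<omega>. (\<Prod>(n, f)\<leftarrow>l. f (X n \<omega>)) \<partial>\<Omega>) = (\<integral>x. iterated_steps 0 l x \<partial>N)"
proof -
  have "(\<integral>\<omega>. (\<Prod>(n, f)\<leftarrow>l. f (X n \<omega>)) \<partial>\<Omega>) = (\<integral>\<omega>. iterated_steps 0 l (X 0 \<omega>) \<partial>\<Omega>)"
    using markov_iterated[of 0 l "\<lambda>_. 1"] assms by simp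
  also have "\<dots> = (\<Sum>x\<in>V. iterated_steps 0 l x * measure \<Omega> {\<omega>\<in>space \<Omega>. X 0 \<omega> = x})"
    using finite_V X_in X_sets by (intro integral_finite_range) auto
  also have "\<dots> = (\<integral>x. iterated_steps 0 l x \<partial>N)"
    unfolding integral_N by (intro sum.cong) (auto simp: X_init)
  finally show ?thesis .
qed

end

section \<open>Grid cubes\<close>

definition mesh :: "nat \<Rightarrow> real" where "mesh k = (1/2)^k"

text \<open>Addressed by the lower corner, which turns families of grid cubes into sets of lattice
  points.\<close>

definition cube :: "nat \<Rightarrow> 'a::euclidean_space \<Rightarrow> 'a set" where
  "cube k a = cbox a (a + mesh k *\<^sub>R \<Sum>Basis)"

lemma mesh_pos [simp]: "mesh k > 0" by (simp add: mesh_def)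

lemma mesh_simps [simp]: "0 \<le> mesh k" "mesh k \<noteq> 0" "\<bar>mesh k\<bar> = mesh k"
  by (simp_all add: mesh_def)

lemma mesh_tendsto_0: "mesh \<longlonglongrightarrow> 0"
  unfolding mesh_def by (rule LIMSEQ_realpow_zero) auto

lemma inner_sum_subset_Basis:
  assumes "S \<subseteq> Basis" "b \<in> Basis"
  shows "\<Sum>S \<bullet> b = (if b \<in> S then 1 else 0)"
proof -
  have "\<Sum>S \<bullet> b = (\<Sum>c\<in>S. if c = b then 1 else 0)"
    unfolding inner_sum_left using assms by (intro sum.cong) (auto simp: inner_Basis)
  then show ?thesis using finite_subset[OF assms(1) finite_Basis] by (simp add: sum.delta')
qed

lemma mem_cube: "x \<in> cube k a \<longleftrightarrow> (\<forall>b\<in>Basis. a \<bullet> b \<le> x \<bullet> b \<and> x \<bullet> b \<le> a \<bullet> b + mesh k)"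
  by (simp add: cube_def mem_box inner_add_left inner_sum_subset_Basis)

lemma cube_corner: "a \<in> cube k a"
  by (simp add: mem_cube less_imp_le)

lemma lattice_ptsE:
  assumes "x \<in> lattice_pts k" "b \<in> Basis"
  obtains z :: int where "x \<bullet> b = of_int z * mesh k"
  using assms by (auto simp: lattice_pts_def mesh_def)

lemma lattice_ptsI: "(\<And>b. b \<in> Basis \<Longrightarrow> \<exists>z::int. x \<bullet> b = of_int z * mesh k) \<Longrightarrow> x \<in> lattice_pts k"
  by (auto simp: lattice_pts_def mesh_def)

lemma lattice_diff_less:
  assumes "x \<in> lattice_pts k" "y \<in> lattice_pts k" "b \<in> Basis" "\<bar>x \<bullet> b - y \<bullet> b\<bar> < mesh k"
  shows "x \<bullet> b = y \<bullet> b"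
proof -
  obtain z w :: int where z: "x \<bullet> b = of_int z * mesh k" and w: "y \<bullet> b = of_int w * mesh k"
    using lattice_ptsE[OF assms(1,3)] lattice_ptsE[OF assms(2,3)] by metis
  have "\<bar>of_int (z - w) :: real\<bar> * mesh k < 1 * mesh k"
    using assms(4) by (simp add: z w abs_mult flip: left_diff_distrib)
  then have "\<bar>of_int (z - w) :: real\<bar> < 1" by (rule mult_right_less_imp_less) simp
  then have "z = w" by linarith
  then show ?thesis by (simp add: z w)
qed

lemma lattice_add_Basis:
  assumes x: "x \<in> lattice_pts k" and S: "S \<subseteq> Basis"
  shows "x + (of_int s * mesh k) *\<^sub>R \<Sum>S \<in> lattice_pts k"
proof (rule lattice_ptsI)
  fix b :: 'a assume b: "b \<in> Basis"
  obtain z :: int where z: "x \<bullet> b = of_int z * mesh k" by (rule lattice_ptsE[OF x b])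
  show "\<exists>z::int. (x + (of_int s * mesh k) *\<^sub>R \<Sum>S) \<bullet> b = of_int z * mesh k"
    using z b S by (intro exI[of _ "z + (if b \<in> S then s else 0)"])
      (auto simp: inner_add_left inner_sum_subset_Basis algebra_simps)
qed

lemma lattice_add:
  assumes "x \<in> lattice_pts k" "S \<subseteq> Basis"
  shows "x + mesh k *\<^sub>R \<Sum>S \<in> lattice_pts k"
  using lattice_add_Basis[OF assms, of 1] by simp

lemma lattice_minus:
  assumes "x \<in> lattice_pts k" "S \<subseteq> Basis"
  shows "x - mesh k *\<^sub>R \<Sum>S \<in> lattice_pts k"
  using lattice_add_Basis[OF assms, of "-1"] by simp

lemma extreme_point_cube_corner: "a extreme_point_of cube k a"
  unfolding extreme_point_of_def
proof (intro conjI ballI notI cube_corner)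
  fix p q assume p: "p \<in> cube k a" and q: "q \<in> cube k a" and "a \<in> open_segment p q"
  then obtain u where u: "p \<noteq> q" "0 < u" "u < 1" "a = (1 - u) *\<^sub>R p + u *\<^sub>R q"
    by (auto simp: in_segment)
  have "p \<bullet> b = q \<bullet> b" if b: "b \<in> Basis" for b
  proof -
    have "(1 - u) * (p \<bullet> b - a \<bullet> b) + u * (q \<bullet> b - a \<bullet> b) = 0"
      unfolding u(4) by (simp add: inner_add_left algebra_simps)
    moreover have "0 \<le> (1 - u) * (p \<bullet> b - a \<bullet> b)" "0 \<le> u * (q \<bullet> b - a \<bullet> b)"
      using p q b u by (auto simp: mem_cube)
    ultimately have "(1 - u) * (p \<bullet> b - a \<bullet> b) = 0" "u * (q \<bullet> b - a \<bullet> b) = 0" by linarith+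
    then show ?thesis using u by simp
  qed
  then show False using u(1) by (meson euclidean_eqI)
qed

text \<open>A coordinate strictly inside its interval would make \<open>v\<close> the midpoint of
  two points of the cube displaced along \<open>b\<close>.\<close>

lemma extreme_point_cube_coord:
  assumes v: "v extreme_point_of cube k a" and b: "b \<in> Basis"
  shows "v \<bullet> b = a \<bullet> b \<or> v \<bullet> b = a \<bullet> b + mesh k"
proof (rule ccontr)
  assume neg: "\<not> ?thesis"
  have vc: "v \<in> cube k a" using v by (simp add: extreme_point_of_def)
  then have le: "a \<bullet> b \<le> v \<bullet> b" "v \<bullet> b \<le> a \<bullet> b + mesh k" using b by (auto simp: mem_cube)
  define e where "e = min (v \<bullet> b - a \<bullet> b) (a \<bullet> b + mesh k - v \<bullet> b)"
  have e: "e > 0" "e \<le> v \<bullet> b - a \<bullet> b" "e \<le> a \<bullet> b + mesh k - v \<bullet> b"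
    using le neg by (auto simp: e_def)
  have in_cube: "v + s *\<^sub>R b \<in> cube k a" if "\<bar>s\<bar> \<le> e" for s
    unfolding mem_cube
  proof
    fix b' :: 'a assume "b' \<in> Basis"
    then show "a \<bullet> b' \<le> (v + s *\<^sub>R b) \<bullet> b' \<and> (v + s *\<^sub>R b) \<bullet> b' \<le> a \<bullet> b' + mesh k"
      using vc b e that by (cases "b' = b") (auto simp: mem_cube inner_add_left inner_Basis)
  qed
  have "v - e *\<^sub>R b \<noteq> v + e *\<^sub>R b"
  proof
    assume "v - e *\<^sub>R b = v + e *\<^sub>R b"
    then have "(v - e *\<^sub>R b) \<bullet> b = (v + e *\<^sub>R b) \<bullet> b" by (rule arg_cong)
    then show False using b e by (simp add: inner_add_left inner_diff_left)
  qed
  then have "midpoint (v - e *\<^sub>R b) (v + e *\<^sub>R b) \<in> open_segment (v - e *\<^sub>R b) (v + e *\<^sub>R b)"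
    by (simp only: midpoint_in_open_segment not_False_eq_True)
  moreover have "midpoint (v - e *\<^sub>R b) (v + e *\<^sub>R b) = v"
    by (simp add: midpoint_def scaleR_2[symmetric])
  ultimately show False
    using v in_cube[of e] in_cube[of "-e"] e(1) by (auto simp: extreme_point_of_def)
qed

text \<open>A full-dimensional base set is all of \<open>Basis\<close>, the lower corner is an
  extreme point, and every extreme point differs from it by 0 or \<open>mesh k\<close> in each
  coordinate. Thus the vertex condition is a condition on the lower corner alone.\<close>

lemma admissible_cube_iff:
  fixes D :: "'a::euclidean_space set"
  shows "admissible_cube D c k Q \<longleftrightarrow> (\<exists>a\<in>lattice_pts k. Q = cube k a \<and> cube k a \<subseteq> D \<and>
    setdist (cube k a) (frontier D) > c * mesh k)" (is "?L \<longleftrightarrow> ?R")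
proof
  assume L: ?L
  then obtain a and B :: "'a set" where B: "B \<subseteq> Basis" "card B = DIM('a)"
    "Q = cbox a (a + mesh k *\<^sub>R \<Sum>B)"
    by (auto simp: admissible_cube_def is_cube_def mesh_def)
  then have "B = Basis" by (intro card_subset_eq) auto
  then have Q: "Q = cube k a" using B by (simp add: cube_def)
  have "a extreme_point_of Q" unfolding Q by (rule extreme_point_cube_corner)
  then have "a \<in> lattice_pts k" using L by (auto simp: admissible_cube_def)
  then show ?R using L Q by (auto simp: admissible_cube_def mesh_def intro!: bexI[of _ a])
next
  assume ?R
  then obtain a where a: "a \<in> lattice_pts k" "Q = cube k a" "cube k a \<subseteq> D"
    "setdist (cube k a) (frontier D) > c * mesh k" by blast
  have "{v. v extreme_point_of cube k a} \<subseteq> lattice_pts k"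
  proof
    fix v assume "v \<in> {v. v extreme_point_of cube k a}"
    then have v: "v extreme_point_of cube k a" by simp
    show "v \<in> lattice_pts k"
    proof (rule lattice_ptsI)
      fix b :: 'a assume b: "b \<in> Basis"
      obtain z :: int where z: "a \<bullet> b = of_int z * mesh k" by (rule lattice_ptsE[OF a(1) b])
      have "v \<bullet> b = of_int z * mesh k \<or> v \<bullet> b = of_int (z + 1) * mesh k"
        using extreme_point_cube_coord[OF v b] by (simp add: z algebra_simps)
      then show "\<exists>z::int. v \<bullet> b = of_int z * mesh k" by blast
    qed
  qed
  moreover have "is_cube DIM('a) ((1/2)^k) (cube k a)"
    by (auto simp: is_cube_def cube_def mesh_def intro!: exI[of _ a] exI[of _ Basis])
  ultimately show ?L using a by (simp add: admissible_cube_def mesh_def)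
qed

text \<open>Only direction \<open>b\<close> collapses, to the value
  \<open>a \<bullet> b + mesh k\<close>; hence the base set \<open>Basis - {b}\<close> of the common
  face.\<close>

lemma is_cube_inter:
  fixes a :: "'a::euclidean_space"
  assumes b: "b \<in> Basis"
  shows "is_cube (DIM('a) - 1) (mesh k) (cube k a \<inter> cube k (a + mesh k *\<^sub>R b))"
  unfolding is_cube_def
proof (intro conjI exI)
  let ?a = "a + mesh k *\<^sub>R b" and ?B = "Basis - {b}"
  show "?B \<subseteq> Basis" "card ?B = DIM('a) - 1" using b by auto
  show "cube k a \<inter> cube k ?a = cbox ?a (?a + mesh k *\<^sub>R \<Sum>?B)"
  proof (intro set_eqI)
    fix x
    have "x \<in> cube k a \<inter> cube k ?a \<longleftrightarrow> (\<forall>b'\<in>Basis. (a \<bullet> b' \<le> x \<bullet> b' \<and> x \<bullet> b' \<le> a \<bullet> b' + mesh k) \<and>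
        (?a \<bullet> b' \<le> x \<bullet> b' \<and> x \<bullet> b' \<le> ?a \<bullet> b' + mesh k))"
      by (auto simp: mem_cube)
    also have "\<dots> \<longleftrightarrow> (\<forall>b'\<in>Basis. ?a \<bullet> b' \<le> x \<bullet> b' \<and> x \<bullet> b' \<le> (?a + mesh k *\<^sub>R \<Sum>?B) \<bullet> b')"
    proof (intro ball_cong refl)
      fix b' :: 'a assume b': "b' \<in> Basis"
      show "((a \<bullet> b' \<le> x \<bullet> b' \<and> x \<bullet> b' \<le> a \<bullet> b' + mesh k) \<and>
          (?a \<bullet> b' \<le> x \<bullet> b' \<and> x \<bullet> b' \<le> ?a \<bullet> b' + mesh k)) \<longleftrightarrow>
        (?a \<bullet> b' \<le> x \<bullet> b' \<and> x \<bullet> b' \<le> (?a + mesh k *\<^sub>R \<Sum>?B) \<bullet> b')"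
        using b b' mesh_pos[of k] inner_sum_subset_Basis[of ?B b']
        by (cases "b' = b") (auto simp: inner_add_left inner_Basis simp del: mesh_pos)
    qed
    finally show "x \<in> cube k a \<inter> cube k ?a \<longleftrightarrow> x \<in> cbox ?a (?a + mesh k *\<^sub>R \<Sum>?B)"
      by (simp add: mem_box)
  qed
qed simp

lemma grid_cubes_extend:
  assumes Q: "Q \<in> grid_cubes D c x0 k" and R: "admissible_cube D c k R"
    and l: "is_cube (DIM('a::euclidean_space) - 1) l (Q \<inter> R)"
  shows "(R :: 'a set) \<in> grid_cubes D c x0 k"
proof -
  obtain Qs where Qs: "Qs \<noteq> []" "last Qs = Q" "x0 \<in> hd Qs" "\<forall>R\<in>set Qs. admissible_cube D c k R"
    "successively (\<lambda>R S. \<exists>l. is_cube (DIM('a) - 1) l (R \<inter> S)) Qs"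
    using Q by (auto simp: grid_cubes_def)
  show ?thesis
    unfolding grid_cubes_def
    using Qs R l by (intro CollectI exI[of _ "Qs @ [R]"]) (auto simp: successively_append_iff)
qed

lemma grid_cubes_admissible: "Q \<in> grid_cubes D c x0 k \<Longrightarrow> admissible_cube D c k Q"
  using last_in_set by (auto simp: grid_cubes_def)

lemma grid_cubes_start: "admissible_cube D c k Q \<Longrightarrow> x0 \<in> Q \<Longrightarrow> Q \<in> grid_cubes D c x0 k"
  unfolding grid_cubes_def by (intro CollectI exI[of _ "[Q]"]) auto

lemma grid_cubes_step:
  fixes a :: "'a::euclidean_space"
  assumes "cube k a \<in> grid_cubes D c x0 k" "b \<in> Basis" "s = 1 \<or> s = -1"
    "admissible_cube D c k (cube k (a + (s * mesh k) *\<^sub>R b))"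
  shows "cube k (a + (s * mesh k) *\<^sub>R b) \<in> grid_cubes D c x0 k"
proof (rule grid_cubes_extend[OF assms(1,4)])
  show "is_cube (DIM('a) - 1) (mesh k) (cube k a \<inter> cube k (a + (s * mesh k) *\<^sub>R b))"
    using assms(3) is_cube_inter[OF assms(2), of k a]
      is_cube_inter[OF assms(2), of k "a - mesh k *\<^sub>R b"]
    by (auto simp: Int_commute)
qed

lemma lattice_step_towards:
  assumes a: "a \<in> lattice_pts k" and a': "a' \<in> lattice_pts k" and b: "b \<in> Basis" and ne: "a \<bullet> b \<noteq> a' \<bullet> b"
  shows "\<exists>s. (s = 1 \<or> s = -1) \<and> \<bar>a \<bullet> b + s * mesh k - a' \<bullet> b\<bar> = \<bar>a \<bullet> b - a' \<bullet> b\<bar> - mesh k \<and>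
    min (a \<bullet> b) (a' \<bullet> b) \<le> a \<bullet> b + s * mesh k \<and> a \<bullet> b + s * mesh k \<le> max (a \<bullet> b) (a' \<bullet> b)"
proof -
  have "\<not> \<bar>a \<bullet> b - a' \<bullet> b\<bar> < mesh k" using lattice_diff_less[OF a a' b] ne by blast
  then show ?thesis using mesh_pos[of k]
    by (intro exI[of _ "if a \<bullet> b < a' \<bullet> b then 1 else -1"]) auto
qed

text \<open>The chain moves one mesh along one coordinate towards \<open>a'\<close> at a time. Each
  move lowers the l1 distance by \<open>mesh k\<close> and shrinks the box spanned by the corners,
  so admissibility of all cubes of the initial box suffices; \<open>n\<close> merely bounds the
  number of moves.\<close>

lemma grid_cubes_connected:
  fixes a a' :: "'a::euclidean_space"
  assumes a': "a' \<in> lattice_pts k"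
    and box: "\<And>e. e \<in> lattice_pts k \<Longrightarrow>
       (\<forall>b\<in>Basis. min (a \<bullet> b) (a' \<bullet> b) \<le> e \<bullet> b \<and> e \<bullet> b \<le> max (a \<bullet> b) (a' \<bullet> b)) \<Longrightarrow>
       admissible_cube D c k (cube k e)"
    and a: "a \<in> lattice_pts k" "cube k a \<in> grid_cubes D c x0 k"
    and n: "(\<Sum>b\<in>Basis. \<bar>a \<bullet> b - a' \<bullet> b\<bar>) < real n * mesh k"
  shows "cube k a' \<in> grid_cubes D c x0 k"
  using box a n
proof (induction n arbitrary: a)
  case 0
  then have "(\<Sum>b\<in>Basis. \<bar>a \<bullet> b - a' \<bullet> b\<bar>) < 0" by simp
  moreover have "(\<Sum>b\<in>Basis. \<bar>a \<bullet> b - a' \<bullet> b\<bar>) \<ge> 0" by (rule sum_nonneg) simp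
  ultimately show ?case by linarith
next
  case (Suc n)
  show ?case
  proof (cases "\<forall>b\<in>Basis. a \<bullet> b = a' \<bullet> b")
    case True
    have "a = a'" by (rule euclidean_eqI) (use True in blast)
    then show ?thesis using Suc.prems(3) by (simp only:)
  next
    case False
    then obtain b where b: "b \<in> Basis" "a \<bullet> b \<noteq> a' \<bullet> b" by blast
    then obtain s where s: "s = 1 \<or> s = -1" "\<bar>a \<bullet> b + s * mesh k - a' \<bullet> b\<bar> = \<bar>a \<bullet> b - a' \<bullet> b\<bar> - mesh k"
      "min (a \<bullet> b) (a' \<bullet> b) \<le> a \<bullet> b + s * mesh k" "a \<bullet> b + s * mesh k \<le> max (a \<bullet> b) (a' \<bullet> b)"
      using lattice_step_towards[OF Suc.prems(2) a'] by blast
    define a1 where "a1 = a + (s * mesh k) *\<^sub>R b"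
    have a1b: "a1 \<bullet> b' = (if b' = b then a \<bullet> b + s * mesh k else a \<bullet> b')" if "b' \<in> Basis" for b'
      using b that by (auto simp: a1_def inner_add_left inner_Basis)
    have a1L: "a1 \<in> lattice_pts k"
      using lattice_add[OF Suc.prems(2), of "{b}"] lattice_minus[OF Suc.prems(2), of "{b}"] b s
      by (auto simp: a1_def)
    have sub: "min (a \<bullet> b') (a' \<bullet> b') \<le> min (a1 \<bullet> b') (a' \<bullet> b') \<and>
        max (a1 \<bullet> b') (a' \<bullet> b') \<le> max (a \<bullet> b') (a' \<bullet> b')" if "b' \<in> Basis" for b'
      using s a1b[OF that] by (cases "b' = b") auto
    show ?thesis
    proof (rule Suc.IH[of a1])
      fix e assume e: "e \<in> lattice_pts k"
        "\<forall>b\<in>Basis. min (a1 \<bullet> b) (a' \<bullet> b) \<le> e \<bullet> b \<and> e \<bullet> b \<le> max (a1 \<bullet> b) (a' \<bullet> b)"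
      show "admissible_cube D c k (cube k e)"
        using sub e(2) by (intro Suc.prems(1) e(1)) (meson order_trans)
    next
      show "a1 \<in> lattice_pts k" by (rule a1L)
      have "admissible_cube D c k (cube k a1)"
        using s a1b by (intro Suc.prems(1) a1L) auto
      then show "cube k a1 \<in> grid_cubes D c x0 k"
        unfolding a1_def by (rule grid_cubes_step[OF Suc.prems(3) b(1) s(1)])
      have "(\<Sum>b'\<in>Basis. \<bar>a1 \<bullet> b' - a' \<bullet> b'\<bar>) = (\<Sum>b'\<in>Basis. \<bar>a \<bullet> b' - a' \<bullet> b'\<bar> - (if b' = b then mesh k else 0))"
        using s a1b by (intro sum.cong) auto
      also have "\<dots> = (\<Sum>b'\<in>Basis. \<bar>a \<bullet> b' - a' \<bullet> b'\<bar>) - mesh k"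
        using b by (simp add: sum_subtractf)
      also have "\<dots> < real n * mesh k" using Suc.prems(4) by (simp add: algebra_simps)
      finally show "(\<Sum>b'\<in>Basis. \<bar>a1 \<bullet> b' - a' \<bullet> b'\<bar>) < real n * mesh k" .
    qed
  qed
qed

lemma norm_le_DIM:
  fixes x :: "'a::euclidean_space"
  assumes "\<And>b. b \<in> Basis \<Longrightarrow> \<bar>x \<bullet> b\<bar> \<le> e"
  shows "norm x \<le> real DIM('a) * e"
  using order_trans[OF norm_le_l1 sum_bounded_above[of Basis "\<lambda>b. \<bar>x \<bullet> b\<bar>" e]] assms by simp

lemma cube_diam:
  fixes p q :: "'a::euclidean_space"
  assumes "p \<in> cube k a" "q \<in> cube k a"
  shows "norm (p - q) \<le> real DIM('a) * mesh k"
proof (rule norm_le_DIM)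
  fix b :: 'a assume "b \<in> Basis"
  then show "\<bar>(p - q) \<bullet> b\<bar> \<le> mesh k"
    using assms by (auto simp: mem_cube inner_diff_left abs_le_iff) (smt (verit))+
qed

section \<open>Exhaustion of the domain by the grid\<close>

locale grid_domain =
  fixes D :: "'a::euclidean_space set" and c1 :: real and x0 :: 'a
  assumes open_D: "open D" and connected_D: "connected D" and bounded_D: "bounded D"
    and c1_pos: "0 < c1" and x0_D: "x0 \<in> D"
begin

abbreviation "G \<equiv> grid_cubes D c1 x0"

lemma frontier_D: "frontier D \<noteq> {}"
proof
  assume "frontier D = {}"
  then have "D = {} \<or> D = UNIV" by (simp add: frontier_eq_empty)
  then show False using x0_D bounded_D not_bounded_UNIV by auto
qed

text \<open>Frontier points have distance at least \<open>R\<close> from \<open>y\<close>, points of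
  the cube at most \<open>R/2\<close>; the half that remains exceeds the required clearance.\<close>

lemma admissible_near:
  assumes "ball y R \<subseteq> D" "e \<in> lattice_pts k" "c1 * mesh k < R/2"
    "\<And>p. p \<in> cube k e \<Longrightarrow> norm (p - y) \<le> R/2"
  shows "admissible_cube D c1 k (cube k e)"
  unfolding admissible_cube_iff
proof (intro bexI[OF _ assms(2)] conjI refl)
  have "0 < c1 * mesh k" using c1_pos by simp
  then have R: "R > 0" using assms(3) by simp
  show "cube k e \<subseteq> D"
    using assms(1,4) R by (force simp: dist_norm norm_minus_commute subset_iff)
  have "R/2 \<le> setdist (cube k e) (frontier D)"
  proof (rule le_setdistI)
    show "cube k e \<noteq> {}" using cube_corner by blast
    show "frontier D \<noteq> {}" by (rule frontier_D)
    fix p q assume p: "p \<in> cube k e" and q: "q \<in> frontier D"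
    have "q \<notin> D" using q open_D by (simp add: frontier_def interior_open)
    then have "q \<notin> ball y R" using assms(1) by blast
    then have "R \<le> dist y q" by simp
    also have "\<dots> \<le> dist y p + dist p q" by (rule dist_triangle)
    finally show "R/2 \<le> dist p q" using assms(4)[OF p] by (simp add: dist_norm norm_minus_commute)
  qed
  then show "c1 * mesh k < setdist (cube k e) (frontier D)" using assms(3) by linarith
qed

text \<open>Near a point of \<open>D\<close> and for fine meshes, the box spanned by any two cubes
  meeting a small ball consists of admissible cubes. Membership in the grid therefore spreads from
  one such cube to all of them.\<close>

lemma locally_connected_grid:
  assumes y: "y \<in> D"
  shows "\<exists>\<delta>>0. \<forall>\<^sub>F k in sequentially. \<forall>a\<in>lattice_pts k. cube k a \<inter> ball y \<delta> \<noteq> {} \<longrightarrow>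
     admissible_cube D c1 k (cube k a) \<and>
     (\<forall>a'\<in>lattice_pts k. cube k a' \<inter> ball y \<delta> \<noteq> {} \<longrightarrow> cube k a' \<in> G k \<longrightarrow> cube k a \<in> G k)"
proof -
  obtain R where R: "R > 0" "ball y R \<subseteq> D" using open_D y open_contains_ball by blast
  define d where "d = real DIM('a)"
  have d: "d \<ge> 1" using DIM_positive[where 'a='a] by (simp add: d_def Suc_le_eq)
  \<comment> \<open>Passing from coordinates to the norm costs a factor \<open>d\<close>:
    \<open>d * \<delta>\<close> is \<open>R/8\<close>, and the mesh terms are kept below
    \<open>R/4\<close>, within the allowed \<open>R/2\<close>.\<close>
  define \<delta> where "\<delta> = R / (8 * d)"
  have \<delta>: "\<delta> > 0" "d * \<delta> = R/8" using R d by (auto simp: \<delta>_def)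
  have "(\<lambda>k. (d * d + d + c1) * mesh k) \<longlonglongrightarrow> (d * d + d + c1) * 0"
    by (intro tendsto_intros mesh_tendsto_0)
  then have ev: "\<forall>\<^sub>F k in sequentially. (d * d + d + c1) * mesh k < R/4"
    by (rule order_tendstoD) (use R in simp)
  have "\<forall>\<^sub>F k in sequentially. \<forall>a\<in>lattice_pts k. cube k a \<inter> ball y \<delta> \<noteq> {} \<longrightarrow>
     admissible_cube D c1 k (cube k a) \<and>
     (\<forall>a'\<in>lattice_pts k. cube k a' \<inter> ball y \<delta> \<noteq> {} \<longrightarrow> cube k a' \<in> G k \<longrightarrow> cube k a \<in> G k)"
    using ev
  proof eventually_elim
    case (elim k)
    have small: "d * (d * mesh k) + d * mesh k + c1 * mesh k < R/4"
      using elim by (simp add: algebra_simps)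
    have pos: "0 \<le> d * (d * mesh k)" "0 \<le> d * mesh k" "0 \<le> c1 * mesh k"
      using d c1_pos by simp_all
    have near: "\<bar>a \<bullet> b - y \<bullet> b\<bar> \<le> \<delta> + d * mesh k"
      if meets: "cube k a \<inter> ball y \<delta> \<noteq> {}" and b: "b \<in> Basis" for a b
    proof -
      obtain p where "p \<in> cube k a \<inter> ball y \<delta>" using meets by blast
      then have p: "p \<in> cube k a" "dist y p < \<delta>" by simp_all
      have "norm (a - y) \<le> norm (a - p) + norm (p - y)"
        using norm_triangle_ineq[of "a - p" "p - y"] by simp
      then have "norm (a - y) \<le> \<delta> + d * mesh k"
        using p cube_diam[OF cube_corner p(1)] by (simp add: d_def dist_norm norm_minus_commute)
      then show ?thesis
        using Basis_le_norm[OF b, of "a - y"] by (simp add: inner_diff_left)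
    qed
    have adm: "admissible_cube D c1 k (cube k e)"
      if "e \<in> lattice_pts k" "\<And>b. b \<in> Basis \<Longrightarrow> \<bar>e \<bullet> b - y \<bullet> b\<bar> \<le> \<delta> + d * mesh k" for e
    proof (rule admissible_near[OF R(2) that(1)])
      show "c1 * mesh k < R/2" using small pos by linarith
      fix p assume p: "p \<in> cube k e"
      have "norm (e - y) \<le> d * (\<delta> + d * mesh k)"
        unfolding d_def by (rule norm_le_DIM) (use that in \<open>auto simp: inner_diff_left d_def\<close>)
      moreover have "norm (p - e) \<le> d * mesh k"
        using cube_diam[OF p cube_corner] by (simp add: d_def)
      moreover have "norm (p - y) \<le> norm (p - e) + norm (e - y)"
        using norm_triangle_ineq[of "p - e" "e - y"] by simp
      ultimately show "norm (p - y) \<le> R/2"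
        using small pos \<delta> by (simp add: distrib_left)
    qed
    show ?case
    proof (intro ballI impI conjI)
      fix a assume a: "a \<in> lattice_pts k" "cube k a \<inter> ball y \<delta> \<noteq> {}"
      show "admissible_cube D c1 k (cube k a)" using near[OF a(2)] by (intro adm a)
      fix a' assume a': "a' \<in> lattice_pts k" "cube k a' \<inter> ball y \<delta> \<noteq> {}" "cube k a' \<in> G k"
      obtain n where n: "(\<Sum>b\<in>Basis. \<bar>a' \<bullet> b - a \<bullet> b\<bar>) < real n * mesh k"
        using reals_Archimedean3[OF mesh_pos[of k]] by blast
      show "cube k a \<in> G k"
      proof (rule grid_cubes_connected[OF a(1) _ a'(1,3) n])
        fix e assume e: "e \<in> lattice_pts k"
          "\<forall>b\<in>Basis. min (a' \<bullet> b) (a \<bullet> b) \<le> e \<bullet> b \<and> e \<bullet> b \<le> max (a' \<bullet> b) (a \<bullet> b)"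
        show "admissible_cube D c1 k (cube k e)"
        proof (rule adm[OF e(1)])
          fix b :: 'a assume b: "b \<in> Basis"
          have "min (a' \<bullet> b) (a \<bullet> b) \<le> e \<bullet> b" "e \<bullet> b \<le> max (a' \<bullet> b) (a \<bullet> b)" using e(2) b by auto
          then show "\<bar>e \<bullet> b - y \<bullet> b\<bar> \<le> \<delta> + d * mesh k"
            using near[OF a(2) b] near[OF a'(2) b] by linarith
        qed
      qed
    qed
  qed
  then show ?thesis using \<delta>(1) by blast
qed

definition floor_pt :: "nat \<Rightarrow> 'a \<Rightarrow> 'a" where
  "floor_pt k y = (\<Sum>b\<in>Basis. (of_int \<lfloor>(y \<bullet> b) / mesh k\<rfloor> * mesh k) *\<^sub>R b)"

lemma floor_pt_inner: "b \<in> Basis \<Longrightarrow> floor_pt k y \<bullet> b = of_int \<lfloor>(y \<bullet> b) / mesh k\<rfloor> * mesh k"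
  by (simp add: floor_pt_def)

lemma floor_pt_lattice: "floor_pt k y \<in> lattice_pts k"
  by (intro lattice_ptsI) (auto simp: floor_pt_inner)

lemma floor_pt_bounds:
  assumes "b \<in> Basis"
  shows "floor_pt k y \<bullet> b \<le> y \<bullet> b" "y \<bullet> b < floor_pt k y \<bullet> b + mesh k"
proof -
  have "of_int \<lfloor>(y \<bullet> b) / mesh k\<rfloor> * mesh k \<le> (y \<bullet> b) / mesh k * mesh k"
    by (intro mult_right_mono) (auto simp: less_imp_le)
  then show "floor_pt k y \<bullet> b \<le> y \<bullet> b" using assms by (simp add: floor_pt_inner)
  have "(y \<bullet> b) / mesh k * mesh k < (of_int \<lfloor>(y \<bullet> b) / mesh k\<rfloor> + 1) * mesh k"
    by (intro mult_strict_right_mono) auto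
  then show "y \<bullet> b < floor_pt k y \<bullet> b + mesh k" using assms by (simp add: floor_pt_inner distrib_right)
qed

lemma floor_pt_cube: "y \<in> cube k (floor_pt k y)"
  using floor_pt_bounds by (auto simp: mem_cube less_imp_le)

text \<open>Every lattice cube that touches \<open>S\<close> is required to be in the grid, not just
  enough cubes to cover \<open>S\<close>; this also settles the cubes around a vertex in
  \<open>S\<close>.\<close>

definition exhausted :: "'a set \<Rightarrow> bool" where
  "exhausted S \<longleftrightarrow>
     (\<forall>\<^sub>F k in sequentially. \<forall>a\<in>lattice_pts k. cube k a \<inter> S \<noteq> {} \<longrightarrow> cube k a \<in> G k)"

lemma exhausted_subset: "exhausted S \<Longrightarrow> S' \<subseteq> S \<Longrightarrow> exhausted S'"
  unfolding exhausted_def by (rule eventually_mono, assumption) blast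

text \<open>In the ball of \<open>locally_connected_grid\<close> one grid cube is enough. The cube
  around \<open>s\<close> is one: for \<open>s = x0\<close> through a chain of length one, otherwise
  because it meets an exhausted ball.\<close>

lemma exhausted_local:
  assumes y: "y \<in> D"
  shows "\<exists>\<delta>>0. (\<exists>s\<in>D. dist y s < \<delta> \<and> (s = x0 \<or> (\<exists>\<epsilon>>0. exhausted (ball s \<epsilon>)))) \<longrightarrow> exhausted (ball y \<delta>)"
proof -
  obtain \<delta> where \<delta>: "\<delta> > 0" "\<forall>\<^sub>F k in sequentially. \<forall>a\<in>lattice_pts k. cube k a \<inter> ball y \<delta> \<noteq> {} \<longrightarrow>
     admissible_cube D c1 k (cube k a) \<and>
     (\<forall>a'\<in>lattice_pts k. cube k a' \<inter> ball y \<delta> \<noteq> {} \<longrightarrow> cube k a' \<in> G k \<longrightarrow> cube k a \<in> G k)"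
    using locally_connected_grid[OF y] by blast
  have "exhausted (ball y \<delta>)" if s: "dist y s < \<delta>" "s = x0 \<or> (\<exists>\<epsilon>>0. exhausted (ball s \<epsilon>))" for s
  proof -
    have meets: "s \<in> cube k (floor_pt k s) \<inter> ball y \<delta>" for k
      using s(1) floor_pt_cube by simp
    have "\<forall>\<^sub>F k in sequentially. (admissible_cube D c1 k (cube k (floor_pt k s)) \<longrightarrow> cube k (floor_pt k s) \<in> G k)"
      using s(2)
    proof
      assume "s = x0"
      then show ?thesis using floor_pt_cube by (intro always_eventually allI impI grid_cubes_start) auto
    next
      assume "\<exists>\<epsilon>>0. exhausted (ball s \<epsilon>)"
      then obtain \<epsilon> where \<epsilon>: "\<epsilon> > 0" "exhausted (ball s \<epsilon>)" by blast
      have "s \<in> cube k (floor_pt k s) \<inter> ball s \<epsilon>" for k using \<epsilon>(1) floor_pt_cube by simp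
      then have ne: "cube k (floor_pt k s) \<inter> ball s \<epsilon> \<noteq> {}" for k by blast
      from \<epsilon>(2)[unfolded exhausted_def] show ?thesis
        by eventually_elim (use ne floor_pt_lattice in blast)
    qed
    with \<delta>(2) show ?thesis
      unfolding exhausted_def
    proof eventually_elim
      case (elim k)
      have ne: "cube k (floor_pt k s) \<inter> ball y \<delta> \<noteq> {}" using meets by blast
      with elim floor_pt_lattice have "cube k (floor_pt k s) \<in> G k" by blast
      with elim(1) floor_pt_lattice ne show ?case by blast
    qed
  qed
  then show ?thesis using \<delta>(1) by blast
qed

text \<open>Connectedness of \<open>D\<close> enters here: the points with an exhausted
  neighbourhood form an open set containing \<open>x0\<close>, and by \<open>exhausted_local\<close>
  the rest of \<open>D\<close> is open as well.\<close>

lemma exhausted_ball: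
  assumes y: "y \<in> D"
  shows "\<exists>\<epsilon>>0. exhausted (ball y \<epsilon>)"
proof -
  define E where "E = {y\<in>D. \<exists>\<epsilon>>0. exhausted (ball y \<epsilon>)}"
  have openE: "open E"
    unfolding open_contains_ball
  proof
    fix y assume "y \<in> E"
    then obtain \<epsilon> where y: "y \<in> D" and \<epsilon>: "\<epsilon> > 0" "exhausted (ball y \<epsilon>)" by (auto simp: E_def)
    obtain R where R: "R > 0" "ball y R \<subseteq> D" using open_D y open_contains_ball by blast
    have "ball y (min R \<epsilon>) \<subseteq> E"
    proof
      fix z assume z: "z \<in> ball y (min R \<epsilon>)"
      have "ball z (\<epsilon> - dist y z) \<subseteq> ball y \<epsilon>"
        using dist_triangle_lt by (auto simp: subset_iff) (smt (verit) dist_triangle)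
      then have "exhausted (ball z (\<epsilon> - dist y z))" by (rule exhausted_subset[OF \<epsilon>(2)])
      moreover have "\<epsilon> - dist y z > 0" "z \<in> D" using z R by auto
      ultimately show "z \<in> E" unfolding E_def by blast
    qed
    then show "\<exists>e>0. ball y e \<subseteq> E" using R \<epsilon> by (intro exI[of _ "min R \<epsilon>"]) auto
  qed
  have openE': "open (D - E)"
    unfolding open_contains_ball
  proof
    fix y assume y: "y \<in> D - E"
    then obtain \<delta> where \<delta>: "\<delta> > 0"
      "(\<exists>s\<in>D. dist y s < \<delta> \<and> (s = x0 \<or> (\<exists>\<epsilon>>0. exhausted (ball s \<epsilon>)))) \<longrightarrow> exhausted (ball y \<delta>)"
      using exhausted_local[of y] by blast
    obtain R where R: "R > 0" "ball y R \<subseteq> D" using open_D y open_contains_ball by blast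
    have "\<not> exhausted (ball y \<delta>)" using y \<delta>(1) by (auto simp: E_def)
    then have "ball y (min R \<delta>) \<subseteq> D - E" using \<delta>(2) R by (auto simp: E_def subset_iff)
    then show "\<exists>e>0. ball y e \<subseteq> D - E" using R \<delta> by (intro exI[of _ "min R \<delta>"]) auto
  qed
  have x0E: "x0 \<in> E"
  proof -
    obtain \<delta> where \<delta>: "\<delta> > 0"
      "(\<exists>s\<in>D. dist x0 s < \<delta> \<and> (s = x0 \<or> (\<exists>\<epsilon>>0. exhausted (ball s \<epsilon>)))) \<longrightarrow> exhausted (ball x0 \<delta>)"
      using exhausted_local[OF x0_D] by blast
    have "exhausted (ball x0 \<delta>)"
      using \<delta>(1) x0_D by (intro \<delta>(2)[rule_format] bexI[of _ x0]) auto
    then show ?thesis using \<delta>(1) x0_D by (auto simp: E_def)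
  qed
  have "E \<inter> D = {} \<or> (D - E) \<inter> D = {}"
    by (rule connectedD[OF connected_D openE openE']) auto
  then have "D - E = {}" using x0E x0_D by blast
  then show ?thesis using y by (auto simp: E_def)
qed

lemma exhausted_compact:
  assumes K: "compact K" "K \<subseteq> D"
  shows "exhausted K"
proof -
  have "\<forall>y\<in>K. \<exists>\<epsilon>. \<epsilon> > 0 \<and> exhausted (ball y \<epsilon>)" using exhausted_ball K(2) by blast
  from bchoice[OF this] obtain \<epsilon> where \<epsilon>: "\<forall>y\<in>K. \<epsilon> y > 0 \<and> exhausted (ball y (\<epsilon> y))" by (elim exE)
  obtain F where F: "F \<subseteq> K" "finite F" "K \<subseteq> (\<Union>y\<in>F. ball y (\<epsilon> y))"
  proof (rule compactE_image[OF K(1), of K "\<lambda>y. ball y (\<epsilon> y)"])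
    show "K \<subseteq> (\<Union>y\<in>K. ball y (\<epsilon> y))"
    proof
      fix y assume "y \<in> K"
      then show "y \<in> (\<Union>y\<in>K. ball y (\<epsilon> y))" using \<epsilon> by (intro UN_I[of y]) auto
    qed
  qed auto
  have "\<forall>\<^sub>F k in sequentially. \<forall>y\<in>F. \<forall>a\<in>lattice_pts k. cube k a \<inter> ball y (\<epsilon> y) \<noteq> {} \<longrightarrow> cube k a \<in> G k"
    using \<epsilon> F by (intro eventually_ball_finite) (auto simp: exhausted_def subset_iff)
  then show ?thesis
    unfolding exhausted_def
  proof eventually_elim
    case (elim k)
    show ?case
    proof (intro ballI impI)
      fix a assume a: "a \<in> lattice_pts k" "cube k a \<inter> K \<noteq> {}"
      then obtain p y where "p \<in> cube k a" "y \<in> F" "p \<in> ball y (\<epsilon> y)" using F(3) by blast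
      then show "cube k a \<in> G k" using elim a(1) by blast
    qed
  qed
qed

end

section \<open>The grid graph\<close>

lemma finite_lattice_bounded:
  fixes B :: "'a::euclidean_space set"
  assumes "bounded B"
  shows "finite (lattice_pts k \<inter> B)"
proof -
  obtain R where R: "\<And>x. x \<in> B \<Longrightarrow> norm x \<le> R" using assms by (auto simp: bounded_iff)
  define n where "n = \<lceil>R / mesh k\<rceil>"
  have "lattice_pts k \<inter> B \<subseteq> (\<lambda>z. \<Sum>b\<in>Basis. (of_int (z b) * mesh k) *\<^sub>R b) ` (PiE Basis (\<lambda>_. {-n..n}))"
  proof
    fix x assume x: "x \<in> lattice_pts k \<inter> B"
    then have "\<forall>b\<in>Basis. \<exists>z::int. x \<bullet> b = of_int z * mesh k" by (auto elim: lattice_ptsE)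
    from bchoice[OF this] obtain z where z: "\<And>b. b \<in> Basis \<Longrightarrow> x \<bullet> b = of_int (z b) * mesh k" by blast
    have "z b \<in> {-n..n}" if b: "b \<in> Basis" for b
    proof -
      have "\<bar>of_int (z b)\<bar> * mesh k \<le> R"
        using Basis_le_norm[OF b, of x] R[of x] x z[OF b] by (simp add: abs_mult)
      then have "\<bar>of_int (z b)\<bar> \<le> R / mesh k" by (simp add: pos_le_divide_eq)
      then have "\<bar>z b\<bar> \<le> n" unfolding n_def by linarith
      then show ?thesis by auto
    qed
    then have "restrict z Basis \<in> PiE Basis (\<lambda>_. {-n..n})" by (simp add: restrict_PiE_iff)
    moreover have "x = (\<Sum>b\<in>Basis. (of_int (restrict z Basis b) * mesh k) *\<^sub>R b)"
      using z by (simp add: euclidean_representation cong: sum.cong flip: z)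
    ultimately show "x \<in> (\<lambda>z. \<Sum>b\<in>Basis. (of_int (z b) * mesh k) *\<^sub>R b) ` (PiE Basis (\<lambda>_. {-n..n}))"
      by blast
  qed
  then show ?thesis by (rule finite_subset) (intro finite_imageI finite_PiE; simp)
qed

text \<open>A nonzero coordinate difference of lattice points is at least \<open>mesh k\<close> and
  thus uses up the whole norm, leaving zero for the other coordinates.\<close>

lemma lattice_unit_distance:
  fixes x y :: "'a::euclidean_space"
  assumes x: "x \<in> lattice_pts k" and y: "y \<in> lattice_pts k" and n: "norm (x - y) = mesh k"
  obtains b s where "b \<in> Basis" "s = 1 \<or> s = -1" "y = x + (s * mesh k) *\<^sub>R b"
proof -
  define v where "v = y - x"
  have nv: "norm v = mesh k" using n by (simp add: v_def norm_minus_commute)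
  have "v \<noteq> 0" using nv by force
  then have "\<not> (\<forall>b\<in>Basis. v \<bullet> b = 0)" by (simp only: euclidean_all_zero_iff not_False_eq_True)
  then obtain b where b: "b \<in> Basis" "v \<bullet> b \<noteq> 0" by blast
  have "\<not> \<bar>y \<bullet> b - x \<bullet> b\<bar> < mesh k"
    using lattice_diff_less[OF y x b(1)] b(2) by (auto simp: v_def inner_diff_left)
  then have "mesh k \<le> \<bar>v \<bullet> b\<bar>" by (simp add: v_def inner_diff_left)
  then have vb: "\<bar>v \<bullet> b\<bar> = mesh k" using Basis_le_norm[OF b(1), of v] nv by simp
  have "(mesh k)\<^sup>2 = (\<Sum>c\<in>Basis. (v \<bullet> c)\<^sup>2)"
    unfolding nv[symmetric] power2_norm_eq_inner by (subst euclidean_inner) (simp add: power2_eq_square)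
  also have "\<dots> = (v \<bullet> b)\<^sup>2 + (\<Sum>c\<in>Basis - {b}. (v \<bullet> c)\<^sup>2)"
    using b(1) by (simp add: sum.remove)
  also have "(v \<bullet> b)\<^sup>2 = (mesh k)\<^sup>2" using vb by (metis power2_abs)
  finally have "(\<Sum>c\<in>Basis - {b}. (v \<bullet> c)\<^sup>2) = 0" by simp
  then have others: "v \<bullet> c = 0" if "c \<in> Basis" "c \<noteq> b" for c
    using that by (subst (asm) sum_nonneg_eq_0_iff) auto
  define s where "s = (if v \<bullet> b > 0 then 1 else -1::real)"
  have sb: "v \<bullet> b = s * mesh k" using vb by (auto simp: s_def abs_if split: if_splits)
  have "v = (s * mesh k) *\<^sub>R b"
  proof (rule euclidean_eqI)
    fix c :: 'a assume "c \<in> Basis"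
    then show "v \<bullet> c = ((s * mesh k) *\<^sub>R b) \<bullet> c"
      using sb others[of c] b(1) by (cases "c = b") (auto simp: inner_Basis)
  qed
  then have "y = x + (s * mesh k) *\<^sub>R b" by (simp add: v_def algebra_simps)
  moreover have "s = 1 \<or> s = -1" by (simp add: s_def)
  ultimately show ?thesis using that b(1) by blast
qed

lemma axis_segment:
  fixes x :: "'a::euclidean_space"
  assumes b: "b \<in> Basis" and m: "m > 0"
  shows "z \<in> closed_segment x (x + m *\<^sub>R b) \<longleftrightarrow>
    (\<forall>c\<in>Basis - {b}. z \<bullet> c = x \<bullet> c) \<and> x \<bullet> b \<le> z \<bullet> b \<and> z \<bullet> b \<le> x \<bullet> b + m"
proof
  assume "z \<in> closed_segment x (x + m *\<^sub>R b)"
  then obtain u where u: "0 \<le> u" "u \<le> 1" "z = (1 - u) *\<^sub>R x + u *\<^sub>R (x + m *\<^sub>R b)"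
    by (auto simp: closed_segment_def)
  have z: "z = x + (u * m) *\<^sub>R b" using u(3) by (simp add: algebra_simps)
  have "u * m \<le> 1 * m" using u m by (intro mult_right_mono) auto
  then show "(\<forall>c\<in>Basis - {b}. z \<bullet> c = x \<bullet> c) \<and> x \<bullet> b \<le> z \<bullet> b \<and> z \<bullet> b \<le> x \<bullet> b + m"
    using b u(1,2) m unfolding z by (auto simp: inner_add_left inner_Basis)
next
  assume *: "(\<forall>c\<in>Basis - {b}. z \<bullet> c = x \<bullet> c) \<and> x \<bullet> b \<le> z \<bullet> b \<and> z \<bullet> b \<le> x \<bullet> b + m"
  define u where "u = (z \<bullet> b - x \<bullet> b) / m"
  have u: "0 \<le> u" "u \<le> 1" "u * m = z \<bullet> b - x \<bullet> b" using * m by (auto simp: u_def)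
  have "z = x + (u * m) *\<^sub>R b"
  proof (rule euclidean_eqI)
    fix c :: 'a assume "c \<in> Basis"
    then show "z \<bullet> c = (x + (u * m) *\<^sub>R b) \<bullet> c"
      using * u(3) b by (cases "c = b") (auto simp: inner_add_left inner_Basis)
  qed
  also have "\<dots> = (1 - u) *\<^sub>R x + u *\<^sub>R (x + m *\<^sub>R b)" by (simp add: algebra_simps)
  finally show "z \<in> closed_segment x (x + m *\<^sub>R b)"
    using u unfolding closed_segment_def by blast
qed

text \<open>The hypothesis is on the midpoint, because a cube may touch the segment in an end point
  only. Containing the midpoint forces the coordinate along \<open>b\<close> to match the corner and
  every other coordinate to lie on a face.\<close>

lemma lattice_segment_edge:
  fixes x :: "'a::euclidean_space"
  assumes x: "x \<in> lattice_pts k" and a: "a \<in> lattice_pts k" and b: "b \<in> Basis"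
    and mid: "x + (mesh k / 2) *\<^sub>R b \<in> cube k a"
  shows "closed_segment x (x + mesh k *\<^sub>R b) edge_of cube k a"
proof -
  let ?S = "closed_segment x (x + mesh k *\<^sub>R b)"
  note seg = axis_segment[OF b mesh_pos[of k], of _ x]
  have cb: "a \<bullet> c \<le> (x + (mesh k / 2) *\<^sub>R b) \<bullet> c \<and> (x + (mesh k / 2) *\<^sub>R b) \<bullet> c \<le> a \<bullet> c + mesh k"
    if "c \<in> Basis" for c
    using mid that by (auto simp: mem_cube)
  have "a \<bullet> b \<le> x \<bullet> b + mesh k / 2" "x \<bullet> b + mesh k / 2 \<le> a \<bullet> b + mesh k"
    using cb[OF b] b by (auto simp: inner_add_left)
  then have "\<bar>x \<bullet> b - a \<bullet> b\<bar> < mesh k" using mesh_pos[of k] by linarith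
  then have xb: "x \<bullet> b = a \<bullet> b" by (rule lattice_diff_less[OF x a b])
  have xc: "x \<bullet> c = a \<bullet> c \<or> x \<bullet> c = a \<bullet> c + mesh k" if "c \<in> Basis" "c \<noteq> b" for c
  proof (rule ccontr)
    assume neg: "\<not> ?thesis"
    have "a \<bullet> c \<le> x \<bullet> c" "x \<bullet> c \<le> a \<bullet> c + mesh k"
      using cb[OF that(1)] that b by (auto simp: inner_add_left inner_Basis)
    with neg have "\<bar>x \<bullet> c - a \<bullet> c\<bar> < mesh k" by auto
    then show False using lattice_diff_less[OF x a that(1)] neg by blast
  qed
  have sub: "?S \<subseteq> cube k a"
  proof
    fix z assume z: "z \<in> ?S"
    show "z \<in> cube k a"
      unfolding mem_cube
    proof
      fix c :: 'a assume c: "c \<in> Basis"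
      show "a \<bullet> c \<le> z \<bullet> c \<and> z \<bullet> c \<le> a \<bullet> c + mesh k"
        using z[unfolded seg] xb xc[OF c] c by (cases "c = b") auto
    qed
  qed
  have "?S face_of cube k a"
    unfolding face_of_def
  proof (intro conjI ballI impI sub convex_closed_segment)
    fix p q z assume p: "p \<in> cube k a" and q: "q \<in> cube k a" and z: "z \<in> ?S" "z \<in> open_segment p q"
    obtain u where u: "0 < u" "u < 1" "z = (1 - u) *\<^sub>R p + u *\<^sub>R q" using z(2) by (auto simp: in_segment)
    have pq: "p \<bullet> c = x \<bullet> c \<and> q \<bullet> c = x \<bullet> c" if c: "c \<in> Basis" "c \<noteq> b" for c
    proof -
      have eq: "(1 - u) * (p \<bullet> c - x \<bullet> c) + u * (q \<bullet> c - x \<bullet> c) = 0"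
      proof -
        have "z \<bullet> c = x \<bullet> c" using z(1)[unfolded seg] c by auto
        then show ?thesis unfolding u(3) by (simp add: inner_add_left algebra_simps)
      qed
      have bnd: "a \<bullet> c \<le> p \<bullet> c" "p \<bullet> c \<le> a \<bullet> c + mesh k" "a \<bullet> c \<le> q \<bullet> c" "q \<bullet> c \<le> a \<bullet> c + mesh k"
        using p q c by (auto simp: mem_cube)
      from xc[OF c] have "(1 - u) * (p \<bullet> c - x \<bullet> c) = 0 \<and> u * (q \<bullet> c - x \<bullet> c) = 0"
      proof
        assume "x \<bullet> c = a \<bullet> c"
        then have "0 \<le> (1 - u) * (p \<bullet> c - x \<bullet> c)" "0 \<le> u * (q \<bullet> c - x \<bullet> c)" using bnd u by auto
        with eq show ?thesis by linarith
      next
        assume "x \<bullet> c = a \<bullet> c + mesh k"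
        then have "(1 - u) * (p \<bullet> c - x \<bullet> c) \<le> 0" "u * (q \<bullet> c - x \<bullet> c) \<le> 0"
          using bnd u by (auto intro!: mult_nonneg_nonpos)
        with eq show ?thesis by linarith
      qed
      then show ?thesis using u by simp
    qed
    have "x \<bullet> b \<le> p \<bullet> b" "p \<bullet> b \<le> x \<bullet> b + mesh k" "x \<bullet> b \<le> q \<bullet> b" "q \<bullet> b \<le> x \<bullet> b + mesh k"
      using p q b xb by (auto simp: mem_cube)
    with pq show "p \<in> ?S" "q \<in> ?S" unfolding seg by auto
  qed
  moreover have "aff_dim ?S = 1"
  proof -
    have "x \<noteq> x + mesh k *\<^sub>R b" using b nonzero_Basis[OF b] by simp
    then show ?thesis by (simp add: segment_convex_hull aff_dim_convex_hull)
  qed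
  ultimately show ?thesis by (simp add: edge_of_def)
qed

context grid_domain
begin

definition corners :: "nat \<Rightarrow> 'a set" where
  "corners k = {a \<in> lattice_pts k. cube k a \<in> G k}"

abbreviation "V \<equiv> graph_verts D c1 x0"
abbreviation "adj \<equiv> graph_adj D c1 x0"

lemma grid_cubes_eq: "Q \<in> G k \<longleftrightarrow> (\<exists>a\<in>corners k. Q = cube k a)"
proof
  assume "Q \<in> G k"
  with grid_cubes_admissible[OF this] show "\<exists>a\<in>corners k. Q = cube k a"
    by (auto simp: admissible_cube_iff corners_def)
qed (auto simp: corners_def)

lemma corner_cube_subset: "a \<in> corners k \<Longrightarrow> cube k a \<subseteq> D"
  using grid_cubes_admissible[of "cube k a" D c1 x0 k] by (auto simp: corners_def admissible_cube_def)

lemma corners_D: "corners k \<subseteq> D"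
  using corner_cube_subset cube_corner by blast

lemma V_D: "V k \<subseteq> D"
proof
  fix x assume "x \<in> V k"
  then obtain Q where Q: "Q \<in> G k" "x \<in> Q" by (auto simp: graph_verts_def)
  from grid_cubes_admissible[OF Q(1)] have "Q \<subseteq> D" by (simp add: admissible_cube_def)
  with Q(2) show "x \<in> D" by blast
qed

lemma V_lattice: "V k \<subseteq> lattice_pts k"
  by (auto simp: graph_verts_def)

lemma finite_V: "finite (V k)"
  by (rule finite_subset[OF _ finite_lattice_bounded[OF bounded_D, of k]]) (use V_D V_lattice in auto)

lemma finite_corners: "finite (corners k)"
  by (rule finite_subset[OF _ finite_lattice_bounded[OF bounded_D, of k]]) (use corners_D in \<open>auto simp: corners_def\<close>)

lemma add_in_cube:
  assumes "S \<subseteq> Basis"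
  shows "a + mesh k *\<^sub>R \<Sum>S \<in> cube k a"
  using inner_sum_subset_Basis[OF assms] by (auto simp: mem_cube inner_add_left)

text \<open>A vertex exceeds the lower corner of a cube containing it by \<open>mesh k\<close> in
  exactly the directions of some set \<open>S\<close>. The pairs of a corner and a set
  \<open>S\<close> are the index set for the later sums over vertices.\<close>

lemma V_iff: "x \<in> V k \<longleftrightarrow> (\<exists>S\<subseteq>Basis. x - mesh k *\<^sub>R \<Sum>S \<in> corners k)"
proof
  assume x: "x \<in> V k"
  then obtain a where a: "a \<in> corners k" "x \<in> cube k a"
    by (auto simp: graph_verts_def grid_cubes_eq)
  have aL: "a \<in> lattice_pts k" and xL: "x \<in> lattice_pts k"
    using a(1) x V_lattice by (auto simp: corners_def)
  define S where "S = {b\<in>Basis. x \<bullet> b \<noteq> a \<bullet> b}"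
  have "x - mesh k *\<^sub>R \<Sum>S = a"
  proof (rule euclidean_eqI)
    fix b :: 'a assume b: "b \<in> Basis"
    have "x \<bullet> b = a \<bullet> b \<or> x \<bullet> b = a \<bullet> b + mesh k"
    proof (rule ccontr)
      assume neg: "\<not> ?thesis"
      then have "\<bar>x \<bullet> b - a \<bullet> b\<bar> < mesh k" using a(2) b by (auto simp: mem_cube less_le)
      then show False using lattice_diff_less[OF xL aL b] neg by blast
    qed
    then show "(x - mesh k *\<^sub>R \<Sum>S) \<bullet> b = a \<bullet> b"
      using b inner_sum_subset_Basis[of S b] by (auto simp: S_def inner_diff_left)
  qed
  then show "\<exists>S\<subseteq>Basis. x - mesh k *\<^sub>R \<Sum>S \<in> corners k"
    using a(1) by (intro exI[of _ S]) (auto simp: S_def)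
next
  assume "\<exists>S\<subseteq>Basis. x - mesh k *\<^sub>R \<Sum>S \<in> corners k"
  then obtain S where S: "S \<subseteq> Basis" "x - mesh k *\<^sub>R \<Sum>S \<in> corners k" by blast
  then have "x \<in> lattice_pts k"
    using lattice_add[of "x - mesh k *\<^sub>R \<Sum>S" k S] by (simp add: corners_def)
  moreover have "x \<in> cube k (x - mesh k *\<^sub>R \<Sum>S)"
    using add_in_cube[OF S(1), of "x - mesh k *\<^sub>R \<Sum>S" k] by simp
  moreover have "cube k (x - mesh k *\<^sub>R \<Sum>S) \<in> G k" using S(2) by (simp add: corners_def)
  ultimately show "x \<in> V k" unfolding graph_verts_def by blast
qed

lemma adj_V: "adj k x y \<Longrightarrow> x \<in> V k \<and> y \<in> V k"
  by (simp add: graph_adj_def)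

lemma adj_sym: "adj k x y \<longleftrightarrow> adj k y x"
  by (auto simp: graph_adj_def norm_minus_commute closed_segment_commute)

definition nbs :: "nat \<Rightarrow> 'a \<Rightarrow> 'a set" where
  "nbs k x = (\<lambda>(b, s). x + (s * mesh k) *\<^sub>R b) ` (Basis \<times> {1, -1})"

lemma card_nbs: "card (nbs k x) = 2 * DIM('a)"
proof -
  have "inj_on (\<lambda>(b, s). x + (s * mesh k) *\<^sub>R b) (Basis \<times> {1, -1::real})"
  proof (rule inj_onI)
    fix p q :: "'a \<times> real"
    assume p: "p \<in> Basis \<times> {1, -1}" and q: "q \<in> Basis \<times> {1, -1}"
      and eq: "(\<lambda>(b, s). x + (s * mesh k) *\<^sub>R b) p = (\<lambda>(b, s). x + (s * mesh k) *\<^sub>R b) q"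
    obtain b s c t where pq: "p = (b, s)" "q = (c, t)" by (cases p, cases q)
    then have bc: "b \<in> Basis" "c \<in> Basis" "s \<noteq> 0" "t \<noteq> 0" using p q by auto
    have "(s * mesh k) *\<^sub>R b = (t * mesh k) *\<^sub>R c" using eq pq by simp
    then have "((s * mesh k) *\<^sub>R b) \<bullet> b = ((t * mesh k) *\<^sub>R c) \<bullet> b" by (rule arg_cong)
    then have "s * mesh k = t * mesh k * (c \<bullet> b)" using bc by simp
    then have "s = t * (c \<bullet> b)" by simp
    then have "c = b" "s = t" using bc by (auto simp: inner_Basis split: if_splits)
    then show "p = q" using pq by simp
  qed
  then have "card (nbs k x) = card (Basis \<times> {1, -1::real} :: ('a \<times> real) set)"
    unfolding nbs_def by (rule card_image)
  then show ?thesis by (simp add: card_cartesian_product)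
qed

lemma finite_nbs: "finite (nbs k x)"
  by (simp add: nbs_def)

lemma adj_nbs: "{y. adj k x y} \<subseteq> nbs k x"
proof
  fix y assume "y \<in> {y. adj k x y}"
  then have "x \<in> lattice_pts k" "y \<in> lattice_pts k" "norm (x - y) = mesh k"
    using V_lattice by (auto simp: graph_adj_def mesh_def)
  then obtain b s where "b \<in> Basis" "s = 1 \<or> s = -1" "y = x + (s * mesh k) *\<^sub>R b"
    by (rule lattice_unit_distance)
  then show "y \<in> nbs k x" by (force simp: nbs_def)
qed

lemma degree_le: "degree_of (adj k) x \<le> 2 * DIM('a)"
  unfolding degree_of_def using card_mono[OF finite_nbs adj_nbs, of k x] by (simp add: card_nbs)

lemma adj_in_cube:
  assumes a: "a \<in> corners k" and x: "x \<in> lattice_pts k" "x \<in> cube k a"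
    and y: "y \<in> lattice_pts k" "y \<in> cube k a" and n: "norm (x - y) = mesh k"
  shows "adj k x y"
proof -
  have "closed_segment x y \<subseteq> cube k a"
    using x y by (intro closed_segment_subset) (auto simp: cube_def)
  moreover have "cube k a \<in> G k" using a by (simp add: corners_def)
  ultimately show ?thesis
    using x y n unfolding graph_adj_def graph_verts_def mesh_def by blast
qed

lemma adj_right:
  assumes a: "a \<in> corners k" and x: "x \<in> lattice_pts k" "x \<in> cube k a" and b: "b \<in> Basis"
    and "x \<bullet> b < a \<bullet> b + mesh k"
  shows "adj k x (x + mesh k *\<^sub>R b)"
proof (rule adj_in_cube[OF a x])
  show "x + mesh k *\<^sub>R b \<in> lattice_pts k" using lattice_add[OF x(1), of "{b}"] b by simp
  have aL: "a \<in> lattice_pts k" using a by (simp add: corners_def)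
  have "\<bar>x \<bullet> b - a \<bullet> b\<bar> < mesh k" using assms(5) x(2) b by (auto simp: mem_cube abs_if)
  then have "x \<bullet> b = a \<bullet> b" by (rule lattice_diff_less[OF x(1) aL b])
  then show "x + mesh k *\<^sub>R b \<in> cube k a"
    using x(2) b unfolding mem_cube by (auto simp: inner_add_left inner_Basis)
  show "norm (x - (x + mesh k *\<^sub>R b)) = mesh k" using b by simp
qed

text \<open>When all cubes around \<open>x\<close> are present, no neighbour is missing: forward
  edges start at \<open>x\<close> as a corner, backward edges are forward edges of the corner
  \<open>x - mesh k *\<^sub>R b\<close>.\<close>

lemma degree_interior:
  assumes x: "x \<in> lattice_pts k" and c: "\<And>S. S \<subseteq> Basis \<Longrightarrow> x - mesh k *\<^sub>R \<Sum>S \<in> corners k"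
  shows "degree_of (adj k) x = 2 * DIM('a)"
proof -
  have "nbs k x \<subseteq> {y. adj k x y}"
  proof
    fix y assume "y \<in> nbs k x"
    then obtain b s where b: "b \<in> Basis" and s: "s = 1 \<or> s = -1" and y: "y = x + (s * mesh k) *\<^sub>R b"
      by (auto simp: nbs_def)
    from s show "y \<in> {y. adj k x y}"
    proof
      assume "s = 1"
      then show ?thesis using adj_right[OF _ x cube_corner b] c[of "{}"] y by simp
    next
      assume s: "s = -1"
      have "y \<in> corners k" using c[of "{b}"] b y s by simp
      then have "adj k y (y + mesh k *\<^sub>R b)"
        by (intro adj_right[OF _ _ cube_corner b]) (auto simp: corners_def)
      then have "adj k y x" using y s by simp
      then show ?thesis using adj_sym by simp
    qed
  qed
  then have "{y. adj k x y} = nbs k x" using adj_nbs by blast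
  then show ?thesis by (simp add: degree_of_def card_nbs)
qed

text \<open>Adjacency only says that the segment lies in the union of the cubes. Some cube contains
  its midpoint, and then the segment is an edge of that cube. So the edge sum in
  \<open>good_functions\<close> dominates the energy of the walk.\<close>

lemma adj_grid_edges:
  assumes "adj k x y"
  shows "(x, y) \<in> grid_edges D c1 x0 k"
proof -
  have *: "\<exists>Q\<in>G k. closed_segment x (x + mesh k *\<^sub>R b) edge_of Q"
    if x: "x \<in> lattice_pts k" and b: "b \<in> Basis" and
      sub: "closed_segment x (x + mesh k *\<^sub>R b) \<subseteq> \<Union>(G k)" for x b
  proof -
    have "x + (mesh k / 2) *\<^sub>R b \<in> closed_segment x (x + mesh k *\<^sub>R b)"
      using b by (subst axis_segment[OF b mesh_pos]) (auto simp: inner_add_left inner_Basis)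
    then obtain Q where Q: "Q \<in> G k" "x + (mesh k / 2) *\<^sub>R b \<in> Q"
      using sub by blast
    then obtain a where a: "a \<in> corners k" "x + (mesh k / 2) *\<^sub>R b \<in> cube k a"
      by (auto simp: grid_cubes_eq)
    then have "closed_segment x (x + mesh k *\<^sub>R b) edge_of cube k a"
      using x b by (intro lattice_segment_edge) (auto simp: corners_def)
    moreover have "cube k a \<in> G k" using a(1) by (simp add: corners_def)
    ultimately show ?thesis by (rule bexI)
  qed
  have L: "x \<in> lattice_pts k" "y \<in> lattice_pts k" "norm (x - y) = mesh k" "closed_segment x y \<subseteq> \<Union>(G k)"
    using assms V_lattice by (auto simp: graph_adj_def mesh_def)
  from L(1-3) obtain b s where b: "b \<in> Basis" "s = 1 \<or> s = -1" "y = x + (s * mesh k) *\<^sub>R b"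
    by (rule lattice_unit_distance)
  from b(2) have "\<exists>Q\<in>G k. closed_segment x y edge_of Q"
  proof
    assume "s = 1"
    then show ?thesis using *[OF L(1) b(1)] L(4) b(3) by simp
  next
    assume "s = -1"
    then have x: "x = y + mesh k *\<^sub>R b" using b(3) by simp
    show ?thesis using *[OF L(2) b(1)] L(4) unfolding x[symmetric] by (simp add: closed_segment_commute)
  qed
  then show ?thesis by (simp add: grid_edges_def)
qed

lemma finite_grid_edges: "finite (grid_edges D c1 x0 k)"
proof (rule finite_subset)
  show "grid_edges D c1 x0 k \<subseteq> (lattice_pts k \<inter> D) \<times> (lattice_pts k \<inter> D)"
  proof (rule subrelI)
    fix x y assume "(x, y) \<in> grid_edges D c1 x0 k"
    then obtain Q where Q: "Q \<in> G k" "closed_segment x y face_of Q"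
      by (auto simp: grid_edges_def edge_of_def)
    have "{x} face_of Q" "{y} face_of Q"
      by (rule face_of_trans[OF _ Q(2)]; simp add: face_of_singleton extreme_point_of_segment)+
    then have ext: "x extreme_point_of Q" "y extreme_point_of Q" by (simp_all add: face_of_singleton)
    have adm: "admissible_cube D c1 k Q" using Q(1) by (rule grid_cubes_admissible)
    then have "v \<in> lattice_pts k \<inter> D" if "v extreme_point_of Q" for v
      using that unfolding admissible_cube_def extreme_point_of_def by blast
    with ext show "(x, y) \<in> (lattice_pts k \<inter> D) \<times> (lattice_pts k \<inter> D)" by blast
  qed
  show "finite ((lattice_pts k \<inter> D) \<times> (lattice_pts k \<inter> D))"
    by (intro finite_cartesian_product finite_lattice_bounded bounded_D)
qed

end

section \<open>Convergence of the weights to Lebesgue measure\<close>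

lemma finite_measure_leb:
  fixes D :: "'a::euclidean_space set"
  assumes "open D" "bounded D"
  shows "finite_measure (leb D)"
proof (rule finite_measureI)
  have "emeasure lborel D < \<infinity>" by (rule emeasure_bounded_finite[OF assms(2)])
  moreover have "emeasure (leb D) (space (leb D)) = emeasure lborel D"
    using assms(1) by (simp add: emeasure_restrict_space space_restrict_space)
  ultimately show "emeasure (leb D) (space (leb D)) \<noteq> \<infinity>" by simp
qed

lemma space_leb [simp]: "space (leb D) = D"
  by (simp add: space_restrict_space)

text \<open>Half-open, so that the cells of one level are disjoint and tile the space.\<close>

definition cell :: "nat \<Rightarrow> 'a::euclidean_space \<Rightarrow> 'a set" where
  "cell k a = {y. \<forall>b\<in>Basis. a \<bullet> b \<le> y \<bullet> b \<and> y \<bullet> b < a \<bullet> b + mesh k}"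

lemma cell_borel [measurable]: "cell k a \<in> sets borel"
  unfolding cell_def by measurable

lemma cell_subset_cube: "cell k a \<subseteq> cube k a"
  by (auto simp: cell_def mem_cube less_imp_le)

lemma emeasure_cell: "emeasure lborel (cell k a :: 'a::euclidean_space set) = ennreal (mesh k ^ DIM('a))"
proof (rule antisym)
  let ?u = "a + mesh k *\<^sub>R \<Sum>Basis"
  have u: "?u \<bullet> b = a \<bullet> b + mesh k" if "b \<in> Basis" for b
    using that by (simp add: inner_add_left inner_sum_subset_Basis)
  have p: "(\<Prod>b\<in>Basis. (?u - a) \<bullet> b) = mesh k ^ DIM('a)"
    by (simp add: inner_sum_subset_Basis)
  have "emeasure lborel (cell k a) \<le> emeasure lborel (cbox a ?u)"
    using cell_subset_cube by (intro emeasure_mono) (auto simp: cube_def)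
  also have "\<dots> = ennreal (mesh k ^ DIM('a))"
    using p by (subst emeasure_lborel_cbox) (auto simp: u)
  finally show "emeasure lborel (cell k a) \<le> ennreal (mesh k ^ DIM('a))" .
  have "box a ?u \<subseteq> cell k a" by (auto simp: cell_def mem_box u less_imp_le)
  then have "emeasure lborel (box a ?u) \<le> emeasure lborel (cell k a)"
    by (intro emeasure_mono) auto
  moreover have "emeasure lborel (box a ?u) = ennreal (mesh k ^ DIM('a))"
    using p by (subst emeasure_lborel_box) (auto simp: u)
  ultimately show "ennreal (mesh k ^ DIM('a)) \<le> emeasure lborel (cell k a)" by simp
qed

context grid_domain
begin

abbreviation "wgt \<equiv> grid_weight D c1 x0"

sublocale leb: finite_measure "leb D"
  by (rule finite_measure_leb[OF open_D bounded_D])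

lemma sets_leb: "A \<in> sets borel \<Longrightarrow> A \<subseteq> D \<Longrightarrow> A \<in> sets (leb D)"
  using open_D by (simp add: sets_restrict_space_iff)

lemma borel_leb: "f \<in> borel_measurable borel \<Longrightarrow> f \<in> borel_measurable (leb D)"
  by (rule measurable_restrict_space1) simp

lemma cell_floor_pt:
  assumes a: "a \<in> lattice_pts k"
  shows "y \<in> cell k a \<longleftrightarrow> floor_pt k y = a"
proof
  assume y: "y \<in> cell k a"
  show "floor_pt k y = a"
  proof (rule euclidean_eqI)
    fix b :: 'a assume b: "b \<in> Basis"
    have "a \<bullet> b \<le> y \<bullet> b" "y \<bullet> b < a \<bullet> b + mesh k" using y b by (auto simp: cell_def)
    with floor_pt_bounds[OF b, where k=k and y=y] have "\<bar>floor_pt k y \<bullet> b - a \<bullet> b\<bar> < mesh k" by linarith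
    then show "floor_pt k y \<bullet> b = a \<bullet> b" by (rule lattice_diff_less[OF floor_pt_lattice a b])
  qed
next
  assume "floor_pt k y = a"
  then show "y \<in> cell k a" using floor_pt_bounds[where k=k and y=y] by (auto simp: cell_def)
qed

lemma cell_D: "a \<in> corners k \<Longrightarrow> cell k a \<subseteq> D"
  using corner_cube_subset cell_subset_cube by blast

lemma measure_cell: "cell k a \<subseteq> D \<Longrightarrow> measure (leb D) (cell k a) = mesh k ^ DIM('a)"
  using open_D by (simp add: measure_def emeasure_restrict_space emeasure_cell)

text \<open>Spreads values at lower corners over their cells; its integral is a sum over grid cubes,
  to which dominated convergence applies.\<close>

definition step_fun :: "nat \<Rightarrow> ('a \<Rightarrow> real) \<Rightarrow> 'a \<Rightarrow> real" where
  "step_fun k f y = (if floor_pt k y \<in> corners k then f (floor_pt k y) else 0)"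

lemma step_fun_eq: "step_fun k f y = (\<Sum>a\<in>corners k. f a * indicator (cell k a) y)"
proof -
  have "(\<Sum>a\<in>corners k. f a * indicator (cell k a) y) =
      (\<Sum>a\<in>corners k. if floor_pt k y = a then f a else 0)"
  proof (rule sum.cong[OF refl])
    fix a assume "a \<in> corners k"
    then have "a \<in> lattice_pts k" by (simp add: corners_def)
    from cell_floor_pt[OF this, of y]
    show "f a * indicator (cell k a) y = (if floor_pt k y = a then f a else 0)" by (simp add: indicator_def)
  qed
  then show ?thesis using finite_corners by (simp add: step_fun_def sum.delta')
qed

lemma step_fun_measurable [measurable]: "step_fun k f \<in> borel_measurable borel"
  unfolding step_fun_eq[abs_def] by measurable

lemma integral_step_fun: "(\<integral>y. step_fun k f y \<partial>leb D) = (\<Sum>a\<in>corners k. f a * mesh k ^ DIM('a))"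
proof -
  have "(\<integral>y. step_fun k f y \<partial>leb D) = (\<Sum>a\<in>corners k. \<integral>y. f a * indicator (cell k a) y \<partial>leb D)"
    unfolding step_fun_eq
    by (intro Bochner_Integration.integral_sum integrable_mult_right integrable_real_indicator sets_leb cell_borel cell_D)
      (auto simp: leb.emeasure_finite less_top[symmetric])
  also have "\<dots> = (\<Sum>a\<in>corners k. f a * mesh k ^ DIM('a))"
    using cell_D measure_cell by (intro sum.cong refl) (simp add: Int_absorb2)
  finally show ?thesis .
qed

definition mult :: "nat \<Rightarrow> 'a \<Rightarrow> nat" where
  "mult k x = card {S \<in> Pow Basis. x - mesh k *\<^sub>R \<Sum>S \<in> corners k}"

lemma mult_pos: "x \<in> V k \<Longrightarrow> mult k x > 0"
  unfolding mult_def V_iff by (subst card_gt_0_iff) auto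

text \<open>Double counting: a vertex is shared by \<open>mult k x\<close> grid cubes and receives
  an equal share from each. \<open>S\<close> is the position of the vertex in the cube with corner
  \<open>a\<close>.\<close>

lemma sum_V: "(\<Sum>x\<in>V k. f x) = (\<Sum>S\<in>Pow Basis. \<Sum>a\<in>corners k.
    f (a + mesh k *\<^sub>R \<Sum>S) / real (mult k (a + mesh k *\<^sub>R \<Sum>S)))" for f :: "'a \<Rightarrow> real"
proof -
  let ?c = "\<lambda>S x. x - mesh k *\<^sub>R \<Sum>S"
  have "(\<Sum>x\<in>V k. f x) = (\<Sum>x\<in>V k. \<Sum>S\<in>Pow Basis. if ?c S x \<in> corners k then f x / real (mult k x) else 0)"
  proof (rule sum.cong[OF refl])
    fix x assume x: "x \<in> V k"
    have "(\<Sum>S\<in>Pow Basis. if ?c S x \<in> corners k then f x / real (mult k x) else 0) =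
        (\<Sum>S\<in>{S\<in>Pow Basis. ?c S x \<in> corners k}. f x / real (mult k x))"
      by (rule sum.inter_filter[symmetric]) simp
    also have "\<dots> = real (mult k x) * (f x / real (mult k x))"
      unfolding mult_def by (rule sum_constant)
    also have "\<dots> = f x" using mult_pos[OF x] by simp
    finally show "f x = (\<Sum>S\<in>Pow Basis. if ?c S x \<in> corners k then f x / real (mult k x) else 0)" by simp
  qed
  also have "\<dots> = (\<Sum>S\<in>Pow Basis. \<Sum>x\<in>V k. if ?c S x \<in> corners k then f x / real (mult k x) else 0)"
    by (rule sum.swap)
  also have "\<dots> = (\<Sum>S\<in>Pow Basis. \<Sum>a\<in>corners k.
    f (a + mesh k *\<^sub>R \<Sum>S) / real (mult k (a + mesh k *\<^sub>R \<Sum>S)))"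
  proof (rule sum.cong[OF refl])
    fix S :: "'a set" assume S: "S \<in> Pow Basis"
    have "(\<Sum>x\<in>V k. if ?c S x \<in> corners k then f x / real (mult k x) else 0) =
        (\<Sum>x\<in>{x\<in>V k. ?c S x \<in> corners k}. f x / real (mult k x))"
      by (rule sum.inter_filter[symmetric, OF finite_V])
    also have "\<dots> = (\<Sum>a\<in>corners k. f (a + mesh k *\<^sub>R \<Sum>S) / real (mult k (a + mesh k *\<^sub>R \<Sum>S)))"
    proof (rule sum.reindex_bij_witness[of _ "\<lambda>a. a + mesh k *\<^sub>R \<Sum>S" "?c S"])
      fix a assume "a \<in> corners k"
      then have "\<exists>S'\<subseteq>Basis. a + mesh k *\<^sub>R \<Sum>S - mesh k *\<^sub>R \<Sum>S' \<in> corners k"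
        using S by (intro exI[of _ S]) auto
      then have "a + mesh k *\<^sub>R \<Sum>S \<in> V k" by (simp only: V_iff)
      with \<open>a \<in> corners k\<close> show "a + mesh k *\<^sub>R \<Sum>S \<in> {x\<in>V k. ?c S x \<in> corners k}" by simp
    qed auto
    finally show "(\<Sum>x\<in>V k. if ?c S x \<in> corners k then f x / real (mult k x) else 0) =
      (\<Sum>a\<in>corners k. f (a + mesh k *\<^sub>R \<Sum>S) / real (mult k (a + mesh k *\<^sub>R \<Sum>S)))" .
  qed
  finally show ?thesis .
qed

lemma mesh_power: "mesh k ^ DIM('a) = (1/2) ^ (k * DIM('a))"
  by (simp add: mesh_def power_mult)

lemma wgt_eq: "wgt k x = real (degree_of (adj k) x) / (2 * real DIM('a)) * mesh k ^ DIM('a)"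
  by (simp add: grid_weight_def mesh_power)

lemma wgt_nonneg: "0 \<le> wgt k x"
  by (simp add: wgt_eq)

lemma wgt_le: "wgt k x \<le> mesh k ^ DIM('a)"
proof -
  have "real (degree_of (adj k) x) \<le> 2 * real DIM('a)"
    using degree_le[of k x] by (metis of_nat_le_iff of_nat_mult of_nat_numeral)
  then have "real (degree_of (adj k) x) / (2 * real DIM('a)) \<le> 1"
    using DIM_positive[where 'a='a] by (simp add: divide_le_eq)
  then have "wgt k x \<le> 1 * mesh k ^ DIM('a)" unfolding wgt_eq by (intro mult_right_mono) auto
  then show ?thesis by simp
qed

lemma floor_pt_tendsto: "(\<lambda>k. floor_pt k y + mesh k *\<^sub>R \<Sum>S) \<longlonglongrightarrow> y"
proof -
  have "(\<lambda>k. floor_pt k y - y) \<longlonglongrightarrow> 0"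
  proof (rule Lim_null_comparison)
    show "\<forall>\<^sub>F k in sequentially. norm (floor_pt k y - y) \<le> real DIM('a) * mesh k"
      by (intro always_eventually allI cube_diam[OF cube_corner floor_pt_cube])
    show "(\<lambda>k. real DIM('a) * mesh k) \<longlonglongrightarrow> 0"
      using tendsto_mult[OF tendsto_const mesh_tendsto_0, of "real DIM('a)"] by simp
  qed
  then have "(\<lambda>k. (floor_pt k y - y) + mesh k *\<^sub>R \<Sum>S + y) \<longlonglongrightarrow> 0 + 0 *\<^sub>R \<Sum>S + y"
    by (intro tendsto_intros mesh_tendsto_0)
  then show ?thesis by (simp add: algebra_simps)
qed

text \<open>Shifting by \<open>S\<close> gives the vertices of the cell around \<open>y\<close>,
  shifting back by \<open>S'\<close> all cubes at these vertices. They lie in the grid for fine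
  meshes, so the vertices have full degree and full multiplicity.\<close>

lemma eventually_interior:
  assumes y: "y \<in> D"
  shows "\<forall>\<^sub>F k in sequentially. \<forall>S\<in>Pow Basis. \<forall>S'\<in>Pow Basis.
    floor_pt k y + mesh k *\<^sub>R \<Sum>S - mesh k *\<^sub>R \<Sum>S' \<in> corners k"
proof -
  obtain \<epsilon> where \<epsilon>: "\<epsilon> > 0" "exhausted (ball y \<epsilon>)" using exhausted_ball[OF y] by blast
  have "\<forall>\<^sub>F k in sequentially. \<forall>S\<in>Pow Basis. dist (floor_pt k y + mesh k *\<^sub>R \<Sum>S) y < \<epsilon>"
    using tendstoD[OF floor_pt_tendsto \<epsilon>(1)] by (intro eventually_ball_finite) auto
  then show ?thesis
    using \<epsilon>(2)[unfolded exhausted_def]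
  proof eventually_elim
    case (elim k)
    show ?case
    proof (intro ballI)
      fix S S' :: "'a set" assume S: "S \<in> Pow Basis" "S' \<in> Pow Basis"
      let ?x = "floor_pt k y + mesh k *\<^sub>R \<Sum>S" and ?a = "floor_pt k y + mesh k *\<^sub>R \<Sum>S - mesh k *\<^sub>R \<Sum>S'"
      have aL: "?a \<in> lattice_pts k"
        using S by (intro lattice_minus lattice_add floor_pt_lattice) auto
      have "?x \<in> cube k ?a" using add_in_cube[of S' ?a k] S by simp
      moreover have "?x \<in> ball y \<epsilon>" using elim(1) S by (auto simp: dist_commute)
      ultimately have "cube k ?a \<inter> ball y \<epsilon> \<noteq> {}" by blast
      then show "?a \<in> corners k" using elim(2) aL by (auto simp: corners_def)
    qed
  qed
qed

text \<open>Continuity only almost everywhere, as for Riemann integrability: it suffices for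
  convergence of the weighted sums and admits cell indicators.\<close>

definition TT :: "('a \<Rightarrow> real) set" where
  "TT = {c \<in> borel_measurable (leb D). (\<exists>B. \<forall>x\<in>D. \<bar>c x\<bar> \<le> B) \<and> (AE y in leb D. isCont c y)}"

text \<open>Regrouped by cubes, the sum becomes integrals of step functions, one for each vertex
  position \<open>S\<close>. At a point of continuity the integrand tends to
  \<open>c y / 2^d\<close>, with \<open>d\<close> the dimension, and the positions add up to
  \<open>c y\<close>. Weights never exceed the cell volume, so a constant dominates up to the
  frontier.\<close>

lemma weighted_sum_tendsto:
  assumes c: "c \<in> TT"
  shows "(\<lambda>k. \<Sum>x\<in>V k. wgt k x * c x) \<longlonglongrightarrow> (\<integral>x. c x \<partial>leb D)"
proof -
  obtain B where B: "\<And>x. x \<in> D \<Longrightarrow> \<bar>c x\<bar> \<le> B" using c by (auto simp: TT_def)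
  have cm: "c \<in> borel_measurable (leb D)" and cont: "AE y in leb D. isCont c y"
    using c by (auto simp: TT_def)
  let ?d = "DIM('a)"
  \<comment> \<open>Division by the cell volume cancels the factor from
    \<open>integral_step_fun\<close>; division by \<open>mult\<close> is the share from
    \<open>sum_V\<close>.\<close>
  define F where "F S k = (\<lambda>a. wgt k (a + mesh k *\<^sub>R \<Sum>S) / mesh k ^ ?d * c (a + mesh k *\<^sub>R \<Sum>S) /
      real (mult k (a + mesh k *\<^sub>R \<Sum>S)))" for S k
  have sum_eq: "(\<Sum>x\<in>V k. wgt k x * c x) = (\<Sum>S\<in>Pow Basis. \<integral>y. step_fun k (F S k) y \<partial>leb D)" for k
    unfolding sum_V integral_step_fun F_def by (intro sum.cong refl) simp
  have lim: "(\<lambda>k. \<integral>y. step_fun k (F S k) y \<partial>leb D) \<longlonglongrightarrow> (\<integral>y. c y / 2 ^ ?d \<partial>leb D)"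
    if S: "S \<in> Pow Basis" for S
  proof (rule integral_dominated_convergence[where w = "\<lambda>_. \<bar>B\<bar>"])
    show "(\<lambda>y. c y / 2 ^ ?d) \<in> borel_measurable (leb D)" using cm by measurable
    show "step_fun k (F S k) \<in> borel_measurable (leb D)" for k by (intro borel_leb step_fun_measurable)
    show "integrable (leb D) (\<lambda>_. \<bar>B\<bar>)" by simp
    show "AE y in leb D. norm (step_fun k (F S k) y) \<le> \<bar>B\<bar>" for k
    proof (rule AE_I2)
      fix y
      show "norm (step_fun k (F S k) y) \<le> \<bar>B\<bar>"
      proof (cases "floor_pt k y \<in> corners k")
        case True
        let ?x = "floor_pt k y + mesh k *\<^sub>R \<Sum>S"
        have "\<exists>S'\<subseteq>Basis. ?x - mesh k *\<^sub>R \<Sum>S' \<in> corners k"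
          using S True by (intro exI[of _ S]) auto
        then have x: "?x \<in> V k" by (simp only: V_iff)
        have w: "0 \<le> wgt k ?x / mesh k ^ ?d" "wgt k ?x / mesh k ^ ?d \<le> 1"
          using wgt_nonneg[of k ?x] wgt_le[of k ?x] by (auto simp: divide_le_eq)
        have cB: "\<bar>c ?x\<bar> \<le> \<bar>B\<bar>" using B[of ?x] V_D x by force
        have m: "1 \<le> real (mult k ?x)" using mult_pos[OF x] by simp
        have "\<bar>F S k (floor_pt k y)\<bar> = wgt k ?x / mesh k ^ ?d * \<bar>c ?x\<bar> / real (mult k ?x)"
          using w(1) by (simp add: F_def abs_mult wgt_nonneg)
        also have "\<dots> \<le> 1 * \<bar>B\<bar> / 1"
          using w cB m by (intro frac_le mult_mono mult_nonneg_nonneg) auto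
        finally show ?thesis using True by (simp add: step_fun_def)
      qed (simp add: step_fun_def)
    qed
    have "AE y in leb D. y \<in> D" by (rule AE_I2) simp
    then show "AE y in leb D. (\<lambda>k. step_fun k (F S k) y) \<longlonglongrightarrow> c y / 2 ^ ?d"
      using cont
    proof eventually_elim
      case (elim y)
      let ?x = "\<lambda>k. floor_pt k y + mesh k *\<^sub>R \<Sum>S"
      have "\<forall>\<^sub>F k in sequentially. step_fun k (F S k) y = c (?x k) / 2 ^ ?d"
        using eventually_interior[OF elim(1)]
      proof eventually_elim
        case (elim k)
        have L: "?x k \<in> lattice_pts k" using S by (intro lattice_add floor_pt_lattice) auto
        have "floor_pt k y \<in> corners k" using elim[rule_format, of "{}" "{}"] by simp
        moreover have "{S' \<in> Pow Basis. ?x k - mesh k *\<^sub>R \<Sum>S' \<in> corners k} = Pow Basis"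
          using elim S by auto
        then have "mult k (?x k) = 2 ^ ?d" by (simp add: mult_def card_Pow)
        moreover have "degree_of (adj k) (?x k) = 2 * ?d"
          using elim S by (intro degree_interior L) auto
        then have "wgt k (?x k) = mesh k ^ ?d" by (simp add: wgt_eq)
        ultimately show ?case by (simp add: step_fun_def F_def)
      qed
      moreover have "(\<lambda>k. c (?x k) / 2 ^ ?d) \<longlonglongrightarrow> c y / 2 ^ ?d"
        using elim(2) by (intro tendsto_intros isCont_tendsto_compose[OF _ floor_pt_tendsto]) auto
      ultimately show ?case by (simp add: tendsto_cong)
    qed
  qed
  have "(\<lambda>k. \<Sum>x\<in>V k. wgt k x * c x) \<longlonglongrightarrow> (\<Sum>S\<in>Pow (Basis::'a set). \<integral>y. c y / 2 ^ ?d \<partial>leb D)"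
    unfolding sum_eq by (intro tendsto_sum lim)
  moreover have "(\<Sum>S\<in>Pow (Basis::'a set). \<integral>y. c y / 2 ^ ?d \<partial>leb D) = (\<integral>x. c x \<partial>leb D)"
    by (simp add: card_Pow)
  ultimately show ?thesis by simp
qed

end

section \<open>A discrete Poincare inequality\<close>

text \<open>Telescoping and Cauchy-Schwarz bound each difference by \<open>real L\<close> times the
  edge sum; there are \<open>L\<close> squared pairs. The conditional keeps only edges inside the
  line.\<close>

lemma poincare_line:
  fixes v :: "nat \<Rightarrow> real"
  shows "(\<Sum>s<L. \<Sum>t<L. (v s - v t)\<^sup>2) \<le>
    real L ^ 3 * (\<Sum>i<L. if Suc i < L then (v (Suc i) - v i)\<^sup>2 else 0)"
proof -
  let ?E = "\<Sum>i<L. if Suc i < L then (v (Suc i) - v i)\<^sup>2 else 0"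
  have le: "(v t - v s)\<^sup>2 \<le> real L * ?E" if "s \<le> t" "t < L" for s t
  proof -
    have "(v t - v s)\<^sup>2 = (\<Sum>i\<in>{s..<t}. v (Suc i) - v i)\<^sup>2"
      using sum_Suc_diff'[OF that(1), of v] by simp
    also have "\<dots> \<le> (\<Sum>i\<in>{s..<t}. (v (Suc i) - v i)\<^sup>2) * real (card {s..<t})"
      by (rule sum_squared_le_sum_of_squares)
    also have "\<dots> \<le> ?E * real L"
    proof (intro mult_mono)
      have "(\<Sum>i\<in>{s..<t}. (v (Suc i) - v i)\<^sup>2) =
          (\<Sum>i\<in>{s..<t}. if Suc i < L then (v (Suc i) - v i)\<^sup>2 else 0)"
        using that by (intro sum.cong) auto
      also have "\<dots> \<le> ?E" using that by (intro sum_mono2) auto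
      finally show "(\<Sum>i\<in>{s..<t}. (v (Suc i) - v i)\<^sup>2) \<le> ?E" .
      show "real (card {s..<t}) \<le> real L" using that by simp
    qed (auto intro!: sum_nonneg)
    finally show ?thesis by (simp add: mult.commute)
  qed
  have "(v s - v t)\<^sup>2 \<le> real L * ?E" if "s < L" "t < L" for s t
    using le[of s t] le[of t s] that by (cases "s \<le> t") (auto simp: power2_commute)
  then have "(\<Sum>s<L. \<Sum>t<L. (v s - v t)\<^sup>2) \<le> (\<Sum>s<L. \<Sum>t<L. real L * ?E)"
    by (intro sum_mono) auto
  also have "\<dots> = real L ^ 3 * ?E" by (simp add: power3_eq_cube)
  finally show ?thesis .
qed

definition box_energy :: "nat \<Rightarrow> 'i set \<Rightarrow> (('i \<Rightarrow> nat) \<Rightarrow> real) \<Rightarrow> real" where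
  "box_energy L I u = (\<Sum>b\<in>I. \<Sum>f\<in>PiE I (\<lambda>_. {..<L}).
     if Suc (f b) < L then (u (f(b := Suc (f b))) - u f)\<^sup>2 else 0)"

lemma sum_PiE_insert:
  fixes h :: "('i \<Rightarrow> nat) \<Rightarrow> real"
  assumes "j \<notin> I"
  shows "(\<Sum>f\<in>PiE (insert j I) (\<lambda>_. {..<L}). h f) =
    (\<Sum>s<L. \<Sum>f\<in>PiE I (\<lambda>_. {..<L}). h (f(j := s)))"
proof -
  have "(\<Sum>f\<in>PiE (insert j I) (\<lambda>_. {..<L}). h f) =
      (\<Sum>p\<in>{..<L} \<times> PiE I (\<lambda>_. {..<L}). h ((\<lambda>(y, g). g(j := y)) p))"
    unfolding PiE_insert_eq by (rule sum.reindex[OF inj_combinator[OF assms], unfolded o_def])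
  also have "\<dots> = (\<Sum>s<L. \<Sum>f\<in>PiE I (\<lambda>_. {..<L}). h (f(j := s)))"
    by (simp add: sum.cartesian_product case_prod_unfold)
  finally show ?thesis .
qed

lemma box_energy_insert:
  assumes j: "j \<notin> I" and fin: "finite I"
  shows "box_energy L (insert j I) u =
    (\<Sum>g\<in>PiE I (\<lambda>_. {..<L}). \<Sum>s<L. if Suc s < L then (u (g(j := Suc s)) - u (g(j := s)))\<^sup>2 else 0)
    + (\<Sum>s<L. box_energy L I (\<lambda>f. u (f(j := s))))"
proof -
  have "(\<Sum>f\<in>PiE (insert j I) (\<lambda>_. {..<L}). if Suc (f j) < L then (u (f(j := Suc (f j))) - u f)\<^sup>2 else 0) =
     (\<Sum>s<L. \<Sum>g\<in>PiE I (\<lambda>_. {..<L}). if Suc s < L then (u (g(j := Suc s)) - u (g(j := s)))\<^sup>2 else 0)"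
    by (subst sum_PiE_insert[OF j]) (simp cong: if_cong)
  also have "\<dots> = (\<Sum>g\<in>PiE I (\<lambda>_. {..<L}). \<Sum>s<L. if Suc s < L then (u (g(j := Suc s)) - u (g(j := s)))\<^sup>2 else 0)"
    by (rule sum.swap)
  finally have 1: "(\<Sum>f\<in>PiE (insert j I) (\<lambda>_. {..<L}). if Suc (f j) < L then (u (f(j := Suc (f j))) - u f)\<^sup>2 else 0) =
     (\<Sum>g\<in>PiE I (\<lambda>_. {..<L}). \<Sum>s<L. if Suc s < L then (u (g(j := Suc s)) - u (g(j := s)))\<^sup>2 else 0)" .
  have "(\<Sum>b\<in>I. \<Sum>f\<in>PiE (insert j I) (\<lambda>_. {..<L}). if Suc (f b) < L then (u (f(b := Suc (f b))) - u f)\<^sup>2 else 0) =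
    (\<Sum>b\<in>I. \<Sum>s<L. \<Sum>f\<in>PiE I (\<lambda>_. {..<L}).
       if Suc (f b) < L then (u ((f(b := Suc (f b)))(j := s)) - u (f(j := s)))\<^sup>2 else 0)"
  proof (rule sum.cong[OF refl])
    fix b assume "b \<in> I"
    then have "b \<noteq> j" using j by auto
    then show "(\<Sum>f\<in>PiE (insert j I) (\<lambda>_. {..<L}). if Suc (f b) < L then (u (f(b := Suc (f b))) - u f)\<^sup>2 else 0) =
      (\<Sum>s<L. \<Sum>f\<in>PiE I (\<lambda>_. {..<L}). if Suc (f b) < L then (u ((f(b := Suc (f b)))(j := s)) - u (f(j := s)))\<^sup>2 else 0)"
      by (subst sum_PiE_insert[OF j]) (simp add: fun_upd_twist cong: if_cong)
  qed
  also have "\<dots> = (\<Sum>s<L. box_energy L I (\<lambda>f. u (f(j := s))))"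
    unfolding box_energy_def by (rule sum.swap)
  finally have 2: "(\<Sum>b\<in>I. \<Sum>f\<in>PiE (insert j I) (\<lambda>_. {..<L}). if Suc (f b) < L then (u (f(b := Suc (f b))) - u f)\<^sup>2 else 0) =
    (\<Sum>s<L. box_energy L I (\<lambda>f. u (f(j := s))))" .
  show ?thesis
    unfolding box_energy_def[of L "insert j I"] sum.insert[OF fin j] 1 2 ..
qed

text \<open>Induction on the dimension. From \<open>(f, s)\<close> to \<open>(g, t)\<close> one
  passes through \<open>(g, s)\<close>: the first leg stays in a slice, the second in a line.
  Splitting the square costs the factor 2 per dimension.\<close>

lemma poincare_box:
  fixes u :: "('i \<Rightarrow> nat) \<Rightarrow> real"
  assumes "finite I"
  shows "(\<Sum>f\<in>PiE I (\<lambda>_. {..<L}). \<Sum>g\<in>PiE I (\<lambda>_. {..<L}). (u f - u g)\<^sup>2) \<le>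
    2 ^ card I * real L ^ (card I + 2) * box_energy L I u"
  using assms
proof (induction I arbitrary: u)
  case empty
  then show ?case by (simp add: box_energy_def)
next
  case (insert j I)
  let ?P = "PiE I (\<lambda>_. {..<L})" and ?n = "card I"
  let ?J = "\<Sum>g\<in>?P. \<Sum>s<L. if Suc s < L then (u (g(j := Suc s)) - u (g(j := s)))\<^sup>2 else 0"
  let ?E = "\<Sum>s<L. box_energy L I (\<lambda>f. u (f(j := s)))"
  have fin: "finite ?P" using insert by (intro finite_PiE) auto
  have cP: "real (card ?P) = real L ^ ?n" using insert by (simp add: card_PiE)
  have "(\<Sum>f\<in>PiE (insert j I) (\<lambda>_. {..<L}). \<Sum>g\<in>PiE (insert j I) (\<lambda>_. {..<L}). (u f - u g)\<^sup>2) =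
      (\<Sum>s<L. \<Sum>f\<in>?P. \<Sum>t<L. \<Sum>g\<in>?P. (u (f(j := s)) - u (g(j := t)))\<^sup>2)"
    by (simp add: sum_PiE_insert[OF insert(2)])
  also have "\<dots> \<le> (\<Sum>s<L. \<Sum>f\<in>?P. \<Sum>t<L. \<Sum>g\<in>?P.
      2 * (u (f(j := s)) - u (g(j := s)))\<^sup>2 + 2 * (u (g(j := s)) - u (g(j := t)))\<^sup>2)"
  proof (intro sum_mono)
    fix s f t g
    show "(u (f(j := s)) - u (g(j := t)))\<^sup>2 \<le>
        2 * (u (f(j := s)) - u (g(j := s)))\<^sup>2 + 2 * (u (g(j := s)) - u (g(j := t)))\<^sup>2"
      using sum_squares_bound[of "u (f(j := s)) - u (g(j := s))" "u (g(j := s)) - u (g(j := t))"]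
        power2_sum[of "u (f(j := s)) - u (g(j := s))" "u (g(j := s)) - u (g(j := t))"] by simp
  qed
  also have "\<dots> = 2 * real L * (\<Sum>s<L. \<Sum>f\<in>?P. \<Sum>g\<in>?P. (u (f(j := s)) - u (g(j := s)))\<^sup>2) +
      2 * real L ^ ?n * (\<Sum>s<L. \<Sum>t<L. \<Sum>g\<in>?P. (u (g(j := s)) - u (g(j := t)))\<^sup>2)"
    by (simp add: sum.distrib sum_distrib_left mult_ac flip: cP)
  also have "(\<Sum>s<L. \<Sum>t<L. \<Sum>g\<in>?P. (u (g(j := s)) - u (g(j := t)))\<^sup>2) =
      (\<Sum>g\<in>?P. \<Sum>s<L. \<Sum>t<L. (u (g(j := s)) - u (g(j := t)))\<^sup>2)"
    by (subst sum.swap[of _ ?P]) (intro sum.cong refl sum.swap)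
  also have "2 * real L * (\<Sum>s<L. \<Sum>f\<in>?P. \<Sum>g\<in>?P. (u (f(j := s)) - u (g(j := s)))\<^sup>2) +
      2 * real L ^ ?n * (\<Sum>g\<in>?P. \<Sum>s<L. \<Sum>t<L. (u (g(j := s)) - u (g(j := t)))\<^sup>2) \<le>
      2 * real L * (\<Sum>s<L. 2 ^ ?n * real L ^ (?n + 2) * box_energy L I (\<lambda>f. u (f(j := s)))) +
      2 * real L ^ ?n * (\<Sum>g\<in>?P. real L ^ 3 *
         (\<Sum>s<L. if Suc s < L then (u (g(j := Suc s)) - u (g(j := s)))\<^sup>2 else 0))"
    using insert.IH poincare_line by (intro add_mono mult_left_mono sum_mono) auto
  also have "\<dots> = 2 ^ Suc ?n * real L ^ (?n + 3) * ?E + 2 * real L ^ (?n + 3) * ?J"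
    by (simp add: sum_distrib_left power_add power3_eq_cube power2_eq_square mult_ac)
  also have "\<dots> \<le> 2 ^ Suc ?n * real L ^ (?n + 3) * ?E + 2 ^ Suc ?n * real L ^ (?n + 3) * ?J"
    by (intro add_left_mono mult_right_mono sum_nonneg) auto
  also have "\<dots> = 2 ^ card (insert j I) * real L ^ (card (insert j I) + 2) * box_energy L (insert j I) u"
  proof -
    have card: "card (insert j I) = Suc ?n" "Suc ?n + 2 = ?n + 3" using insert(1,2) by simp_all
    show ?thesis
      unfolding box_energy_insert[OF insert(2,1)] card by (simp only: distrib_left add.commute)
  qed
  finally show ?case .
qed

text \<open>An average over \<open>g\<close> is attained or undercut by some \<open>g\<close>.
  Comparing with a value of \<open>u\<close> rather than with its mean makes the comparison constant
  inherit every bound on \<open>u\<close>.\<close>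

lemma poincare_box_point:
  fixes u :: "('i \<Rightarrow> nat) \<Rightarrow> real"
  assumes fin: "finite I" and L: "L > 0"
  shows "\<exists>g\<in>PiE I (\<lambda>_. {..<L}). (\<Sum>f\<in>PiE I (\<lambda>_. {..<L}). (u f - u g)\<^sup>2) \<le>
    2 ^ card I * (real L)\<^sup>2 * box_energy L I u"
proof (rule ccontr)
  let ?P = "PiE I (\<lambda>_. {..<L})" and ?C = "2 ^ card I * (real L)\<^sup>2 * box_energy L I u"
  assume "\<not> ?thesis"
  then have gt: "(\<Sum>f\<in>?P. (u f - u g)\<^sup>2) > ?C" if "g \<in> ?P" for g using that by force
  have finP: "finite ?P" using fin by (intro finite_PiE) auto
  have ne: "?P \<noteq> {}" using L by (auto simp: PiE_eq_empty_iff)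
  have cP: "real (card ?P) = real L ^ card I" using fin by (simp add: card_PiE)
  have "real L ^ card I * ?C = (\<Sum>g\<in>?P. ?C)" by (simp add: cP)
  also have "\<dots> < (\<Sum>g\<in>?P. \<Sum>f\<in>?P. (u f - u g)\<^sup>2)"
    using gt by (intro sum_strict_mono finP ne) auto
  also have "\<dots> = (\<Sum>g\<in>?P. \<Sum>f\<in>?P. (u g - u f)\<^sup>2)" by (simp add: power2_commute)
  also have "\<dots> \<le> 2 ^ card I * real L ^ (card I + 2) * box_energy L I u"
    by (rule poincare_box[OF fin])
  also have "\<dots> = real L ^ card I * ?C" by (simp add: power_add power2_eq_square mult_ac)
  finally show False by simp
qed

lemma mesh_refine: "j \<le> k \<Longrightarrow> mesh j = 2 ^ (k - j) * mesh k"
  by (simp add: mesh_def power_diff field_simps)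

lemma lattice_refine:
  assumes "j \<le> k" "x \<in> lattice_pts j"
  shows "x \<in> lattice_pts k"
proof (rule lattice_ptsI)
  fix b :: 'a assume "b \<in> Basis"
  then obtain z :: int where "x \<bullet> b = of_int z * mesh j" by (rule lattice_ptsE[OF assms(2)])
  then show "\<exists>z::int. x \<bullet> b = of_int z * mesh k"
    by (intro exI[of _ "z * 2 ^ (k - j)"]) (simp add: mesh_refine[OF assms(1)])
qed

text \<open>The lattice points of level \<open>k\<close> in a cell of level \<open>j\<close> form a
  discrete box with side \<open>L = 2^(k-j)\<close>, the ratio of the two meshes; this is where the
  square of \<open>mesh j / mesh k\<close> comes from.\<close>

lemma cell_poincare:
  fixes u :: "'a::euclidean_space \<Rightarrow> real"
  assumes jk: "j \<le> k" and z: "z \<in> lattice_pts j"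
  shows "\<exists>y\<in>lattice_pts k \<inter> cell j z. (\<Sum>x\<in>lattice_pts k \<inter> cell j z. (u x - u y)\<^sup>2) \<le>
    2 ^ DIM('a) * (mesh j / mesh k)\<^sup>2 * (\<Sum>x\<in>lattice_pts k \<inter> cell j z. \<Sum>b\<in>Basis.
       if x + mesh k *\<^sub>R b \<in> cell j z then (u (x + mesh k *\<^sub>R b) - u x)\<^sup>2 else 0)"
proof -
  define L where "L = (2::nat) ^ (k - j)"
  have Lj: "real L * mesh k = mesh j" by (simp add: L_def mesh_refine[OF jk])
  let ?P = "PiE (Basis :: 'a set) (\<lambda>_. {..<L})" and ?A = "lattice_pts k \<inter> cell j z"
  define pt where "pt f = z + (\<Sum>b\<in>Basis. (real (f b) * mesh k) *\<^sub>R b)" for f :: "'a \<Rightarrow> nat"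
  have ptb: "pt f \<bullet> b = z \<bullet> b + real (f b) * mesh k" if "b \<in> Basis" for f b
    using that by (simp add: pt_def inner_add_left)
  have zk: "z \<in> lattice_pts k" by (rule lattice_refine[OF jk z])
  have in_cell: "pt f \<in> cell j z \<longleftrightarrow> (\<forall>b\<in>Basis. f b < L)" for f
  proof -
    have "real (f b) * mesh k < mesh j \<longleftrightarrow> f b < L" for b
      unfolding Lj[symmetric] by simp
    then show ?thesis by (simp add: cell_def ptb)
  qed
  have pt_lattice: "pt f \<in> lattice_pts k" for f
  proof (rule lattice_ptsI)
    fix b :: 'a assume b: "b \<in> Basis"
    then obtain w :: int where "z \<bullet> b = of_int w * mesh k" by (rule lattice_ptsE[OF zk])
    then show "\<exists>w::int. pt f \<bullet> b = of_int w * mesh k"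
      using b by (intro exI[of _ "w + int (f b)"]) (simp add: ptb distrib_right)
  qed
  have bij: "bij_betw pt ?P ?A"
  proof (rule bij_betw_imageI)
    show "inj_on pt ?P"
    proof (rule inj_onI)
      fix f g assume f: "f \<in> ?P" and g: "g \<in> ?P" and eq: "pt f = pt g"
      show "f = g"
      proof (rule PiE_ext[OF f g])
        fix b :: 'a assume "b \<in> Basis"
        then show "f b = g b" using ptb[of b f] ptb[of b g] eq by simp
      qed
    qed
    show "pt ` ?P = ?A"
    proof (intro subset_antisym image_subsetI)
      show "pt f \<in> ?A" if "f \<in> ?P" for f using that pt_lattice in_cell by auto
      show "?A \<subseteq> pt ` ?P"
      proof
        fix x assume x: "x \<in> ?A"
        have "\<forall>b\<in>Basis. \<exists>n<L. x \<bullet> b = z \<bullet> b + real n * mesh k"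
        proof
          fix b :: 'a assume b: "b \<in> Basis"
          obtain w :: int where w: "x \<bullet> b = of_int w * mesh k" using lattice_ptsE[OF _ b] x by blast
          obtain v :: int where v: "z \<bullet> b = of_int v * mesh k" by (rule lattice_ptsE[OF zk b])
          have "z \<bullet> b \<le> x \<bullet> b" "x \<bullet> b < z \<bullet> b + mesh j" using x b by (auto simp: cell_def)
          then have "of_int v * mesh k \<le> of_int w * mesh k"
            "of_int w * mesh k < (of_int v + real L) * mesh k"
            using w v Lj by (auto simp: distrib_right)
          then have "real_of_int v \<le> of_int w" "real_of_int w < of_int v + real L"
            by (auto simp: mult_less_cancel_right_pos)
          then have vw: "v \<le> w" "w < v + int L" by linarith+
          then have "x \<bullet> b = z \<bullet> b + real (nat (w - v)) * mesh k"
            by (simp add: w v left_diff_distrib)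
          moreover have "nat (w - v) < L" using vw by linarith
          ultimately show "\<exists>n<L. x \<bullet> b = z \<bullet> b + real n * mesh k" by blast
        qed
        from bchoice[OF this] obtain f where f: "\<And>b. b \<in> Basis \<Longrightarrow> f b < L \<and> x \<bullet> b = z \<bullet> b + real (f b) * mesh k"
          by blast
        have "x = pt (restrict f Basis)"
        proof (rule euclidean_eqI)
          fix b :: 'a assume "b \<in> Basis"
          then show "x \<bullet> b = pt (restrict f Basis) \<bullet> b" using f by (simp add: ptb)
        qed
        moreover have "restrict f Basis \<in> ?P" using f by (simp add: restrict_PiE_iff)
        ultimately show "x \<in> pt ` ?P" by blast
      qed
    qed
  qed
  have upd: "pt (f(b := Suc (f b))) = pt f + mesh k *\<^sub>R b" if b: "b \<in> Basis" for f b
  proof (rule euclidean_eqI)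
    fix c :: 'a assume "c \<in> Basis"
    then show "pt (f(b := Suc (f b))) \<bullet> c = (pt f + mesh k *\<^sub>R b) \<bullet> c"
      using b by (auto simp: ptb inner_add_left inner_Basis algebra_simps)
  qed
  have sums: "(\<Sum>x\<in>?A. h x) = (\<Sum>f\<in>?P. h (pt f))" for h :: "'a \<Rightarrow> real"
    by (rule sum.reindex_bij_betw[OF bij, symmetric])
  have energy: "box_energy L Basis (u \<circ> pt) = (\<Sum>x\<in>?A. \<Sum>b\<in>Basis.
       if x + mesh k *\<^sub>R b \<in> cell j z then (u (x + mesh k *\<^sub>R b) - u x)\<^sup>2 else 0)"
    unfolding sums box_energy_def
  proof (subst sum.swap, intro sum.cong refl)
    fix f b assume f: "f \<in> ?P" and b: "b \<in> (Basis :: 'a set)"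
    have "pt f + mesh k *\<^sub>R b \<in> cell j z \<longleftrightarrow> Suc (f b) < L"
      unfolding upd[OF b, symmetric] in_cell using f b by auto
    then show "(if Suc (f b) < L then ((u \<circ> pt) (f(b := Suc (f b))) - (u \<circ> pt) f)\<^sup>2 else 0) =
      (if pt f + mesh k *\<^sub>R b \<in> cell j z then (u (pt f + mesh k *\<^sub>R b) - u (pt f))\<^sup>2 else 0)"
      by (simp add: upd[OF b])
  qed
  have "L > 0" by (simp add: L_def)
  from poincare_box_point[OF finite_Basis this, of "u \<circ> pt"]
  obtain g where g: "g \<in> ?P" "(\<Sum>f\<in>?P. (u (pt f) - u (pt g))\<^sup>2) \<le>
      2 ^ DIM('a) * (real L)\<^sup>2 * box_energy L Basis (u \<circ> pt)" by auto
  have "real L = mesh j / mesh k" using Lj by (simp add: field_simps)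
  moreover have "pt g \<in> ?A" using bij g(1) by (rule bij_betw_apply)
  ultimately show ?thesis
    using g(2) unfolding energy
    by (intro bexI[of _ "pt g"]) (simp_all add: sums[of "\<lambda>x. (u x - u (pt g))\<^sup>2"])
qed

section \<open>Compactness and the limiting semigroup\<close>

lemma diagonal_convergent:
  fixes f :: "'i \<Rightarrow> nat \<Rightarrow> real"
  assumes I: "countable I" and bnd: "\<And>i. i \<in> I \<Longrightarrow> bounded (range (f i))"
  shows "\<exists>s. strict_mono s \<and> (\<forall>i\<in>I. convergent (\<lambda>n. f i (s n)))"
proof (cases "I = {}")
  case True
  then show ?thesis by (intro exI[of _ id]) (simp add: strict_mono_def)
next
  case False
  define g where "g = from_nat_into I"
  have g: "g n \<in> I" for n using from_nat_into[OF False] by (simp add: g_def)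
  interpret subseqs "\<lambda>n s. convergent (\<lambda>k. f (g n) (s k))"
  proof
    fix n and s :: "nat \<Rightarrow> nat"
    have "bounded (range (\<lambda>k. f (g n) (s k)))"
      by (rule bounded_subset[OF bnd[OF g[of n]]]) auto
    then obtain l r where "strict_mono r" "((\<lambda>k. f (g n) (s k)) \<circ> r) \<longlonglongrightarrow> l"
      using bounded_imp_convergent_subsequence by blast
    then show "\<exists>r'. strict_mono r' \<and> convergent (\<lambda>k. f (g n) ((s \<circ> r') k))"
      by (intro exI[of _ r]) (auto simp: o_def convergent_def)
  qed
  have "convergent (\<lambda>n. f i (diagseq n))" if i: "i \<in> I" for i
  proof -
    obtain k where k: "g k = i" using from_nat_into_surj[OF I i] by (auto simp: g_def)
    have "convergent (\<lambda>n. f (g k) ((diagseq \<circ> ((+) (Suc k))) n))"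
    proof (rule diagseq_holds)
      fix r s :: "nat \<Rightarrow> nat" and n
      assume "strict_mono r" "convergent (\<lambda>k. f (g n) (s k))"
      then show "convergent (\<lambda>k. f (g n) ((s \<circ> r) k))"
        using convergent_subseq_convergent[of "\<lambda>k. f (g n) (s k)" r] by (simp add: o_def)
    qed
    then have "convergent (\<lambda>n. f i (diagseq (n + Suc k)))" by (simp add: k o_def add.commute)
    \<comment> \<open>The diagonal sequence follows the k-th extraction only from index
      \<open>Suc k\<close> on; finitely many terms do not affect convergence.\<close>
    then show ?thesis by (rule convergent_ignore_initial_segment[THEN iffD1])
  qed
  then show ?thesis using subseq_diagseq by blast
qed

context L2_approx
begin

lemma sconv_zero: "sconv (\<lambda>k x. 0) (\<lambda>x. 0)"
  using sconv_TT[OF TT_lin[OF TT_one TT_one, of "-1"]] by simp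

lemma sconv_scaleR:
  assumes a: "a \<longlonglongrightarrow> \<alpha>" and c: "c \<in> TT"
  shows "sconv (\<lambda>n x. a n * c x) (\<lambda>x. \<alpha> * c x)"
proof (rule sconv_close)
  show "sconv (\<lambda>k x. \<alpha> * c x) (\<lambda>x. \<alpha> * c x)"
    using sconv_lin[OF sconv_TT[OF c] sconv_zero, of \<alpha>] by simp
  have "(\<lambda>k. \<bar>a k - \<alpha>\<bar> * norm_L2 (\<mu> k) c) \<longlonglongrightarrow> \<bar>\<alpha> - \<alpha>\<bar> * norm_L2 M c"
    by (intro tendsto_intros a TT_norm c)
  then show "(\<lambda>k. norm_L2 (\<mu> k) (\<lambda>x. a k * c x - \<alpha> * c x)) \<longlonglongrightarrow> 0"
    by (simp add: norm_L2_cmult flip: left_diff_distrib)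
qed

lemma sconv_sum:
  assumes "finite Z" "\<And>z. z \<in> Z \<Longrightarrow> a z \<longlonglongrightarrow> \<alpha> z" "\<And>z. z \<in> Z \<Longrightarrow> c z \<in> TT"
  shows "sconv (\<lambda>n x. \<Sum>z\<in>Z. a z n * c z x) (\<lambda>x. \<Sum>z\<in>Z. \<alpha> z * c z x)"
  using assms
proof (induction Z rule: finite_induct)
  case empty
  then show ?case by (simp add: sconv_zero)
next
  case (insert z Z)
  have "sconv (\<lambda>n x. 1 * (a z n * c z x) + (\<Sum>z\<in>Z. a z n * c z x)) (\<lambda>x. 1 * (\<alpha> z * c z x) + (\<Sum>z\<in>Z. \<alpha> z * c z x))"
    using insert by (intro sconv_lin sconv_scaleR) auto
  then show ?case using insert(1,2) by simp
qed

end

section \<open>Conductances of the grid walk and approximation by cell constants\<close>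

context grid_domain
begin

text \<open>Normalised so that the vertex weight of the conductance network is
  \<open>grid_weight\<close> and its transition operator is that of the simple random walk.\<close>

definition cond :: "nat \<Rightarrow> 'a \<Rightarrow> 'a \<Rightarrow> real" where
  "cond k x y = (if adj k x y then mesh k ^ DIM('a) / (2 * real DIM('a)) else 0)"

sublocale ch: conductances "V k" "cond k" for k
  by unfold_locales (auto simp: finite_V cond_def adj_sym)

lemma ch_wt: "ch.wt k x = wgt k x"
proof -
  have "ch.wt k x = (\<Sum>y\<in>{y\<in>V k. adj k x y}. mesh k ^ DIM('a) / (2 * real DIM('a)))"
    unfolding ch.wt_def cond_def by (rule sum.inter_filter[symmetric, OF finite_V])
  also have "{y\<in>V k. adj k x y} = {y. adj k x y}" using adj_V by blast
  finally show ?thesis by (simp add: wgt_eq degree_of_def)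
qed

lemma integral_ch: "(\<integral>x. f x \<partial>ch.N k) = (\<Sum>x\<in>V k. wgt k x * f x)" for f :: "'a \<Rightarrow> real"
  by (simp add: ch.integral_N ch_wt)

lemma TTI:
  assumes "c \<in> borel_measurable (leb D)" "\<And>x. x \<in> D \<Longrightarrow> \<bar>c x\<bar> \<le> B" "AE y in leb D. isCont c y"
  shows "c \<in> TT"
  using assms unfolding TT_def by blast

lemma TTE:
  assumes "c \<in> TT"
  obtains B where "c \<in> borel_measurable (leb D)" "\<And>x. x \<in> D \<Longrightarrow> \<bar>c x\<bar> \<le> B" "0 \<le> B" "AE y in leb D. isCont c y"
proof -
  obtain B where B: "\<forall>x\<in>D. \<bar>c x\<bar> \<le> B" using assms by (auto simp: TT_def)
  show ?thesis
  proof (rule that[of "max B 0"])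
    show "\<bar>c x\<bar> \<le> max B 0" if "x \<in> D" for x using B that by (simp add: max.coboundedI1)
  qed (use assms in \<open>auto simp: TT_def\<close>)
qed

lemma TT_lin: "c \<in> TT \<Longrightarrow> c' \<in> TT \<Longrightarrow> (\<lambda>x. a * c x + c' x) \<in> TT"
proof -
  assume c: "c \<in> TT" and c': "c' \<in> TT"
  obtain B where B: "c \<in> borel_measurable (leb D)" "\<And>x. x \<in> D \<Longrightarrow> \<bar>c x\<bar> \<le> B" "0 \<le> B" "AE y in leb D. isCont c y"
    using TTE[OF c] by blast
  obtain B' where B': "c' \<in> borel_measurable (leb D)" "\<And>x. x \<in> D \<Longrightarrow> \<bar>c' x\<bar> \<le> B'" "0 \<le> B'" "AE y in leb D. isCont c' y"
    using TTE[OF c'] by blast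
  show ?thesis
  proof (rule TTI)
    show "(\<lambda>x. a * c x + c' x) \<in> borel_measurable (leb D)" using B(1) B'(1) by measurable
    show "\<bar>a * c x + c' x\<bar> \<le> \<bar>a\<bar> * B + B'" if "x \<in> D" for x
    proof -
      have "\<bar>a\<bar> * \<bar>c x\<bar> \<le> \<bar>a\<bar> * B" using B(2)[OF that] by (rule mult_left_mono) simp
      then show ?thesis using B'(2)[OF that] abs_triangle_ineq[of "a * c x" "c' x"] by (simp add: abs_mult)
    qed
    show "AE y in leb D. isCont (\<lambda>x. a * c x + c' x) y"
      using B(4) B'(4) by eventually_elim (intro continuous_intros)
  qed
qed

lemma TT_mult: "c \<in> TT \<Longrightarrow> c' \<in> TT \<Longrightarrow> (\<lambda>x. c x * c' x) \<in> TT"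
proof -
  assume c: "c \<in> TT" and c': "c' \<in> TT"
  obtain B where B: "c \<in> borel_measurable (leb D)" "\<And>x. x \<in> D \<Longrightarrow> \<bar>c x\<bar> \<le> B" "0 \<le> B" "AE y in leb D. isCont c y"
    using TTE[OF c] by blast
  obtain B' where B': "c' \<in> borel_measurable (leb D)" "\<And>x. x \<in> D \<Longrightarrow> \<bar>c' x\<bar> \<le> B'" "0 \<le> B'" "AE y in leb D. isCont c' y"
    using TTE[OF c'] by blast
  show ?thesis
  proof (rule TTI)
    show "(\<lambda>x. c x * c' x) \<in> borel_measurable (leb D)" using B(1) B'(1) by measurable
    show "\<bar>c x * c' x\<bar> \<le> B * B'" if "x \<in> D" for x
      using B(2)[OF that] B'(2)[OF that] B(3) by (simp add: abs_mult mult_mono)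
    show "AE y in leb D. isCont (\<lambda>x. c x * c' x) y"
      using B(4) B'(4) by eventually_elim (intro continuous_intros)
  qed
qed

lemma TT_truncate: "c \<in> TT \<Longrightarrow> (\<lambda>x. truncate B (c x)) \<in> TT"
proof -
  assume c: "c \<in> TT"
  then have m: "c \<in> borel_measurable (leb D)" "AE y in leb D. isCont c y" by (auto simp: TT_def)
  show ?thesis
  proof (rule TTI)
    show "(\<lambda>x. truncate B (c x)) \<in> borel_measurable (leb D)" using m(1) by measurable
    show "\<bar>truncate B (c x)\<bar> \<le> \<bar>B\<bar>" for x by (auto simp: truncate_def max_def min_def)
    show "AE y in leb D. isCont (\<lambda>x. truncate B (c x)) y"
      using m(2) unfolding truncate_def by eventually_elim (intro continuous_intros)
  qed
qed

lemma TT_one: "(\<lambda>x. 1) \<in> TT"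
  by (rule TTI[of _ 1]) auto

lemma convex_cell: "convex (cell k a)"
proof -
  have "cell k a = (\<Inter>b\<in>Basis. {y. b \<bullet> y \<ge> a \<bullet> b} \<inter> {y. b \<bullet> y < a \<bullet> b + mesh k})"
    by (auto simp: cell_def inner_commute)
  then show ?thesis
    by (simp only:) (intro convex_INT convex_Int convex_halfspace_ge convex_halfspace_lt)
qed

text \<open>A cell is convex, so its frontier, where the indicator is discontinuous, is a null
  set.\<close>

lemma indicator_cell_TT: "indicator (cell k a) \<in> TT"
proof (rule TTI[of _ 1])
  show "indicator (cell k a) \<in> borel_measurable (leb D)" by (intro borel_leb) measurable
  show "\<bar>indicator (cell k a) x\<bar> \<le> (1::real)" for x by (auto simp: indicator_def)
  have "frontier (cell k a) \<in> null_sets lborel"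
    using negligible_convex_frontier[OF convex_cell, of k a]
    by (simp add: negligible_iff_null_sets null_sets_completion_iff)
  then have "AE y in lborel. y \<notin> frontier (cell k a)" by (rule AE_not_in)
  then have "AE y in lborel. isCont (indicator (cell k a) :: 'a \<Rightarrow> real) y"
    by eventually_elim (simp add: continuous_at_imp_continuous_within isCont_indicator)
  then show "AE y in leb D. isCont (indicator (cell k a) :: 'a \<Rightarrow> real) y"
    using open_D by (subst AE_restrict_space_iff) auto
qed

definition Zs :: "nat \<Rightarrow> 'a set" where
  "Zs j = {z\<in>lattice_pts j. cube j z \<subseteq> D}"

lemma finite_Zs: "finite (Zs j)"
  by (rule finite_subset[OF _ finite_lattice_bounded[OF bounded_D, of j]])
    (use cube_corner in \<open>auto simp: Zs_def\<close>)

text \<open>All fine lattice points of the coarse cells inside \<open>D\<close> are lower corners of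
  grid cubes, so every forward edge from such a point is an edge of the graph.\<close>

definition resolves :: "nat \<Rightarrow> nat \<Rightarrow> bool" where
  "resolves j k \<longleftrightarrow> j \<le> k \<and> (\<forall>z\<in>Zs j. lattice_pts k \<inter> cell j z \<subseteq> corners k)"

lemma eventually_resolves: "\<forall>\<^sub>F k in sequentially. resolves j k"
proof -
  have "exhausted (\<Union>z\<in>Zs j. cube j z)"
    by (rule exhausted_compact) (auto simp: cube_def Zs_def intro!: compact_UN finite_Zs[unfolded Zs_def cube_def])
  then show ?thesis
    unfolding exhausted_def using eventually_ge_at_top[of j]
  proof eventually_elim
    case (elim k)
    have "x \<in> corners k" if z: "z \<in> Zs j" and x: "x \<in> lattice_pts k \<inter> cell j z" for x z
    proof -
      have "x \<in> cube k x \<inter> (\<Union>z\<in>Zs j. cube j z)"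
        using z x cell_subset_cube[of j z] cube_corner[of x k] by blast
      then show ?thesis using elim(1) x by (auto simp: corners_def)
    qed
    then show ?case using elim(2) by (auto simp: resolves_def)
  qed
qed

lemma dirichlet_eq_adj:
  "ch.dirichlet k u = mesh k ^ DIM('a) / (2 * real DIM('a)) *
     (\<Sum>x\<in>V k. \<Sum>y\<in>V k. if adj k x y then (u x - u y)\<^sup>2 else 0)"
  unfolding ch.dirichlet_def cond_def sum_distrib_left by (intro sum.cong refl) auto

lemma corners_V: "corners k \<subseteq> V k"
  unfolding subset_iff V_iff by (auto intro!: exI[of _ "{}"])

text \<open>Disjoint coarse cells use disjoint sets of forward edges, so the local inequalities add
  up to the total energy. The energy divided by \<open>(mesh k)\<^sup>2\<close> is the quantity that
  stays bounded in \<open>k\<close>, which leaves the small factor \<open>(mesh j)\<^sup>2\<close>;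
  \<open>2 * real DIM('a)\<close> undoes the normalisation of \<open>cond\<close>.\<close>

lemma poincare_sum:
  assumes "resolves j k"
  shows "\<exists>a. (\<forall>z\<in>Zs j. a z \<in> u ` V k) \<and>
    mesh k ^ DIM('a) * (\<Sum>z\<in>Zs j. \<Sum>x\<in>lattice_pts k \<inter> cell j z. (u x - a z)\<^sup>2) \<le>
      2 ^ DIM('a) * (2 * real DIM('a)) * (mesh j)\<^sup>2 * (ch.dirichlet k u / (mesh k)\<^sup>2)"
proof -
  have jk: "j \<le> k" and sub: "\<And>z. z \<in> Zs j \<Longrightarrow> lattice_pts k \<inter> cell j z \<subseteq> corners k"
    using assms by (auto simp: resolves_def)
  let ?A = "\<lambda>z. lattice_pts k \<inter> cell j z"
  let ?e = "\<lambda>x. \<Sum>y\<in>V k. if adj k x y then (u x - u y)\<^sup>2 else 0"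
  let ?C = "2 ^ DIM('a) * (mesh j / mesh k)\<^sup>2"
  \<comment> \<open>Distinct directions lead to distinct neighbours, so the forward edges inside the
    cell form part of the edges at \<open>x\<close>.\<close>
  have edge: "(\<Sum>b\<in>Basis. if x + mesh k *\<^sub>R b \<in> cell j z then (u (x + mesh k *\<^sub>R b) - u x)\<^sup>2 else 0) \<le> ?e x"
    if z: "z \<in> Zs j" and x: "x \<in> ?A z" for x z
  proof -
    let ?B = "{b\<in>Basis. x + mesh k *\<^sub>R b \<in> cell j z}"
    have xc: "x \<in> corners k" using sub[OF z] x by blast
    have adj: "adj k x (x + mesh k *\<^sub>R b)" if "b \<in> Basis" for b
      using x by (intro adj_right[OF xc _ cube_corner that]) auto
    have inj: "inj_on (\<lambda>b. x + mesh k *\<^sub>R b) ?B" by (auto simp: inj_on_def)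
    have "(\<Sum>b\<in>Basis. if x + mesh k *\<^sub>R b \<in> cell j z then (u (x + mesh k *\<^sub>R b) - u x)\<^sup>2 else 0) =
        (\<Sum>b\<in>?B. (u (x + mesh k *\<^sub>R b) - u x)\<^sup>2)"
      by (rule sum.inter_filter[symmetric]) simp
    also have "\<dots> = (\<Sum>b\<in>?B. if adj k x (x + mesh k *\<^sub>R b) then (u x - u (x + mesh k *\<^sub>R b))\<^sup>2 else 0)"
      using adj by (intro sum.cong) (auto simp: power2_commute)
    also have "\<dots> = (\<Sum>y\<in>(\<lambda>b. x + mesh k *\<^sub>R b) ` ?B. if adj k x y then (u x - u y)\<^sup>2 else 0)"
      by (simp add: sum.reindex[OF inj])
    also have "\<dots> \<le> ?e x"
      using adj adj_V by (intro sum_mono2 finite_V) auto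
    finally show ?thesis .
  qed
  have "\<forall>z\<in>Zs j. \<exists>y. y \<in> ?A z \<and> (\<Sum>x\<in>?A z. (u x - u y)\<^sup>2) \<le> ?C * (\<Sum>x\<in>?A z. ?e x)"
  proof
    fix z assume z: "z \<in> Zs j"
    then have zL: "z \<in> lattice_pts j" by (simp add: Zs_def)
    obtain y where y: "y \<in> ?A z" "(\<Sum>x\<in>?A z. (u x - u y)\<^sup>2) \<le> ?C * (\<Sum>x\<in>?A z. \<Sum>b\<in>Basis.
       if x + mesh k *\<^sub>R b \<in> cell j z then (u (x + mesh k *\<^sub>R b) - u x)\<^sup>2 else 0)"
      using cell_poincare[OF jk zL, of u] by blast
    have le: "?C * (\<Sum>x\<in>?A z. \<Sum>b\<in>Basis.
       if x + mesh k *\<^sub>R b \<in> cell j z then (u (x + mesh k *\<^sub>R b) - u x)\<^sup>2 else 0) \<le> ?C * (\<Sum>x\<in>?A z. ?e x)"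
      by (intro mult_left_mono sum_mono edge z) auto
    show "\<exists>y. y \<in> ?A z \<and> (\<Sum>x\<in>?A z. (u x - u y)\<^sup>2) \<le> ?C * (\<Sum>x\<in>?A z. ?e x)"
      by (intro exI[of _ y] conjI y(1) order_trans[OF y(2) le])
  qed
  from bchoice[OF this] obtain y where y: "\<forall>z\<in>Zs j. y z \<in> ?A z \<and>
      (\<Sum>x\<in>?A z. (u x - u (y z))\<^sup>2) \<le> ?C * (\<Sum>x\<in>?A z. ?e x)" by (elim exE)
  have yV: "\<forall>z\<in>Zs j. u (y z) \<in> u ` V k"
    using y sub corners_V by blast
  have disj: "\<forall>z\<in>Zs j. \<forall>z'\<in>Zs j. z \<noteq> z' \<longrightarrow> ?A z \<inter> ?A z' = {}"
    using cell_floor_pt by (auto simp: Zs_def)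
  have fin: "\<forall>z\<in>Zs j. finite (?A z)"
    using sub finite_corners finite_subset by metis
  have "(\<Sum>z\<in>Zs j. \<Sum>x\<in>?A z. (u x - u (y z))\<^sup>2) \<le> (\<Sum>z\<in>Zs j. ?C * (\<Sum>x\<in>?A z. ?e x))"
    using y by (intro sum_mono) auto
  also have "\<dots> = ?C * (\<Sum>x\<in>(\<Union>z\<in>Zs j. ?A z). ?e x)"
    by (simp only: sum.UNION_disjoint[OF finite_Zs fin disj] sum_distrib_left)
  also have "\<dots> \<le> ?C * (\<Sum>x\<in>V k. ?e x)"
    using sub corners_V by (intro mult_left_mono sum_mono2 finite_V) (auto intro!: sum_nonneg)
  finally have "mesh k ^ DIM('a) * (\<Sum>z\<in>Zs j. \<Sum>x\<in>?A z. (u x - u (y z))\<^sup>2) \<le>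
      mesh k ^ DIM('a) * (?C * (\<Sum>x\<in>V k. ?e x))"
    by (intro mult_left_mono) auto
  also have "\<dots> = 2 ^ DIM('a) * (2 * real DIM('a)) * (mesh j)\<^sup>2 * (ch.dirichlet k u / (mesh k)\<^sup>2)"
    unfolding dirichlet_eq_adj using DIM_positive[where 'a='a] by (simp add: field_simps)
  finally show ?thesis using yV by (intro exI[of _ "\<lambda>z. u (y z)"]) simp
qed

text \<open>The comparison constants as a fixed choice, with the default 0 where the fine grid does
  not yet resolve level \<open>j\<close>. The sequences in \<open>k\<close> are then bounded
  throughout, as the diagonal argument requires.\<close>

definition cf :: "nat \<Rightarrow> ('a \<Rightarrow> real) \<Rightarrow> nat \<Rightarrow> 'a \<Rightarrow> real" where
  "cf k u j z = (if resolves j k then (SOME a. (\<forall>z\<in>Zs j. a z \<in> u ` V k) \<and>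
    mesh k ^ DIM('a) * (\<Sum>z\<in>Zs j. \<Sum>x\<in>lattice_pts k \<inter> cell j z. (u x - a z)\<^sup>2) \<le>
      2 ^ DIM('a) * (2 * real DIM('a)) * (mesh j)\<^sup>2 * (ch.dirichlet k u / (mesh k)\<^sup>2)) z else 0)"

lemma cf:
  assumes "resolves j k"
  shows "\<And>z. z \<in> Zs j \<Longrightarrow> cf k u j z \<in> u ` V k"
    "mesh k ^ DIM('a) * (\<Sum>z\<in>Zs j. \<Sum>x\<in>lattice_pts k \<inter> cell j z. (u x - cf k u j z)\<^sup>2) \<le>
      2 ^ DIM('a) * (2 * real DIM('a)) * (mesh j)\<^sup>2 * (ch.dirichlet k u / (mesh k)\<^sup>2)"
proof -
  have "cf k u j = (SOME a. (\<forall>z\<in>Zs j. a z \<in> u ` V k) \<and>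
    mesh k ^ DIM('a) * (\<Sum>z\<in>Zs j. \<Sum>x\<in>lattice_pts k \<inter> cell j z. (u x - a z)\<^sup>2) \<le>
      2 ^ DIM('a) * (2 * real DIM('a)) * (mesh j)\<^sup>2 * (ch.dirichlet k u / (mesh k)\<^sup>2))"
    using assms unfolding cf_def by simp
  with someI_ex[OF poincare_sum[OF assms, of u]]
  show "\<And>z. z \<in> Zs j \<Longrightarrow> cf k u j z \<in> u ` V k"
    "mesh k ^ DIM('a) * (\<Sum>z\<in>Zs j. \<Sum>x\<in>lattice_pts k \<inter> cell j z. (u x - cf k u j z)\<^sup>2) \<le>
      2 ^ DIM('a) * (2 * real DIM('a)) * (mesh j)\<^sup>2 * (ch.dirichlet k u / (mesh k)\<^sup>2)"
    by simp_all
qed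

lemma cf_bounded:
  assumes "\<And>x. x \<in> V k \<Longrightarrow> \<bar>u x\<bar> \<le> B" "0 \<le> B" "z \<in> Zs j"
  shows "\<bar>cf k u j z\<bar> \<le> B"
proof (cases "resolves j k")
  case True
  then show ?thesis using cf(1)[OF True assms(3), of u] assms(1) by auto
next
  case False
  then show ?thesis using assms(2) by (simp add: cf_def)
qed

lemma sum_cells:
  "(\<Sum>z\<in>Zs j. a z * indicator (cell j z) x) = (if floor_pt j x \<in> Zs j then a (floor_pt j x) else (0::real))"
proof -
  have "(\<Sum>z\<in>Zs j. a z * indicator (cell j z) x) = (\<Sum>z\<in>Zs j. if floor_pt j x = z then a z else 0)"
  proof (rule sum.cong[OF refl])
    fix z assume "z \<in> Zs j"
    then have "z \<in> lattice_pts j" by (simp add: Zs_def)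
    from cell_floor_pt[OF this, of x] show "a z * indicator (cell j z) x = (if floor_pt j x = z then a z else 0)"
      by (simp add: indicator_def)
  qed
  then show ?thesis using finite_Zs by (simp add: sum.delta')
qed

text \<open>Indicator of the complement of the coarse cells, spelt as a linear combination of
  members of \<open>TT\<close> so that its weighted sums converge.\<close>

definition outer :: "nat \<Rightarrow> 'a \<Rightarrow> real" where
  "outer j x = (-1) * (\<Sum>z\<in>Zs j. 1 * indicator (cell j z) x) + 1"

lemma outer_eq: "outer j x = (if floor_pt j x \<in> Zs j then 0 else 1)"
  unfolding outer_def sum_cells by simp

lemma sum_TT: "finite Z \<Longrightarrow> (\<And>z. z \<in> Z \<Longrightarrow> c z \<in> TT) \<Longrightarrow> (\<lambda>x. \<Sum>z\<in>Z. a z * c z x) \<in> TT"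
proof (induction Z rule: finite_induct)
  case empty
  then show ?case using TT_lin[OF TT_one TT_one, of "-1"] by simp
next
  case (insert z Z)
  then have "(\<lambda>x. a z * c z x + (\<Sum>z\<in>Z. a z * c z x)) \<in> TT" by (intro TT_lin) auto
  then show ?case using insert by simp
qed

lemma outer_TT: "outer j \<in> TT"
proof -
  have "(\<lambda>x. \<Sum>z\<in>Zs j. 1 * indicator (cell j z) x) \<in> TT"
    by (intro sum_TT finite_Zs indicator_cell_TT)
  from TT_lin[OF this TT_one, of "-1"] show ?thesis by (simp only: outer_def[abs_def])
qed

lemma outer_tendsto_0: "(\<lambda>j. \<integral>x. outer j x \<partial>leb D) \<longlonglongrightarrow> 0"
proof -
  have "(\<lambda>j. \<integral>x. outer j x \<partial>leb D) \<longlonglongrightarrow> (\<integral>x. 0 \<partial>leb D)"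
  proof (rule integral_dominated_convergence[where w = "\<lambda>_. 1"])
    show "outer j \<in> borel_measurable (leb D)" for j using outer_TT by (auto simp: TT_def)
    show "AE x in leb D. norm (outer j x) \<le> 1" for j by (simp add: outer_eq)
    have "AE y in leb D. y \<in> D" by (rule AE_I2) simp
    then show "AE x in leb D. (\<lambda>j. outer j x) \<longlonglongrightarrow> 0"
    proof eventually_elim
      case (elim x)
      have "\<forall>\<^sub>F j in sequentially. outer j x = 0"
        using eventually_interior[OF elim]
      proof eventually_elim
        case (elim j)
        then have "floor_pt j x \<in> corners j" using elim[rule_format, of "{}" "{}"] by simp
        then have "floor_pt j x \<in> Zs j" using corner_cube_subset floor_pt_lattice by (auto simp: Zs_def)
        then show ?case by (simp add: outer_eq)
      qed
      then show ?case by (rule tendsto_eventually)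
    qed
  qed simp_all
  then show ?thesis by simp
qed

text \<open>Inside the coarse cells the Poincare bound applies; outside them the approximation is
  zero and the error is at most \<open>B\<^sup>2\<close> times the mass of the layer, with no use of
  gradients near the frontier.\<close>

lemma approx_error:
  assumes f: "resolves j k" and B: "\<And>x. x \<in> V k \<Longrightarrow> \<bar>u x\<bar> \<le> B"
  shows "(norm_L2 (ch.N k) (\<lambda>x. u x - (\<Sum>z\<in>Zs j. cf k u j z * indicator (cell j z) x)))\<^sup>2 \<le>
    2 ^ DIM('a) * (2 * real DIM('a)) * (mesh j)\<^sup>2 * (ch.dirichlet k u / (mesh k)\<^sup>2) +
    B\<^sup>2 * (\<Sum>x\<in>V k. wgt k x * outer j x)"
proof -
  let ?A = "\<lambda>z. lattice_pts k \<inter> cell j z" and ?a = "cf k u j"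
  let ?U = "{x\<in>V k. floor_pt j x \<in> Zs j}"
  have sub: "\<And>z. z \<in> Zs j \<Longrightarrow> ?A z \<subseteq> corners k" using f by (auto simp: resolves_def)
  have U: "?U = (\<Union>z\<in>Zs j. ?A z)"
  proof (intro set_eqI iffI)
    fix x assume x: "x \<in> ?U"
    then have "x \<in> cell j (floor_pt j x)" using cell_floor_pt[OF floor_pt_lattice] by blast
    then show "x \<in> (\<Union>z\<in>Zs j. ?A z)" using x V_lattice by blast
  next
    fix x assume "x \<in> (\<Union>z\<in>Zs j. ?A z)"
    then obtain z where z: "z \<in> Zs j" "x \<in> ?A z" by blast
    then have "floor_pt j x = z" using cell_floor_pt by (auto simp: Zs_def)
    moreover have "x \<in> V k" using z sub corners_V by blast
    ultimately show "x \<in> ?U" using z(1) by simp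
  qed
  have disj: "\<forall>z\<in>Zs j. \<forall>z'\<in>Zs j. z \<noteq> z' \<longrightarrow> ?A z \<inter> ?A z' = {}"
    using cell_floor_pt by (auto simp: Zs_def)
  have fin: "\<forall>z\<in>Zs j. finite (?A z)"
    using sub finite_corners finite_subset by metis
  have "(norm_L2 (ch.N k) (\<lambda>x. u x - (\<Sum>z\<in>Zs j. ?a z * indicator (cell j z) x)))\<^sup>2 =
      (\<Sum>x\<in>V k. wgt k x * (u x - (if floor_pt j x \<in> Zs j then ?a (floor_pt j x) else 0))\<^sup>2)"
    unfolding norm_L2_sq integral_ch sum_cells ..
  also have "\<dots> \<le> (\<Sum>x\<in>V k. (if floor_pt j x \<in> Zs j then mesh k ^ DIM('a) * (u x - ?a (floor_pt j x))\<^sup>2 else 0)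
      + B\<^sup>2 * (wgt k x * outer j x))"
  proof (rule sum_mono)
    fix x assume x: "x \<in> V k"
    have "(u x)\<^sup>2 \<le> B\<^sup>2" using B[OF x] by (simp add: abs_le_square_iff[symmetric])
    then have "wgt k x * (u x)\<^sup>2 \<le> wgt k x * B\<^sup>2" by (intro mult_left_mono wgt_nonneg)
    moreover have "wgt k x * (u x - ?a (floor_pt j x))\<^sup>2 \<le> mesh k ^ DIM('a) * (u x - ?a (floor_pt j x))\<^sup>2"
      by (intro mult_right_mono wgt_le) simp
    ultimately show "wgt k x * (u x - (if floor_pt j x \<in> Zs j then ?a (floor_pt j x) else 0))\<^sup>2 \<le>
       (if floor_pt j x \<in> Zs j then mesh k ^ DIM('a) * (u x - ?a (floor_pt j x))\<^sup>2 else 0)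
        + B\<^sup>2 * (wgt k x * outer j x)"
      by (auto simp: outer_eq mult.commute)
  qed
  also have "\<dots> = (\<Sum>x\<in>?U. mesh k ^ DIM('a) * (u x - ?a (floor_pt j x))\<^sup>2) + B\<^sup>2 * (\<Sum>x\<in>V k. wgt k x * outer j x)"
    by (simp only: sum.distrib sum_distrib_left sum.inter_filter[OF finite_V])
  also have "(\<Sum>x\<in>?U. mesh k ^ DIM('a) * (u x - ?a (floor_pt j x))\<^sup>2) =
      (\<Sum>z\<in>Zs j. \<Sum>x\<in>?A z. mesh k ^ DIM('a) * (u x - ?a (floor_pt j x))\<^sup>2)"
    unfolding U by (rule sum.UNION_disjoint[OF finite_Zs fin disj])
  also have "\<dots> = (\<Sum>z\<in>Zs j. \<Sum>x\<in>?A z. mesh k ^ DIM('a) * (u x - ?a z)\<^sup>2)"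
  proof (intro sum.cong refl)
    fix z x assume "z \<in> Zs j" "x \<in> ?A z"
    then have "floor_pt j x = z" using cell_floor_pt by (auto simp: Zs_def)
    then show "mesh k ^ DIM('a) * (u x - ?a (floor_pt j x))\<^sup>2 = mesh k ^ DIM('a) * (u x - ?a z)\<^sup>2" by simp
  qed
  also have "\<dots> = mesh k ^ DIM('a) * (\<Sum>z\<in>Zs j. \<Sum>x\<in>?A z. (u x - ?a z)\<^sup>2)"
    by (simp only: sum_distrib_left)
  finally show ?thesis using cf(2)[OF f, of u] by linarith
qed

end

section \<open>Strong compactness under energy bounds\<close>

locale grid_core = grid_domain +
  fixes core :: "('a \<Rightarrow> real) set"
  assumes core_TT: "core \<subseteq> TT"
    and core_dense: "\<And>h e. h \<in> L2 (leb D) \<Longrightarrow> e > 0 \<Longrightarrow> \<exists>c\<in>core. norm_L2 (leb D) (\<lambda>x. h x - c x) < e"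
    and core_countable: "countable core"
    and core_energy: "\<And>c. c \<in> core \<Longrightarrow> \<exists>K. \<forall>\<^sub>F k in sequentially. ch.dirichlet k c \<le> K * (mesh k)\<^sup>2"
begin

lemma L2_approx_grid:
  fixes r :: "nat \<Rightarrow> nat"
  assumes r: "filterlim r at_top sequentially"
  shows "L2_approx (\<lambda>n. ch.N (r n)) (leb D) TT"
proof
  show "u \<in> L2 (ch.N (r k))" for k u by (rule ch.L2_N)
  show "c \<in> borel_measurable (leb D)" if "c \<in> TT" for c using that by (simp add: TT_def)
  show "\<exists>B. (\<forall>x\<in>space (leb D). \<bar>c x\<bar> \<le> B) \<and> (\<forall>k. \<forall>x\<in>space (ch.N (r k)). \<bar>c x\<bar> \<le> B)" if "c \<in> TT" for c
    using that V_D unfolding TT_def by (auto simp: subset_iff)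
  show "(\<lambda>k. \<integral>x. c x \<partial>ch.N (r k)) \<longlonglongrightarrow> (\<integral>x. c x \<partial>leb D)" if "c \<in> TT" for c
    unfolding integral_ch by (rule filterlim_compose[OF weighted_sum_tendsto[OF that] r])
  show "\<exists>c\<in>TT. norm_L2 (leb D) (\<lambda>x. h x - c x) < e" if "h \<in> L2 (leb D)" "e > 0" for h e
    using core_dense[OF that] core_TT by blast
qed (rule leb.finite_measure_axioms TT_lin TT_mult TT_truncate TT_one; assumption?)+

text \<open>A Rellich-type statement without regularity of the frontier. Choosing \<open>j\<close>
  large makes the error of the cell approximation small for all late \<open>n\<close>; for that
  \<open>j\<close> only finitely many constants remain, and they converge by
  \<open>conv\<close>.\<close>

lemma compactness:
  fixes r :: "nat \<Rightarrow> nat"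
  assumes r: "filterlim r at_top sequentially"
    and B: "\<And>n x. x \<in> V (r n) \<Longrightarrow> \<bar>u n x\<bar> \<le> B"
    and K: "\<forall>\<^sub>F n in sequentially. ch.dirichlet (r n) (u n) \<le> K * (mesh (r n))\<^sup>2"
    and conv: "\<And>j z. z \<in> Zs j \<Longrightarrow> convergent (\<lambda>n. cf (r n) (u n) j z)"
  shows "\<exists>h. L2_approx.sconv (\<lambda>n. ch.N (r n)) (leb D) TT u h"
proof -
  interpret L2_approx "\<lambda>n. ch.N (r n)" "leb D" TT by (rule L2_approx_grid[OF r])
  let ?C = "2 ^ DIM('a) * (2 * real DIM('a))"
  show ?thesis
  proof (rule sconv_complete)
    fix e :: real assume e: "e > 0"
    have "(\<lambda>j. ?C * (mesh j)\<^sup>2 * K + B\<^sup>2 * (\<integral>x. outer j x \<partial>leb D)) \<longlonglongrightarrow> ?C * 0\<^sup>2 * K + B\<^sup>2 * 0"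
      by (intro tendsto_intros mesh_tendsto_0 outer_tendsto_0)
    then have "\<forall>\<^sub>F j in sequentially. ?C * (mesh j)\<^sup>2 * K + B\<^sup>2 * (\<integral>x. outer j x \<partial>leb D) < e\<^sup>2"
      by (rule order_tendstoD) (use e in simp)
    then obtain j where j: "?C * (mesh j)\<^sup>2 * K + B\<^sup>2 * (\<integral>x. outer j x \<partial>leb D) < e\<^sup>2"
      by (auto simp: eventually_sequentially)
    let ?v = "\<lambda>n x. \<Sum>z\<in>Zs j. cf (r n) (u n) j z * indicator (cell j z) x"
    have "sconv ?v (\<lambda>x. \<Sum>z\<in>Zs j. lim (\<lambda>n. cf (r n) (u n) j z) * indicator (cell j z) x)"
      using conv by (intro sconv_sum finite_Zs indicator_cell_TT) (auto simp: convergent_LIMSEQ_iff)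
    moreover have "\<forall>\<^sub>F n in sequentially. norm_L2 (ch.N (r n)) (\<lambda>x. u n x - ?v n x) < e"
    proof -
      have "(\<lambda>n. ?C * (mesh j)\<^sup>2 * K + B\<^sup>2 * (\<Sum>x\<in>V (r n). wgt (r n) x * outer j x)) \<longlonglongrightarrow>
          ?C * (mesh j)\<^sup>2 * K + B\<^sup>2 * (\<integral>x. outer j x \<partial>leb D)"
        by (intro tendsto_intros filterlim_compose[OF weighted_sum_tendsto[OF outer_TT] r])
      from order_tendstoD(2)[OF this j] K filterlim_iff[THEN iffD1, OF r, rule_format, OF eventually_resolves[of j]]
      show ?thesis
      proof eventually_elim
        case (elim n)
        have "ch.dirichlet (r n) (u n) / (mesh (r n))\<^sup>2 \<le> K"
          using elim(2) by (simp add: pos_divide_le_eq)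
        then have "?C * (mesh j)\<^sup>2 * (ch.dirichlet (r n) (u n) / (mesh (r n))\<^sup>2) \<le> ?C * (mesh j)\<^sup>2 * K"
          by (intro mult_left_mono) auto
        then have "(norm_L2 (ch.N (r n)) (\<lambda>x. u n x - ?v n x))\<^sup>2 < e\<^sup>2"
          using approx_error[where u = "u n", OF elim(3) B] elim(1) by linarith
        then show ?case using e by (simp add: power_less_imp_less_base)
      qed
    qed
    ultimately show "\<exists>v g. sconv v g \<and>
        (\<forall>\<^sub>F n in sequentially. norm_L2 (ch.N (r n)) (\<lambda>x. u n x - v n x) < e)"
      by (intro exI conjI)
  qed
qed

lemma core_energy_steps:
  assumes "c \<in> core"
  shows "\<exists>K. \<forall>\<^sub>F k in sequentially. \<forall>n. ch.dirichlet k (ch.steps k n c) \<le> K * (mesh k)\<^sup>2"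
proof -
  obtain K where "\<forall>\<^sub>F k in sequentially. ch.dirichlet k c \<le> K * (mesh k)\<^sup>2"
    using core_energy[OF assms] by blast
  then have "\<forall>\<^sub>F k in sequentially. \<forall>n. ch.dirichlet k (ch.steps k n c) \<le> K * (mesh k)\<^sup>2"
    by eventually_elim (blast intro: order_trans[OF ch.dirichlet_steps_le])
  then show ?thesis by blast
qed

theorem semigroup_subsequence:
  fixes r :: "nat \<Rightarrow> nat"
  assumes r: "strict_mono r"
  shows "\<exists>s. strict_mono s \<and> L2_semigroup (\<lambda>n. ch.N (r (s n))) (leb D) TT
    (\<lambda>n. ch.steps (r (s n))) (\<lambda>n. (mesh (r (s n)))\<^sup>2) core"
proof -
  \<comment> \<open>One index for each core function, rational time, coarse level and coarse cell: a
    countable family of bounded real sequences.\<close>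
  define I where "I = (SIGMA c:core. SIGMA q:(\<rat> :: real set). SIGMA j:UNIV. Zs j)"
  define st where "st c q k = ch.steps k (nat \<lfloor>q / (mesh k)\<^sup>2\<rfloor>) c" for c and q :: real and k
  define f where "f = (\<lambda>(c, q, j, z) n. cf (r n) (st c q (r n)) j z)"
  have bound: "\<exists>B\<ge>0. \<forall>k q. \<forall>x\<in>V k. \<bar>st c q k x\<bar> \<le> B" if c: "c \<in> core" for c
  proof -
    have "c \<in> TT" using c core_TT by blast
    then obtain B where B: "\<And>x. x \<in> D \<Longrightarrow> \<bar>c x\<bar> \<le> B" "0 \<le> B" using TTE by metis
    then have "\<bar>st c q k x\<bar> \<le> B" if "x \<in> V k" for q k x
      unfolding st_def using V_D that by (intro ch.steps_bounded) auto
    then show ?thesis using B(2) by blast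
  qed
  have cI: "countable I"
    unfolding I_def by (intro countable_SIGMA core_countable countable_rat) (auto intro: countable_finite finite_Zs)
  have bnd: "bounded (range (f i))" if i: "i \<in> I" for i
  proof -
    obtain c q j z where cz: "i = (c, q, j, z)" "c \<in> core" "z \<in> Zs j" using i by (auto simp: I_def)
    obtain B where "0 \<le> B" "\<forall>k q. \<forall>x\<in>V k. \<bar>st c q k x\<bar> \<le> B" using bound[OF cz(2)] by blast
    then have "\<bar>f i n\<bar> \<le> B" for n
      unfolding f_def cz(1) using cz(3) by (auto intro: cf_bounded)
    then show ?thesis by (auto simp: bounded_iff)
  qed
  have "\<exists>s. strict_mono s \<and> (\<forall>i\<in>I. convergent (\<lambda>n. f i (s n)))"
    by (rule diagonal_convergent[OF cI bnd])
  then obtain s where s: "strict_mono s" "\<forall>i\<in>I. convergent (\<lambda>n. f i (s n))"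
    by (elim exE conjE)
  define rs where "rs n = r (s n)" for n
  have rs: "filterlim rs at_top sequentially"
    using filterlim_compose[OF filterlim_subseq[OF r] filterlim_subseq[OF s(1)]] by (simp add: rs_def[abs_def])
  interpret L2_approx "\<lambda>n. ch.N (rs n)" "leb D" TT by (rule L2_approx_grid[OF rs])
  have "L2_semigroup (\<lambda>n. ch.N (rs n)) (leb D) TT (\<lambda>n. ch.steps (rs n)) (\<lambda>n. (mesh (rs n))\<^sup>2) core"
  proof
    show "\<bar>ch.steps (rs k) n u x\<bar> \<le> B"
      if "\<And>x. x \<in> space (ch.N (rs k)) \<Longrightarrow> \<bar>u x\<bar> \<le> B" "0 \<le> B" "x \<in> space (ch.N (rs k))" for k n u B x
      using that by (auto intro: ch.steps_bounded)
    show "\<exists>K. \<forall>\<^sub>F k in sequentially. \<forall>m n. (norm_L2 (ch.N (rs k))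
        (\<lambda>x. ch.steps (rs k) m c x - ch.steps (rs k) n c x))\<^sup>2 \<le> K * \<bar>real m - real n\<bar> * (mesh (rs k))\<^sup>2"
      if c: "c \<in> core" for c
    proof -
      obtain K where K: "\<forall>\<^sub>F k in sequentially. ch.dirichlet k c \<le> K * (mesh k)\<^sup>2"
        using core_energy[OF c] by blast
      have "\<forall>\<^sub>F k in sequentially. \<forall>m n. (norm_L2 (ch.N (rs k))
        (\<lambda>x. ch.steps (rs k) m c x - ch.steps (rs k) n c x))\<^sup>2 \<le> K * \<bar>real m - real n\<bar> * (mesh (rs k))\<^sup>2"
        using filterlim_iff[THEN iffD1, OF rs, rule_format, OF K]
      proof eventually_elim
        case (elim k)
        show ?case
        proof (intro allI)
          fix m n
          have "(norm_L2 (ch.N (rs k)) (\<lambda>x. ch.steps (rs k) m c x - ch.steps (rs k) n c x))\<^sup>2 \<le>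
              \<bar>real m - real n\<bar> * ch.dirichlet (rs k) c" by (rule ch.steps_equicontinuous)
          also have "\<dots> \<le> \<bar>real m - real n\<bar> * (K * (mesh (rs k))\<^sup>2)"
            using elim by (intro mult_left_mono) auto
          finally show "(norm_L2 (ch.N (rs k)) (\<lambda>x. ch.steps (rs k) m c x - ch.steps (rs k) n c x))\<^sup>2 \<le>
              K * \<bar>real m - real n\<bar> * (mesh (rs k))\<^sup>2" by (simp add: mult_ac)
        qed
      qed
      then show ?thesis by blast
    qed
    show "(\<lambda>n. (mesh (rs n))\<^sup>2) \<longlonglongrightarrow> 0"
      using tendsto_power[OF filterlim_compose[OF mesh_tendsto_0 rs], of 2] by simp
    show "\<exists>h. sconv (\<lambda>k. ch.steps (rs k) (nat \<lfloor>t / (mesh (rs k))\<^sup>2\<rfloor>) c) h"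
      if c: "c \<in> core" and t: "t \<in> \<rat>" for c t
    proof -
      obtain B where B: "0 \<le> B" "\<forall>k q. \<forall>x\<in>V k. \<bar>st c q k x\<bar> \<le> B" using bound[OF c] by blast
      obtain K where K: "\<forall>\<^sub>F k in sequentially. \<forall>n. ch.dirichlet k (ch.steps k n c) \<le> K * (mesh k)\<^sup>2"
        using core_energy_steps[OF c] by blast
      have "\<exists>h. sconv (\<lambda>n. st c t (rs n)) h"
      proof (rule compactness[OF rs])
        show "\<bar>st c t (rs n) x\<bar> \<le> B" if "x \<in> V (rs n)" for n x using B that by blast
        show "\<forall>\<^sub>F n in sequentially. ch.dirichlet (rs n) (st c t (rs n)) \<le> K * (mesh (rs n))\<^sup>2"
          using filterlim_iff[THEN iffD1, OF rs, rule_format, OF K] by eventually_elim (simp add: st_def)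
        show "convergent (\<lambda>n. cf (rs n) (st c t (rs n)) j z)" if "z \<in> Zs j" for j z
          using s(2)[rule_format, of "(c, t, j, z)"] c t that by (simp add: I_def f_def rs_def)
      qed
      then show ?thesis by (simp only: st_def)
    qed
  qed (use core_TT core_dense in \<open>auto simp: ch.steps_0 ch.steps_add ch.steps_lin ch.steps_symmetric
      ch.steps_integral intro: ch.steps_contraction\<close>)
  then show ?thesis using s(1) by (auto simp: rs_def)
qed

end

section \<open>Time-averaged functionals on the Skorokhod space\<close>

definition jumps :: "real \<Rightarrow> (real \<Rightarrow> 'b::metric_space) \<Rightarrow> real set" where
  "jumps T w = {q\<in>{0..T}. \<not> continuous (at q within {0..T}) w}"

text \<open>One-sided limits give each time a punctured neighbourhood in which the path stays within
  \<open>e/2\<close> of a limit on either side, hence without jumps of size \<open>e\<close>.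
  Compactness of the interval then leaves finitely many candidates.\<close>

lemma cadlag_large_jumps_finite:
  fixes w :: "real \<Rightarrow> 'b::metric_space"
  assumes w: "w \<in> cadlag T" and e: "e > 0"
  shows "finite {q\<in>{0..T}. \<forall>d>0. \<exists>s\<in>{0..T}. \<bar>s - q\<bar> < d \<and> e \<le> dist (w s) (w q)}" (is "finite ?J")
proof -
  have "\<exists>U. open U \<and> t \<in> U \<and> ?J \<inter> U \<subseteq> {t}" if t: "t \<in> {0..T}" for t
  proof -
    have near: "s \<notin> ?J" if ab: "a < s" "s < b" and l: "\<And>s. a < s \<Longrightarrow> s < b \<Longrightarrow> s \<in> {0..T} \<Longrightarrow> dist (w s) l < e/2"
      for a b s l
    proof
      assume s: "s \<in> ?J"
      define d where "d = min (s - a) (b - s)"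
      have "d > 0" using ab by (simp add: d_def)
      then obtain s' where s': "s' \<in> {0..T}" "\<bar>s' - s\<bar> < d" "e \<le> dist (w s') (w s)" using s by blast
      have "dist (w s') l < e/2" "dist (w s) l < e/2"
        using s' s ab by (intro l; auto simp: d_def)+
      then show False using s'(3) dist_triangle2[of "w s'" "w s" l] by simp
    qed
    have R: "\<exists>b>t. ?J \<inter> {t<..<b} = {}"
    proof (cases "t < T")
      case True
      then have "(w \<longlongrightarrow> w t) (at_right t)" using w t by (auto simp: cadlag_def)
      then have "eventually (\<lambda>s. dist (w s) (w t) < e/2) (at_right t)"
        by (rule tendstoD) (use e in simp)
      then obtain b where b: "b > t" "\<And>s. s > t \<Longrightarrow> s < b \<Longrightarrow> dist (w s) (w t) < e/2"
        by (auto simp: eventually_at_right_field)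
      have "q \<notin> ?J" if "t < q" "q < b" for q
        by (rule near[of t q b "w t"]) (use that b(2) in auto)
      then have "?J \<inter> {t<..<b} = {}" by (metis (no_types, lifting) disjoint_iff greaterThanLessThan_iff)
      then show ?thesis using b(1) by blast
    next
      case False
      then have "?J \<inter> {t<..<t+1} = {}" using t by auto
      then show ?thesis by (intro exI[of _ "t+1"]) simp
    qed
    have L: "\<exists>a<t. ?J \<inter> {a<..<t} = {}"
    proof (cases "t > 0")
      case True
      then have "\<exists>l. (w \<longlongrightarrow> l) (at_left t)" using w t unfolding cadlag_def by simp
      then obtain l where "(w \<longlongrightarrow> l) (at_left t)" by blast
      then have "eventually (\<lambda>s. dist (w s) l < e/2) (at_left t)"
        by (rule tendstoD) (use e in simp)
      then obtain a where a: "a < t" "\<And>s. s > a \<Longrightarrow> s < t \<Longrightarrow> dist (w s) l < e/2"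
        by (auto simp: eventually_at_left_field)
      have "q \<notin> ?J" if "a < q" "q < t" for q
        by (rule near[of a q t l]) (use that a(2) in auto)
      then have "?J \<inter> {a<..<t} = {}" by (metis (no_types, lifting) disjoint_iff greaterThanLessThan_iff)
      then show ?thesis using a(1) by blast
    next
      case False
      then have "?J \<inter> {t-1<..<t} = {}" using t by auto
      then show ?thesis by (intro exI[of _ "t-1"]) simp
    qed
    obtain a b where ab: "a < t" "t < b" "?J \<inter> {a<..<t} = {}" "?J \<inter> {t<..<b} = {}"
      using L R by (elim exE conjE) (rule that)
    have "?J \<inter> {a<..<b} \<subseteq> {t}"
    proof
      fix s assume s: "s \<in> ?J \<inter> {a<..<b}"
      show "s \<in> {t}"
      proof (rule ccontr)
        assume "s \<notin> {t}"
        then have "s \<in> {a<..<t} \<or> s \<in> {t<..<b}" using s by auto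
        then show False using s ab(3,4) by blast
      qed
    qed
    then show ?thesis using ab by (intro exI[of _ "{a<..<b}"]) auto
  qed
  then have "\<forall>t\<in>{0..T}. \<exists>U. open U \<and> t \<in> U \<and> ?J \<inter> U \<subseteq> {t}" by blast
  from bchoice[OF this] obtain U where U: "\<forall>t\<in>{0..T}. open (U t) \<and> t \<in> U t \<and> ?J \<inter> U t \<subseteq> {t}"
    by (elim exE)
  have "compact {0..T}" by simp
  then obtain F where F: "F \<subseteq> {0..T}" "finite F" "{0..T} \<subseteq> (\<Union>t\<in>F. U t)"
    using U by (elim compactE_image[of _ "{0..T}" U]) auto
  have "?J \<subseteq> F"
  proof
    fix q assume q: "q \<in> ?J"
    then have "q \<in> {0..T}" by blast
    then obtain t where t: "t \<in> F" "q \<in> U t" using F(3) by blast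
    then have "q = t" using U F(1) q by blast
    then show "q \<in> F" using t by simp
  qed
  then show ?thesis using F(2) by (rule finite_subset)
qed

lemma countable_jumps:
  fixes w :: "real \<Rightarrow> 'b::metric_space"
  assumes w: "w \<in> cadlag T"
  shows "countable (jumps T w)"
proof (rule countable_subset)
  let ?J = "\<lambda>n::nat. {q\<in>{0..T}. \<forall>d>0. \<exists>s\<in>{0..T}. \<bar>s - q\<bar> < d \<and> inverse (real (Suc n)) \<le> dist (w s) (w q)}"
  show "jumps T w \<subseteq> (\<Union>n. ?J n)"
  proof
    fix q assume "q \<in> jumps T w"
    then have q: "q \<in> {0..T}" "\<not> continuous (at q within {0..T}) w" by (auto simp: jumps_def)
    then obtain e where e: "e > 0" "\<forall>d>0. \<exists>s\<in>{0..T}. dist s q < d \<and> \<not> dist (w s) (w q) < e"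
      unfolding continuous_within_eps_delta by blast
    obtain n where "inverse (real (Suc n)) < e" using reals_Archimedean[OF e(1)] by (elim exE)
    moreover have "\<exists>s\<in>{0..T}. \<bar>s - q\<bar> < d \<and> e \<le> dist (w s) (w q)" if "d > 0" for d
      using e(2)[rule_format, OF that] by (auto simp: dist_real_def not_less)
    ultimately have "q \<in> ?J n" using q(1) by (blast intro: order_trans less_imp_le)
    then show "q \<in> (\<Union>n. ?J n)" by blast
  qed
  show "countable (\<Union>n. ?J n)"
    by (intro countable_UN[OF countableI_type] countable_finite cadlag_large_jumps_finite w) auto
qed

text \<open>The path frozen before 0 and after \<open>T\<close>, so that short averages to the right
  are defined also near \<open>T\<close>.\<close>

definition ext_path :: "real \<Rightarrow> (real \<Rightarrow> 'b) \<Rightarrow> real \<Rightarrow> 'b" where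
  "ext_path T w s = w (max 0 (min s T))"

lemma ext_path_id: "s \<in> {0..T} \<Longrightarrow> ext_path T w s = w s"
  by (simp add: ext_path_def)

definition exceptional :: "real \<Rightarrow> (real \<Rightarrow> 'b::metric_space) \<Rightarrow> real set" where
  "exceptional T w = insert 0 (insert T (jumps T w))"

lemma countable_exceptional: "w \<in> cadlag T \<Longrightarrow> countable (exceptional T w)"
  by (simp add: exceptional_def countable_jumps)

lemma isCont_ext_path:
  assumes T: "T > 0" and s: "s \<notin> exceptional T w"
  shows "isCont (ext_path T w) s"
proof -
  have ev_cong: "isCont (ext_path T w) s" if "isCont g s" "\<forall>\<^sub>F x in nhds s. ext_path T w x = g x" for g
    using that by (simp add: isCont_cong)
  have s': "s \<noteq> 0" "s \<noteq> T" "s \<notin> jumps T w" using s by (auto simp: exceptional_def)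
  then consider "s < 0" | "T < s" | "s \<in> {0<..<T}" by force
  then show ?thesis
  proof cases
    case 1
    have "\<forall>\<^sub>F x in nhds s. ext_path T w x = w 0"
    proof -
      have "\<forall>\<^sub>F x in nhds s. x \<in> {..<0}" using 1 by (intro eventually_nhds_in_open) auto
      then show ?thesis by eventually_elim (use T in \<open>auto simp: ext_path_def\<close>)
    qed
    then show ?thesis by (intro ev_cong[of "\<lambda>_. w 0"]) auto
  next
    case 2
    have "\<forall>\<^sub>F x in nhds s. ext_path T w x = w T"
    proof -
      have "\<forall>\<^sub>F x in nhds s. x \<in> {T<..}" using 2 by (intro eventually_nhds_in_open) auto
      then show ?thesis by eventually_elim (use T in \<open>auto simp: ext_path_def\<close>)
    qed
    then show ?thesis by (intro ev_cong[of "\<lambda>_. w T"]) auto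
  next
    case 3
    then have "continuous (at s within {0..T}) w" using s'(3) by (auto simp: jumps_def)
    moreover have "s \<in> interior {0..T}" using 3 by simp
    ultimately have "isCont w s" by (metis at_within_interior)
    moreover have "\<forall>\<^sub>F x in nhds s. ext_path T w x = w x"
    proof -
      have "\<forall>\<^sub>F x in nhds s. x \<in> {0<..<T}" using 3 by (intro eventually_nhds_in_open) auto
      then show ?thesis by eventually_elim (auto simp: ext_path_def)
    qed
    ultimately show ?thesis by (intro ev_cong[of w])
  qed
qed

text \<open>The time change sends some \<open>t\<close> close to \<open>min s T\<close> exactly to
  \<open>min s T\<close>; there the values of \<open>w\<close> and of the n-th path are close, and
  continuity of \<open>w\<close> does the rest.\<close>

lemma skorokhod_pointwise:
  fixes w :: "real \<Rightarrow> 'b::metric_space"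
  assumes T: "T > 0" and w: "w \<in> cadlag T" and v: "\<And>n. v n \<in> cadlag T"
    and conv: "(\<lambda>n. skorokhod_dist T w (v n)) \<longlonglongrightarrow> 0"
    and s: "s \<notin> exceptional T w" "s \<ge> 0"
  shows "(\<lambda>n. ext_path T (v n) s) \<longlonglongrightarrow> ext_path T w s"
proof (rule tendstoI)
  fix e :: real assume e: "e > 0"
  have T0: "T \<ge> 0" using T by simp
  \<comment> \<open>A jump at \<open>T\<close> is allowed: time changes fix \<open>T\<close>, so for
    \<open>s \<ge> T\<close> only the values at \<open>T\<close> are compared.\<close>
  have near: "\<exists>d>0. \<forall>t\<in>{0..T}. \<bar>t - min s T\<bar> < d \<longrightarrow> (s \<ge> T \<longrightarrow> t = T) \<longrightarrow> dist (w t) (ext_path T w s) < e/2"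
  proof (cases "s \<ge> T")
    case True
    then show ?thesis using T e by (intro exI[of _ 1]) (simp add: ext_path_def)
  next
    case False
    then have "continuous (at s within {0..T}) w" using s by (auto simp: exceptional_def jumps_def)
    then obtain d where "d > 0" "\<forall>t\<in>{0..T}. dist t s < d \<longrightarrow> dist (w t) (w s) < e/2"
      unfolding continuous_within_eps_delta using e by (meson half_gt_zero)
    then show ?thesis using False s by (intro exI[of _ d]) (auto simp: dist_real_def ext_path_def)
  qed
  then obtain d where d: "d > 0" "\<forall>t\<in>{0..T}. \<bar>t - min s T\<bar> < d \<longrightarrow> (s \<ge> T \<longrightarrow> t = T) \<longrightarrow> dist (w t) (ext_path T w s) < e/2"
    by blast
  have "min d (e/2) > 0" using d e by simp
  from order_tendstoD(2)[OF conv this]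
  show "\<forall>\<^sub>F n in sequentially. dist (ext_path T (v n) s) (ext_path T w s) < e"
  proof eventually_elim
    case (elim n)
    then obtain e' \<theta> where e': "0 \<le> e'" "e' < min d (e/2)" and \<theta>: "\<theta> \<in> time_changes T"
      "\<forall>t\<in>{0..T}. \<bar>\<theta> t - t\<bar> \<le> e' \<and> dist (w t) (v n (\<theta> t)) \<le> e'"
      using skorokhod_dist_less_iff[OF T0 w v] by blast
    have q: "min s T \<in> {0..T}" using s T by auto
    then have "min s T \<in> \<theta> ` {0..T}" using \<theta>(1) by (simp add: time_changes_def)
    then obtain t where t: "t \<in> {0..T}" "\<theta> t = min s T" by (elim imageE) simp
    have tT: "t = T" if "s \<ge> T"
    proof (rule ccontr)
      assume "t \<noteq> T"
      then have "\<theta> t < \<theta> T" using \<theta>(1) t(1) T by (auto simp: time_changes_def strict_mono_on_def)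
      then show False using t(2) that time_changes_end[OF \<theta>(1) T0] by simp
    qed
    have "\<bar>t - min s T\<bar> < d" using \<theta>(2) t e' by force
    then have "dist (w t) (ext_path T w s) < e/2" using d(2) t(1) tT by blast
    moreover have "dist (w t) (v n (min s T)) < e/2" using \<theta>(2) t e' by force
    moreover have "ext_path T (v n) s = v n (min s T)" using q by (simp add: ext_path_def)
    ultimately show ?case
      using dist_triangle3[of "ext_path T (v n) s" "ext_path T w s" "w t"] by simp
  qed
qed

text \<open>All factors share the same shift \<open>\<epsilon> * s\<close>, so the order of the
  times is preserved and each shifted product is again a finite-dimensional functional.\<close>

definition avg :: "real \<Rightarrow> (real \<times> ('b \<Rightarrow> real)) list \<Rightarrow> real \<Rightarrow> (real \<Rightarrow> 'b) \<Rightarrow> real" where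
  "avg T tfs \<epsilon> w = (\<integral>s. (\<Prod>(t, f)\<leftarrow>tfs. f (ext_path T w (t + \<epsilon> * s))) \<partial>leb {0..1})"

definition good_list :: "real \<Rightarrow> (real \<times> ('b::topological_space \<Rightarrow> real)) list \<Rightarrow> bool" where
  "good_list T tfs \<longleftrightarrow> (\<forall>(t, f)\<in>set tfs. t \<in> {0..T} \<and> continuous_on UNIV f \<and> bounded (range f))"

lemma good_list_Cons:
  "good_list T ((t, f) # tfs) \<longleftrightarrow> t \<in> {0..T} \<and> continuous_on UNIV f \<and> bounded (range f) \<and> good_list T tfs"
  by (auto simp: good_list_def)

lemma prod_list_bounded:
  fixes l :: "('i \<times> ('b \<Rightarrow> real)) list"
  assumes "\<forall>(t, f)\<in>set l. bounded (range f)"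
  shows "\<exists>B\<ge>0. \<forall>y. \<bar>\<Prod>(t, f)\<leftarrow>l. f (y t)\<bar> \<le> B"
  using assms
proof (induction l)
  case Nil
  then show ?case by (intro exI[of _ 1]) simp
next
  case (Cons a l)
  obtain t f where a: "a = (t, f)" by (cases a)
  obtain B where B: "B \<ge> 0" "\<And>y. \<bar>\<Prod>(t, f)\<leftarrow>l. f (y t)\<bar> \<le> B" using Cons by auto
  obtain K where K: "\<And>x. \<bar>f x\<bar> \<le> K" using Cons.prems a by (auto simp: bounded_iff)
  have K0: "0 \<le> K" using K[of undefined] by (meson abs_ge_zero order_trans)
  have "\<bar>f (y t) * (\<Prod>(t, f)\<leftarrow>l. f (y t))\<bar> \<le> K * B" for y
    unfolding abs_mult using K B K0 by (intro mult_mono) auto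
  then show ?case using B(1) K0 a by (intro exI[of _ "K * B"]) simp
qed

lemma good_list_bounded: "good_list T tfs \<Longrightarrow> \<exists>B\<ge>0. \<forall>y. \<bar>\<Prod>(t, f)\<leftarrow>tfs. f (y t)\<bar> \<le> B"
  by (rule prod_list_bounded) (auto simp: good_list_def)

lemma tendsto_prod_list:
  fixes tfs :: "('i \<times> ('b::metric_space \<Rightarrow> real)) list"
  assumes "\<forall>(t, f)\<in>set tfs. continuous_on UNIV f \<and> (\<lambda>n. y n t) \<longlonglongrightarrow> z t"
  shows "(\<lambda>n. \<Prod>(t, f)\<leftarrow>tfs. f (y n t)) \<longlonglongrightarrow> (\<Prod>(t, f)\<leftarrow>tfs. f (z t) :: real)"
  using assms
proof (induction tfs)
  case (Cons a tfs)
  obtain t f where a: "a = (t, f)" by (cases a)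
  have "isCont f (z t)" using Cons.prems a by (auto simp: continuous_on_eq_continuous_at)
  then have "(\<lambda>n. f (y n t)) \<longlonglongrightarrow> f (z t)" using Cons.prems a by (auto intro: isCont_tendsto_compose)
  then show ?case using Cons a by (auto intro!: tendsto_mult)
qed simp

lemma finite_measure_unit: "finite_measure (leb {0..1::real})"
  by (rule finite_measureI) (simp add: emeasure_restrict_space space_restrict_space)

lemma measure_unit: "measure (leb {0..1::real}) {0..1} = 1"
  by (simp add: measure_restrict_space)

text \<open>Frozen paths are continuous off a countable set, which is enough for Borel measurability
  in time.\<close>

lemma measurable_prod_path:
  fixes w :: "real \<Rightarrow> 'b::metric_space"
  assumes T: "T > 0" and g: "good_list T tfs" and w: "w \<in> cadlag T"
  shows "(\<lambda>s. \<Prod>(t, f)\<leftarrow>tfs. f (ext_path T w (t + \<epsilon> * s))) \<in> borel_measurable (leb {0..1})"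
  using g
proof (induction tfs)
  case (Cons a tfs)
  obtain t f where a: "a = (t, f)" by (cases a)
  have f: "continuous_on UNIV f" using Cons.prems a by (simp add: good_list_Cons)
  have "continuous_on (- exceptional T w) (\<lambda>s. f (ext_path T w s))"
  proof (intro continuous_at_imp_continuous_on ballI)
    fix s assume "s \<in> - exceptional T w"
    then have "isCont (ext_path T w) s" using T by (intro isCont_ext_path) auto
    then show "isCont (\<lambda>s. f (ext_path T w s)) s"
      using f by (intro isCont_o2[of _ "ext_path T w" f]) (auto simp: continuous_on_eq_continuous_at)
  qed
  then have [measurable]: "(\<lambda>s. f (ext_path T w s)) \<in> borel_measurable borel"
    by (rule borel_measurable_continuous_countable_exceptions[OF countable_exceptional[OF w]])
  have "(\<lambda>s. f (ext_path T w (t + \<epsilon> * s))) \<in> borel_measurable (leb {0..1})"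
    by (rule measurable_restrict_space1) measurable
  with Cons a show ?case by (auto simp: good_list_Cons intro!: borel_measurable_times)
qed simp

lemma avg_bounded:
  assumes B: "\<And>y. \<bar>\<Prod>(t, f)\<leftarrow>tfs. f (y t)\<bar> \<le> B" "0 \<le> B"
  shows "\<bar>avg T tfs \<epsilon> w\<bar> \<le> B"
proof -
  interpret finite_measure "leb {0..1::real}" by (rule finite_measure_unit)
  let ?p = "\<lambda>s. \<Prod>(t, f)\<leftarrow>tfs. f (ext_path T w (t + \<epsilon> * s))"
  have b: "\<bar>?p s\<bar> \<le> B" for s using B(1)[of "\<lambda>t. ext_path T w (t + \<epsilon> * s)"] .
  show ?thesis
  proof (cases "integrable (leb {0..1}) ?p")
    case True
    have "norm (avg T tfs \<epsilon> w) \<le> (\<integral>s. B \<partial>leb {0..1::real})"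
      unfolding avg_def by (rule Bochner_Integration.integral_norm_bound_integral[OF True]) (use b in auto)
    then show ?thesis by (simp add: measure_unit)
  next
    case False
    then show ?thesis using B(2) by (simp add: avg_def not_integrable_integral_eq)
  qed
qed

text \<open>Stated for varying paths and varying \<open>\<epsilon>\<close> together: it is applied
  once with fixed \<open>\<epsilon>\<close> for Skorokhod continuity and once with a fixed path for
  the limit of short averages.\<close>

lemma avg_tendsto:
  assumes T: "T > 0" and g: "good_list T tfs" and v: "\<And>n. v n \<in> cadlag T" and w: "w \<in> cadlag T"
    and lim: "AE s in leb {0..1}. \<forall>(t, f)\<in>set tfs. (\<lambda>n. ext_path T (v n) (t + \<epsilon> n * s)) \<longlonglongrightarrow> ext_path T w (t + \<epsilon>' * s)"
  shows "(\<lambda>n. avg T tfs (\<epsilon> n) (v n)) \<longlonglongrightarrow> avg T tfs \<epsilon>' w"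
proof -
  interpret finite_measure "leb {0..1::real}" by (rule finite_measure_unit)
  obtain B where B: "B \<ge> 0" "\<And>y. \<bar>\<Prod>(t, f)\<leftarrow>tfs. f (y t)\<bar> \<le> B" using good_list_bounded[OF g] by blast
  show ?thesis
    unfolding avg_def
  proof (rule integral_dominated_convergence[where w = "\<lambda>_. B"])
    show "AE s in leb {0..1}. (\<lambda>n. \<Prod>(t, f)\<leftarrow>tfs. f (ext_path T (v n) (t + \<epsilon> n * s))) \<longlonglongrightarrow>
        (\<Prod>(t, f)\<leftarrow>tfs. f (ext_path T w (t + \<epsilon>' * s)))"
      using lim
    proof eventually_elim
      case (elim s)
      show ?case
        by (rule tendsto_prod_list[of tfs "\<lambda>n t. ext_path T (v n) (t + \<epsilon> n * s)" "\<lambda>t. ext_path T w (t + \<epsilon>' * s)"])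
          (use elim g in \<open>auto simp: good_list_def\<close>)
    qed
    show "AE s in leb {0..1}. norm (\<Prod>(t, f)\<leftarrow>tfs. f (ext_path T (v n) (t + \<epsilon> n * s))) \<le> B" for n
      using B(2)[of "\<lambda>t. ext_path T (v n) (t + \<epsilon> n * _)"] by (intro AE_I2) simp
    show "(\<lambda>s. \<Prod>(t, f)\<leftarrow>tfs. f (ext_path T (v n) (t + \<epsilon> n * s))) \<in> borel_measurable (leb {0..1})" for n
      by (rule measurable_prod_path[OF T g v])
    show "(\<lambda>s. \<Prod>(t, f)\<leftarrow>tfs. f (ext_path T w (t + \<epsilon>' * s))) \<in> borel_measurable (leb {0..1})"
      by (rule measurable_prod_path[OF T g w])
  qed simp
qed

text \<open>Skorokhod convergence gives pointwise convergence outside the exceptional times of the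
  limit. For positive \<open>\<epsilon>\<close> these correspond to countably many values of the
  averaging variable, which the integral ignores.\<close>

lemma avg_continuous:
  fixes tfs :: "(real \<times> ('b::metric_space \<Rightarrow> real)) list"
  assumes T: "T > 0" and g: "good_list T tfs" and \<epsilon>: "\<epsilon> > 0"
  shows "continuous_map (skorokhod_topology T) euclideanreal (avg T tfs \<epsilon>)"
proof -
  have T0: "T \<ge> 0" using T by simp
  interpret Metric_space "cadlag T :: (real \<Rightarrow> 'b) set" "skorokhod_dist T"
    by (rule Metric_space_skorokhod[OF T0])
  show ?thesis
    unfolding skorokhod_topology_def continuous_map_from_metric
  proof (intro conjI ballI allI impI)
    show "avg T tfs \<epsilon> \<in> cadlag T \<rightarrow> topspace euclideanreal" by simp
    fix w :: "real \<Rightarrow> 'b" and U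
    assume w: "w \<in> cadlag T" and U: "openin euclideanreal U \<and> avg T tfs \<epsilon> w \<in> U"
    show "\<exists>r>0. \<forall>x. x \<in> cadlag T \<and> skorokhod_dist T w x < r \<longrightarrow> avg T tfs \<epsilon> x \<in> U"
    \<comment> \<open>The Skorokhod topology is metric, so a failure of continuity is witnessed by a
      convergent sequence.\<close>
    proof (rule ccontr)
      assume neg: "\<not> ?thesis"
      have "\<forall>n. \<exists>x. x \<in> cadlag T \<and> skorokhod_dist T w x < inverse (real (Suc n)) \<and> avg T tfs \<epsilon> x \<notin> U"
      proof
        fix n
        have "inverse (real (Suc n)) > 0" by simp
        then show "\<exists>x. x \<in> cadlag T \<and> skorokhod_dist T w x < inverse (real (Suc n)) \<and> avg T tfs \<epsilon> x \<notin> U"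
          using neg by blast
      qed
      from choice[OF this] obtain v where vs: "\<forall>n. v n \<in> cadlag T \<and>
          skorokhod_dist T w (v n) < inverse (real (Suc n)) \<and> avg T tfs \<epsilon> (v n) \<notin> U"
        by (elim exE)
      have v: "v n \<in> cadlag T" "skorokhod_dist T w (v n) < inverse (real (Suc n))"
        "avg T tfs \<epsilon> (v n) \<notin> U" for n
        using spec[OF vs, of n] by blast+
      have conv: "(\<lambda>n. skorokhod_dist T w (v n)) \<longlonglongrightarrow> 0"
      proof (rule tendsto_sandwich[OF _ _ tendsto_const LIMSEQ_inverse_real_of_nat])
        show "\<forall>\<^sub>F n in sequentially. 0 \<le> skorokhod_dist T w (v n)" by simp
        show "\<forall>\<^sub>F n in sequentially. skorokhod_dist T w (v n) \<le> inverse (real (Suc n))"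
          using v(2) by (intro always_eventually allI less_imp_le)
      qed
      have "AE s in leb {0..1}. \<forall>(t, f)\<in>set tfs. (\<lambda>n. ext_path T (v n) (t + \<epsilon> * s)) \<longlonglongrightarrow> ext_path T w (t + \<epsilon> * s)"
      proof -
        let ?X = "\<Union>(t, f)\<in>set tfs. (\<lambda>x. (x - t) / \<epsilon>) ` exceptional T w"
        have "countable ?X"
          using countable_exceptional[OF w]
          by (intro countable_UN countable_finite[OF finite_set]) (auto split: prod.splits)
        then have "AE s in lborel. s \<notin> ?X" by (intro AE_not_in countable_imp_null_set_lborel)
        then have "AE s in leb {0..1}. s \<notin> ?X" by (subst AE_restrict_space_iff) auto
        moreover have "AE s in leb {0..1::real}. s \<in> {0..1}" by (rule AE_I2) simp
        ultimately show ?thesis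
        proof eventually_elim
          case (elim s)
          show ?case
          proof clarify
            fix t f assume tf: "(t, f) \<in> set tfs"
            then have t: "t \<ge> 0" using g by (auto simp: good_list_def)
            have "t + \<epsilon> * s \<notin> exceptional T w"
            proof
              assume "t + \<epsilon> * s \<in> exceptional T w"
              then have "((t + \<epsilon> * s) - t) / \<epsilon> \<in> (\<lambda>x. (x - t) / \<epsilon>) ` exceptional T w" by (rule imageI)
              then have "s \<in> ?X" using \<epsilon> tf by auto
              then show False using elim(1) by simp
            qed
            then show "(\<lambda>n. ext_path T (v n) (t + \<epsilon> * s)) \<longlonglongrightarrow> ext_path T w (t + \<epsilon> * s)"
              using t elim(2) \<epsilon> by (intro skorokhod_pointwise T w v conv) auto
          qed
        qed
      qed
      then have "(\<lambda>n. avg T tfs \<epsilon> (v n)) \<longlonglongrightarrow> avg T tfs \<epsilon> w"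
        by (rule avg_tendsto[OF T g v(1) w])
      then have "\<forall>\<^sub>F n in sequentially. avg T tfs \<epsilon> (v n) \<in> U"
        by (rule topological_tendstoD) (use U in auto)
      then show False using v(3) by (auto simp: eventually_sequentially)
    qed
  qed
qed

lemma avg_right_limit:
  fixes tfs :: "(real \<times> ('b::metric_space \<Rightarrow> real)) list"
  assumes T: "T > 0" and g: "good_list T tfs" and w: "w \<in> cadlag T"
  shows "(\<lambda>n. avg T tfs (inverse (real (Suc n))) w) \<longlonglongrightarrow> (\<Prod>(t, f)\<leftarrow>tfs. f (w t))"
proof -
  have "(\<lambda>n. avg T tfs (inverse (real (Suc n))) w) \<longlonglongrightarrow> avg T tfs 0 w"
  proof (rule avg_tendsto[OF T g w w], rule AE_I2, clarify)
    fix s t f assume s: "s \<in> space (leb {0..1::real})" and tf: "(t, f) \<in> set tfs"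
    have s: "0 \<le> s" "s \<le> 1" using s by auto
    have t: "t \<in> {0..T}" using g tf by (auto simp: good_list_def)
    show "(\<lambda>n. ext_path T w (t + inverse (real (Suc n)) * s)) \<longlonglongrightarrow> ext_path T w (t + 0 * s)"
    proof (cases "t = T \<or> s = 0")
      case True
      then have "ext_path T w (t + inverse (real (Suc n)) * s) = ext_path T w t" for n
        using s by (auto simp: ext_path_def min_absorb2)
      then show ?thesis by simp
    next
      case False
      then have t': "t \<in> {0..<T}" "s > 0" using t s by auto
      have "(\<lambda>n. t + inverse (real (Suc n)) * s) \<longlonglongrightarrow> t + 0 * s"
        by (intro tendsto_intros LIMSEQ_inverse_real_of_nat)
      then have lim: "(\<lambda>n. t + inverse (real (Suc n)) * s) \<longlonglongrightarrow> t" by simp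
      then have "filterlim (\<lambda>n. t + inverse (real (Suc n)) * s) (at_right t) sequentially"
        unfolding filterlim_at using t' by (intro conjI always_eventually allI) auto
      moreover have "(w \<longlongrightarrow> w t) (at_right t)" using w t' by (simp add: cadlag_def)
      ultimately have "(\<lambda>n. w (t + inverse (real (Suc n)) * s)) \<longlonglongrightarrow> w t"
        by (rule filterlim_compose[rotated])
      moreover have "\<forall>\<^sub>F n in sequentially. t + inverse (real (Suc n)) * s < T"
        using order_tendstoD(2)[OF lim] t' by simp
      then have "\<forall>\<^sub>F n in sequentially. w (t + inverse (real (Suc n)) * s) = ext_path T w (t + inverse (real (Suc n)) * s)"
      proof eventually_elim
        case (elim n)
        have "0 \<le> inverse (real (Suc n)) * s" using t'(2) by simp
        then show ?case using elim t'(1) by (intro ext_path_id[symmetric]) (auto simp del: inverse_nonnegative_iff_nonnegative)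
      qed
      ultimately have "(\<lambda>n. ext_path T w (t + inverse (real (Suc n)) * s)) \<longlonglongrightarrow> w t"
        by (rule Lim_transform_eventually)
      then show ?thesis using ext_path_id[OF t, of w] by simp
    qed
  qed
  moreover have "avg T tfs 0 w = (\<Prod>(t, f)\<leftarrow>tfs. f (w t))"
  proof -
    have "map (\<lambda>(t, f). f (ext_path T w (t + 0 * s))) tfs = map (\<lambda>(t, f). f (w t)) tfs" for s
      using g by (intro map_cong refl) (auto simp: good_list_def ext_path_id)
    then have "avg T tfs 0 w = (\<integral>s. (\<Prod>(t, f)\<leftarrow>tfs. f (w t)) \<partial>leb {0..1::real})"
      unfolding avg_def by (simp only:)
    then show ?thesis by (simp add: measure_unit)
  qed
  ultimately show ?thesis by simp
qed

lemma continuous_map_skorokhod_measurable: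
  fixes F :: "(real \<Rightarrow> 'b::metric_space) \<Rightarrow> real"
  assumes T: "T \<ge> 0" and F: "continuous_map (skorokhod_topology T) euclideanreal F"
  shows "F \<in> borel_measurable (skorokhod_borel T)"
proof (rule borel_measurableI)
  interpret Metric_space "cadlag T :: (real \<Rightarrow> 'b) set" "skorokhod_dist T"
    by (rule Metric_space_skorokhod[OF T])
  have ts: "topspace (skorokhod_topology T) = (cadlag T :: (real \<Rightarrow> 'b) set)"
    unfolding skorokhod_topology_def by (rule topspace_mtopology)
  fix S :: "real set" assume "open S"
  then have "openin (skorokhod_topology T) {x \<in> topspace (skorokhod_topology T). F x \<in> S}"
    using F by (auto simp: continuous_map_def)
  moreover have "{x \<in> topspace (skorokhod_topology T). F x \<in> S} = F -` S \<inter> cadlag T" using ts by auto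
  moreover have "{U :: (real \<Rightarrow> 'b) set. openin (skorokhod_topology T) U} \<subseteq> Pow (cadlag T)"
    using openin_subset ts by blast
  ultimately show "F -` S \<inter> space (skorokhod_borel T) \<in> sets (skorokhod_borel T)"
    unfolding space_skorokhod_borel[OF T] unfolding skorokhod_borel_def
    by (auto simp: sets_measure_of)
qed

lemma avg_measurable:
  assumes "T > 0" "good_list T tfs" "\<epsilon> > 0"
  shows "avg T tfs \<epsilon> \<in> borel_measurable (skorokhod_borel T)"
  using assms by (intro continuous_map_skorokhod_measurable avg_continuous) auto

text \<open>Evaluation is not continuous, but composed with a bounded continuous \<open>f\<close> it
  is a pointwise limit of the measurable short averages.\<close>

lemma eval_measurable:
  assumes T: "T > 0" and t: "t \<in> {0..T}"
  shows "(\<lambda>w. w t :: 'b::metric_space) \<in> skorokhod_borel T \<rightarrow>\<^sub>M borel"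
proof (rule borel_measurableI)
  fix S :: "'b set" assume S: "open S"
  show "(\<lambda>w. w t) -` S \<inter> space (skorokhod_borel T) \<in> sets (skorokhod_borel T)"
  \<comment> \<open>The whole space is treated apart because the distance to its empty complement is
    0 by convention.\<close>
  proof (cases "S = UNIV")
    case False
    define f where "f y = min 1 (infdist y (- S))" for y
    have g: "good_list T [(t, f)]"
      using t by (auto simp: good_list_def f_def bounded_iff infdist_nonneg intro!: continuous_intros exI[of _ 1])
    have "(\<lambda>w. f (w t)) \<in> borel_measurable (skorokhod_borel T)"
    proof (rule borel_measurable_LIMSEQ_metric)
      show "avg T [(t, f)] (inverse (real (Suc n))) \<in> borel_measurable (skorokhod_borel T)" for n
        using T g by (intro avg_measurable) auto
      fix w :: "real \<Rightarrow> 'b" assume "w \<in> space (skorokhod_borel T)"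
      then have "w \<in> cadlag T" using T by (simp add: space_skorokhod_borel)
      from avg_right_limit[OF T g this]
      show "(\<lambda>n. avg T [(t, f)] (inverse (real (Suc n))) w) \<longlonglongrightarrow> f (w t)" by simp
    qed
    then have "(\<lambda>w. f (w t)) -` {0<..} \<inter> space (skorokhod_borel T) \<in> sets (skorokhod_borel T)"
      by (rule measurable_sets) simp
    moreover have "f y > 0 \<longleftrightarrow> y \<in> S" for y
    proof -
      have "- S \<noteq> {}" "closed (- S)" using False S by auto
      then have "y \<in> - S \<longleftrightarrow> infdist y (- S) = 0" by (intro in_closed_iff_infdist_zero)
      moreover have "0 \<le> infdist y (- S)" by (rule infdist_nonneg)
      ultimately show ?thesis unfolding f_def by auto
    qed
    ultimately show ?thesis by (simp add: vimage_def)
  qed simp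
qed

section \<open>Finite-dimensional distributions\<close>

text \<open>The difference is \<open>F n * (h n - h') + h' * (F n - F')\<close>, so sup bounds are
  needed for all \<open>F n\<close> but only for the limit \<open>h'\<close>.\<close>

lemma L2_mult_tendsto:
  assumes F: "\<And>n. F n \<in> L2 N" "F' \<in> L2 N" "(\<lambda>n. norm_L2 N (\<lambda>x. F n x - F' x)) \<longlonglongrightarrow> 0"
    and FK: "\<And>n. AE x in N. \<bar>F n x\<bar> \<le> K"
    and h: "\<And>n. h n \<in> L2 N" "h' \<in> L2 N" "(\<lambda>n. norm_L2 N (\<lambda>x. h n x - h' x)) \<longlonglongrightarrow> 0"
    and hB: "AE x in N. \<bar>h' x\<bar> \<le> B"
  shows "(\<lambda>n. norm_L2 N (\<lambda>x. F n x * h n x - F' x * h' x)) \<longlonglongrightarrow> 0"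
proof (rule tendsto_sandwich[OF _ _ tendsto_const])
  show "\<forall>\<^sub>F n in sequentially. 0 \<le> norm_L2 N (\<lambda>x. F n x * h n x - F' x * h' x)" by simp
  show "\<forall>\<^sub>F n in sequentially. norm_L2 N (\<lambda>x. F n x * h n x - F' x * h' x) \<le>
      \<bar>K\<bar> * norm_L2 N (\<lambda>x. h n x - h' x) + \<bar>B\<bar> * norm_L2 N (\<lambda>x. F n x - F' x)"
  proof (intro always_eventually allI)
    fix n
    note Fm = L2_measurable[OF F(1)[of n]] and hm = L2_measurable[OF h(2)]
    have a: "(\<lambda>x. F n x * (h n x - h' x)) \<in> L2 N"
      by (rule L2_bounded_mult[OF L2_diff[OF h(1,2)] Fm FK])
    have b: "(\<lambda>x. h' x * (F n x - F' x)) \<in> L2 N"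
      by (rule L2_bounded_mult[OF L2_diff[OF F(1,2)] hm hB])
    have eq: "(\<lambda>x. F n x * h n x - F' x * h' x) = (\<lambda>x. F n x * (h n x - h' x) + h' x * (F n x - F' x))"
      by (auto simp: algebra_simps)
    have "norm_L2 N (\<lambda>x. F n x * h n x - F' x * h' x) \<le>
        norm_L2 N (\<lambda>x. F n x * (h n x - h' x)) + norm_L2 N (\<lambda>x. h' x * (F n x - F' x))"
      unfolding eq by (rule norm_L2_triangle[OF a b])
    also have "\<dots> \<le> \<bar>K\<bar> * norm_L2 N (\<lambda>x. h n x - h' x) + \<bar>B\<bar> * norm_L2 N (\<lambda>x. F n x - F' x)"
      by (intro add_mono norm_L2_bounded_mult[OF L2_diff[OF h(1,2)] Fm FK]
          norm_L2_bounded_mult[OF L2_diff[OF F(1,2)] hm hB])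
    finally show "norm_L2 N (\<lambda>x. F n x * h n x - F' x * h' x) \<le>
      \<bar>K\<bar> * norm_L2 N (\<lambda>x. h n x - h' x) + \<bar>B\<bar> * norm_L2 N (\<lambda>x. F n x - F' x)" .
  qed
  have "(\<lambda>n. \<bar>K\<bar> * norm_L2 N (\<lambda>x. h n x - h' x) + \<bar>B\<bar> * norm_L2 N (\<lambda>x. F n x - F' x)) \<longlonglongrightarrow>
      \<bar>K\<bar> * 0 + \<bar>B\<bar> * 0"
    by (intro tendsto_intros F h)
  then show "(\<lambda>n. \<bar>K\<bar> * norm_L2 N (\<lambda>x. h n x - h' x) + \<bar>B\<bar> * norm_L2 N (\<lambda>x. F n x - F' x)) \<longlonglongrightarrow> 0"
    by simp
qed

section \<open>Strong continuity of the limiting semigroup and limits of nested products\<close>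

context L2_semigroup
begin

lemma Q_diff_AE:
  assumes "h \<in> L2 M" "g \<in> L2 M" "0 \<le> t"
  shows "AE x in M. Q t (\<lambda>x. h x - g x) x = Q t h x - Q t g x"
  using Q_lin[OF assms(2,1,3), of "-1"] by simp

lemma Q_close:
  assumes h: "h \<in> L2 M" and g: "g \<in> L2 M" and t: "0 \<le> t"
  shows "norm_L2 M (\<lambda>x. Q t h x - Q t g x) \<le> norm_L2 M (\<lambda>x. h x - g x)"
proof -
  have d: "(\<lambda>x. h x - g x) \<in> L2 M" by (rule L2_diff[OF h g])
  have "norm_L2 M (\<lambda>x. Q t h x - Q t g x) = norm_L2 M (Q t (\<lambda>x. h x - g x))"
  proof (rule norm_L2_cong_AE)
    show "(\<lambda>x. Q t h x - Q t g x) \<in> borel_measurable M"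
      by (rule L2_measurable[OF L2_diff[OF Q_L2[OF h t] Q_L2[OF g t]]])
    show "Q t (\<lambda>x. h x - g x) \<in> borel_measurable M" by (rule L2_measurable[OF Q_L2[OF d t]])
    show "AE x in M. Q t h x - Q t g x = Q t (\<lambda>x. h x - g x) x"
      using Q_diff_AE[OF h g t] by eventually_elim simp
  qed
  also have "\<dots> \<le> norm_L2 M (\<lambda>x. h x - g x)" by (rule Q_contraction[OF d t])
  finally show ?thesis .
qed

text \<open>Strong continuity, inherited from the equicontinuity of the discrete semigroups on the
  core, whose \<open>\<delta>\<close> is independent of \<open>k\<close>; contractivity extends it
  to \<open>L2 M\<close>.\<close>

lemma Q_continuous:
  assumes h: "h \<in> L2 M" and t: "0 \<le> t" "\<And>n. 0 \<le> s n" "s \<longlonglongrightarrow> t"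
  shows "(\<lambda>n. norm_L2 M (\<lambda>x. Q (s n) h x - Q t h x)) \<longlonglongrightarrow> 0"
proof (rule order_tendstoI)
  fix e :: real assume e: "0 < e"
  then have e4: "e/4 > 0" by simp
  obtain c where c: "c \<in> core" "norm_L2 M (\<lambda>x. h x - c x) < e/4"
    using core_dense[OF h e4] by blast
  have cL: "c \<in> L2 M" using c(1) core_TT by (intro TT_L2) auto
  obtain \<delta> where \<delta>: "\<delta> > 0" and close:
    "\<And>m n. (\<forall>\<^sub>F k in sequentially. \<bar>real (m k) - real (n k)\<bar> * \<tau> k < \<delta>) \<Longrightarrow>
    (\<forall>\<^sub>F k in sequentially. norm_L2 (\<mu> k) (\<lambda>x. P k (m k) c x - P k (n k) c x) < e/4)"
    using core_equi_eventually[OF c(1) e4] by blast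
  have c_close: "norm_L2 M (\<lambda>x. Q a c x - Q t c x) \<le> e/4" if a: "0 \<le> a" "\<bar>a - t\<bar> < \<delta>" for a
  proof -
    let ?m = "\<lambda>k. nat \<lfloor>a / \<tau> k\<rfloor>" and ?n = "\<lambda>k. nat \<lfloor>t / \<tau> k\<rfloor>"
    have "(\<lambda>k. \<bar>real (?m k) * \<tau> k - real (?n k) * \<tau> k\<bar>) \<longlonglongrightarrow> \<bar>a - t\<bar>"
      by (intro tendsto_rabs tendsto_diff floor_steps a t)
    from order_tendstoD(2)[OF this a(2)]
    have "\<forall>\<^sub>F k in sequentially. \<bar>real (?m k) - real (?n k)\<bar> * \<tau> k < \<delta>"
    proof eventually_elim
      case (elim k)
      then show ?case using \<tau>_pos[of k] by (simp add: abs_mult_pos' flip: left_diff_distrib)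
    qed
    from close[OF this]
    have ev: "\<forall>\<^sub>F k in sequentially. norm_L2 (\<mu> k) (\<lambda>x. P k (?m k) c x - P k (?n k) c x) \<le> e/4"
      by eventually_elim simp
    have cs: "sconv (\<lambda>k. c) c" using c(1) core_TT by (intro sconv_TT) auto
    have "sconv (\<lambda>k x. P k (?m k) c x - P k (?n k) c x) (\<lambda>x. Q a c x - Q t c x)"
      by (intro sconv_diff Q_conv cs a t floor_steps)
    from tendsto_upperbound[OF sconv_norm[OF this] ev] show ?thesis by simp
  qed
  have "\<forall>\<^sub>F n in sequentially. \<bar>s n - t\<bar> < \<delta>"
    using tendstoD[OF t(3) \<delta>] by (simp add: dist_real_def)
  then show "\<forall>\<^sub>F n in sequentially. norm_L2 M (\<lambda>x. Q (s n) h x - Q t h x) < e"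
  proof eventually_elim
    case (elim n)
    note L = Q_L2[OF h t(2)[of n]] Q_L2[OF cL t(2)[of n]] Q_L2[OF h t(1)] Q_L2[OF cL t(1)]
    have "norm_L2 M (\<lambda>x. Q (s n) h x - Q t h x) \<le>
        norm_L2 M (\<lambda>x. Q (s n) h x - Q (s n) c x) + norm_L2 M (\<lambda>x. Q (s n) c x - Q t h x)"
      by (rule norm_L2_triangle_diff[OF L(1,2,3)])
    moreover have "norm_L2 M (\<lambda>x. Q (s n) c x - Q t h x) \<le>
        norm_L2 M (\<lambda>x. Q (s n) c x - Q t c x) + norm_L2 M (\<lambda>x. Q t c x - Q t h x)"
      by (rule norm_L2_triangle_diff[OF L(2,4,3)])
    moreover have "norm_L2 M (\<lambda>x. Q (s n) h x - Q (s n) c x) < e/4"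
      using Q_close[OF h cL t(2)[of n]] c(2) by linarith
    moreover have "norm_L2 M (\<lambda>x. Q t c x - Q t h x) < e/4"
      using Q_close[OF h cL t(1)] c(2) by (simp add: norm_L2_minus[of _ "Q t c"])
    ultimately show ?case using c_close[OF t(2) elim] e by linarith
  qed
next
  fix a :: real assume "a < 0"
  then show "\<forall>\<^sub>F n in sequentially. a < norm_L2 M (\<lambda>x. Q (s n) h x - Q t h x)"
    by (intro always_eventually allI less_le_trans[OF _ norm_L2_nonneg])
qed

lemma iterated_Q_bounded:
  assumes "sorted (s # map fst l)"
    and "\<And>t f. (t, f) \<in> set l \<Longrightarrow> f \<in> borel_measurable M \<and> (AE x in M. \<bar>f x\<bar> \<le> K)" and K: "K \<ge> 0"
  shows "iterated_semigroup Q s l \<in> L2 M \<and> (AE x in M. \<bar>iterated_semigroup Q s l x\<bar> \<le> K ^ length l)"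
  using assms(1,2)
proof (induction l arbitrary: s)
  case Nil
  show ?case by (auto intro!: L2_bounded[of _ 1])
next
  case (Cons a l)
  obtain t f where a: "a = (t, f)" by (cases a)
  have IH: "iterated_semigroup Q t l \<in> L2 M" "AE x in M. \<bar>iterated_semigroup Q t l x\<bar> \<le> K ^ length l"
    using Cons.IH[of t] Cons.prems a by auto
  have f: "f \<in> borel_measurable M" "AE x in M. \<bar>f x\<bar> \<le> K" using Cons.prems(2)[of t f] a by auto
  have ts: "0 \<le> t - s" using Cons.prems(1) a by simp
  have L: "(\<lambda>x. f x * iterated_semigroup Q t l x) \<in> L2 M" by (rule L2_bounded_mult[OF IH(1) f])
  have "AE x in M. \<bar>f x * iterated_semigroup Q t l x\<bar> \<le> K ^ length (a # l)"
    using f(2) IH(2) by eventually_elim (simp add: abs_mult mult_mono K)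
  from Q_bounded[OF L this _ ts] Q_L2[OF L ts] K show ?case by (simp add: a)
qed

text \<open>Times and functions vary simultaneously: the shifts of \<open>avg\<close> move the
  times, and the extension to Borel functions moves the functions. The uniform bound
  \<open>K\<close> keeps the nested products bounded, as \<open>L2_mult_tendsto\<close>
  requires.\<close>

lemma iterated_Q_tendsto:
  fixes xs :: "'i list"
  assumes K: "K \<ge> 0"
    and F: "\<And>n i. i \<in> set xs \<Longrightarrow> F n i \<in> borel_measurable M \<and> (\<forall>x\<in>space M. \<bar>F n i x\<bar> \<le> K)"
      "\<And>i. i \<in> set xs \<Longrightarrow> F' i \<in> borel_measurable M \<and> (\<forall>x\<in>space M. \<bar>F' i x\<bar> \<le> K)"
      "\<And>i. i \<in> set xs \<Longrightarrow> (\<lambda>n. norm_L2 M (\<lambda>x. F n i x - F' i x)) \<longlonglongrightarrow> 0"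
    and t: "\<And>i. i \<in> set xs \<Longrightarrow> (\<lambda>n. t n i) \<longlonglongrightarrow> t' i"
    and s: "s \<longlonglongrightarrow> s'" "\<And>n. sorted (s n # map (t n) xs)"
  shows "(\<lambda>n. norm_L2 M (\<lambda>x. iterated_semigroup Q (s n) (map (\<lambda>i. (t n i, F n i)) xs) x -
      iterated_semigroup Q s' (map (\<lambda>i. (t' i, F' i)) xs) x)) \<longlonglongrightarrow> 0"
  using F t s
proof (induction xs arbitrary: s s')
  case Nil
  then show ?case by simp
next
  case (Cons i xs)
  let ?G = "\<lambda>n. iterated_semigroup Q (t n i) (map (\<lambda>i. (t n i, F n i)) xs)"
  let ?G' = "iterated_semigroup Q (t' i) (map (\<lambda>i. (t' i, F' i)) xs)"
  have srt: "sorted (t n i # map (t n) xs)" for n using Cons.prems(6)[of n] by simp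
  \<comment> \<open>Weak inequalities between the times survive the limit, so the limiting list is
    sorted and its time increments are nonnegative.\<close>
  have lims: "sorted (s' # map t' (i # xs))"
  proof -
    have le: "lim1 \<le> lim2" if "X \<longlonglongrightarrow> lim1" "Y \<longlonglongrightarrow> lim2" "\<And>n. X n \<le> Y n" for X Y and lim1 lim2 :: real
      using that by (auto intro: LIMSEQ_le)
    have tt: "t' a \<le> t' b" if "\<And>n. t n a \<le> t n b" "a \<in> set (i # xs)" "b \<in> set (i # xs)" for a b
      by (rule le[OF Cons.prems(4)[OF that(2)] Cons.prems(4)[OF that(3)] that(1)])
    have srtw: "sorted_wrt (\<lambda>a b. t' a \<le> t' b) ys" if "\<And>n. sorted_wrt (\<lambda>a b. t n a \<le> t n b) ys" "set ys \<subseteq> set (i # xs)" for ys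
      using that by (induction ys) (auto intro!: tt)
    have "sorted_wrt (\<lambda>a b. t' a \<le> t' b) (i # xs)"
    proof (rule srtw)
      show "sorted_wrt (\<lambda>a b. t n a \<le> t n b) (i # xs)" for n
        using Cons.prems(6)[of n] by (auto simp: sorted_map)
    qed simp
    moreover have "s' \<le> t' a" if "a \<in> set (i # xs)" for a
      by (rule le[OF Cons.prems(5) Cons.prems(4)[OF that]]) (use Cons.prems(6) that in auto)
    ultimately show ?thesis by (auto simp: sorted_map)
  qed
  have IH: "(\<lambda>n. norm_L2 M (\<lambda>x. ?G n x - ?G' x)) \<longlonglongrightarrow> 0"
    by (rule Cons.IH[OF _ _ _ _ Cons.prems(4)[of i] srt]) (use Cons.prems in auto)
  have G: "?G n \<in> L2 M \<and> (AE x in M. \<bar>?G n x\<bar> \<le> K ^ length (map (\<lambda>i. (t n i, F n i)) xs))" for n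
    by (rule iterated_Q_bounded[OF _ _ K]) (use srt[of n] Cons.prems(1) in \<open>auto simp: o_def intro!: AE_I2\<close>)
  have G': "?G' \<in> L2 M \<and> (AE x in M. \<bar>?G' x\<bar> \<le> K ^ length (map (\<lambda>i. (t' i, F' i)) xs))"
    by (rule iterated_Q_bounded[OF _ _ K]) (use lims Cons.prems(2) in \<open>auto simp: o_def intro!: AE_I2\<close>)
  have FL: "F n i \<in> L2 M" "AE x in M. \<bar>F n i x\<bar> \<le> K" for n
    using Cons.prems(1)[of i n] by (auto intro!: L2_bounded[of _ K] AE_I2)
  have FL': "F' i \<in> L2 M" "F' i \<in> borel_measurable M" "AE x in M. \<bar>F' i x\<bar> \<le> K"
    using Cons.prems(2)[of i] by (auto intro!: L2_bounded[of _ K] AE_I2)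
  have prod: "(\<lambda>n. norm_L2 M (\<lambda>x. F n i x * ?G n x - F' i x * ?G' x)) \<longlonglongrightarrow> 0"
    by (rule L2_mult_tendsto[OF FL(1) FL'(1) _ FL(2) _ _ IH]) (use Cons.prems(3) G G' in auto)
  have PL: "(\<lambda>x. F n i x * ?G n x) \<in> L2 M" for n
    by (rule L2_bounded_mult[OF _ L2_measurable[OF FL(1)] FL(2)]) (use G in blast)
  have PL': "(\<lambda>x. F' i x * ?G' x) \<in> L2 M"
    by (rule L2_bounded_mult[OF _ FL'(2,3)]) (use G' in blast)
  have ts: "0 \<le> t n i - s n" "0 \<le> t' i - s'" for n using Cons.prems(6)[of n] lims by auto
  have "(\<lambda>n. t n i - s n) \<longlonglongrightarrow> t' i - s'" using Cons.prems(4,5) by (intro tendsto_diff) auto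
  from Q_continuous[OF PL' ts(2) ts(1) this]
  have Qc: "(\<lambda>n. norm_L2 M (\<lambda>x. Q (t n i - s n) (\<lambda>x. F' i x * ?G' x) x - Q (t' i - s') (\<lambda>x. F' i x * ?G' x) x)) \<longlonglongrightarrow> 0" .
  have sum0: "(\<lambda>n. norm_L2 M (\<lambda>x. F n i x * ?G n x - F' i x * ?G' x) +
     norm_L2 M (\<lambda>x. Q (t n i - s n) (\<lambda>x. F' i x * ?G' x) x - Q (t' i - s') (\<lambda>x. F' i x * ?G' x) x)) \<longlonglongrightarrow> 0"
    using tendsto_add[OF prod Qc] by simp
  have "(\<lambda>n. norm_L2 M (\<lambda>x. Q (t n i - s n) (\<lambda>x. F n i x * ?G n x) x - Q (t' i - s') (\<lambda>x. F' i x * ?G' x) x)) \<longlonglongrightarrow> 0"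
  proof (rule tendsto_sandwich[OF _ _ tendsto_const sum0])
    show "\<forall>\<^sub>F n in sequentially. norm_L2 M (\<lambda>x. Q (t n i - s n) (\<lambda>x. F n i x * ?G n x) x - Q (t' i - s') (\<lambda>x. F' i x * ?G' x) x) \<le>
      norm_L2 M (\<lambda>x. F n i x * ?G n x - F' i x * ?G' x) +
      norm_L2 M (\<lambda>x. Q (t n i - s n) (\<lambda>x. F' i x * ?G' x) x - Q (t' i - s') (\<lambda>x. F' i x * ?G' x) x)"
    proof (intro always_eventually allI)
      fix n
      show "norm_L2 M (\<lambda>x. Q (t n i - s n) (\<lambda>x. F n i x * ?G n x) x - Q (t' i - s') (\<lambda>x. F' i x * ?G' x) x) \<le>
      norm_L2 M (\<lambda>x. F n i x * ?G n x - F' i x * ?G' x) +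
      norm_L2 M (\<lambda>x. Q (t n i - s n) (\<lambda>x. F' i x * ?G' x) x - Q (t' i - s') (\<lambda>x. F' i x * ?G' x) x)"
        using norm_L2_triangle_diff[OF Q_L2[OF PL[of n] ts(1)[of n]] Q_L2[OF PL' ts(1)[of n]] Q_L2[OF PL' ts(2)]]
          Q_close[OF PL[of n] PL' ts(1)[of n]] by linarith
    qed
  qed simp
  then show ?case by simp
qed

fun iter :: "nat \<Rightarrow> nat \<Rightarrow> (nat \<times> ('a \<Rightarrow> real)) list \<Rightarrow> 'a \<Rightarrow> real" where
  "iter k s [] = (\<lambda>x. 1)"
| "iter k s ((n, f) # l) = P k (n - s) (\<lambda>x. f x * iter k n l x)"

text \<open>Induction from the innermost factor outwards: multiplication by a member of
  \<open>TT\<close> and application of \<open>P k\<close> both preserve strong convergence. The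
  bounds needed for products are built into \<open>TT\<close>.\<close>

lemma iter_sconv:
  assumes "sorted (s # map fst l)" "\<And>t f. (t, f) \<in> set l \<Longrightarrow> f \<in> TT"
    and m: "(\<lambda>k. real (m k) * \<tau> k) \<longlonglongrightarrow> s"
    and nn: "\<And>t f. (t, f) \<in> set l \<Longrightarrow> (\<lambda>k. real (nn k t) * \<tau> k) \<longlonglongrightarrow> t"
  shows "sconv (\<lambda>k. iter k (m k) (map (\<lambda>(t, f). (nn k t, f)) l)) (iterated_semigroup Q s l)"
  using assms
proof (induction l arbitrary: s m)
  case Nil
  then show ?case using sconv_TT[OF TT_one] by simp
next
  case (Cons a l)
  obtain t f where a: "a = (t, f)" by (cases a)
  have nt: "(\<lambda>k. real (nn k t) * \<tau> k) \<longlonglongrightarrow> t" using Cons.prems(4) a by auto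
  have st: "s \<le> t" and f: "f \<in> TT" using Cons.prems a by auto
  have "sconv (\<lambda>k. iter k (nn k t) (map (\<lambda>(t, f). (nn k t, f)) l)) (iterated_semigroup Q t l)"
    by (rule Cons.IH[OF _ _ nt]) (use Cons.prems a in auto)
  from sconv_mult[OF this f]
  have 1: "sconv (\<lambda>k x. f x * iter k (nn k t) (map (\<lambda>(t, f). (nn k t, f)) l) x) (\<lambda>x. f x * iterated_semigroup Q t l x)" .
  \<comment> \<open>The positive part mirrors the truncated subtraction of step counts, whose order
    before the limit is not assumed.\<close>
  have "(\<lambda>k. max 0 (real (nn k t) * \<tau> k - real (m k) * \<tau> k)) \<longlonglongrightarrow> max 0 (t - s)"
    by (intro tendsto_intros nt Cons.prems)
  moreover have "max 0 (real (nn k t) * \<tau> k - real (m k) * \<tau> k) = real (nn k t - m k) * \<tau> k" for k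
  proof (cases "m k \<le> nn k t")
    case True
    then show ?thesis using \<tau>_pos[of k] by (simp add: of_nat_diff left_diff_distrib)
  next
    case False
    then show ?thesis using \<tau>_pos[of k] by simp
  qed
  ultimately have "(\<lambda>k. real (nn k t - m k) * \<tau> k) \<longlonglongrightarrow> t - s" using st by simp
  from Q_conv[OF 1 _ this] st show ?case by (simp add: a)
qed

end

lemma step_path_cadlag:
  fixes x :: "nat \<Rightarrow> 'b::metric_space"
  assumes a: "a > 0"
  shows "(\<lambda>t\<in>{0..T}. x (nat \<lfloor>a * t\<rfloor>)) \<in> cadlag T"
  unfolding cadlag_def
proof (intro CollectI conjI ballI)
  let ?w = "\<lambda>t\<in>{0..T}. x (nat \<lfloor>a * t\<rfloor>)"
  show "?w \<in> extensional {0..T}" by simp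
  show "(?w \<longlongrightarrow> ?w t) (at_right t)" if t: "t \<in> {0..<T}" for t
  proof (rule tendsto_eventually)
    define u where "u = min T ((of_int \<lfloor>a * t\<rfloor> + 1) / a)"
    have "a * t < of_int \<lfloor>a * t\<rfloor> + 1" by linarith
    then have "t < (of_int \<lfloor>a * t\<rfloor> + 1) / a" using a by (simp add: field_simps)
    then have tu: "t < u" using t by (simp add: u_def)
    show "\<forall>\<^sub>F s in at_right t. ?w s = ?w t"
      unfolding eventually_at_right_field
    proof (intro exI[of _ u] conjI tu allI impI)
      fix s assume s: "t < s" "s < u"
      then have "s < (of_int \<lfloor>a * t\<rfloor> + 1) / a" by (simp add: u_def)
      then have "a * s < of_int \<lfloor>a * t\<rfloor> + 1" using a by (simp add: field_simps)
      moreover have "a * t \<le> a * s" using s a by simp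
      ultimately have "\<lfloor>a * s\<rfloor> = \<lfloor>a * t\<rfloor>" by linarith
      then show "?w s = ?w t" using s t by (simp add: u_def)
    qed
  qed
  show "\<exists>l. (?w \<longlongrightarrow> l) (at_left t)" if t: "t \<in> {0<..T}" for t
  proof (intro exI tendsto_eventually)
    \<comment> \<open>The step occupied just before \<open>t\<close>; it differs from the floor when
      \<open>a * t\<close> is an integer.\<close>
    define m where "m = \<lceil>a * t\<rceil> - 1"
    have at: "a * t > 0" using t a by simp
    have m: "0 \<le> m" "of_int m < a * t" "a * t \<le> of_int m + 1"
      using at unfolding m_def by linarith+
    have mt: "of_int m / a < t" using m(2) a by (simp add: field_simps)
    show "\<forall>\<^sub>F s in at_left t. ?w s = x (nat m)"
      unfolding eventually_at_left_field
    proof (intro exI[of _ "of_int m / a"] conjI mt allI impI)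
      fix s assume s: "of_int m / a < s" "s < t"
      have "of_int m < a * s" using s(1) a by (simp add: field_simps)
      moreover have "a * s < a * t" using s(2) a by simp
      ultimately have "\<lfloor>a * s\<rfloor> = m" using m by linarith
      moreover have "0 \<le> of_int m / a" using m(1) a by simp
      then have "0 \<le> s" using s(1) by linarith
      ultimately show "?w s = x (nat m)" using s t by simp
    qed
  qed
qed

section \<open>Laws of the walk on path space\<close>

context reversible_walk
begin

definition path :: "real \<Rightarrow> ('v \<Rightarrow> 'b::metric_space) \<Rightarrow> nat \<Rightarrow> (nat \<Rightarrow> 'v) \<Rightarrow> real \<Rightarrow> 'b" where
  "path T \<iota> k x = (\<lambda>t\<in>{0..T}. \<iota> (x (nat \<lfloor>2^(2*k) * t\<rfloor>)))"

lemma path_cadlag: "path T \<iota> k x \<in> cadlag T"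
  unfolding path_def by (rule step_path_cadlag[where x = "\<lambda>n. \<iota> (x n)"]) simp

lemma path_past: "(\<lambda>t\<in>{0..T}. \<iota> (step_process k X t \<omega>)) = path T \<iota> k (past (nat \<lfloor>2^(2*k) * T\<rfloor>) \<omega>)"
proof
  fix t
  show "(\<lambda>t\<in>{0..T}. \<iota> (step_process k X t \<omega>)) t = path T \<iota> k (past (nat \<lfloor>2^(2*k) * T\<rfloor>) \<omega>) t"
  proof (cases "t \<in> {0..T}")
    case True
    then have "(2::real)^(2*k) * t \<le> 2^(2*k) * T" by simp
    then have "nat \<lfloor>2^(2*k) * t\<rfloor> \<le> nat \<lfloor>2^(2*k) * T\<rfloor>" by (intro nat_mono floor_mono)
    then show ?thesis using True by (simp add: path_def past_def step_process_def)
  next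
    case False
    then show ?thesis unfolding path_def by (simp only: restrict_apply if_False)
  qed
qed

text \<open>Up to time \<open>T\<close> the path is a function of a past that takes finitely many
  values, so only finitely many events have to be measurable.\<close>

lemma path_measurable:
  assumes "T > 0"
  shows "(\<lambda>\<omega>. \<lambda>t\<in>{0..T}. \<iota> (step_process k X t \<omega>)) \<in> \<Omega> \<rightarrow>\<^sub>M (skorokhod_borel T :: (real \<Rightarrow> 'b::metric_space) measure)"
proof -
  let ?n = "nat \<lfloor>2^(2*k) * T\<rfloor>"
  have 1: "past ?n \<in> \<Omega> \<rightarrow>\<^sub>M count_space (PiE {..?n} (\<lambda>_. V))"
    unfolding measurable_count_space_eq2[OF finite_paths]
  proof (intro conjI ballI)
    show "past ?n \<in> space \<Omega> \<rightarrow> PiE {..?n} (\<lambda>_. V)" using past_in by blast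
    fix x assume x: "x \<in> PiE {..?n} (\<lambda>_. V)"
    have "past ?n -` {x} \<inter> space \<Omega> = {\<omega>\<in>space \<Omega>. past ?n \<omega> = x}" by auto
    then show "past ?n -` {x} \<inter> space \<Omega> \<in> sets \<Omega>" using past_sets[OF x] by simp
  qed
  have 2: "path T \<iota> k \<in> count_space (PiE {..?n} (\<lambda>_. V)) \<rightarrow>\<^sub>M (skorokhod_borel T :: (real \<Rightarrow> 'b) measure)"
    using assms by (simp add: measurable_count_space_eq1 space_skorokhod_borel path_cadlag)
  show ?thesis
    unfolding path_past by (rule measurable_compose[OF 1 2])
qed

text \<open>With finitely many paths, exchanging expectation and time average is linearity of the
  integral over a finite sum. The other two conclusions provide what dominated convergence in
  \<open>s\<close> needs when the mesh tends to zero.\<close>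

lemma integral_avg_walk:
  fixes tfs :: "(real \<times> ('b::metric_space \<Rightarrow> real)) list" and \<iota> :: "'v \<Rightarrow> 'b" and k :: nat
  assumes T: "T > 0" and g: "good_list T tfs" and srt: "sorted (map fst tfs)" and \<epsilon>: "\<epsilon> > 0"
  defines "I \<equiv> \<lambda>s. \<integral>x. iterated_steps 0
      (map (\<lambda>(t, f). (nat \<lfloor>2^(2*k) * min (t + \<epsilon> * s) T\<rfloor>, \<lambda>x. f (\<iota> x))) tfs) x \<partial>N"
  shows "(\<integral>w. avg T tfs \<epsilon> w \<partial>walk_law T \<iota> k \<Omega> X) = (\<integral>s. I s \<partial>leb {0..1})"
    and "I \<in> borel_measurable (leb {0..1})"
    and "\<And>s B. s \<in> {0..1} \<Longrightarrow> (\<And>y. \<bar>\<Prod>(t, f)\<leftarrow>tfs. f (y t)\<bar> \<le> B) \<Longrightarrow> \<bar>I s\<bar> \<le> B * measure N (space N)"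
proof -
  let ?n = "nat \<lfloor>2^(2*k) * T\<rfloor>"
  let ?S = "PiE {..?n} (\<lambda>_. V)"
  let ?p = "\<lambda>w s. \<Prod>(t, f)\<leftarrow>tfs. f (ext_path T w (t + \<epsilon> * s))"
  let ?m = "\<lambda>x. measure \<Omega> {\<omega>\<in>space \<Omega>. past ?n \<omega> = x}"
  obtain B where B: "B \<ge> 0" "\<And>y. \<bar>\<Prod>(t, f)\<leftarrow>tfs. f (y t)\<bar> \<le> B" using good_list_bounded[OF g] by blast
  interpret U: finite_measure "leb {0..1::real}" by (rule finite_measure_unit)
  have pm: "?p (path T \<iota> k x) \<in> borel_measurable (leb {0..1})" for x
    by (rule measurable_prod_path[OF T g path_cadlag])
  have pb: "\<bar>?p w s\<bar> \<le> B" for w s using B(2)[of "\<lambda>t. ext_path T w (t + \<epsilon> * s)"] .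
  have pint: "integrable (leb {0..1}) (?p (path T \<iota> k x))" for x
    by (rule U.integrable_const_bound[of _ B]) (use pb pm in auto)
  have fr: "(\<integral>\<omega>. H (past ?n \<omega>) \<partial>\<Omega>) = (\<Sum>x\<in>?S. H x * ?m x)" for H :: "(nat \<Rightarrow> 'v) \<Rightarrow> real"
    using finite_paths past_in past_sets by (intro integral_finite_range) auto
  have I_eq: "I s = (\<Sum>x\<in>?S. ?p (path T \<iota> k x) s * ?m x)" if s: "s \<in> {0..1}" for s
  proof -
    let ?l = "map (\<lambda>(t, f). (nat \<lfloor>2^(2*k) * min (t + \<epsilon> * s) T\<rfloor>, \<lambda>x. f (\<iota> x))) tfs"
    have mono: "nat \<lfloor>2^(2*k) * min (a + \<epsilon> * s) T\<rfloor> \<le> nat \<lfloor>2^(2*k) * min (b + \<epsilon> * s) T\<rfloor>" if "a \<le> b" for a b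
      using that by (intro nat_mono floor_mono mult_left_mono) auto
    have "sorted_wrt (\<le>) (map fst ?l)"
      using srt unfolding sorted_map sorted_wrt_map by (rule sorted_wrt_mono_rel[rotated]) (use mono in \<open>auto split: prod.splits\<close>)
    then have "I s = (\<integral>\<omega>. (\<Prod>(n, f)\<leftarrow>?l. f (X n \<omega>)) \<partial>\<Omega>)"
      unfolding I_def by (intro walk_fdd[symmetric])
    also have "\<dots> = (\<integral>\<omega>. ?p (path T \<iota> k (past ?n \<omega>)) s \<partial>\<Omega>)"
    proof (rule Bochner_Integration.integral_cong[OF refl])
      fix \<omega> assume "\<omega> \<in> space \<Omega>"
      have "map (\<lambda>(n, f). f (X n \<omega>)) ?l = map (\<lambda>(t, f). f (ext_path T (path T \<iota> k (past ?n \<omega>)) (t + \<epsilon> * s))) tfs"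
        unfolding map_map
      proof (rule map_cong[OF refl], clarsimp)
        fix t f assume "(t, f) \<in> set tfs"
        then have "0 \<le> t" using g by (auto simp: good_list_def)
        then have "0 \<le> t + \<epsilon> * s" using s \<epsilon> by simp
        then show "f (\<iota> (X (nat \<lfloor>2^(2*k) * min (t + \<epsilon> * s) T\<rfloor>) \<omega>)) =
            f (ext_path T (path T \<iota> k (past ?n \<omega>)) (t + \<epsilon> * s))"
          using T unfolding path_past[symmetric] by (simp add: ext_path_def step_process_def max_def)
      qed
      then show "(\<Prod>(n, f)\<leftarrow>?l. f (X n \<omega>)) = ?p (path T \<iota> k (past ?n \<omega>)) s" by (rule arg_cong)
    qed
    also have "\<dots> = (\<Sum>x\<in>?S. ?p (path T \<iota> k x) s * ?m x)" by (rule fr)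
    finally show ?thesis .
  qed
  have "(\<integral>w. avg T tfs \<epsilon> w \<partial>walk_law T \<iota> k \<Omega> X) = (\<integral>\<omega>. avg T tfs \<epsilon> (path T \<iota> k (past ?n \<omega>)) \<partial>\<Omega>)"
    unfolding walk_law_def path_past[symmetric]
    by (rule integral_distr[OF path_measurable[OF T] avg_measurable[OF T g \<epsilon>]])
  also have "\<dots> = (\<Sum>x\<in>?S. avg T tfs \<epsilon> (path T \<iota> k x) * ?m x)" by (rule fr)
  also have "\<dots> = (\<Sum>x\<in>?S. \<integral>s. ?p (path T \<iota> k x) s * ?m x \<partial>leb {0..1})"
    unfolding avg_def by simp
  also have "\<dots> = (\<integral>s. (\<Sum>x\<in>?S. ?p (path T \<iota> k x) s * ?m x) \<partial>leb {0..1})"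
    by (intro Bochner_Integration.integral_sum[symmetric] integrable_mult_left pint)
  also have "\<dots> = (\<integral>s. I s \<partial>leb {0..1})"
    by (intro Bochner_Integration.integral_cong refl) (simp add: I_eq)
  finally show "(\<integral>w. avg T tfs \<epsilon> w \<partial>walk_law T \<iota> k \<Omega> X) = (\<integral>s. I s \<partial>leb {0..1})" .
  have "(\<lambda>s. \<Sum>x\<in>?S. ?p (path T \<iota> k x) s * ?m x) \<in> borel_measurable (leb {0..1})"
    by (intro borel_measurable_sum borel_measurable_times pm) auto
  then show "I \<in> borel_measurable (leb {0..1})"
    by (rule measurable_cong[THEN iffD1, rotated]) (simp add: I_eq)
  have mass: "measure N (space N) = (\<Sum>x\<in>?S. ?m x)"
  proof -
    have "(\<Sum>x\<in>?S. ?m x) = (\<integral>\<omega>. (\<Prod>(n, f)\<leftarrow>[]. f (X n \<omega>)) \<partial>\<Omega>)" using fr[of "\<lambda>_. 1"] by simp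
    also have "\<dots> = (\<integral>x. iterated_steps 0 [] x \<partial>N)" by (rule walk_fdd) simp
    finally show ?thesis by simp
  qed
  show "\<bar>I s\<bar> \<le> C * measure N (space N)" if s: "s \<in> {0..1}" and C: "\<And>y. \<bar>\<Prod>(t, f)\<leftarrow>tfs. f (y t)\<bar> \<le> C" for s C
  proof -
    have "\<bar>I s\<bar> \<le> (\<Sum>x\<in>?S. \<bar>?p (path T \<iota> k x) s * ?m x\<bar>)" unfolding I_eq[OF s] by (rule sum_abs)
    also have "\<dots> \<le> (\<Sum>x\<in>?S. C * ?m x)"
      using C[of "\<lambda>t. ext_path T (path T \<iota> k _) (t + \<epsilon> * s)"]
      by (intro sum_mono) (auto simp: abs_mult intro!: mult_right_mono)
    finally show ?thesis unfolding mass by (simp add: sum_distrib_left)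
  qed
qed

end

section \<open>The completion and its core\<close>

text \<open>Exhausts the rational algebra by countable stages of expression depth, which gives
  countability of the core.\<close>

primrec alg_level :: "('a \<Rightarrow> real) set \<Rightarrow> nat \<Rightarrow> ('a \<Rightarrow> real) set" where
  "alg_level \<Phi> 0 = \<Phi> \<union> range (\<lambda>q x. of_rat q)"
| "alg_level \<Phi> (Suc n) = alg_level \<Phi> n \<union>
     (\<lambda>(f, g) x. f x + g x) ` (alg_level \<Phi> n \<times> alg_level \<Phi> n) \<union>
     (\<lambda>(f, g) x. f x * g x) ` (alg_level \<Phi> n \<times> alg_level \<Phi> n)"

lemma countable_rat_algebra:
  assumes "countable \<Phi>"
  shows "countable (rat_algebra \<Phi>)"
proof (rule countable_subset)
  have mono: "alg_level \<Phi> m \<subseteq> alg_level \<Phi> n" if "m \<le> n" for m n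
    using that by (induction rule: dec_induct) auto
  show "rat_algebra \<Phi> \<subseteq> (\<Union>n. alg_level \<Phi> n)"
  proof
    fix f assume "f \<in> rat_algebra \<Phi>"
    then show "f \<in> (\<Union>n. alg_level \<Phi> n)"
    proof induction
      case (gen f)
      then show ?case by (intro UN_I[of 0]) auto
    next
      case (const q)
      then show ?case by (intro UN_I[of 0]) auto
    next
      case (add f g)
      then obtain m n where "f \<in> alg_level \<Phi> m" "g \<in> alg_level \<Phi> n" by blast
      then have "(f, g) \<in> alg_level \<Phi> (max m n) \<times> alg_level \<Phi> (max m n)"
        using mono[of m "max m n"] mono[of n "max m n"] by auto
      then have "(\<lambda>(f, g) x. f x + g x) (f, g) \<in> alg_level \<Phi> (Suc (max m n))"
        unfolding alg_level.simps by blast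
      then show ?case by (intro UN_I[of "Suc (max m n)"]) auto
    next
      case (mult f g)
      then obtain m n where "f \<in> alg_level \<Phi> m" "g \<in> alg_level \<Phi> n" by blast
      then have "(f, g) \<in> alg_level \<Phi> (max m n) \<times> alg_level \<Phi> (max m n)"
        using mono[of m "max m n"] mono[of n "max m n"] by auto
      then have "(\<lambda>(f, g) x. f x * g x) (f, g) \<in> alg_level \<Phi> (Suc (max m n))"
        unfolding alg_level.simps by blast
      then show ?case by (intro UN_I[of "Suc (max m n)"]) auto
    qed
  qed
  have "countable (alg_level \<Phi> n)" for n
    by (induction n) (use assms in auto)
  then show "countable (\<Union>n. alg_level \<Phi> n)" by auto
qed

context conductances
begin

lemma dirichlet_cong: "(\<And>x y. x \<in> V \<Longrightarrow> y \<in> V \<Longrightarrow> (u x - u y)\<^sup>2 \<le> K * (f x - f y)\<^sup>2 + L * (g x - g y)\<^sup>2) \<Longrightarrow>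
  dirichlet u \<le> K * dirichlet f + L * dirichlet g"
proof -
  assume *: "\<And>x y. x \<in> V \<Longrightarrow> y \<in> V \<Longrightarrow> (u x - u y)\<^sup>2 \<le> K * (f x - f y)\<^sup>2 + L * (g x - g y)\<^sup>2"
  have "dirichlet u \<le> (\<Sum>x\<in>V. \<Sum>y\<in>V. K * (c x y * (f x - f y)\<^sup>2) + L * (c x y * (g x - g y)\<^sup>2))"
    unfolding dirichlet_def
  proof (intro sum_mono)
    fix x y assume "x \<in> V" "y \<in> V"
    from mult_left_mono[OF *[OF this] c_nonneg[of x y]]
    show "c x y * (u x - u y)\<^sup>2 \<le> K * (c x y * (f x - f y)\<^sup>2) + L * (c x y * (g x - g y)\<^sup>2)"
      by (simp add: algebra_simps)
  qed
  also have "\<dots> = K * dirichlet f + L * dirichlet g"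
    by (simp only: dirichlet_def sum.distrib sum_distrib_left)
  finally show ?thesis .
qed

lemma dirichlet_add: "dirichlet (\<lambda>x. f x + g x) \<le> 2 * dirichlet f + 2 * dirichlet g"
proof (rule dirichlet_cong)
  fix x y
  have "(p + q)\<^sup>2 \<le> 2 * p\<^sup>2 + 2 * q\<^sup>2" for p q :: real
    using sum_squares_bound[of p q] by (simp add: power2_sum)
  from this[of "f x - f y" "g x - g y"]
  show "(f x + g x - (f y + g y))\<^sup>2 \<le> 2 * (f x - f y)\<^sup>2 + 2 * (g x - g y)\<^sup>2"
    by (simp add: algebra_simps)
qed

text \<open>Discrete Leibniz rule with one factor taken at each end point. It is why bounds on the
  functions are carried along with their energies through the algebra.\<close>

lemma dirichlet_mult:
  assumes "\<And>x. x \<in> V \<Longrightarrow> \<bar>f x\<bar> \<le> A" "\<And>x. x \<in> V \<Longrightarrow> \<bar>g x\<bar> \<le> B"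
  shows "dirichlet (\<lambda>x. f x * g x) \<le> (2 * B\<^sup>2) * dirichlet f + (2 * A\<^sup>2) * dirichlet g"
proof (rule dirichlet_cong)
  fix x y assume xy: "x \<in> V" "y \<in> V"
  have "(p + q)\<^sup>2 \<le> 2 * p\<^sup>2 + 2 * q\<^sup>2" for p q :: real
    using sum_squares_bound[of p q] by (simp add: power2_sum)
  note sq = this[of "g y * (f x - f y)" "f x * (g x - g y)"]
  have "f x * g x - f y * g y = g y * (f x - f y) + f x * (g x - g y)" by (simp add: algebra_simps)
  then have "(f x * g x - f y * g y)\<^sup>2 \<le> 2 * (g y)\<^sup>2 * (f x - f y)\<^sup>2 + 2 * (f x)\<^sup>2 * (g x - g y)\<^sup>2"
    using sq by (simp only: power_mult_distrib mult.assoc)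
  also have "\<dots> \<le> 2 * B\<^sup>2 * (f x - f y)\<^sup>2 + 2 * A\<^sup>2 * (g x - g y)\<^sup>2"
  proof -
    have "(g y)\<^sup>2 \<le> B\<^sup>2" "(f x)\<^sup>2 \<le> A\<^sup>2"
      using assms xy by (simp_all add: abs_le_square_iff[symmetric] order_trans[OF _ abs_ge_self])
    then show ?thesis by (intro add_mono mult_right_mono mult_left_mono) auto
  qed
  finally show "(f x * g x - f y * g y)\<^sup>2 \<le> 2 * B\<^sup>2 * (f x - f y)\<^sup>2 + 2 * A\<^sup>2 * (g x - g y)\<^sup>2" .
qed

end

context grid_domain
begin

lemma dirichlet_edges_le:
  "ch.dirichlet k u \<le> mesh k ^ DIM('a) / (2 * real DIM('a)) * (\<Sum>(x, y)\<in>grid_edges D c1 x0 k. (u x - u y)\<^sup>2)"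
proof -
  have "(\<Sum>x\<in>V k. \<Sum>y\<in>V k. if adj k x y then (u x - u y)\<^sup>2 else 0) =
      (\<Sum>p\<in>V k \<times> V k. if adj k (fst p) (snd p) then (u (fst p) - u (snd p))\<^sup>2 else 0)"
    by (simp add: sum.cartesian_product case_prod_unfold)
  also have "\<dots> = (\<Sum>p\<in>{p\<in>V k \<times> V k. adj k (fst p) (snd p)}. (u (fst p) - u (snd p))\<^sup>2)"
    by (rule sum.inter_filter[symmetric]) (simp add: finite_V)
  also have "\<dots> \<le> (\<Sum>p\<in>grid_edges D c1 x0 k. (u (fst p) - u (snd p))\<^sup>2)"
    using adj_grid_edges by (intro sum_mono2 finite_grid_edges) auto
  finally show ?thesis
    unfolding dirichlet_eq_adj by (intro mult_left_mono) (auto simp: case_prod_unfold)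
qed

lemma TT_continuous:
  assumes "continuous_on D c" "\<And>x. x \<in> D \<Longrightarrow> \<bar>c x\<bar> \<le> B"
  shows "c \<in> TT"
proof (rule TTI[OF _ assms(2)])
  have "c \<in> borel_measurable (restrict_space borel D)"
    by (rule borel_measurable_continuous_on_restrict[OF assms(1)])
  then show "c \<in> borel_measurable (leb D)"
    by (simp cong: measurable_cong_sets add: sets_restrict_space_cong[OF sets_lborel])
  show "AE y in leb D. isCont c y"
    using assms(1) open_D by (intro AE_I2) (simp add: continuous_on_eq_continuous_at)
qed

end

locale good_completion = grid_domain +
  fixes \<phi> :: "nat \<Rightarrow> 'a \<Rightarrow> real" and \<rho> :: "'a \<Rightarrow> 'a \<Rightarrow> real" and \<iota> :: "'a \<Rightarrow> 'b::polish_space"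
  assumes good: "good_functions D c1 x0 \<phi>" and completion: "is_good_completion D \<phi> \<rho> \<iota>"
begin

abbreviation "m \<equiv> ext_lebesgue D \<iota>"
definition core :: "('a \<Rightarrow> real) set" where "core = rat_algebra (range \<phi>)"

lemma metric: "Metric_space D \<rho>" and mtop: "Metric_space.mtopology D \<rho> = top_of_set D"
  and isometric: "\<And>x y. x \<in> D \<Longrightarrow> y \<in> D \<Longrightarrow> dist (\<iota> x) (\<iota> y) = \<rho> x y"
  and compact_UNIV: "compact (UNIV :: 'b set)" and open_range: "open (\<iota> ` D)"
  using completion by (auto simp: is_good_completion_def)

lemma inj_\<iota>: "inj_on \<iota> D"
proof (rule inj_onI)
  fix x y assume xy: "x \<in> D" "y \<in> D" "\<iota> x = \<iota> y"
  then have "\<rho> x y = 0" using isometric by (metis dist_self)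
  then show "x = y" using Metric_space.zero[OF metric] xy by blast
qed

lemma continuous_\<iota>: "continuous_on D \<iota>"
  unfolding continuous_on_iff
proof (intro ballI allI impI)
  fix x and e :: real assume x: "x \<in> D" and e: "e > 0"
  let ?B = "Metric_space.mball D \<rho> x e"
  have "openin (top_of_set D) ?B"
    using Metric_space.openin_mball[OF metric, of x e] by (simp add: mtop)
  moreover have "x \<in> ?B" using Metric_space.centre_in_mball_iff[OF metric] x e by blast
  ultimately obtain d where d: "d > 0" "\<forall>y\<in>D. dist y x < d \<longrightarrow> y \<in> ?B"
    unfolding openin_euclidean_subtopology_iff by blast
  have "dist (\<iota> y) (\<iota> x) < e" if "y \<in> D" "dist y x < d" for y
  proof -
    have "y \<in> ?B" using d(2) that by blast
    then have "\<rho> x y < e" by (simp add: Metric_space.in_mball[OF metric])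
    then show ?thesis using isometric[OF x that(1)] by (simp add: dist_commute)
  qed
  then show "\<exists>d>0. \<forall>y\<in>D. dist y x < d \<longrightarrow> dist (\<iota> y) (\<iota> x) < e" using d(1) by blast
qed

text \<open>\<open>\<iota>\<close> is an isometry onto an open set, so a small ball around an image
  point consists of images of a \<open>\<rho>\<close>-ball.\<close>

lemma open_image:
  assumes "open W" "W \<subseteq> D"
  shows "open (\<iota> ` W)"
  unfolding open_dist
proof
  fix y assume "y \<in> \<iota> ` W"
  then obtain x where x: "x \<in> W" "y = \<iota> x" by blast
  have "openin (top_of_set D) W" using assms by (simp add: openin_open_eq[OF open_D])
  then have "openin (Metric_space.mtopology D \<rho>) W" by (simp only: mtop)
  then obtain e where e: "e > 0" "Metric_space.mball D \<rho> x e \<subseteq> W"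
    using x unfolding Metric_space.openin_mtopology[OF metric] by blast
  have "y \<in> \<iota> ` D" using x assms(2) by blast
  then obtain e' where e': "e' > 0" "\<forall>z. dist z y < e' \<longrightarrow> z \<in> \<iota> ` D"
    using open_range unfolding open_dist by blast
  have "z \<in> \<iota> ` W" if near: "dist z y < min e e'" for z
  proof -
    obtain x' where x': "x' \<in> D" "z = \<iota> x'" using e'(2) near by auto
    have "\<rho> x x' < e" using near x x' isometric[of x x'] assms(2) by (auto simp: dist_commute)
    then have "x' \<in> Metric_space.mball D \<rho> x e"
      using x x' assms(2) by (auto simp: Metric_space.in_mball[OF metric])
    then show ?thesis using e(2) x'(2) by blast
  qed
  then show "\<exists>e>0. \<forall>z. dist z y < e \<longrightarrow> z \<in> \<iota> ` W" using e(1) e'(1) by (intro exI[of _ "min e e'"]) auto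
qed

lemma measurable_\<iota> [measurable]: "\<iota> \<in> leb D \<rightarrow>\<^sub>M borel"
proof -
  have "\<iota> \<in> borel_measurable (restrict_space borel D)"
    by (rule borel_measurable_continuous_on_restrict[OF continuous_\<iota>])
  then show ?thesis
    by (simp cong: measurable_cong_sets add: sets_restrict_space_cong[OF sets_lborel])
qed

lemma sets_m: "sets m = sets borel" and space_m: "space m = UNIV"
  by (simp_all add: ext_lebesgue_def)

lemma measurable_m: "borel_measurable m = borel_measurable borel"
  by (rule measurable_cong_sets) (simp_all add: sets_m)

lemma finite_measure_m: "finite_measure m"
  unfolding ext_lebesgue_def by (rule leb.finite_measure_distr[OF measurable_\<iota>])

lemma integral_m: "f \<in> borel_measurable borel \<Longrightarrow> (\<integral>y. f y \<partial>m) = (\<integral>x. f (\<iota> x) \<partial>leb D)" for f :: "'b \<Rightarrow> real"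
  unfolding ext_lebesgue_def by (rule integral_distr[OF measurable_\<iota>])

lemma L2_m_iff: "f \<in> L2 m \<longleftrightarrow> f \<in> borel_measurable borel \<and> (\<lambda>x. f (\<iota> x)) \<in> L2 (leb D)"
proof -
  have "integrable m (\<lambda>y. (f y)\<^sup>2) \<longleftrightarrow> integrable (leb D) (\<lambda>x. (f (\<iota> x))\<^sup>2)" if "f \<in> borel_measurable borel"
    unfolding ext_lebesgue_def using that by (intro integrable_distr_eq measurable_\<iota>) measurable
  moreover have "(\<lambda>x. f (\<iota> x)) \<in> borel_measurable (leb D)" if "f \<in> borel_measurable borel"
    by (rule measurable_compose[OF measurable_\<iota> that])
  ultimately show ?thesis by (auto simp: L2_def measurable_m)
qed

lemma norm_L2_m: "f \<in> borel_measurable borel \<Longrightarrow> norm_L2 m f = norm_L2 (leb D) (\<lambda>x. f (\<iota> x))"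
  unfolding norm_L2_def by (subst integral_m) auto

lemma AE_m_eq:
  fixes f g :: "'b \<Rightarrow> real"
  assumes [measurable]: "f \<in> borel_measurable borel" "g \<in> borel_measurable borel"
  shows "(AE y in m. f y = g y) \<longleftrightarrow> (AE x in leb D. f (\<iota> x) = g (\<iota> x))"
  unfolding ext_lebesgue_def by (rule AE_distr_iff[OF measurable_\<iota>]) measurable

text \<open>Extension by zero off the image of \<open>D\<close>, a null set for
  \<open>m\<close>.\<close>

definition lift :: "('a \<Rightarrow> real) \<Rightarrow> 'b \<Rightarrow> real" where
  "lift q y = indicator (\<iota> ` D) y *\<^sub>R q (inv_into D \<iota> y)"

lemma lift_\<iota>: "x \<in> D \<Longrightarrow> lift q (\<iota> x) = q x"
  by (simp add: lift_def inv_into_f_f[OF inj_\<iota>])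

lemma lift_measurable:
  assumes q: "q \<in> borel_measurable (leb D)"
  shows "lift q \<in> borel_measurable borel"
proof -
  \<comment> \<open>Preimages under the inverse are images under \<open>\<iota>\<close>, hence open
    by \<open>open_image\<close>.\<close>
  have "continuous_on (\<iota> ` D) (inv_into D \<iota>)"
    unfolding continuous_on_open_vimage[OF open_range]
  proof (intro allI impI)
    fix B :: "'a set" assume "open B"
    have "inv_into D \<iota> -` B \<inter> \<iota> ` D = \<iota> ` (B \<inter> D)"
      using inv_into_f_f[OF inj_\<iota>] by auto
    then show "open (inv_into D \<iota> -` B \<inter> \<iota> ` D)"
      using \<open>open B\<close> open_D by (simp add: open_image open_Int)
  qed
  then have "inv_into D \<iota> \<in> restrict_space borel (\<iota> ` D) \<rightarrow>\<^sub>M borel"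
    by (rule borel_measurable_continuous_on_restrict)
  then have "inv_into D \<iota> \<in> restrict_space borel (\<iota> ` D) \<rightarrow>\<^sub>M lborel" by simp
  then have "inv_into D \<iota> \<in> restrict_space borel (\<iota> ` D) \<rightarrow>\<^sub>M leb D"
    by (intro measurable_restrict_space2) (auto simp: space_restrict_space inv_into_into)
  from measurable_compose[OF this q]
  have "(\<lambda>y. q (inv_into D \<iota> y)) \<in> borel_measurable (restrict_space borel (\<iota> ` D))" .
  then show ?thesis
    unfolding lift_def using open_range by (subst (asm) borel_measurable_restrict_space_iff) auto
qed

lemma pull_TT:
  fixes f :: "'b \<Rightarrow> real"
  assumes f: "continuous_on UNIV f" "bounded (range f)"
  shows "(\<lambda>x. f (\<iota> x)) \<in> TT"
proof -
  obtain B where B: "\<And>y. \<bar>f y\<bar> \<le> B" using f(2) by (auto simp: bounded_iff)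
  have "continuous_on D (\<lambda>x. f (\<iota> x))"
    by (rule continuous_on_compose2[OF f(1) continuous_\<iota>]) auto
  then show ?thesis using B by (rule TT_continuous)
qed

text \<open>Read off from regularity of the Dirichlet form: its domain is dense in L2, and within
  the domain continuous functions are dense for energy plus squared norm, where the nonnegative
  energy may be dropped.\<close>

lemma continuous_dense:
  assumes f: "f \<in> L2 m" and e: "e > 0"
  shows "\<exists>g. continuous_on UNIV g \<and> bounded (range g) \<and> norm_L2 m (\<lambda>y. f y - g y) < e"
proof -
  let ?F = "{f \<in> borel_measurable borel. f \<circ> \<iota> \<in> W12 D}"
  let ?E = "\<lambda>f g. energy D (f \<circ> \<iota>) (g \<circ> \<iota>)"
  have reg: "regular_dirichlet_form m ?F ?E" using completion by (simp add: is_good_completion_def)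
  have dir: "dirichlet_form m ?F ?E" using reg by (simp add: regular_dirichlet_form_def)
  have e2: "e/2 > 0" "(e/2)\<^sup>2 > 0" using e by auto
  have "\<forall>f\<in>L2 m. \<forall>e>0. \<exists>g\<in>?F. norm_L2 m (\<lambda>x. f x - g x) < e"
    using dir unfolding dirichlet_form_def by (elim conjE)
  then obtain h where h: "h \<in> ?F" "norm_L2 m (\<lambda>y. f y - h y) < e/2" using f e2(1) by blast
  have "\<forall>f\<in>?F. \<forall>e>0. \<exists>g\<in>?F \<inter> Cc.
        ?E (\<lambda>x. f x - g x) (\<lambda>x. f x - g x) + (norm_L2 m (\<lambda>x. f x - g x))\<^sup>2 < e"
    using reg unfolding regular_dirichlet_form_def by (elim conjE)
  then obtain g where g: "g \<in> ?F" "g \<in> Cc" "?E (\<lambda>x. h x - g x) (\<lambda>x. h x - g x) + (norm_L2 m (\<lambda>x. h x - g x))\<^sup>2 < (e/2)\<^sup>2"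
    using h(1) e2(2) by blast
  have "?E (\<lambda>x. h x - g x) (\<lambda>x. h x - g x) \<ge> 0" by (simp add: energy_def)
  then have "(norm_L2 m (\<lambda>x. h x - g x))\<^sup>2 < (e/2)\<^sup>2" using g(3) by linarith
  then have hg: "norm_L2 m (\<lambda>x. h x - g x) < e/2" by (rule power_less_imp_less_base) (use e in simp)
  have FL2: "?F \<subseteq> L2 m" using dir unfolding dirichlet_form_def by (elim conjE)
  have "norm_L2 m (\<lambda>y. f y - g y) < e"
    using norm_L2_triangle_diff[OF f subsetD[OF FL2 h(1)] subsetD[OF FL2 g(1)]] h(2) hg by simp
  moreover have gc: "continuous_on UNIV g" using g(2) by (simp add: Cc_def)
  moreover have "bounded (range g)"
    by (rule compact_imp_bounded[OF compact_continuous_image[OF gc compact_UNIV]])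
  ultimately show ?thesis by blast
qed

lemma core_dense: 
  assumes h: "h \<in> L2 (leb D)" and e: "e > 0"
  shows "\<exists>c\<in>core. norm_L2 (leb D) (\<lambda>x. h x - c x) < e"
proof -
  have lm: "lift h \<in> borel_measurable borel" using h by (intro lift_measurable L2_measurable)
  have lh: "AE x in leb D. lift h (\<iota> x) = h x" by (rule AE_I2) (simp add: lift_\<iota>)
  have hm: "h \<in> borel_measurable (leb D)" using h by (rule L2_measurable)
  have lhm: "(\<lambda>x. lift h (\<iota> x)) \<in> borel_measurable (leb D)" by (rule measurable_compose[OF measurable_\<iota> lm])
  have "(\<lambda>x. lift h (\<iota> x)) \<in> L2 (leb D)"
    by (rule L2_dominated[OF h lhm, of 1]) (use lh in auto)
  then have "lift h \<in> L2 m" using lm by (simp add: L2_m_iff)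
  moreover have "e/2 > 0" using e by simp
  ultimately obtain g where g: "continuous_on UNIV g" "bounded (range g)" "norm_L2 m (\<lambda>y. lift h y - g y) < e/2"
    using continuous_dense by blast
  have gm: "g \<in> borel_measurable borel" by (rule borel_measurable_continuous_onI[OF g(1)])
  define C where "C = sqrt (measure (leb D) (space (leb D)))"
  \<comment> \<open>\<open>C\<close> is the L2 norm of the constant 1, the price of turning a
    uniform error into an L2 error.\<close>
  define \<delta> where "\<delta> = e / (2 * (C + 1))"
  have C: "C \<ge> 0" by (simp add: C_def)
  then have \<delta>: "\<delta> > 0" "\<delta> * C < e/2" using e by (auto simp: \<delta>_def field_simps)
  have clo: "closure {F::'b \<Rightarrow>\<^sub>C real. \<exists>f\<in>rat_algebra (range \<phi>). \<forall>x\<in>D. apply_bcontfun F (\<iota> x) = f x} = UNIV"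
    using completion unfolding is_good_completion_def by (elim conjE)
  have "g \<in> bcontfun" using g(1,2) by (simp add: bcontfun_def)
  then have gG: "apply_bcontfun (Bcontfun g) = g" by (rule Bcontfun_inverse)
  have "Bcontfun g \<in> closure {F::'b \<Rightarrow>\<^sub>C real. \<exists>f\<in>rat_algebra (range \<phi>). \<forall>x\<in>D. apply_bcontfun F (\<iota> x) = f x}"
    unfolding clo by simp
  then obtain F where F: "\<exists>f\<in>rat_algebra (range \<phi>). \<forall>x\<in>D. apply_bcontfun F (\<iota> x) = f x" "dist F (Bcontfun g) < \<delta>"
    unfolding closure_approachable using \<delta>(1) by blast
  then obtain c where c: "c \<in> core" "\<And>x. x \<in> D \<Longrightarrow> apply_bcontfun F (\<iota> x) = c x" by (auto simp: core_def)
  have near: "\<bar>g (\<iota> x) - c x\<bar> \<le> \<delta>" if x: "x \<in> D" for x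
    using dist_bounded[of F "\<iota> x" "Bcontfun g"] F(2) c(2)[OF x] gG by (simp add: dist_real_def)
  have cm: "c \<in> borel_measurable (leb D)"
  proof -
    have "apply_bcontfun F \<in> borel_measurable borel"
      by (intro borel_measurable_continuous_onI continuous_on_apply_bcontfun)
    from measurable_compose[OF measurable_\<iota> this]
    show ?thesis by (rule measurable_cong[THEN iffD1, rotated]) (simp add: c(2))
  qed
  have gL: "(\<lambda>x. g (\<iota> x)) \<in> L2 (leb D)"
  proof -
    obtain B where "\<And>y. \<bar>g y\<bar> \<le> B" using g(2) by (auto simp: bounded_iff)
    then show ?thesis by (intro leb.L2_bounded[of _ B] measurable_compose[OF measurable_\<iota> gm]) auto
  qed
  have gcm: "(\<lambda>x. g (\<iota> x) - c x) \<in> borel_measurable (leb D)"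
    using L2_measurable[OF gL] cm by measurable
  have one: "(\<lambda>x. 1) \<in> L2 (leb D)" by (simp add: L2_def)
  have gc: "norm_L2 (leb D) (\<lambda>x. g (\<iota> x) - c x) \<le> \<bar>\<delta>\<bar> * norm_L2 (leb D) (\<lambda>x. 1)"
    by (rule norm_L2_mono[OF gcm one]) (use near in \<open>auto intro!: AE_I2\<close>)
  have gcL: "(\<lambda>x. g (\<iota> x) - c x) \<in> L2 (leb D)"
    by (rule leb.L2_bounded[OF gcm, of \<delta>]) (use near in \<open>auto intro!: AE_I2\<close>)
  have cL: "c \<in> L2 (leb D)" using L2_diff[OF gL gcL] by simp
  have "norm_L2 (leb D) (\<lambda>x. h x - g (\<iota> x)) = norm_L2 (leb D) (\<lambda>x. lift h (\<iota> x) - g (\<iota> x))"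
    using lh hm lhm L2_measurable[OF gL] by (intro norm_L2_cong_AE) (measurable, auto)
  also have "\<dots> = norm_L2 m (\<lambda>y. lift h y - g y)"
    using lm gm by (intro norm_L2_m[symmetric]) measurable
  finally have "norm_L2 (leb D) (\<lambda>x. h x - g (\<iota> x)) < e/2" using g(3) by simp
  moreover have "norm_L2 (leb D) (\<lambda>x. 1) = C" by (simp add: norm_L2_def C_def)
  ultimately have "norm_L2 (leb D) (\<lambda>x. h x - c x) < e"
    using norm_L2_triangle_diff[OF h gL cL] gc \<delta> by simp
  then show ?thesis using c(1) by blast
qed

text \<open>The three properties must be proved together, since the energy of a product depends on
  the bounds of its factors.\<close>

lemma core_properties:
  assumes "f \<in> core"
  shows "(\<exists>B. \<forall>x\<in>D. \<bar>f x\<bar> \<le> B) \<and> continuous_on D f \<and>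
    (\<exists>K. \<forall>\<^sub>F k in sequentially. ch.dirichlet k f \<le> K * (mesh k)\<^sup>2)"
  using assms unfolding core_def
proof induction
  case (gen f)
  then obtain j where f: "f = \<phi> j" by blast
  have bnd: "bounded (\<phi> j ` D)" and sm: "smooth_on D (\<phi> j)"
    using good by (auto simp: good_functions_def)
  have "Cn_on 0 D (\<phi> j)" using sm unfolding smooth_on_def by blast
  then have cont: "continuous_on D (\<phi> j)" by simp
  let ?a = "\<lambda>k. 2 powi (int k * (2 - int DIM('a))) * (\<Sum>(x, y)\<in>grid_edges D c1 x0 k. (\<phi> j x - \<phi> j y)\<^sup>2)"
  let ?C = "2 * (\<integral>x. (norm (weak_grad D (\<phi> j) x))\<^sup>2 \<partial>leb D)"
  have "limsup (\<lambda>k. ereal (?a k)) \<le> ereal ?C"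
    using good unfolding good_functions_def by blast
  also have "\<dots> < ereal (?C + 1)" by simp
  finally have "\<forall>\<^sub>F k in sequentially. ereal (?a k) < ereal (?C + 1)" by (rule Limsup_lessD)
  then have ev: "\<forall>\<^sub>F k in sequentially. ch.dirichlet k (\<phi> j) \<le> ((?C + 1) / (2 * real DIM('a))) * (mesh k)\<^sup>2"
  proof eventually_elim
    case (elim k)
    \<comment> \<open>The cell volume in \<open>dirichlet\<close> is the scaling factor of the
      limsup condition times \<open>(mesh k)\<^sup>2\<close>, so that condition bounds the energy by
      a multiple of the time step.\<close>
    have p: "mesh k ^ DIM('a) = (mesh k)\<^sup>2 * 2 powi (int k * (2 - int DIM('a)))"
    proof -
      have "2 powi (int k * (2 - int DIM('a))) = (2::real) powi (int (2 * k) - int (k * DIM('a)))"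
        by (simp add: algebra_simps)
      also have "\<dots> = 2 ^ (2 * k) / 2 ^ (k * DIM('a))"
        by (subst power_int_diff) (simp_all only: power_int_of_nat, simp_all)
      finally show ?thesis by (simp add: mesh_def power_divide power_mult[symmetric] mult.commute)
    qed
    have "ch.dirichlet k (\<phi> j) \<le> (mesh k)\<^sup>2 / (2 * real DIM('a)) * ?a k"
      using dirichlet_edges_le[of k "\<phi> j"] unfolding p by (simp add: mult_ac)
    also have "\<dots> \<le> (mesh k)\<^sup>2 / (2 * real DIM('a)) * (?C + 1)"
      using elim by (intro mult_left_mono) auto
    finally show ?case by (simp add: mult_ac)
  qed
  have "\<exists>B. \<forall>x\<in>D. \<bar>\<phi> j x\<bar> \<le> B" using bnd by (auto simp: bounded_iff)
  then show ?case using cont ev unfolding f by (intro conjI) (assumption | rule exI)+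
next
  case (const q)
  have "ch.dirichlet k (\<lambda>x. of_rat q) \<le> 0 * (mesh k)\<^sup>2" for k by (simp add: ch.dirichlet_def)
  then have "\<exists>K. \<forall>\<^sub>F k in sequentially. ch.dirichlet k (\<lambda>x. of_rat q) \<le> K * (mesh k)\<^sup>2"
    by (intro exI[of _ 0] always_eventually allI)
  then show ?case by (auto intro: exI[of _ "\<bar>of_rat q\<bar>"])
next
  case (add f g)
  then obtain A B K L where AB: "\<And>x. x \<in> D \<Longrightarrow> \<bar>f x\<bar> \<le> A" "\<And>x. x \<in> D \<Longrightarrow> \<bar>g x\<bar> \<le> B" and
    cont: "continuous_on D f" "continuous_on D g" and
    KL: "\<forall>\<^sub>F k in sequentially. ch.dirichlet k f \<le> K * (mesh k)\<^sup>2"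
      "\<forall>\<^sub>F k in sequentially. ch.dirichlet k g \<le> L * (mesh k)\<^sup>2" by blast
  have "\<forall>\<^sub>F k in sequentially. ch.dirichlet k (\<lambda>x. f x + g x) \<le> (2 * K + 2 * L) * (mesh k)\<^sup>2"
    using KL
  proof eventually_elim
    case (elim k)
    have "ch.dirichlet k (\<lambda>x. f x + g x) \<le> 2 * (K * (mesh k)\<^sup>2) + 2 * (L * (mesh k)\<^sup>2)"
      using ch.dirichlet_add[of k f g] elim by linarith
    then show ?case by (simp add: algebra_simps)
  qed
  moreover have "\<bar>f x + g x\<bar> \<le> A + B" if "x \<in> D" for x
    using AB(1)[OF that] AB(2)[OF that] by linarith
  moreover have "continuous_on D (\<lambda>x. f x + g x)" using cont by (intro continuous_intros)
  ultimately show ?case by blast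
next
  case (mult f g)
  then obtain A B K L where AB: "\<And>x. x \<in> D \<Longrightarrow> \<bar>f x\<bar> \<le> A" "\<And>x. x \<in> D \<Longrightarrow> \<bar>g x\<bar> \<le> B" and
    cont: "continuous_on D f" "continuous_on D g" and
    KL: "\<forall>\<^sub>F k in sequentially. ch.dirichlet k f \<le> K * (mesh k)\<^sup>2"
      "\<forall>\<^sub>F k in sequentially. ch.dirichlet k g \<le> L * (mesh k)\<^sup>2" by blast
  have "\<forall>\<^sub>F k in sequentially. ch.dirichlet k (\<lambda>x. f x * g x) \<le> (2 * B\<^sup>2 * K + 2 * A\<^sup>2 * L) * (mesh k)\<^sup>2"
    using KL
  proof eventually_elim
    case (elim k)
    have "ch.dirichlet k (\<lambda>x. f x * g x) \<le> 2 * B\<^sup>2 * ch.dirichlet k f + 2 * A\<^sup>2 * ch.dirichlet k g"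
      using AB V_D by (intro ch.dirichlet_mult) auto
    also have "\<dots> \<le> 2 * B\<^sup>2 * (K * (mesh k)\<^sup>2) + 2 * A\<^sup>2 * (L * (mesh k)\<^sup>2)"
      using elim by (intro add_mono mult_left_mono) auto
    finally show ?case by (simp add: algebra_simps)
  qed
  moreover have "\<bar>f x * g x\<bar> \<le> A * B" if "x \<in> D" for x
    unfolding abs_mult using AB(1)[OF that] AB(2)[OF that] by (intro mult_mono) auto
  moreover have "continuous_on D (\<lambda>x. f x * g x)" using cont by (intro continuous_intros)
  ultimately show ?case by blast
qed

sublocale grid_core D c1 x0 core
proof
  show "core \<subseteq> TT"
  proof
    fix f assume "f \<in> core"
    then obtain B where "\<And>x. x \<in> D \<Longrightarrow> \<bar>f x\<bar> \<le> B" "continuous_on D f" using core_properties by blast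
    then show "f \<in> TT" by (intro TT_continuous)
  qed
  show "\<exists>c\<in>core. norm_L2 (leb D) (\<lambda>x. h x - c x) < e" if "h \<in> L2 (leb D)" "e > 0" for h e
    using that by (rule core_dense)
  show "countable core" unfolding core_def by (intro countable_rat_algebra) simp
  show "\<exists>K. \<forall>\<^sub>F k in sequentially. ch.dirichlet k c \<le> K * (mesh k)\<^sup>2" if "c \<in> core" for c
    using core_properties[OF that] by blast
qed

end

section \<open>The limit process\<close>

text \<open>Closed sets are stable under intersection and generate the Borel sets; the indicator of
  a closed set is the limit of the bounded continuous functions
  \<open>max 0 (1 - n * infdist x C)\<close>.\<close>

lemma finite_measure_eqI_continuous:
  fixes M N :: "'b::metric_space measure"
  assumes M: "finite_measure M" "sets M = sets borel" and N: "finite_measure N" "sets N = sets borel"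
    and eq: "\<And>f :: 'b \<Rightarrow> real. continuous_on UNIV f \<Longrightarrow> bounded (range f) \<Longrightarrow> (\<integral>x. f x \<partial>M) = (\<integral>x. f x \<partial>N)"
  shows "M = N"
proof (rule measure_eqI_generator_eq[of "Collect closed" UNIV M N "\<lambda>_. UNIV"])
  interpret M: finite_measure M by (rule M)
  interpret N: finite_measure N by (rule N)
  have spM: "space M = UNIV" and spN: "space N = UNIV"
    using sets_eq_imp_space_eq[OF M(2)] sets_eq_imp_space_eq[OF N(2)] by auto
  show "Int_stable (Collect closed :: 'b set set)" by (auto simp: Int_stable_def)
  show "sets M = sigma_sets UNIV (Collect closed)" "sets N = sigma_sets UNIV (Collect closed)"
    using M(2) N(2) by (simp_all add: borel_eq_closed)
  show "emeasure M UNIV \<noteq> \<infinity>" using M.emeasure_finite[of UNIV] by simp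
  show "emeasure M C = emeasure N C" if "C \<in> Collect closed" for C
  proof (cases "C = {}")
    case False
    have C: "closed C" using that by simp
    define f where "f n x = max 0 (1 - real n * infdist x C)" for n x
    have fc: "continuous_on UNIV (f n)" for n unfolding f_def by (intro continuous_intros)
    have f01: "0 \<le> f n x \<and> f n x \<le> 1" for n x unfolding f_def using infdist_nonneg[of x C] by auto
    have fb: "bounded (range (f n))" for n
      using f01[of n] by (auto simp: bounded_iff intro!: exI[of _ 1])
    have lim: "(\<lambda>n. f n x) \<longlonglongrightarrow> indicator C x" for x
    proof (cases "x \<in> C")
      case True
      then show ?thesis by (simp add: f_def)
    next
      case False
      then have "infdist x C > 0"
        using in_closed_iff_infdist_zero[OF C \<open>C \<noteq> {}\<close>, of x] infdist_nonneg[of x C] by linarith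
      then obtain n0 where n0: "1 < real n0 * infdist x C" using reals_Archimedean3 by blast
      have "f n x = 0" if "n \<ge> n0" for n
      proof -
        have "real n0 * infdist x C \<le> real n * infdist x C"
          using that infdist_nonneg[of x C] by (intro mult_right_mono) auto
        then show ?thesis using n0 by (simp add: f_def)
      qed
      then have "\<forall>\<^sub>F n in sequentially. f n x = 0" by (rule eventually_sequentiallyI)
      then show ?thesis using False by (simp add: tendsto_eventually)
    qed
    have conv: "(\<lambda>n. \<integral>x. f n x \<partial>L) \<longlonglongrightarrow> measure L C" if L: "finite_measure L" "sets L = sets borel" for L
    proof -
      interpret L: finite_measure L by (rule L)
      have CL: "C \<in> sets L" using C L(2) by simp
      have "(\<lambda>n. \<integral>x. f n x \<partial>L) \<longlonglongrightarrow> (\<integral>x. indicator C x \<partial>L)"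
      proof (rule integral_dominated_convergence[where w = "\<lambda>_. 1"])
        show "f n \<in> borel_measurable L" for n
          using borel_measurable_continuous_onI[OF fc] measurable_cong_sets[OF L(2) refl] by blast
        show "(\<lambda>x. indicator C x :: real) \<in> borel_measurable L" using CL by measurable
        show "AE x in L. norm (f n x) \<le> 1" for n using f01 by (intro AE_I2) auto
      qed (use lim in auto)
      then show ?thesis using CL by (simp add: sets.Int_space_eq2)
    qed
    have "measure M C = measure N C"
      using conv[OF M] conv[OF N] eq[OF fc fb] by (simp add: LIMSEQ_unique)
    then show ?thesis by (simp add: M.emeasure_eq_measure N.emeasure_eq_measure)
  qed simp
qed auto

lemma tendsto_of_diff_bound:
  fixes a b :: "nat \<Rightarrow> real"
  assumes "\<And>n. \<bar>a n - l\<bar> \<le> b n" "b \<longlonglongrightarrow> 0"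
  shows "a \<longlonglongrightarrow> l"
  by (rule LIM_zero_cancel, rule Lim_null_comparison[OF _ assms(2)]) (simp add: assms(1))

lemma weakly_converges_subseq:
  "weakly_converges S \<mu> \<nu> \<Longrightarrow> strict_mono s \<Longrightarrow> weakly_converges S (\<lambda>n. \<mu> (s n)) \<nu>"
  unfolding weakly_converges_def using LIMSEQ_subseq_LIMSEQ by (auto simp: o_def)

context grid_domain
begin

lemma reversible_walk_grid:
  assumes w: "simple_random_walk M (V k) (adj k) (wgt k) Y"
  shows "reversible_walk (V k) (cond k) M Y"
proof -
  have fin: "finite_measure M" using w by (simp add: simple_random_walk_def)
  interpret finite_measure M by (rule fin)
  have prob: "ch.prob k x y = (if adj k x y then 1 / real (degree_of (adj k) x) else 0)" for x y
  proof (cases "adj k x y")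
    case True
    have "finite {y. adj k x y}" using adj_nbs finite_nbs finite_subset by metis
    then have "degree_of (adj k) x > 0" unfolding degree_of_def using True by (subst card_gt_0_iff) auto
    then show ?thesis
      using True DIM_positive[where 'a='a] unfolding ch.prob_def ch_wt wgt_eq cond_def by simp
  next
    case False
    then show ?thesis by (simp add: ch.prob_def cond_def)
  qed
  show ?thesis
  proof
    show "Y j \<in> M \<rightarrow>\<^sub>M count_space (V k)" for j using w by (simp add: simple_random_walk_def)
    show "measure M {\<omega> \<in> space M. Y 0 \<omega> = x} = ch.wt k x" if "x \<in> V k" for x
      using w that by (simp add: simple_random_walk_def ch_wt)
    show "measure M {\<omega> \<in> space M. (\<forall>i\<le>n. Y i \<omega> = x i) \<and> Y (Suc n) \<omega> = y} =
        measure M {\<omega> \<in> space M. \<forall>i\<le>n. Y i \<omega> = x i} * ch.prob k (x n) y"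
      if "x \<in> {..n} \<rightarrow> V k" "y \<in> V k" for n x y
      using w that unfolding simple_random_walk_def prob by blast
  qed
qed

end

text \<open>\<open>rs\<close> is the sequence after thinning: along it both the discrete semigroups
  and the laws of the walks converge, which is all that the rest of the argument uses about
  \<open>k\<close>.\<close>

locale walk_limit = good_completion D c1 x0 \<phi> \<rho> \<iota>
  for D :: "'a::euclidean_space set" and c1 x0 \<phi> \<rho> and \<iota> :: "'a \<Rightarrow> 'b::polish_space" +
  fixes rs :: "nat \<Rightarrow> nat" and \<Omega> :: "nat \<Rightarrow> 'w measure" and X :: "nat \<Rightarrow> nat \<Rightarrow> 'w \<Rightarrow> 'a"
    and T :: real and PP :: "'p measure" and Xt :: "'p \<Rightarrow> real \<Rightarrow> 'b"
  assumes T: "T > 0"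
    and semigroup: "L2_semigroup (\<lambda>n. ch.N (rs n)) (leb D) TT (\<lambda>n. ch.steps (rs n)) (\<lambda>n. (mesh (rs n))\<^sup>2) core"
    and walks: "\<And>n. reversible_walk (V (rs n)) (cond (rs n)) (\<Omega> n) (X n)"
    and fin_PP: "finite_measure PP" and Xt: "Xt \<in> PP \<rightarrow>\<^sub>M skorokhod_borel T"
    and limit: "weakly_converges (skorokhod_topology T)
      (\<lambda>n. walk_law T \<iota> (rs n) (\<Omega> n) (X n)) (distr PP (skorokhod_borel T) Xt)"
begin

sublocale sg: L2_semigroup "\<lambda>n. ch.N (rs n)" "leb D" TT "\<lambda>n. ch.steps (rs n)" "\<lambda>n. (mesh (rs n))\<^sup>2" core
  by (rule semigroup)

sublocale PP: finite_measure PP by (rule fin_PP)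

abbreviation "Q \<equiv> sg.Q"

lemma cadlag_Xt: "\<omega> \<in> space PP \<Longrightarrow> Xt \<omega> \<in> cadlag T"
  using measurable_space[OF Xt] T by (simp add: space_skorokhod_borel)

lemma Xt_measurable: "t \<in> {0..T} \<Longrightarrow> (\<lambda>\<omega>. Xt \<omega> t) \<in> PP \<rightarrow>\<^sub>M borel"
  by (rule measurable_compose[OF Xt eval_measurable[OF T]])

lemma iterated_steps_eq: "ch.iterated_steps (rs n) s l = sg.iter n s l"
  by (induction l arbitrary: s) auto

text \<open>The map \<open>\<theta>\<close> relocates the listed times, so that the same list
  describes the original and the shifted distributions.\<close>

definition fdd :: "(real \<Rightarrow> real) \<Rightarrow> (real \<times> ('b \<Rightarrow> real)) list \<Rightarrow> real" where
  "fdd \<theta> tfs = (\<integral>x. iterated_semigroup Q 0 (map (\<lambda>(t, f). (\<theta> t, \<lambda>x. f (\<iota> x))) tfs) x \<partial>leb D)"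

lemma two_pow_mesh: "2^(2*k) * t = t / (mesh k)\<^sup>2"
  by (simp add: mesh_def power_divide power_mult[symmetric] mult.commute)

text \<open>The averaged functional of the walk has two limits: weak convergence gives its
  expectation under the limit process, strong convergence of the semigroups gives the average of
  nested products. Equating them avoids evaluating the limit process at a fixed time.\<close>

lemma avg_identity:
  assumes g: "good_list T tfs" and srt: "sorted (map fst tfs)" and \<epsilon>: "\<epsilon> > 0"
  shows "(\<integral>\<omega>. avg T tfs \<epsilon> (Xt \<omega>) \<partial>PP) = (\<integral>s. fdd (\<lambda>t. min (t + \<epsilon> * s) T) tfs \<partial>leb {0..1})"
    and "(\<lambda>s. fdd (\<lambda>t. min (t + \<epsilon> * s) T) tfs) \<in> borel_measurable (leb {0..1})"
proof -
  interpret U: finite_measure "leb {0..1::real}" by (rule finite_measure_unit)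
  define I where "I n s = (\<integral>x. ch.iterated_steps (rs n) 0
      (map (\<lambda>(t, f). (nat \<lfloor>2^(2*rs n) * min (t + \<epsilon> * s) T\<rfloor>, \<lambda>x. f (\<iota> x))) tfs) x \<partial>ch.N (rs n))" for n s
  obtain B where B: "B \<ge> 0" "\<And>y. \<bar>\<Prod>(t, f)\<leftarrow>tfs. f (y t)\<bar> \<le> B" using good_list_bounded[OF g] by blast
  have I1: "(\<integral>w. avg T tfs \<epsilon> w \<partial>walk_law T \<iota> (rs n) (\<Omega> n) (X n)) = (\<integral>s. I n s \<partial>leb {0..1})" for n
    unfolding I_def by (rule reversible_walk.integral_avg_walk(1)[OF walks T g srt \<epsilon>])
  have I2: "I n \<in> borel_measurable (leb {0..1})" for n
    unfolding I_def[abs_def] by (rule reversible_walk.integral_avg_walk(2)[OF walks T g srt \<epsilon>])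
  have I3: "\<bar>I n s\<bar> \<le> B * measure (ch.N (rs n)) (space (ch.N (rs n)))" if "s \<in> {0..1}" for n s
    unfolding I_def by (rule reversible_walk.integral_avg_walk(3)[OF walks T g srt \<epsilon> that B(2)])
  have "(\<lambda>n. \<integral>x. (1::real) \<partial>ch.N (rs n)) \<longlonglongrightarrow> (\<integral>x. (1::real) \<partial>leb D)"
    by (rule sg.TT_integral[OF sg.TT_one])
  \<comment> \<open>The total masses converge to the volume of \<open>D\<close>, hence are bounded;
    this yields the dominating constant.\<close>
  then have "Bseq (\<lambda>n. \<integral>x. (1::real) \<partial>ch.N (rs n))" by (intro convergent_imp_Bseq) (auto simp: convergent_def)
  then obtain C where C: "\<And>n. \<bar>\<integral>x. (1::real) \<partial>ch.N (rs n)\<bar> \<le> C" by (auto simp: Bseq_def)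
  then have mass: "measure (ch.N (rs n)) (space (ch.N (rs n))) \<le> C" for n using C[of n] by simp
  have lim: "(\<lambda>n. I n s) \<longlonglongrightarrow> fdd (\<lambda>t. min (t + \<epsilon> * s) T) tfs" if s: "s \<in> {0..1}" for s
  proof -
    let ?l = "map (\<lambda>(t, f). (min (t + \<epsilon> * s) T, \<lambda>x. f (\<iota> x))) tfs"
    have "sorted_wrt (\<le>) (map fst ?l)"
      using srt unfolding sorted_map sorted_wrt_map by (rule sorted_wrt_mono_rel[rotated]) (auto split: prod.splits)
    moreover have pos: "0 \<le> t" if "t \<in> fst ` set ?l" for t
      using that g s \<epsilon> T by (force simp: good_list_def)
    moreover have "\<forall>t\<in>set (map fst ?l). 0 \<le> t" using pos unfolding set_map by blast
    ultimately have "sorted (0 # map fst ?l)" unfolding sorted_wrt.simps by blast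
    then have "sg.sconv (\<lambda>n. sg.iter n 0 (map (\<lambda>(t, f). (nat \<lfloor>t / (mesh (rs n))\<^sup>2\<rfloor>, f)) ?l)) (iterated_semigroup Q 0 ?l)"
    proof (rule sg.iter_sconv)
      show "f \<in> TT" if "(t, f) \<in> set ?l" for t f
        using that g by (auto simp: good_list_def intro!: pull_TT)
      show "(\<lambda>k. real (nat \<lfloor>t / (mesh (rs k))\<^sup>2\<rfloor>) * (mesh (rs k))\<^sup>2) \<longlonglongrightarrow> t" if "(t, f) \<in> set ?l" for t f
        using pos[of t] that by (intro sg.floor_steps) force
    qed simp
    from sg.sconv_integral[OF this] show ?thesis
      unfolding I_def fdd_def iterated_steps_eq two_pow_mesh by (simp add: o_def case_prod_unfold)
  qed
  have meas: "(\<lambda>s. fdd (\<lambda>t. min (t + \<epsilon> * s) T) tfs) \<in> borel_measurable (leb {0..1})"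
    by (rule borel_measurable_LIMSEQ_metric[OF I2]) (use lim in simp)
  then show "(\<lambda>s. fdd (\<lambda>t. min (t + \<epsilon> * s) T) tfs) \<in> borel_measurable (leb {0..1})" .
  have "(\<lambda>n. \<integral>s. I n s \<partial>leb {0..1}) \<longlonglongrightarrow> (\<integral>s. fdd (\<lambda>t. min (t + \<epsilon> * s) T) tfs \<partial>leb {0..1})"
  proof (rule integral_dominated_convergence[OF meas I2, where w = "\<lambda>_. B * C"])
    show "AE s in leb {0..1}. (\<lambda>n. I n s) \<longlonglongrightarrow> fdd (\<lambda>t. min (t + \<epsilon> * s) T) tfs"
      by (rule AE_I2) (use lim in simp)
    show "AE s in leb {0..1}. norm (I n s) \<le> B * C" for n
    proof (rule AE_I2)
      fix s assume "s \<in> space (leb {0..1::real})"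
      then have "\<bar>I n s\<bar> \<le> B * measure (ch.N (rs n)) (space (ch.N (rs n)))" by (intro I3) simp
      also have "\<dots> \<le> B * C" using B mass by (intro mult_left_mono) auto
      finally show "norm (I n s) \<le> B * C" by simp
    qed
  qed simp
  moreover have "(\<lambda>n. \<integral>s. I n s \<partial>leb {0..1}) \<longlonglongrightarrow> (\<integral>w. avg T tfs \<epsilon> w \<partial>distr PP (skorokhod_borel T) Xt)"
  proof -
    have "bounded (avg T tfs \<epsilon> ` topspace (skorokhod_topology T))"
      using avg_bounded[OF B(2,1)] by (auto simp: bounded_iff)
    with avg_continuous[OF T g \<epsilon>] show ?thesis
      using limit unfolding weakly_converges_def I1[symmetric] by blast
  qed
  ultimately have "(\<integral>w. avg T tfs \<epsilon> w \<partial>distr PP (skorokhod_borel T) Xt) =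
      (\<integral>s. fdd (\<lambda>t. min (t + \<epsilon> * s) T) tfs \<partial>leb {0..1})"
    by (rule LIMSEQ_unique[rotated])
  then show "(\<integral>\<omega>. avg T tfs \<epsilon> (Xt \<omega>) \<partial>PP) = (\<integral>s. fdd (\<lambda>t. min (t + \<epsilon> * s) T) tfs \<partial>leb {0..1})"
    by (simp add: integral_distr[OF Xt avg_measurable[OF T g \<epsilon>]])
qed

lemma list_bound:
  assumes "\<forall>(t, f)\<in>set tfs. bounded (range (f :: 'b \<Rightarrow> real))"
  obtains K where "K \<ge> 0" "\<And>t f y. (t, f) \<in> set tfs \<Longrightarrow> \<bar>f y\<bar> \<le> K"
proof -
  have "\<exists>K\<ge>0. \<forall>(t, f)\<in>set tfs. \<forall>y. \<bar>f y\<bar> \<le> K"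
    using assms
  proof (induction tfs)
    case Nil
    then show ?case by auto
  next
    case (Cons a tfs)
    obtain t f where a: "a = (t, f)" by (cases a)
    obtain K where K: "K \<ge> 0" "\<forall>(t, f)\<in>set tfs. \<forall>y. \<bar>f y\<bar> \<le> K" using Cons by auto
    obtain L where L: "\<And>y. \<bar>f y\<bar> \<le> L" using Cons.prems a by (auto simp: bounded_iff)
    show ?case
      using K L a by (intro exI[of _ "max K L"]) (auto simp: le_max_iff_disj)
  qed
  then show ?thesis using that by blast
qed

lemma fdd_list: "fdd \<theta> tfs = (\<integral>x. iterated_semigroup Q 0 (map (\<lambda>i. (\<theta> (fst i), \<lambda>x. snd i (\<iota> x))) tfs) x \<partial>leb D)"
  unfolding fdd_def by (simp add: case_prod_unfold)

lemma integral_tendsto_of_norm: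
  assumes "\<And>n. u n \<in> L2 (leb D)" "u' \<in> L2 (leb D)" "(\<lambda>n. norm_L2 (leb D) (\<lambda>x. u n x - u' x)) \<longlonglongrightarrow> 0"
  shows "(\<lambda>n. \<integral>x. u n x \<partial>leb D) \<longlonglongrightarrow> (\<integral>x. u' x \<partial>leb D)"
proof (rule tendsto_of_diff_bound)
  let ?C = "sqrt (measure (leb D) (space (leb D)))"
  have "(\<lambda>n. ?C * norm_L2 (leb D) (\<lambda>x. u n x - u' x)) \<longlonglongrightarrow> ?C * 0"
    by (intro tendsto_intros assms)
  then show "(\<lambda>n. ?C * norm_L2 (leb D) (\<lambda>x. u n x - u' x)) \<longlonglongrightarrow> 0" by simp
  show "\<bar>(\<integral>x. u n x \<partial>leb D) - (\<integral>x. u' x \<partial>leb D)\<bar> \<le> ?C * norm_L2 (leb D) (\<lambda>x. u n x - u' x)" for n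
    by (rule leb.L2_integral_diff_le[OF assms(1,2)])
qed

text \<open>The functional \<open>avg\<close> sees the process only at times right of the \<open>t\<close>'s, so right-continuity of
  the paths and strong continuity of \<open>Q\<close> recover the distributions at arbitrary fixed times, including
  the countably many at which the limit may jump with positive probability.\<close>

lemma fdd_continuous:
  assumes g: "good_list T tfs" and srt: "sorted (map fst tfs)"
  shows "(\<integral>\<omega>. (\<Prod>(t, f)\<leftarrow>tfs. f (Xt \<omega> t)) \<partial>PP) = fdd (\<lambda>t. t) tfs"
proof -
  interpret U: finite_measure "leb {0..1::real}" by (rule finite_measure_unit)
  define \<epsilon> where "\<epsilon> n = inverse (real (Suc n))" for n
  have \<epsilon>: "\<epsilon> n > 0" for n by (simp add: \<epsilon>_def)
  have \<epsilon>0: "\<epsilon> \<longlonglongrightarrow> 0" unfolding \<epsilon>_def by (rule LIMSEQ_inverse_real_of_nat)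
  obtain B where B: "B \<ge> 0" "\<And>y. \<bar>\<Prod>(t, f)\<leftarrow>tfs. f (y t)\<bar> \<le> B" using good_list_bounded[OF g] by blast
  have lhs: "(\<lambda>n. \<integral>\<omega>. avg T tfs (\<epsilon> n) (Xt \<omega>) \<partial>PP) \<longlonglongrightarrow> (\<integral>\<omega>. (\<Prod>(t, f)\<leftarrow>tfs. f (Xt \<omega> t)) \<partial>PP)"
  proof (rule integral_dominated_convergence[where w = "\<lambda>_. B"])
    show am: "(\<lambda>\<omega>. avg T tfs (\<epsilon> n) (Xt \<omega>)) \<in> borel_measurable PP" for n
      by (rule measurable_compose[OF Xt avg_measurable[OF T g \<epsilon>]])
    have lim: "(\<lambda>n. avg T tfs (\<epsilon> n) (Xt \<omega>)) \<longlonglongrightarrow> (\<Prod>(t, f)\<leftarrow>tfs. f (Xt \<omega> t))" if "\<omega> \<in> space PP" for \<omega>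
      unfolding \<epsilon>_def by (rule avg_right_limit[OF T g cadlag_Xt[OF that]])
    show "(\<lambda>\<omega>. \<Prod>(t, f)\<leftarrow>tfs. f (Xt \<omega> t)) \<in> borel_measurable PP"
      by (rule borel_measurable_LIMSEQ_metric[OF am lim])
    show "AE \<omega> in PP. (\<lambda>n. avg T tfs (\<epsilon> n) (Xt \<omega>)) \<longlonglongrightarrow> (\<Prod>(t, f)\<leftarrow>tfs. f (Xt \<omega> t))"
      using lim by (rule AE_I2)
    show "AE \<omega> in PP. norm (avg T tfs (\<epsilon> n) (Xt \<omega>)) \<le> B" for n
      using avg_bounded[OF B(2,1)] by (intro AE_I2) simp
  qed simp
  have bdd: "\<forall>(t, f)\<in>set tfs. bounded (range f)" using g by (auto simp: good_list_def)
  obtain K where K: "K \<ge> 0" "\<And>t f y. (t, f) \<in> set tfs \<Longrightarrow> \<bar>f y\<bar> \<le> K" using list_bound[OF bdd] by blast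
  have fm: "(\<lambda>x. snd i (\<iota> x)) \<in> borel_measurable (leb D) \<and> (\<forall>x\<in>space (leb D). \<bar>snd i (\<iota> x)\<bar> \<le> K)" if "i \<in> set tfs" for i
  proof
    have "continuous_on UNIV (snd i)" using g that by (auto simp: good_list_def)
    then show "(\<lambda>x. snd i (\<iota> x)) \<in> borel_measurable (leb D)"
      by (intro measurable_compose[OF measurable_\<iota> borel_measurable_continuous_onI])
    show "\<forall>x\<in>space (leb D). \<bar>snd i (\<iota> x)\<bar> \<le> K" using K(2)[of "fst i" "snd i"] that by simp
  qed
  have t0: "0 \<le> fst i \<and> fst i \<le> T" if "i \<in> set tfs" for i using g that by (auto simp: good_list_def)
  have srt_min: "sorted (0 # map (\<lambda>i. min (fst i + e * s) T) tfs)" if "e \<ge> 0" "s \<ge> 0" for e s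
  proof -
    have "sorted_wrt (\<lambda>i j. min (fst i + e * s) T \<le> min (fst j + e * s) T) tfs"
      using srt unfolding sorted_map by (rule sorted_wrt_mono_rel[rotated]) auto
    moreover have "0 \<le> min (fst i + e * s) T" if "i \<in> set tfs" for i
      using t0[OF that] \<open>e \<ge> 0\<close> \<open>s \<ge> 0\<close> T by simp
    ultimately show ?thesis by (simp add: sorted_map)
  qed
  have L: "iterated_semigroup Q 0 (map (\<lambda>i. (min (fst i + e * s) T, \<lambda>x. snd i (\<iota> x))) tfs) \<in> L2 (leb D) \<and>
      (AE x in leb D. \<bar>iterated_semigroup Q 0 (map (\<lambda>i. (min (fst i + e * s) T, \<lambda>x. snd i (\<iota> x))) tfs) x\<bar> \<le>
        K ^ length (map (\<lambda>i. (min (fst i + e * s) T, \<lambda>x. snd i (\<iota> x))) tfs))"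
    if "e \<ge> 0" "s \<ge> 0" for e s
    by (rule sg.iterated_Q_bounded[OF _ _ K(1)])
      (use srt_min[OF that] fm in \<open>auto simp: o_def intro!: AE_I2\<close>)
  have min_id: "map (\<lambda>i. (min (fst i + 0 * s) T, \<lambda>x. snd i (\<iota> x))) tfs = map (\<lambda>i. (fst i, \<lambda>x. snd i (\<iota> x))) tfs" for s
    using t0 by (intro map_cong refl) simp
  have lim: "(\<lambda>n. fdd (\<lambda>t. min (t + \<epsilon> n * s) T) tfs) \<longlonglongrightarrow> fdd (\<lambda>t. t) tfs" if s: "s \<ge> 0" for s
  proof -
    have "(\<lambda>n. norm_L2 (leb D) (\<lambda>x.
        iterated_semigroup Q 0 (map (\<lambda>i. (min (fst i + \<epsilon> n * s) T, \<lambda>x. snd i (\<iota> x))) tfs) x -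
        iterated_semigroup Q 0 (map (\<lambda>i. (min (fst i + 0 * s) T, \<lambda>x. snd i (\<iota> x))) tfs) x)) \<longlonglongrightarrow> 0"
    proof (rule sg.iterated_Q_tendsto[OF K(1) fm fm])
      show "(\<lambda>n. min (fst i + \<epsilon> n * s) T) \<longlonglongrightarrow> min (fst i + 0 * s) T" for i :: "real \<times> ('b \<Rightarrow> real)"
        by (intro tendsto_intros \<epsilon>0)
      show "sorted (0 # map (\<lambda>i. min (fst i + \<epsilon> n * s) T) tfs)" for n
        using \<epsilon>[of n] s by (intro srt_min) auto
    qed auto
    then have "(\<lambda>n. fdd (\<lambda>t. min (t + \<epsilon> n * s) T) tfs) \<longlonglongrightarrow> fdd (\<lambda>t. min (t + 0 * s) T) tfs"
      unfolding fdd_list using L[of "\<epsilon> _" s] L[of 0 s] \<epsilon> s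
      by (intro integral_tendsto_of_norm) (auto intro: less_imp_le)
    moreover have "fdd (\<lambda>t. min (t + 0 * s) T) tfs = fdd (\<lambda>t. t) tfs"
      unfolding fdd_list min_id ..
    ultimately show ?thesis by simp
  qed
  have bound: "\<bar>fdd (\<lambda>t. min (t + \<epsilon> n * s) T) tfs\<bar> \<le> K ^ length tfs * measure (leb D) (space (leb D))" if s: "s \<ge> 0" for n s
  proof -
    note l = L[OF less_imp_le[OF \<epsilon>[of n]] s]
    have "norm (fdd (\<lambda>t. min (t + \<epsilon> n * s) T) tfs) \<le> (\<integral>x. K ^ length tfs \<partial>leb D)"
      unfolding fdd_list using l
      by (intro order.trans[OF integral_norm_bound] integral_mono_AE integrable_norm leb.L2_integrable[OF conjunct1[OF l]]) auto
    then show ?thesis by (simp add: mult.commute)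
  qed
  have rhs: "(\<lambda>n. \<integral>s. fdd (\<lambda>t. min (t + \<epsilon> n * s) T) tfs \<partial>leb {0..1}) \<longlonglongrightarrow> (\<integral>s. fdd (\<lambda>t. t) tfs \<partial>leb {0..1::real})"
  proof (rule integral_dominated_convergence[where w = "\<lambda>_. K ^ length tfs * measure (leb D) (space (leb D))"])
    show "(\<lambda>s. fdd (\<lambda>t. min (t + \<epsilon> n * s) T) tfs) \<in> borel_measurable (leb {0..1})" for n
      by (rule avg_identity(2)[OF g srt \<epsilon>])
    show "AE s in leb {0..1}. (\<lambda>n. fdd (\<lambda>t. min (t + \<epsilon> n * s) T) tfs) \<longlonglongrightarrow> fdd (\<lambda>t. t) tfs"
      using lim by (intro AE_I2) simp
    show "AE s in leb {0..1}. norm (fdd (\<lambda>t. min (t + \<epsilon> n * s) T) tfs) \<le> K ^ length tfs * measure (leb D) (space (leb D))" for n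
      using bound by (intro AE_I2) simp
  qed simp_all
  have "(\<integral>\<omega>. (\<Prod>(t, f)\<leftarrow>tfs. f (Xt \<omega> t)) \<partial>PP) = (\<integral>s. fdd (\<lambda>t. t) tfs \<partial>leb {0..1::real})"
    using LIMSEQ_unique[OF lhs] rhs by (simp add: avg_identity(1)[OF g srt \<epsilon>])
  then show ?thesis by (simp add: measure_unit)
qed

text \<open>The one-time distribution is the integral of \<open>Q t\<close>, which
  \<open>Q_integral\<close> shows to be independent of \<open>t\<close>. Having it for every
  \<open>t\<close> transfers L2 estimates from \<open>m\<close> to the process.\<close>

lemma distr_Xt:
  assumes t: "t \<in> {0..T}"
  shows "distr PP borel (\<lambda>\<omega>. Xt \<omega> t) = m"
proof (rule finite_measure_eqI_continuous)
  show "finite_measure (distr PP borel (\<lambda>\<omega>. Xt \<omega> t))" by (rule PP.finite_measure_distr[OF Xt_measurable[OF t]])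
  fix f :: "'b \<Rightarrow> real" assume f: "continuous_on UNIV f" "bounded (range f)"
  have fm: "f \<in> borel_measurable borel" by (rule borel_measurable_continuous_onI[OF f(1)])
  have "(\<integral>x. f x \<partial>distr PP borel (\<lambda>\<omega>. Xt \<omega> t)) = (\<integral>\<omega>. f (Xt \<omega> t) \<partial>PP)"
    by (rule integral_distr[OF Xt_measurable[OF t] fm])
  also have "\<dots> = fdd (\<lambda>t. t) [(t, f)]"
    using fdd_continuous[of "[(t, f)]"] f t by (simp add: good_list_def)
  also have "\<dots> = (\<integral>x. f (\<iota> x) \<partial>leb D)"
    using t sg.TT_L2[OF pull_TT[OF f]] by (simp add: fdd_def sg.Q_integral)
  also have "\<dots> = (\<integral>x. f x \<partial>m)" by (rule integral_m[OF fm, symmetric])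
  finally show "(\<integral>x. f x \<partial>distr PP borel (\<lambda>\<omega>. Xt \<omega> t)) = (\<integral>x. f x \<partial>m)" .
qed (simp_all add: finite_measure_m sets_m)

lemma L2_Xt:
  assumes t: "t \<in> {0..T}" and f: "f \<in> L2 m"
  shows "(\<lambda>\<omega>. f (Xt \<omega> t)) \<in> L2 PP" "norm_L2 PP (\<lambda>\<omega>. f (Xt \<omega> t)) = norm_L2 m f"
    "(\<integral>\<omega>. f (Xt \<omega> t) \<partial>PP) = (\<integral>x. f (\<iota> x) \<partial>leb D)"
proof -
  have fm [measurable]: "f \<in> borel_measurable borel" using f by (simp add: L2_m_iff)
  note Xm [measurable] = Xt_measurable[OF t]
  have "integrable (distr PP borel (\<lambda>\<omega>. Xt \<omega> t)) (\<lambda>y. (f y)\<^sup>2)"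
    unfolding distr_Xt[OF t] by (rule L2_integrable_sq[OF f])
  then have "integrable PP (\<lambda>\<omega>. (f (Xt \<omega> t))\<^sup>2)" by (subst (asm) integrable_distr_eq[OF Xm]) measurable
  then show "(\<lambda>\<omega>. f (Xt \<omega> t)) \<in> L2 PP" by (intro L2_I) measurable
  have "(\<integral>y. (f y)\<^sup>2 \<partial>m) = (\<integral>\<omega>. (f (Xt \<omega> t))\<^sup>2 \<partial>PP)"
    unfolding distr_Xt[OF t, symmetric] by (rule integral_distr[OF Xm]) measurable
  then show "norm_L2 PP (\<lambda>\<omega>. f (Xt \<omega> t)) = norm_L2 m f" by (simp add: norm_L2_def)
  have "(\<integral>y. f y \<partial>m) = (\<integral>\<omega>. f (Xt \<omega> t) \<partial>PP)"
    unfolding distr_Xt[OF t, symmetric] by (rule integral_distr[OF Xm fm])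
  then show "(\<integral>\<omega>. f (Xt \<omega> t) \<partial>PP) = (\<integral>x. f (\<iota> x) \<partial>leb D)" by (simp add: integral_m[OF fm])
qed

lemma bounded_L2_m:
  assumes "f \<in> borel_measurable borel" "\<And>y. \<bar>f y\<bar> \<le> K"
  shows "f \<in> L2 m"
  using assms by (intro finite_measure.L2_bounded[OF finite_measure_m, of _ K]) (auto simp: measurable_m)

text \<open>Truncation at \<open>K\<close> restores the sup bound and, being 1-Lipschitz and fixing
  \<open>f\<close>, does not spoil the approximation.\<close>

lemma continuous_approx:
  assumes f: "f \<in> borel_measurable borel" "\<And>y. \<bar>f y\<bar> \<le> K" and K: "K \<ge> 0"
  shows "\<exists>g :: nat \<Rightarrow> 'b \<Rightarrow> real. (\<forall>n. continuous_on UNIV (g n) \<and> (\<forall>y. \<bar>g n y\<bar> \<le> K)) \<and>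
    (\<lambda>n. norm_L2 m (\<lambda>y. g n y - f y)) \<longlonglongrightarrow> 0"
proof -
  have fL: "f \<in> L2 m" by (rule bounded_L2_m[OF f])
  have "\<forall>n. \<exists>g. continuous_on UNIV g \<and> bounded (range g) \<and> norm_L2 m (\<lambda>y. f y - g y) < inverse (real (Suc n))"
    using continuous_dense[OF fL] by simp
  from choice[OF this] obtain g where g: "\<forall>n. continuous_on UNIV (g n) \<and> bounded (range (g n)) \<and>
      norm_L2 m (\<lambda>y. f y - g n y) < inverse (real (Suc n))" by (elim exE)
  define h where "h n y = truncate K (g n y)" for n y
  have hc: "continuous_on UNIV (h n)" for n
    unfolding h_def truncate_def using g by (intro continuous_intros) blast
  have gL: "g n \<in> L2 m" for n
  proof -
    obtain B where "\<And>y. \<bar>g n y\<bar> \<le> B" using g by (auto simp: bounded_iff)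
    then show ?thesis using g by (intro bounded_L2_m borel_measurable_continuous_onI) auto
  qed
  have "norm_L2 m (\<lambda>y. h n y - f y) \<le> inverse (real (Suc n))" for n
  proof -
    have "norm_L2 m (\<lambda>y. truncate K (g n y) - truncate K (f y)) \<le> norm_L2 m (\<lambda>y. g n y - f y)"
      by (rule sg.norm_L2_truncate_le[OF gL fL])
    also have "\<dots> \<le> inverse (real (Suc n))" using g by (simp add: norm_L2_minus[of _ "g n"] less_imp_le)
    finally show ?thesis unfolding h_def using truncate_id[OF f(2)] by simp
  qed
  then have "(\<lambda>n. norm_L2 m (\<lambda>y. h n y - f y)) \<longlonglongrightarrow> 0"
    by (intro tendsto_sandwich[OF _ _ tendsto_const LIMSEQ_inverse_real_of_nat]) auto
  then show ?thesis using hc truncate_bound[OF K] unfolding h_def by (intro exI[of _ h]) (simp add: h_def[abs_def])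
qed

text \<open>Each one-time law is \<open>m\<close>, so approximation in \<open>L2 m\<close> is
  approximation in \<open>L2 PP\<close> factor by factor; the uniform bound \<open>K\<close> lets it
  pass through the product.\<close>

lemma prod_Xt_tendsto:
  assumes K: "K \<ge> 0"
    and i: "\<And>i. i \<in> set tfs \<Longrightarrow> fst i \<in> {0..T} \<and> snd i \<in> borel_measurable borel \<and> (\<forall>y. \<bar>snd i y\<bar> \<le> K)"
    and g: "\<And>i n. i \<in> set tfs \<Longrightarrow> continuous_on UNIV (g i n) \<and> (\<forall>y. \<bar>g i n y\<bar> \<le> K)"
      "\<And>i. i \<in> set tfs \<Longrightarrow> (\<lambda>n. norm_L2 m (\<lambda>y. g i n y - snd i y)) \<longlonglongrightarrow> 0"
  shows "(\<forall>n. (\<lambda>\<omega>. \<Prod>i\<leftarrow>tfs. g i n (Xt \<omega> (fst i))) \<in> L2 PP) \<and>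
    (\<lambda>\<omega>. \<Prod>i\<leftarrow>tfs. snd i (Xt \<omega> (fst i))) \<in> L2 PP \<and>
    (\<forall>\<omega>. \<bar>\<Prod>i\<leftarrow>tfs. snd i (Xt \<omega> (fst i))\<bar> \<le> K ^ length tfs) \<and>
    (\<lambda>n. norm_L2 PP (\<lambda>\<omega>. (\<Prod>i\<leftarrow>tfs. g i n (Xt \<omega> (fst i))) - (\<Prod>i\<leftarrow>tfs. snd i (Xt \<omega> (fst i))))) \<longlonglongrightarrow> 0"
  using i g
proof (induction tfs)
  case Nil
  then show ?case by (simp add: L2_def)
next
  case (Cons a tfs)
  have IH: "(\<forall>n. (\<lambda>\<omega>. \<Prod>i\<leftarrow>tfs. g i n (Xt \<omega> (fst i))) \<in> L2 PP) \<and>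
    (\<lambda>\<omega>. \<Prod>i\<leftarrow>tfs. snd i (Xt \<omega> (fst i))) \<in> L2 PP \<and>
    (\<forall>\<omega>. \<bar>\<Prod>i\<leftarrow>tfs. snd i (Xt \<omega> (fst i))\<bar> \<le> K ^ length tfs) \<and>
    (\<lambda>n. norm_L2 PP (\<lambda>\<omega>. (\<Prod>i\<leftarrow>tfs. g i n (Xt \<omega> (fst i))) - (\<Prod>i\<leftarrow>tfs. snd i (Xt \<omega> (fst i))))) \<longlonglongrightarrow> 0"
    by (rule Cons.IH) (use Cons.prems in auto)
  have a: "fst a \<in> {0..T}" "snd a \<in> borel_measurable borel" "\<And>y. \<bar>snd a y\<bar> \<le> K" using Cons.prems(1)[of a] by auto
  have ga: "g a n \<in> borel_measurable borel" "\<And>y. \<bar>g a n y\<bar> \<le> K" for n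
    using Cons.prems(2)[of a n] by (auto intro: borel_measurable_continuous_onI)
  have sL: "snd a \<in> L2 m" by (rule bounded_L2_m[OF a(2,3)])
  have gL: "g a n \<in> L2 m" for n by (rule bounded_L2_m[OF ga])
  note sP = L2_Xt(1)[OF a(1) sL] and gP = L2_Xt(1)[OF a(1) gL]
  have lim: "(\<lambda>n. norm_L2 PP (\<lambda>\<omega>. g a n (Xt \<omega> (fst a)) - snd a (Xt \<omega> (fst a)))) \<longlonglongrightarrow> 0"
    using Cons.prems(3)[of a] by (simp add: L2_Xt(2)[OF a(1) L2_diff[OF gL sL]])
  have "(\<lambda>n. norm_L2 PP (\<lambda>\<omega>. g a n (Xt \<omega> (fst a)) * (\<Prod>i\<leftarrow>tfs. g i n (Xt \<omega> (fst i))) -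
      snd a (Xt \<omega> (fst a)) * (\<Prod>i\<leftarrow>tfs. snd i (Xt \<omega> (fst i))))) \<longlonglongrightarrow> 0"
    by (rule L2_mult_tendsto[OF gP sP lim, of K _ _ "K ^ length tfs"]) (use IH ga in auto)
  moreover have "(\<lambda>\<omega>. g a n (Xt \<omega> (fst a)) * (\<Prod>i\<leftarrow>tfs. g i n (Xt \<omega> (fst i)))) \<in> L2 PP" for n
    by (rule L2_bounded_mult[OF _ L2_measurable[OF gP], of _ _ K]) (use IH ga in auto)
  moreover have "(\<lambda>\<omega>. snd a (Xt \<omega> (fst a)) * (\<Prod>i\<leftarrow>tfs. snd i (Xt \<omega> (fst i)))) \<in> L2 PP"
    by (rule L2_bounded_mult[OF _ L2_measurable[OF sP], of _ K]) (use IH a in auto)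
  moreover have "\<bar>snd a (Xt \<omega> (fst a)) * (\<Prod>i\<leftarrow>tfs. snd i (Xt \<omega> (fst i)))\<bar> \<le> K ^ length (a # tfs)" for \<omega>
    using a(3)[of "Xt \<omega> (fst a)"] IH K by (auto simp: abs_mult intro!: mult_mono)
  ultimately show ?case by simp
qed

text \<open>Bounded Borel factors are approximated in L2 by continuous ones with the same bound, and
  both sides of \<open>fdd_continuous\<close> are stable under this approximation.\<close>

lemma fdd_bounded:
  assumes srt: "sorted (map fst tfs)"
    and tfs: "\<forall>(t, f)\<in>set tfs. t \<in> {0..T} \<and> f \<in> borel_measurable borel \<and> bounded (range f)"
  shows "(\<integral>\<omega>. (\<Prod>(t, f)\<leftarrow>tfs. f (Xt \<omega> t)) \<partial>PP) = fdd (\<lambda>t. t) tfs"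
proof -
  have bdd: "\<forall>(t, f)\<in>set tfs. bounded (range f)" using tfs by auto
  obtain K where K: "K \<ge> 0" "\<And>t f y. (t, f) \<in> set tfs \<Longrightarrow> \<bar>f y\<bar> \<le> K" using list_bound[OF bdd] by blast
  have i: "fst i \<in> {0..T} \<and> snd i \<in> borel_measurable borel \<and> (\<forall>y. \<bar>snd i y\<bar> \<le> K)" if "i \<in> set tfs" for i
    using tfs K(2)[of "fst i" "snd i"] that by auto
  have "\<forall>i\<in>set tfs. \<exists>g :: nat \<Rightarrow> 'b \<Rightarrow> real. (\<forall>n. continuous_on UNIV (g n) \<and> (\<forall>y. \<bar>g n y\<bar> \<le> K)) \<and>
    (\<lambda>n. norm_L2 m (\<lambda>y. g n y - snd i y)) \<longlonglongrightarrow> 0"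
    using i K(1) by (intro ballI continuous_approx) auto
  from bchoice[OF this] obtain g :: "real \<times> ('b \<Rightarrow> real) \<Rightarrow> nat \<Rightarrow> 'b \<Rightarrow> real" where
    g: "\<forall>i\<in>set tfs. (\<forall>n. continuous_on UNIV (g i n) \<and> (\<forall>y. \<bar>g i n y\<bar> \<le> K)) \<and>
      (\<lambda>n. norm_L2 m (\<lambda>y. g i n y - snd i y)) \<longlonglongrightarrow> 0" by (elim exE)
  have gm: "g i n \<in> borel_measurable borel" if "i \<in> set tfs" for i n
    using g that by (auto intro: borel_measurable_continuous_onI)
  let ?l = "\<lambda>n. map (\<lambda>i. (fst i, g i n)) tfs"
  have eq: "(\<integral>\<omega>. (\<Prod>i\<leftarrow>tfs. g i n (Xt \<omega> (fst i))) \<partial>PP) = fdd (\<lambda>t. t) (?l n)" for n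
  proof -
    have "bounded (range (g i n))" if "i \<in> set tfs" for i using g that by (auto simp: bounded_iff)
    then have "good_list T (?l n)" using g i by (auto simp: good_list_def)
    moreover have "sorted (map fst (?l n))" using srt by (simp add: o_def)
    ultimately show ?thesis using fdd_continuous[of "?l n"] by (simp add: o_def)
  qed
  have prod: "(\<forall>n. (\<lambda>\<omega>. \<Prod>i\<leftarrow>tfs. g i n (Xt \<omega> (fst i))) \<in> L2 PP) \<and>
    (\<lambda>\<omega>. \<Prod>i\<leftarrow>tfs. snd i (Xt \<omega> (fst i))) \<in> L2 PP \<and>
    (\<forall>\<omega>. \<bar>\<Prod>i\<leftarrow>tfs. snd i (Xt \<omega> (fst i))\<bar> \<le> K ^ length tfs) \<and>
    (\<lambda>n. norm_L2 PP (\<lambda>\<omega>. (\<Prod>i\<leftarrow>tfs. g i n (Xt \<omega> (fst i))) - (\<Prod>i\<leftarrow>tfs. snd i (Xt \<omega> (fst i))))) \<longlonglongrightarrow> 0"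
    by (rule prod_Xt_tendsto[OF K(1) i]) (use g in auto)
  have lhs: "(\<lambda>n. \<integral>\<omega>. (\<Prod>i\<leftarrow>tfs. g i n (Xt \<omega> (fst i))) \<partial>PP) \<longlonglongrightarrow> (\<integral>\<omega>. (\<Prod>i\<leftarrow>tfs. snd i (Xt \<omega> (fst i))) \<partial>PP)"
  proof (rule tendsto_of_diff_bound)
    let ?C = "sqrt (measure PP (space PP))"
    let ?N = "\<lambda>n. norm_L2 PP (\<lambda>\<omega>. (\<Prod>i\<leftarrow>tfs. g i n (Xt \<omega> (fst i))) - (\<Prod>i\<leftarrow>tfs. snd i (Xt \<omega> (fst i))))"
    have "(\<lambda>n. ?C * ?N n) \<longlonglongrightarrow> ?C * 0" using prod by (intro tendsto_intros) blast
    then show "(\<lambda>n. ?C * ?N n) \<longlonglongrightarrow> 0" by simp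
    show "\<bar>(\<integral>\<omega>. (\<Prod>i\<leftarrow>tfs. g i n (Xt \<omega> (fst i))) \<partial>PP) - (\<integral>\<omega>. (\<Prod>i\<leftarrow>tfs. snd i (Xt \<omega> (fst i))) \<partial>PP)\<bar> \<le> ?C * ?N n" for n
      using prod by (intro PP.L2_integral_diff_le) blast+
  qed
  have srt0: "sorted (0 # map fst tfs)" using srt i by auto
  have pm: "(\<lambda>x. f (\<iota> x)) \<in> borel_measurable (leb D)" if "f \<in> borel_measurable borel" for f :: "'b \<Rightarrow> real"
    by (rule measurable_compose[OF measurable_\<iota> that])
  have rhs: "(\<lambda>n. fdd (\<lambda>t. t) (?l n)) \<longlonglongrightarrow> fdd (\<lambda>t. t) tfs"
  proof -
    have 1: "(\<lambda>n. norm_L2 (leb D) (\<lambda>x.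
        iterated_semigroup Q 0 (map (\<lambda>i. (fst i, \<lambda>x. g i n (\<iota> x))) tfs) x -
        iterated_semigroup Q 0 (map (\<lambda>i. (fst i, \<lambda>x. snd i (\<iota> x))) tfs) x)) \<longlonglongrightarrow> 0"
    proof (rule sg.iterated_Q_tendsto[OF K(1)])
      fix j assume j: "j \<in> set tfs"
      show "(\<lambda>x. g j n (\<iota> x)) \<in> borel_measurable (leb D) \<and> (\<forall>x\<in>space (leb D). \<bar>g j n (\<iota> x)\<bar> \<le> K)" for n
        using pm[OF gm[OF j]] g j by blast
      show "(\<lambda>x. snd j (\<iota> x)) \<in> borel_measurable (leb D) \<and> (\<forall>x\<in>space (leb D). \<bar>snd j (\<iota> x)\<bar> \<le> K)"
        using pm i[OF j] by blast
      have dm: "(\<lambda>y. g j n y - snd j y) \<in> borel_measurable borel" for n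
        using gm[OF j] i[OF j] by (intro borel_measurable_diff) auto
      have "(\<lambda>n. norm_L2 m (\<lambda>y. g j n y - snd j y)) \<longlonglongrightarrow> 0" using g j by blast
      then show "(\<lambda>n. norm_L2 (leb D) (\<lambda>x. g j n (\<iota> x) - snd j (\<iota> x))) \<longlonglongrightarrow> 0"
        by (simp only: norm_L2_m[OF dm])
    qed (use srt0 in auto)
    have bdd_L2: "iterated_semigroup Q 0 (map (\<lambda>i. (fst i, \<lambda>x. h i (\<iota> x))) tfs) \<in> L2 (leb D)"
      if h: "\<And>i. i \<in> set tfs \<Longrightarrow> h i \<in> borel_measurable borel \<and> (\<forall>y. \<bar>h i y\<bar> \<le> K)" for h
    proof (rule conjunct1[OF sg.iterated_Q_bounded[OF _ _ K(1)]])
      show "sorted (0 # map fst (map (\<lambda>i. (fst i, \<lambda>x. h i (\<iota> x))) tfs))" using srt0 by (simp add: o_def)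
      fix t u assume "(t, u) \<in> set (map (\<lambda>i. (fst i, \<lambda>x. h i (\<iota> x))) tfs)"
      then obtain i where i: "i \<in> set tfs" "u = (\<lambda>x. h i (\<iota> x))" by auto
      show "u \<in> borel_measurable (leb D) \<and> (AE x in leb D. \<bar>u x\<bar> \<le> K)"
        unfolding i(2) using h[OF i(1)] by (intro conjI pm AE_I2) auto
    qed
    have 2: "iterated_semigroup Q 0 (map (\<lambda>i. (fst i, \<lambda>x. g i n (\<iota> x))) tfs) \<in> L2 (leb D)" for n
      by (rule bdd_L2) (use g gm in blast)
    have 3: "iterated_semigroup Q 0 (map (\<lambda>i. (fst i, \<lambda>x. snd i (\<iota> x))) tfs) \<in> L2 (leb D)"
      by (rule bdd_L2) (use i in blast)
    show ?thesis
      using integral_tendsto_of_norm[OF 2 3 1] unfolding fdd_list by (simp add: o_def)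
  qed
  have "(\<integral>\<omega>. (\<Prod>i\<leftarrow>tfs. snd i (Xt \<omega> (fst i))) \<partial>PP) = fdd (\<lambda>t. t) tfs"
    using LIMSEQ_unique[OF lhs] rhs by (simp add: eq)
  then show ?thesis by (simp add: case_prod_unfold)
qed

text \<open>\<open>Q\<close> transported to the completion. The value 0 outside the image of
  \<open>D\<close> is a choice on a null set.\<close>

definition P :: "real \<Rightarrow> ('b \<Rightarrow> real) \<Rightarrow> 'b \<Rightarrow> real" where
  "P t f = lift (Q t (\<lambda>x. f (\<iota> x)))"

lemma P_\<iota>: "x \<in> D \<Longrightarrow> P t f (\<iota> x) = Q t (\<lambda>x. f (\<iota> x)) x"
  by (simp add: P_def lift_\<iota>)

lemma P_\<iota>_AE: "AE x in leb D. P t f (\<iota> x) = Q t (\<lambda>x. f (\<iota> x)) x"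
  by (rule AE_I2) (simp add: P_\<iota>)

lemma pull_L2: "f \<in> L2 m \<Longrightarrow> (\<lambda>x. f (\<iota> x)) \<in> L2 (leb D)"
  by (simp add: L2_m_iff)

lemma L2_m_borel: "f \<in> L2 m \<Longrightarrow> f \<in> borel_measurable borel"
  by (simp add: L2_m_iff)

lemma P_L2:
  assumes f: "f \<in> L2 m" and t: "0 \<le> t"
  shows "P t f \<in> L2 m"
proof -
  have Q: "Q t (\<lambda>x. f (\<iota> x)) \<in> L2 (leb D)" by (rule sg.Q_L2[OF pull_L2[OF f] t])
  have Pm: "P t f \<in> borel_measurable borel" unfolding P_def by (rule lift_measurable[OF L2_measurable[OF Q]])
  have "(\<lambda>x. P t f (\<iota> x)) \<in> L2 (leb D)"
    by (rule L2_dominated[OF Q measurable_compose[OF measurable_\<iota> Pm], of 1])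
      (use P_\<iota>_AE[of t f] in auto)
  then show ?thesis using Pm by (simp add: L2_m_iff)
qed

lemma integral_m_L2: "f \<in> L2 m \<Longrightarrow> (\<integral>y. f y \<partial>m) = (\<integral>x. f (\<iota> x) \<partial>leb D)"
  by (rule integral_m[OF L2_m_borel])

lemma integral_leb_cong: "(\<And>x. x \<in> D \<Longrightarrow> f x = g x) \<Longrightarrow> (\<integral>x. f x \<partial>leb D) = (\<integral>x. g x \<partial>leb D)" for f g :: "'a \<Rightarrow> real"
  by (rule Bochner_Integration.integral_cong) auto

lemma symmetric_semigroup_P: "symmetric_semigroup m P"
  unfolding symmetric_semigroup_def
proof (intro conjI allI impI ballI)
  show "P t f \<in> L2 m" if "0 \<le> t" "f \<in> L2 m" for t f using that by (intro P_L2)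
  show "AE x in m. P t f x = P t g x" if t: "0 \<le> t" and fg: "f \<in> L2 m" "g \<in> L2 m" "AE x in m. f x = g x" for t f g
  proof -
    have "AE x in leb D. f (\<iota> x) = g (\<iota> x)"
      using fg AE_m_eq[OF L2_m_borel L2_m_borel, of f g] by blast
    from sg.Q_cong[OF pull_L2[OF fg(1)] pull_L2[OF fg(2)] this t] P_\<iota>_AE[of t f] P_\<iota>_AE[of t g]
    have "AE x in leb D. P t f (\<iota> x) = P t g (\<iota> x)" by eventually_elim simp
    then show ?thesis
      using AE_m_eq[OF L2_m_borel[OF P_L2[OF fg(1) t]] L2_m_borel[OF P_L2[OF fg(2) t]]] by blast
  qed
  show "AE x in m. P t (\<lambda>x. a * f x + g x) x = a * P t f x + P t g x"
    if t: "0 \<le> t" and fg: "f \<in> L2 m" "g \<in> L2 m" for t f g a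
  proof -
    have L: "(\<lambda>x. a * f x + g x) \<in> L2 m" by (rule L2_lin[OF fg])
    have R: "(\<lambda>x. a * P t f x + P t g x) \<in> L2 m" by (rule L2_lin[OF P_L2[OF fg(1) t] P_L2[OF fg(2) t]])
    from sg.Q_lin[OF pull_L2[OF fg(1)] pull_L2[OF fg(2)] t, of a] P_\<iota>_AE[of t f] P_\<iota>_AE[of t g]
      P_\<iota>_AE[of t "\<lambda>x. a * f x + g x"]
    have "AE x in leb D. P t (\<lambda>x. a * f x + g x) (\<iota> x) = a * P t f (\<iota> x) + P t g (\<iota> x)"
      by eventually_elim simp
    then show ?thesis
      using AE_m_eq[OF L2_m_borel[OF P_L2[OF L t]] L2_m_borel[OF R]] by blast
  qed
  show "AE x in m. P 0 f x = f x" if f: "f \<in> L2 m" for f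
  proof -
    from sg.Q_0[OF pull_L2[OF f]] P_\<iota>_AE[of 0 f] have "AE x in leb D. P 0 f (\<iota> x) = f (\<iota> x)"
      by eventually_elim simp
    then show ?thesis using AE_m_eq[OF L2_m_borel[OF P_L2[OF f order_refl]] L2_m_borel[OF f]] by blast
  qed
  show "AE x in m. P (s + t) f x = P s (P t f) x" if st: "0 \<le> s" "0 \<le> t" and f: "f \<in> L2 m" for s t f
  proof -
    have st': "0 \<le> s + t" using st by simp
    note Pt = P_L2[OF f st(2)]
    have "AE x in leb D. Q s (\<lambda>x. P t f (\<iota> x)) x = Q s (Q t (\<lambda>x. f (\<iota> x))) x"
      by (rule sg.Q_cong[OF pull_L2[OF Pt] sg.Q_L2[OF pull_L2[OF f] st(2)] P_\<iota>_AE st(1)])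
    with sg.Q_add[OF pull_L2[OF f] st] P_\<iota>_AE[of "s + t" f] P_\<iota>_AE[of s "P t f"]
    have "AE x in leb D. P (s + t) f (\<iota> x) = P s (P t f) (\<iota> x)" by eventually_elim simp
    then show ?thesis
      using AE_m_eq[OF L2_m_borel[OF P_L2[OF f st']] L2_m_borel[OF P_L2[OF Pt st(1)]]] by blast
  qed
  show "(\<integral>x. P t f x * g x \<partial>m) = (\<integral>x. f x * P t g x \<partial>m)"
    if t: "0 \<le> t" and fg: "f \<in> L2 m" "g \<in> L2 m" for t f g
  proof -
    have "(\<integral>x. P t f x * g x \<partial>m) = (\<integral>x. P t f (\<iota> x) * g (\<iota> x) \<partial>leb D)"
      using L2_m_borel[OF P_L2[OF fg(1) t]] L2_m_borel[OF fg(2)] by (intro integral_m) measurable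
    also have "\<dots> = (\<integral>x. Q t (\<lambda>x. f (\<iota> x)) x * g (\<iota> x) \<partial>leb D)"
      by (rule integral_leb_cong) (simp add: P_\<iota>)
    also have "\<dots> = (\<integral>x. f (\<iota> x) * Q t (\<lambda>x. g (\<iota> x)) x \<partial>leb D)"
      by (rule sg.Q_symmetric[OF pull_L2[OF fg(1)] pull_L2[OF fg(2)] t])
    also have "\<dots> = (\<integral>x. f (\<iota> x) * P t g (\<iota> x) \<partial>leb D)"
      by (rule integral_leb_cong) (simp add: P_\<iota>)
    also have "\<dots> = (\<integral>x. f x * P t g x \<partial>m)"
      using L2_m_borel[OF P_L2[OF fg(2) t]] L2_m_borel[OF fg(1)] by (intro integral_m[symmetric]) measurable
    finally show ?thesis .
  qed
qed

lemma P_integral: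
  assumes f: "f \<in> L2 m" and t: "0 \<le> t"
  shows "(\<integral>x. P t f x \<partial>m) = (\<integral>x. f x \<partial>m)"
proof -
  have "(\<integral>x. P t f x \<partial>m) = (\<integral>x. Q t (\<lambda>x. f (\<iota> x)) x \<partial>leb D)"
    unfolding integral_m_L2[OF P_L2[OF f t]] by (rule integral_leb_cong) (simp add: P_\<iota>)
  also have "\<dots> = (\<integral>x. f x \<partial>m)"
    unfolding sg.Q_integral[OF pull_L2[OF f] t] by (rule integral_m_L2[OF f, symmetric])
  finally show ?thesis .
qed

text \<open>\<open>Q\<close> respects equality only almost everywhere, so the nested products are
  matched by induction through \<open>Q_cong\<close> rather than by rewriting; membership in L2 is
  carried along because \<open>Q_cong\<close> asks for it.\<close>

lemma iterated_P:
  assumes "sorted (s # map fst tfs)"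
    and "\<forall>(t, f)\<in>set tfs. f \<in> borel_measurable borel \<and> bounded (range f)"
  shows "iterated_semigroup P s tfs \<in> L2 m \<and>
    (AE x in leb D. iterated_semigroup P s tfs (\<iota> x) =
       iterated_semigroup Q s (map (\<lambda>(t, f). (t, \<lambda>x. f (\<iota> x))) tfs) x)"
  using assms
proof (induction tfs arbitrary: s)
  case Nil
  then show ?case by (auto intro!: bounded_L2_m[of _ 1])
next
  case (Cons a tfs)
  obtain t f where a: "a = (t, f)" by (cases a)
  let ?l = "map (\<lambda>(t, f). (t, \<lambda>x. f (\<iota> x))) tfs"
  have IH: "iterated_semigroup P t tfs \<in> L2 m"
    "AE x in leb D. iterated_semigroup P t tfs (\<iota> x) = iterated_semigroup Q t ?l x"
    using Cons.IH[of t] Cons.prems a by auto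
  have st: "0 \<le> t - s" using Cons.prems(1) a by simp
  have fb: "f \<in> borel_measurable borel" using Cons.prems(2) a by simp
  obtain K where K: "\<And>y. \<bar>f y\<bar> \<le> K" using Cons.prems(2) a by (auto simp: bounded_iff)
  have L: "(\<lambda>y. f y * iterated_semigroup P t tfs y) \<in> L2 m"
    by (rule L2_bounded_mult[OF IH(1), of _ K]) (use fb K in \<open>auto simp: measurable_m\<close>)
  have ae: "AE x in leb D. f (\<iota> x) * iterated_semigroup P t tfs (\<iota> x) = f (\<iota> x) * iterated_semigroup Q t ?l x"
    using IH(2) by eventually_elim simp
  have bdd: "\<forall>(t, f)\<in>set tfs. bounded (range f)" using Cons.prems(2) by auto
  obtain K' where K': "K' \<ge> 0" "\<And>t f y. (t, f) \<in> set tfs \<Longrightarrow> \<bar>f y\<bar> \<le> K'" using list_bound[OF bdd] by blast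
  have "iterated_semigroup Q t ?l \<in> L2 (leb D)"
  proof (rule conjunct1[OF sg.iterated_Q_bounded[OF _ _ K'(1)]])
    show "sorted (t # map fst ?l)" using Cons.prems(1) a by (simp add: o_def case_prod_unfold)
    fix q h assume "(q, h) \<in> set ?l"
    then obtain h' where h': "(q, h') \<in> set tfs" "h = (\<lambda>x. h' (\<iota> x))" by auto
    then have "h' \<in> borel_measurable borel" using Cons.prems(2) by auto
    then show "h \<in> borel_measurable (leb D) \<and> (AE x in leb D. \<bar>h x\<bar> \<le> K')"
      using K'(2)[OF h'(1)] unfolding h'(2) by (auto intro: measurable_compose[OF measurable_\<iota>])
  qed
  then have LQ: "(\<lambda>x. f (\<iota> x) * iterated_semigroup Q t ?l x) \<in> L2 (leb D)"
    by (rule L2_bounded_mult[of _ _ _ K]) (use K in \<open>auto intro: measurable_compose[OF measurable_\<iota> fb]\<close>)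
  have "AE x in leb D. P (t - s) (\<lambda>y. f y * iterated_semigroup P t tfs y) (\<iota> x) =
      Q (t - s) (\<lambda>x. f (\<iota> x) * iterated_semigroup Q t ?l x) x"
    using P_\<iota>_AE[of "t - s" "\<lambda>y. f y * iterated_semigroup P t tfs y"] sg.Q_cong[OF pull_L2[OF L] LQ ae st]
    by eventually_elim simp
  then show ?case using P_L2[OF L st] by (simp add: a)
qed

lemma iterated_P_integral:
  assumes srt: "sorted (map fst tfs)"
    and tfs: "\<forall>(t, f)\<in>set tfs. t \<in> {0..T} \<and> f \<in> borel_measurable borel \<and> bounded (range f)"
  shows "(\<integral>\<omega>. (\<Prod>(t, f)\<leftarrow>tfs. f (Xt \<omega> t)) \<partial>PP) = (\<integral>x. iterated_semigroup P 0 tfs x \<partial>m)"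
proof -
  have it: "iterated_semigroup P 0 tfs \<in> L2 m \<and>
    (AE x in leb D. iterated_semigroup P 0 tfs (\<iota> x) =
       iterated_semigroup Q 0 (map (\<lambda>(t, f). (t, \<lambda>x. f (\<iota> x))) tfs) x)"
    by (rule iterated_P) (use srt tfs in auto)
  have bdd: "\<forall>(t, f)\<in>set tfs. bounded (range f)" using tfs by auto
  obtain K where K: "K \<ge> 0" "\<And>t f y. (t, f) \<in> set tfs \<Longrightarrow> \<bar>f y\<bar> \<le> K" using list_bound[OF bdd] by blast
  let ?l = "map (\<lambda>(t, f). (t, \<lambda>x. f (\<iota> x))) tfs"
  have LQ: "iterated_semigroup Q 0 ?l \<in> L2 (leb D)"
  proof (rule conjunct1[OF sg.iterated_Q_bounded[OF _ _ K(1)]])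
    have "sorted (0 # map fst tfs)" using srt tfs by auto
    then show "sorted (0 # map fst ?l)" by (simp add: o_def case_prod_unfold)
    fix q h assume "(q, h) \<in> set ?l"
    then obtain h' where h': "(q, h') \<in> set tfs" "h = (\<lambda>x. h' (\<iota> x))" by auto
    then have "h' \<in> borel_measurable borel" using tfs by auto
    then show "h \<in> borel_measurable (leb D) \<and> (AE x in leb D. \<bar>h x\<bar> \<le> K)"
      using K(2)[OF h'(1)] unfolding h'(2) by (auto intro: measurable_compose[OF measurable_\<iota>])
  qed
  have "(\<integral>x. iterated_semigroup P 0 tfs x \<partial>m) = (\<integral>x. iterated_semigroup P 0 tfs (\<iota> x) \<partial>leb D)"
    using it by (intro integral_m_L2) blast
  also have "\<dots> = (\<integral>x. iterated_semigroup Q 0 ?l x \<partial>leb D)"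
    using it LQ by (intro integral_cong_AE) (auto intro: L2_measurable pull_L2)
  also have "\<dots> = fdd (\<lambda>t. t) tfs" by (simp add: fdd_def)
  finally show ?thesis using fdd_bounded[OF srt tfs] by simp
qed

text \<open>The two-time law is known for bounded factors; truncating \<open>f\<close> at level
  \<open>n\<close> and letting \<open>n\<close> grow reaches all of \<open>L2 m\<close>.
  Cauchy-Schwarz controls both sides, with contractivity of \<open>Q\<close> on the right.\<close>

lemma two_times:
  assumes t: "t \<in> {0..T}" and g: "g \<in> borel_measurable borel" "\<And>y. \<bar>g y\<bar> \<le> K" and f: "f \<in> L2 m"
  shows "(\<integral>\<omega>. g (Xt \<omega> 0) * f (Xt \<omega> t) \<partial>PP) = (\<integral>\<omega>. g (Xt \<omega> 0) * P t f (Xt \<omega> 0) \<partial>PP)"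
proof -
  have t0: "0 \<le> t" and z: "0 \<in> {0..T}" using t T by auto
  have gL: "g \<in> L2 m" by (rule bounded_L2_m[OF g])
  define h where "h n y = truncate (real n) (f y)" for n y
  have hm: "h n \<in> borel_measurable borel" for n
    unfolding h_def using L2_m_borel[OF f] by measurable
  have hb: "\<bar>h n y\<bar> \<le> real n" for n y unfolding h_def by (rule truncate_bound) simp
  have hL: "h n \<in> L2 m" for n by (rule bounded_L2_m[OF hm hb])
  \<comment> \<open>The list starts at time 0, and the outer \<open>Q 0\<close> of the nested
    product disappears under the integral by \<open>Q_integral\<close>.\<close>
  have eq: "(\<integral>\<omega>. g (Xt \<omega> 0) * h n (Xt \<omega> t) \<partial>PP) = (\<integral>x. g (\<iota> x) * Q t (\<lambda>x. h n (\<iota> x)) x \<partial>leb D)" for n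
  proof -
    have "bounded (range g)" "bounded (range (h n))" using g(2) hb by (auto simp: bounded_iff)
    then have "(\<integral>\<omega>. (\<Prod>(t, f)\<leftarrow>[(0, g), (t, h n)]. f (Xt \<omega> t)) \<partial>PP) = fdd (\<lambda>t. t) [(0, g), (t, h n)]"
      using t t0 z g(1) hm by (intro fdd_bounded) auto
    moreover have "(\<lambda>x. g (\<iota> x) * Q t (\<lambda>x. h n (\<iota> x)) x) \<in> L2 (leb D)"
      by (rule L2_bounded_mult[OF sg.Q_L2[OF pull_L2[OF hL] t0], of _ K])
        (use g in \<open>auto intro: measurable_compose[OF measurable_\<iota>]\<close>)
    ultimately show ?thesis by (simp add: fdd_def sg.Q_integral)
  qed
  have lim: "(\<lambda>n. norm_L2 m (\<lambda>y. h n y - f y)) \<longlonglongrightarrow> 0"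
  proof -
    have "(\<lambda>n. \<integral>y. (h n y - f y)\<^sup>2 \<partial>m) \<longlonglongrightarrow> (\<integral>y. 0 \<partial>m)"
    proof (rule integral_dominated_convergence[where w = "\<lambda>y. (f y)\<^sup>2"])
      show "(\<lambda>y. (h n y - f y)\<^sup>2) \<in> borel_measurable m" for n
        unfolding measurable_m using hm L2_m_borel[OF f] by measurable
      show "integrable m (\<lambda>y. (f y)\<^sup>2)" by (rule L2_integrable_sq[OF f])
      show "AE y in m. (\<lambda>n. (h n y - f y)\<^sup>2) \<longlonglongrightarrow> 0"
      proof (rule AE_I2)
        fix y
        have "(h n y - f y)\<^sup>2 = 0" if "n \<ge> nat \<lceil>\<bar>f y\<bar>\<rceil>" for n
        proof -
          have "\<bar>f y\<bar> \<le> real n" using that by linarith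
          then show ?thesis by (simp add: h_def truncate_id)
        qed
        then have "\<forall>\<^sub>F n in sequentially. (h n y - f y)\<^sup>2 = 0" by (rule eventually_sequentiallyI)
        then show "(\<lambda>n. (h n y - f y)\<^sup>2) \<longlonglongrightarrow> 0" by (rule tendsto_eventually)
      qed
      show "AE y in m. norm ((h n y - f y)\<^sup>2) \<le> (f y)\<^sup>2" for n
      proof (rule AE_I2)
        fix y
        have "\<bar>h n y - f y\<bar> \<le> \<bar>f y\<bar>" by (auto simp: h_def truncate_def max_def min_def)
        then show "norm ((h n y - f y)\<^sup>2) \<le> (f y)\<^sup>2" by (simp add: abs_le_square_iff)
      qed
    qed simp
    from tendsto_real_sqrt[OF this] show ?thesis by (simp add: norm_L2_def)
  qed
  have lhs: "(\<lambda>n. \<integral>\<omega>. g (Xt \<omega> 0) * h n (Xt \<omega> t) \<partial>PP) \<longlonglongrightarrow> (\<integral>\<omega>. g (Xt \<omega> 0) * f (Xt \<omega> t) \<partial>PP)"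
  proof (rule tendsto_of_diff_bound)
    have "(\<lambda>n. norm_L2 m g * norm_L2 m (\<lambda>y. h n y - f y)) \<longlonglongrightarrow> norm_L2 m g * 0"
      by (intro tendsto_intros lim)
    then show "(\<lambda>n. norm_L2 m g * norm_L2 m (\<lambda>y. h n y - f y)) \<longlonglongrightarrow> 0" by simp
    show "\<bar>(\<integral>\<omega>. g (Xt \<omega> 0) * h n (Xt \<omega> t) \<partial>PP) - (\<integral>\<omega>. g (Xt \<omega> 0) * f (Xt \<omega> t) \<partial>PP)\<bar> \<le> norm_L2 m g * norm_L2 m (\<lambda>y. h n y - f y)" for n
    proof -
      note G = L2_Xt(1)[OF z gL] and H = L2_Xt(1)[OF t hL[of n]] and F = L2_Xt(1)[OF t f]
      have "(\<integral>\<omega>. g (Xt \<omega> 0) * h n (Xt \<omega> t) \<partial>PP) - (\<integral>\<omega>. g (Xt \<omega> 0) * f (Xt \<omega> t) \<partial>PP) =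
          (\<integral>\<omega>. g (Xt \<omega> 0) * (h n (Xt \<omega> t) - f (Xt \<omega> t)) \<partial>PP)"
        using L2_integrable_mult[OF G H] L2_integrable_mult[OF G F] by (simp add: right_diff_distrib)
      then show "\<bar>(\<integral>\<omega>. g (Xt \<omega> 0) * h n (Xt \<omega> t) \<partial>PP) - (\<integral>\<omega>. g (Xt \<omega> 0) * f (Xt \<omega> t) \<partial>PP)\<bar> \<le>
          norm_L2 m g * norm_L2 m (\<lambda>y. h n y - f y)"
        using L2_Cauchy_Schwarz[OF G L2_diff[OF H F]]
        by (simp add: L2_Xt(2)[OF z gL] L2_Xt(2)[OF t L2_diff[OF hL f]] abs_mult)
    qed
  qed
  have rhs: "(\<lambda>n. \<integral>x. g (\<iota> x) * Q t (\<lambda>x. h n (\<iota> x)) x \<partial>leb D) \<longlonglongrightarrow> (\<integral>x. g (\<iota> x) * Q t (\<lambda>x. f (\<iota> x)) x \<partial>leb D)"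
  proof (rule tendsto_of_diff_bound)
    have "(\<lambda>n. norm_L2 m g * norm_L2 m (\<lambda>y. h n y - f y)) \<longlonglongrightarrow> norm_L2 m g * 0"
      by (intro tendsto_intros lim)
    then show "(\<lambda>n. norm_L2 m g * norm_L2 m (\<lambda>y. h n y - f y)) \<longlonglongrightarrow> 0" by simp
    show "\<bar>(\<integral>x. g (\<iota> x) * Q t (\<lambda>x. h n (\<iota> x)) x \<partial>leb D) - (\<integral>x. g (\<iota> x) * Q t (\<lambda>x. f (\<iota> x)) x \<partial>leb D)\<bar> \<le> norm_L2 m g * norm_L2 m (\<lambda>y. h n y - f y)" for n
    proof -
      note G = pull_L2[OF gL] and H = sg.Q_L2[OF pull_L2[OF hL[of n]] t0] and F = sg.Q_L2[OF pull_L2[OF f] t0]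
      have eq0: "(\<integral>x. g (\<iota> x) * Q t (\<lambda>x. h n (\<iota> x)) x \<partial>leb D) - (\<integral>x. g (\<iota> x) * Q t (\<lambda>x. f (\<iota> x)) x \<partial>leb D) =
          (\<integral>x. g (\<iota> x) * (Q t (\<lambda>x. h n (\<iota> x)) x - Q t (\<lambda>x. f (\<iota> x)) x) \<partial>leb D)"
        using L2_integrable_mult[OF G H] L2_integrable_mult[OF G F] by (simp add: right_diff_distrib)
      have "\<bar>(\<integral>x. g (\<iota> x) * (Q t (\<lambda>x. h n (\<iota> x)) x - Q t (\<lambda>x. f (\<iota> x)) x) \<partial>leb D)\<bar> \<le>
          norm_L2 (leb D) (\<lambda>x. g (\<iota> x)) * norm_L2 (leb D) (\<lambda>x. Q t (\<lambda>x. h n (\<iota> x)) x - Q t (\<lambda>x. f (\<iota> x)) x)"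
        by (rule L2_Cauchy_Schwarz[OF G L2_diff[OF H F]])
      also have "\<dots> \<le> norm_L2 (leb D) (\<lambda>x. g (\<iota> x)) * norm_L2 (leb D) (\<lambda>x. h n (\<iota> x) - f (\<iota> x))"
        by (intro mult_left_mono sg.Q_close pull_L2 hL f t0) simp
      also have "\<dots> = norm_L2 m g * norm_L2 m (\<lambda>y. h n y - f y)"
        using norm_L2_m[OF g(1)] norm_L2_m[OF L2_m_borel[OF L2_diff[OF hL f]], of n] by simp
      finally show ?thesis unfolding eq0 .
    qed
  qed
  have "(\<integral>\<omega>. g (Xt \<omega> 0) * f (Xt \<omega> t) \<partial>PP) = (\<integral>x. g (\<iota> x) * Q t (\<lambda>x. f (\<iota> x)) x \<partial>leb D)"
    using LIMSEQ_unique[OF lhs] rhs by (simp add: eq)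
  also have "\<dots> = (\<integral>x. g (\<iota> x) * P t f (\<iota> x) \<partial>leb D)"
    by (rule integral_leb_cong) (simp add: P_\<iota>)
  also have "\<dots> = (\<integral>\<omega>. g (Xt \<omega> 0) * P t f (Xt \<omega> 0) \<partial>PP)"
  proof (rule L2_Xt(3)[OF z, symmetric])
    show "(\<lambda>y. g y * P t f y) \<in> L2 m"
      by (rule L2_bounded_mult[OF P_L2[OF f t0], of _ K]) (use g in \<open>auto simp: measurable_m\<close>)
  qed
  finally show ?thesis .
qed

text \<open>Sets of the generated sigma-algebra are events on \<open>Xt\<close> at time 0, so the
  defining property of conditional expectation is \<open>two_times\<close> with an indicator for
  \<open>g\<close>.\<close>

lemma cond_exp_P:
  assumes t: "t \<in> {0..T}" and f: "f \<in> L2 m"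
  shows "AE \<omega> in PP. P t f (Xt \<omega> 0) =
    real_cond_exp PP (vimage_algebra (space PP) (\<lambda>\<omega>. Xt \<omega> 0) borel) (\<lambda>\<omega>. f (Xt \<omega> t)) \<omega>"
proof -
  have t0: "0 \<le> t" and z: "0 \<in> {0..T}" using t T by auto
  let ?F = "vimage_algebra (space PP) (\<lambda>\<omega>. Xt \<omega> 0) borel"
  have "sets ?F \<subseteq> sets PP" by (rule sets_image_in_sets[OF refl Xt_measurable[OF z]])
  then interpret finite_measure_subalgebra PP ?F
    by unfold_locales (auto simp: subalgebra_def)
  have "AE \<omega> in PP. real_cond_exp PP ?F (\<lambda>\<omega>. f (Xt \<omega> t)) \<omega> = P t f (Xt \<omega> 0)"
  proof (rule real_cond_exp_charact)
    show "integrable PP (\<lambda>\<omega>. f (Xt \<omega> t))" by (rule PP.L2_integrable[OF L2_Xt(1)[OF t f]])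
    show "integrable PP (\<lambda>\<omega>. P t f (Xt \<omega> 0))" by (rule PP.L2_integrable[OF L2_Xt(1)[OF z P_L2[OF f t0]]])
    have "(\<lambda>\<omega>. Xt \<omega> 0) \<in> ?F \<rightarrow>\<^sub>M borel" by (rule measurable_vimage_algebra1) simp
    from measurable_compose[OF this L2_m_borel[OF P_L2[OF f t0]]]
    show "(\<lambda>\<omega>. P t f (Xt \<omega> 0)) \<in> borel_measurable ?F" .
    fix A assume "A \<in> sets ?F"
    then obtain B where B: "B \<in> sets borel" "A = (\<lambda>\<omega>. Xt \<omega> 0) -` B \<inter> space PP"
      by (auto simp: sets_vimage_algebra2)
    have ind: "indicator A \<omega> = (indicator B (Xt \<omega> 0) :: real)" if "\<omega> \<in> space PP" for \<omega>
      using that B(2) by (simp add: indicator_def)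
    have "(\<integral>\<omega>. indicator B (Xt \<omega> 0) * f (Xt \<omega> t) \<partial>PP) = (\<integral>\<omega>. indicator B (Xt \<omega> 0) * P t f (Xt \<omega> 0) \<partial>PP)"
      using B(1) by (intro two_times[OF t _ _ f, of _ 1]) (auto simp: indicator_def)
    moreover have "set_lebesgue_integral PP A (\<lambda>\<omega>. f (Xt \<omega> t)) = (\<integral>\<omega>. indicator B (Xt \<omega> 0) * f (Xt \<omega> t) \<partial>PP)"
      unfolding set_lebesgue_integral_def by (rule Bochner_Integration.integral_cong) (simp_all add: ind)
    moreover have "set_lebesgue_integral PP A (\<lambda>\<omega>. P t f (Xt \<omega> 0)) = (\<integral>\<omega>. indicator B (Xt \<omega> 0) * P t f (Xt \<omega> 0) \<partial>PP)"
      unfolding set_lebesgue_integral_def by (rule Bochner_Integration.integral_cong) (simp_all add: ind)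
    ultimately show "set_lebesgue_integral PP A (\<lambda>\<omega>. f (Xt \<omega> t)) = set_lebesgue_integral PP A (\<lambda>\<omega>. P t f (Xt \<omega> 0))"
      by simp
  qed
  then show ?thesis by eventually_elim simp
qed

theorem stationary_symmetric_markov_Xt: "stationary_symmetric_markov T m PP (\<lambda>t \<omega>. Xt \<omega> t)"
  unfolding stationary_symmetric_markov_def
proof (intro conjI exI[of _ P] ballI allI impI)
  show "(\<lambda>\<omega>. Xt \<omega> t) \<in> PP \<rightarrow>\<^sub>M borel" if "t \<in> {0..T}" for t using that by (rule Xt_measurable)
  show "distr PP borel (\<lambda>\<omega>. Xt \<omega> 0) = m" using T by (intro distr_Xt) simp
  show "symmetric_semigroup m P" by (rule symmetric_semigroup_P)
  show "(\<integral>x. P t f x \<partial>m) = (\<integral>x. f x \<partial>m)" if "0 \<le> t" "f \<in> L2 m" for t f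
    using that by (intro P_integral)
  show "AE \<omega> in PP. P t f (Xt \<omega> 0) =
    real_cond_exp PP (vimage_algebra (space PP) (\<lambda>\<omega>. Xt \<omega> 0) borel) (\<lambda>\<omega>. f (Xt \<omega> t)) \<omega>"
    if "t \<in> {0..T}" "f \<in> L2 m" for t f using that by (rule cond_exp_P)
  fix tfs :: "(real \<times> ('b \<Rightarrow> real)) list"
  assume "sorted (map fst tfs) \<and> (\<forall>(t, f)\<in>set tfs. t \<in> {0..T} \<and> f \<in> borel_measurable borel \<and> bounded (range f))"
  then show "(\<integral>\<omega>. (\<Prod>(t, f)\<leftarrow>tfs. f (Xt \<omega> t)) \<partial>PP) = (\<integral>x. iterated_semigroup P 0 tfs x \<partial>m)"
    by (intro iterated_P_integral) blast+
qed

end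

theorem theorem3p3:
  fixes D :: "'a::euclidean_space set" and c1 T :: real and x0 :: 'a
    and \<phi> :: "nat \<Rightarrow> 'a \<Rightarrow> real"
    and \<rho> :: "'a \<Rightarrow> 'a \<Rightarrow> real" and \<iota> :: "'a \<Rightarrow> 'b::polish_space"
    and \<Omega> :: "nat \<Rightarrow> 'w measure" and X :: "nat \<Rightarrow> nat \<Rightarrow> 'w \<Rightarrow> 'a"
    and r :: "nat \<Rightarrow> nat" and PP :: "'p measure" and Xt :: "'p \<Rightarrow> real \<Rightarrow> 'b"
  assumes "open D" "connected D" "bounded D"
    and "0 < c1" "c1 < 1" "x0 \<in> D" "T > 0"
    and "good_functions D c1 x0 \<phi>"
    and "is_good_completion D \<phi> \<rho> \<iota>"
    and walks: "\<And>k. k \<ge> 1 \<Longrightarrow> grid_cubes D c1 x0 k \<noteq> {} \<Longrightarrow>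
      simple_random_walk (\<Omega> k) (graph_verts D c1 x0 k) (graph_adj D c1 x0 k)
        (grid_weight D c1 x0 k) (X k)"
    and subseq: "strict_mono r" "\<And>n. r n \<ge> 1" "\<And>n. grid_cubes D c1 x0 (r n) \<noteq> {}"
    and limit: "finite_measure PP" "Xt \<in> PP \<rightarrow>\<^sub>M skorokhod_borel T"
      "weakly_converges (skorokhod_topology T)
         (\<lambda>n. walk_law T \<iota> (r n) (\<Omega> (r n)) (X (r n)))
         (distr PP (skorokhod_borel T) Xt)"
  shows "stationary_symmetric_markov T (ext_lebesgue D \<iota>) PP (\<lambda>t \<omega>. Xt \<omega> t)"
proof -
  interpret good_completion D c1 x0 \<phi> \<rho> \<iota>
    by unfold_locales (use assms in auto)
  \<comment> \<open>A further subsequence keeps the weak limit, so the thinning that the semigroups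
    require is compatible with the given \<open>Xt\<close>.\<close>
  obtain s where s: "strict_mono s" "L2_semigroup (\<lambda>n. ch.N (r (s n))) (leb D) TT
    (\<lambda>n. ch.steps (r (s n))) (\<lambda>n. (mesh (r (s n)))\<^sup>2) core"
    using semigroup_subsequence[OF subseq(1)] by (elim exE conjE)
  interpret walk_limit D c1 x0 \<phi> \<rho> \<iota> "\<lambda>n. r (s n)" "\<lambda>n. \<Omega> (r (s n))" "\<lambda>n. X (r (s n))" T PP Xt
  proof (intro walk_limit.intro walk_limit_axioms.intro)
    show "good_completion D c1 x0 \<phi> \<rho> \<iota>" by unfold_locales
    show "reversible_walk (V (r (s n))) (cond (r (s n))) (\<Omega> (r (s n))) (X (r (s n)))" for n
      by (intro reversible_walk_grid walks subseq)
    show "weakly_converges (skorokhod_topology T)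
      (\<lambda>n. walk_law T \<iota> (r (s n)) (\<Omega> (r (s n))) (X (r (s n)))) (distr PP (skorokhod_borel T) Xt)"
      by (rule weakly_converges_subseq[OF limit(3) s(1)])
  qed (rule \<open>T > 0\<close> s(2) limit(1,2))+
  show ?thesis by (rule stationary_symmetric_markov_Xt)
qed

end
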